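(* Let $D$ and $\Omega$ be two bounded Lipschitz domains in $\mathbb R^2$ with connected complements $\mathbb R^2\setminus\overline D$ and $\mathbb R^2\setminus\overline\Omega$, and with $\overline\Omega\subset D$. Let $\gamma_1\in\mathbb R_+$ be a positive constant and let $\gamma_2\in L^\infty(D)\cap H^2(\Omega)$ with $\operatorname{supp}(\gamma_2-\gamma_1)\subset\overline\Omega$. Suppose $\mathbf 0\in\partial\Omega$ and that $\Omega\cap B_{r_0}=\mathcal S_{r_0}$ for some sufficiently small $r_0>0$, where $\mathcal S_{r_0}$ is a truncated sector with vertex $\mathbf 0$ and opening angle $\vartheta_M-\vartheta_m\in(0,\pi)$, and let $\Gamma^{\pm}_{r_0}$ be its two straight boundary segments. Let $\eta\in\mathbb C$ be a constant and let $(v,w)\in H^1(D)\times H^1(D)$ satisfy $$\Delta v+\gamma_1 v=0\ \text{ in } D,\qquad \Delta w+\gamma_2 w=0\ \text{ in } D,$$ $$v=w,\qquad \partial_\nu v+\eta v=\partial_\nu w\quad\text{ on }\Gamma^{\pm}_{r_0},$$ where $\nu$ is the exterior unit normal to $\partial\Omega$. If $\mathcal S_{r_0}$ is an irrational corner (that is, $(\vartheta_M-\vartheta_m)/\pi$ is irrational) and $\eta\neq0$, then $v=0$ and $w=0$ in $D$.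
   Context: $B_{r_0}$ is the open disk of radius $r_0$ centred at the origin. For angles $-\pi\le\vartheta_m<\vartheta_M<\pi$ with $\vartheta_M-\vartheta_m\in(0,\pi)$, $\mathcal S=\{\mathbf x\in\mathbb R^2\setminus\{\mathbf 0\}:\vartheta_m<\arg(x_1+\mathrm i x_2)<\vartheta_M\}$, $\Gamma^+=\{(r\cos\vartheta_M,r\sin\vartheta_M):r>0\}$, $\Gamma^-=\{(r\cos\vartheta_m,r\sin\vartheta_m):r>0\}$, $\mathcal S_{r_0}=\mathcal S\cap B_{r_0}$, $\Gamma^\pm_{r_0}=\Gamma^\pm\cap B_{r_0}$. Conditions "on $\Gamma^\pm_{r_0}$" are required on both segments $\Gamma^+_{r_0}$ and $\Gamma^-_{r_0}$. *)

theory Defs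
  imports "HOL-Analysis.Analysis"
begin

section \<open>Domains and sectors\<close>

text \<open>Near each boundary point the set is, in suitable Cartesian coordinates centred at that
  point, the strict subgraph of a Lipschitz function.\<close>

definition bounded_lipschitz_domain :: "(real^2) set \<Rightarrow> bool" where
  "bounded_lipschitz_domain U \<longleftrightarrow>
     open U \<and> connected U \<and> U \<noteq> {} \<and> bounded U \<and>
     (\<forall>p\<in>frontier U. \<exists>\<rho>>0. \<exists>e1 e2 :: real^2. \<exists>h :: real \<Rightarrow> real. \<exists>L.
        norm e1 = 1 \<and> norm e2 = 1 \<and> e1 \<bullet> e2 = 0 \<and> L-lipschitz_on UNIV h \<and>
        U \<inter> ball p \<rho> = {x \<in> ball p \<rho>. (x - p) \<bullet> e2 < h ((x - p) \<bullet> e1)})"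

definition direction :: "real \<Rightarrow> real^2" where
  "direction \<theta> = vector [cos \<theta>, sin \<theta>]"

definition sector :: "real \<Rightarrow> real \<Rightarrow> (real^2) set" where
  "sector \<theta>m \<theta>M =
     {x. x \<noteq> 0 \<and> \<theta>m < Arg (Complex (x$1) (x$2)) \<and> Arg (Complex (x$1) (x$2)) < \<theta>M}"

definition side :: "real \<Rightarrow> real \<Rightarrow> (real^2) set" where
  "side \<theta> r0 = {r *\<^sub>R direction \<theta> | r. r > 0} \<inter> ball 0 r0"

text \<open>Arc length on \<^term>\<open>side \<theta> r0\<close>, as a Borel measure on the plane.\<close>

definition side_length :: "real \<Rightarrow> real \<Rightarrow> (real^2) measure" where
  "side_length \<theta> r0 =
     distr (restrict_space lborel {0<..<r0}) borel (\<lambda>r. r *\<^sub>R direction \<theta>)"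


section \<open>Smooth functions and weak derivatives\<close>

definition pd :: "2 \<Rightarrow> (real^2 \<Rightarrow> 'b::real_normed_vector) \<Rightarrow> real^2 \<Rightarrow> 'b" where
  "pd i f x = frechet_derivative f (at x) (axis i 1)"

text \<open>All iterated partial derivatives, in any order, are (totally) differentiable; this is
  equivalent to being infinitely often continuously differentiable on the plane.\<close>

definition smooth :: "(real^2 \<Rightarrow> 'b::real_normed_vector) \<Rightarrow> bool" where
  "smooth f \<longleftrightarrow> (\<forall>is x. foldr pd is f differentiable (at x))"

definition supp :: "(real^2 \<Rightarrow> real) \<Rightarrow> (real^2) set" where
  "supp \<phi> = closure {x. \<phi> x \<noteq> 0}"

definition test_functions :: "(real^2) set \<Rightarrow> (real^2 \<Rightarrow> real) set" where
  "test_functions U = {\<phi>. smooth \<phi> \<and> compact (supp \<phi>) \<and> supp \<phi> \<subseteq> U}"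

definition L2 :: "'a measure \<Rightarrow> ('a \<Rightarrow> complex) set" where
  "L2 M = {u \<in> borel_measurable M. integrable M (\<lambda>x. (norm (u x))\<^sup>2)}"

definition L_infinity :: "'a measure \<Rightarrow> ('a \<Rightarrow> complex) set" where
  "L_infinity M = {u \<in> borel_measurable M. \<exists>C. AE x in M. norm (u x) \<le> C}"

definition has_weak_pd ::
    "(real^2) set \<Rightarrow> 2 \<Rightarrow> (real^2 \<Rightarrow> complex) \<Rightarrow> (real^2 \<Rightarrow> complex) \<Rightarrow> bool" where
  "has_weak_pd U i u g \<longleftrightarrow>
     (\<forall>\<phi>\<in>test_functions U.
        (LINT x|lebesgue_on U. pd i \<phi> x *\<^sub>R u x) = - (LINT x|lebesgue_on U. \<phi> x *\<^sub>R g x))"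

definition has_weak_laplacian ::
    "(real^2) set \<Rightarrow> (real^2 \<Rightarrow> complex) \<Rightarrow> (real^2 \<Rightarrow> complex) \<Rightarrow> bool" where
  "has_weak_laplacian U u F \<longleftrightarrow>
     (\<forall>\<phi>\<in>test_functions U.
        (LINT x|lebesgue_on U. (\<Sum>i\<in>UNIV. pd i (pd i \<phi>) x) *\<^sub>R u x)
          = (LINT x|lebesgue_on U. \<phi> x *\<^sub>R F x))"

text \<open>The space \<open>H\<^sup>k(U)\<close>: the recursion says that all weak derivatives of order at most \<open>k\<close>
  exist in \<open>L\<^sup>2(U)\<close>.\<close>

primrec sobolev :: "nat \<Rightarrow> (real^2) set \<Rightarrow> (real^2 \<Rightarrow> complex) set" where
  "sobolev 0 U = L2 (lebesgue_on U)"
| "sobolev (Suc k) U =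
     {u \<in> L2 (lebesgue_on U). \<forall>i. \<exists>g\<in>sobolev k U. has_weak_pd U i u g}"

text \<open>Representatives of the weak derivatives; on an open set they are unique up to null sets
  whenever they exist.\<close>

definition weak_pd :: "(real^2) set \<Rightarrow> 2 \<Rightarrow> (real^2 \<Rightarrow> complex) \<Rightarrow> real^2 \<Rightarrow> complex" where
  "weak_pd U i u = (SOME g. g \<in> L2 (lebesgue_on U) \<and> has_weak_pd U i u g)"

definition weak_laplacian :: "(real^2) set \<Rightarrow> (real^2 \<Rightarrow> complex) \<Rightarrow> real^2 \<Rightarrow> complex" where
  "weak_laplacian U u = (SOME F. F \<in> L2 (lebesgue_on U) \<and> has_weak_laplacian U u F)"

text \<open>The function \<open>u\<close> is a (distributional) solution of
  \<open>\<Delta>u + \<gamma>u = 0\<close> in \<open>U\<close>.\<close>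

definition helmholtz :: "(real^2) set \<Rightarrow> (real^2 \<Rightarrow> complex) \<Rightarrow> (real^2 \<Rightarrow> complex) \<Rightarrow> bool" where
  "helmholtz U \<gamma> u \<longleftrightarrow> has_weak_laplacian U u (\<lambda>x. - (\<gamma> x * u x))"

text \<open>Support of an equivalence class of functions on \<open>U\<close>: the points without a neighbourhood on
  which the function vanishes almost everywhere.\<close>

definition ess_supp :: "(real^2) set \<Rightarrow> (real^2 \<Rightarrow> complex) \<Rightarrow> (real^2) set" where
  "ess_supp U f = {x. \<forall>N. open N \<and> x \<in> N \<longrightarrow> \<not> (AE y in lebesgue_on (U \<inter> N). f y = 0)}"


section \<open>Traces and normal derivatives\<close>

text \<open>The trace operator is the continuous extension, from the \<open>H\<^sup>1(U)\<close> norm to the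
  \<open>L\<^sup>2(\<sigma>)\<close> norm, of restricting smooth functions to the boundary portion carrying \<open>\<sigma>\<close>.
  Nonnegative integrals are used so that infinite distances are not read as zero.\<close>

definition has_trace ::
    "(real^2) set \<Rightarrow> (real^2) measure \<Rightarrow> (real^2 \<Rightarrow> complex) \<Rightarrow> (real^2 \<Rightarrow> complex) \<Rightarrow> bool" where
  "has_trace U \<sigma> u g \<longleftrightarrow> g \<in> borel_measurable \<sigma> \<and>
     (\<exists>\<Phi> :: nat \<Rightarrow> real^2 \<Rightarrow> complex. (\<forall>n. smooth (\<Phi> n)) \<and>
        (\<lambda>n. \<integral>\<^sup>+x. ennreal ((norm (\<Phi> n x - u x))\<^sup>2
                 + (\<Sum>i\<in>UNIV. (norm (pd i (\<Phi> n) x - weak_pd U i u x))\<^sup>2)) \<partial>lebesgue_on U)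
          \<longlonglongrightarrow> 0 \<and>
        (\<lambda>n. \<integral>\<^sup>+x. ennreal ((norm (\<Phi> n x - g x))\<^sup>2) \<partial>\<sigma>) \<longlonglongrightarrow> 0)"

text \<open>Smooth functions whose restriction to the boundary of \<open>U\<close> is compactly supported in the
  relatively open boundary portion \<open>\<Gamma>\<close>.\<close>

definition boundary_tests :: "(real^2) set \<Rightarrow> (real^2) set \<Rightarrow> (real^2 \<Rightarrow> real) set" where
  "boundary_tests U \<Gamma> =
     {\<phi>. smooth \<phi> \<and> compact (supp \<phi>) \<and> supp \<phi> \<inter> frontier U \<subseteq> \<Gamma>}"

text \<open>The exterior normal derivative of an \<open>H\<^sup>1(U)\<close> function with square-integrable Laplacian, as
  a functional on boundary test functions. It is defined through Green's formula
  \<open>\<integral>\<^bsub>\<partial>U\<^esub> \<partial>\<^sub>\<nu>u \<phi> = \<integral>\<^bsub>U\<^esub> (\<nabla>u \<cdot> \<nabla>\<phi> + \<phi> \<Delta>u)\<close> with \<open>\<nu>\<close> the exterior unit normal.\<close>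

definition normal_derivative ::
    "(real^2) set \<Rightarrow> (real^2 \<Rightarrow> complex) \<Rightarrow> (real^2 \<Rightarrow> real) \<Rightarrow> complex" where
  "normal_derivative U u \<phi> =
     (LINT x|lebesgue_on U.
        (\<Sum>i\<in>UNIV. pd i \<phi> x *\<^sub>R weak_pd U i u x) + \<phi> x *\<^sub>R weak_laplacian U u x)"

text \<open>The conditions \<open>v = w\<close> and \<open>\<partial>\<^sub>\<nu>v + \<eta>v = \<partial>\<^sub>\<nu>w\<close> on a
  boundary portion \<open>\<Gamma>\<close> of \<open>U\<close> with arc length \<open>\<sigma>\<close>; here \<open>g\<close> is the common trace.\<close>

definition conductive_transmission ::
    "(real^2) set \<Rightarrow> (real^2) set \<Rightarrow> (real^2) measure \<Rightarrow> complex \<Rightarrow>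
     (real^2 \<Rightarrow> complex) \<Rightarrow> (real^2 \<Rightarrow> complex) \<Rightarrow> bool" where
  "conductive_transmission U \<Gamma> \<sigma> \<eta> v w \<longleftrightarrow>
     (\<exists>g. has_trace U \<sigma> v g \<and> has_trace U \<sigma> w g \<and>
        (\<forall>\<phi>\<in>boundary_tests U \<Gamma>.
           normal_derivative U v \<phi> + \<eta> * (LINT x|\<sigma>. \<phi> x *\<^sub>R g x) = normal_derivative U w \<phi>))"

end

theory Submission imports Defs begin

text \<open>Write \<open>U = w - v\<close>, and let \<open>E\<close> be the part of a small ball about the vertex outside the closed
  corner; there both functions solve the equation with \<open>\<gamma>\<^sub>1\<close>, hence so does \<open>U\<close>. On a side with normal
  \<open>\<nu>\<close> the transmission conditions become the Cauchy data \<open>U = 0\<close>, \<open>\<partial>\<^sub>\<nu>U = \<eta> v\<close>. In the whole ball an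
  explicit solution \<open>V\<close> has the same data on the line through that side: with \<open>P\<close> the even part of
  \<open>\<eta> v\<close> under reflection in the line, \<open>V\<close> is the primitive of \<open>P\<close> along the normals. Cutting \<open>U - V\<close>
  off to \<open>E\<close> gives a weak solution in the ball slit along the other side, which vanishes inside the
  corner, so \<open>U = V\<close> on \<open>E\<close> by unique continuation. Consequently the functions \<open>V\<close> belonging to the two
  sides agree, and their common value vanishes on two lines meeting at an irrational angle. It is odd
  under both reflections, hence invariant under an irrational rotation, hence zero. As \<open>\<eta> \<noteq> 0\<close>, the
  Cauchy data give \<open>v = 0\<close> on both lines, and the same argument gives \<open>v = 0\<close> near the vertex. Then
  \<open>U = 0\<close> on \<open>E\<close>, and unique continuation in \<open>D\<close> yields \<open>v = 0\<close> and \<open>w = 0\<close>.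

  Unique continuation rests on a Carleman estimate for weak solutions, smoothness of \<open>v\<close> near the vertex on
  mollification and interior estimates.\<close>

section \<open>Smooth functions on the plane\<close>

text \<open>Nothing is expanded at the vertex inside the corner, where \<open>w\<close> solves an
  equation with a variable coefficient: \<open>w\<close> is seen only from outside, where
  \<open>U\<close> solves an equation with a constant coefficient, and the corner enters through the
  Cauchy data on its two sides.

  Cauchy problems for elliptic equations are in general unsolvable. Here the Neumann datum is a
  multiple of a solution, and applying the equation to the primitive of \<open>P\<close> along the
  normals leaves just one unwanted term, the normal derivative of \<open>P\<close> at the foot on
  the line. Passing to the even part removes that term and keeps the datum.

  A test function meeting both sides would pick up both sets of data at once. Removing the ray of
  one side isolates the other, and the slit ball stays connected, so that vanishing inside the
  corner spreads to its outside.

  Two reflections compose to the rotation by twice the opening angle; irrationality makes its orbits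
  dense in circles, and continuity does the rest.

  For \<open>w\<close> only an inequality \<open>|\<Delta>w| \<le> C |w|\<close> is used in
  \<open>D\<close>; this is why unique continuation rests on a Carleman estimate and not on
  analyticity.\<close>

lemma pd_eq:
  assumes "(f has_derivative f') (at x)"
  shows "pd i f x = f' (axis i 1)"
  using frechet_derivative_at[OF assms] by (simp add: pd_def)

lemma vec2_expand: "(h :: real^2) = (\<Sum>i\<in>UNIV. (h $ i) *\<^sub>R axis i 1)"
  using basis_expansion[of h] by (simp add: scalar_mult_eq_scaleR)

lemma sum_axis [simp]:
  fixes f :: "2 \<Rightarrow> 'b::real_vector"
  shows "(\<Sum>j\<in>UNIV. (axis i (1::real) $ j) *\<^sub>R f j) = f i"
proof -
  have "(\<Sum>j\<in>UNIV. (axis i (1::real) $ j) *\<^sub>R f j) = (\<Sum>j\<in>UNIV. if j = i then f j else 0)"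
    by (intro sum.cong) (auto simp: axis_def)
  then show ?thesis by simp
qed

lemma sum_axis_mult [simp]: "(\<Sum>j\<in>UNIV. (axis i (1::real) $ j) * f j) = f (i::2)"
  using sum_axis[of i f] by simp

lemma pd_has_derivative:
  assumes "f differentiable (at x)"
  shows "(f has_derivative (\<lambda>h. \<Sum>i\<in>UNIV. (h $ i) *\<^sub>R pd i f x)) (at x)"
proof -
  let ?D = "frechet_derivative f (at x)"
  have D: "(f has_derivative ?D) (at x)"
    using assms frechet_derivative_works by blast
  then interpret bounded_linear ?D by (rule has_derivative_bounded_linear)
  have "?D h = (\<Sum>i\<in>UNIV. (h $ i) *\<^sub>R pd i f x)" for h
    by (subst vec2_expand) (simp add: sum scale pd_def)
  then have "?D = (\<lambda>h. \<Sum>i\<in>UNIV. (h $ i) *\<^sub>R pd i f x)" by (rule ext)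
  with D show ?thesis by simp
qed

text \<open>Near \<open>x\<close> both functions have the same derivatives in the sense of
  \<open>has_derivative\<close>, so the choice inside \<open>frechet_derivative\<close> is made from
  the same set. Differentiability therefore does not have to be assumed.\<close>

lemma pd_cong:
  assumes "open U" "x \<in> U" "\<And>y. y \<in> U \<Longrightarrow> f y = g y"
  shows "pd i f x = pd i g x"
proof -
  have "(f has_derivative D) (at x) \<longleftrightarrow> (g has_derivative D) (at x)" for D
    using assms has_derivative_transform_within_open[of f D x UNIV U g]
      has_derivative_transform_within_open[of g D x UNIV U f] by auto
  then show ?thesis by (simp add: pd_def frechet_derivative_def)
qed

lemma differentiable_cong_open:
  assumes "open U" "x \<in> U" "\<And>y. y \<in> U \<Longrightarrow> f y = g y" "g differentiable (at x)"
  shows "f differentiable (at x)"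
  using assms has_derivative_transform_within_open[of g _ x UNIV U f]
  unfolding differentiable_def by auto

text \<open>The local notion serves limits of smooth functions, which are controlled only on a ball;
  \<open>smooth_on_Un\<close> then glues such a limit, after a cutoff, to the zero function
  outside.\<close>

definition smooth_on :: "(real^2) set \<Rightarrow> (real^2 \<Rightarrow> 'b::real_normed_vector) \<Rightarrow> bool" where
  "smooth_on U f \<longleftrightarrow> (\<forall>is. \<forall>x\<in>U. foldr pd is f differentiable (at x))"

lemma smooth_on_UNIV: "smooth_on UNIV f \<longleftrightarrow> smooth f"
  by (simp add: smooth_on_def smooth_def)

lemma smooth_onD: "smooth_on U f \<Longrightarrow> x \<in> U \<Longrightarrow> f differentiable (at x)"
  by (auto simp: smooth_on_def dest: spec[of _ "[]"])

lemma smooth_on_pd: "smooth_on U f \<Longrightarrow> smooth_on U (pd i f)"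
  unfolding smooth_on_def
proof safe
  fix "is" x assume *: "\<forall>is. \<forall>x\<in>U. foldr pd is f differentiable (at x)" "x \<in> U"
  from *(1)[THEN spec, of "is @ [i]"] *(2) show "foldr pd is (pd i f) differentiable (at x)" by auto
qed

lemma smooth_on_foldr: "smooth_on U f \<Longrightarrow> smooth_on U (foldr pd is f)"
  by (induction "is") (auto intro: smooth_on_pd)

lemma smoothD: "smooth f \<Longrightarrow> f differentiable (at x)"
  using smooth_onD[of UNIV f x] by (simp add: smooth_on_UNIV)

lemma smooth_pd: "smooth f \<Longrightarrow> smooth (pd i f)"
  using smooth_on_pd[of UNIV f i] by (simp add: smooth_on_UNIV)

lemma smooth_foldr: "smooth f \<Longrightarrow> smooth (foldr pd is f)"
  using smooth_on_foldr[of UNIV f] by (simp add: smooth_on_UNIV)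

lemma smooth_continuous: "smooth f \<Longrightarrow> continuous_on S f"
  by (meson smoothD differentiable_imp_continuous_within continuous_at_imp_continuous_on)

lemma smooth_has_derivative:
  "smooth f \<Longrightarrow> (f has_derivative (\<lambda>h. \<Sum>i\<in>UNIV. (h $ i) *\<^sub>R pd i f x)) (at x)"
  by (rule pd_has_derivative[OF smoothD])

lemma differentiable_sum_list:
  assumes "\<And>g. g \<in> set gs \<Longrightarrow> g differentiable (at x)"
  shows "(\<lambda>y. \<Sum>g\<leftarrow>gs. g y) differentiable (at x)
    \<and> pd i (\<lambda>y. \<Sum>g\<leftarrow>gs. g y) x = (\<Sum>g\<leftarrow>gs. pd i g x)"
  using assms
proof (induction gs)
  case Nil
  have "((\<lambda>y. 0) has_derivative (\<lambda>h. 0)) (at x)" by simp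
  from pd_eq[OF this, of i] show ?case by auto
next
  case (Cons g gs)
  let ?s = "\<lambda>y. \<Sum>g\<leftarrow>gs. g y"
  have d: "g differentiable (at x)" "?s differentiable (at x)" using Cons by auto
  have "pd i (\<lambda>y. g y + ?s y) x = pd i g x + pd i ?s x"
    using pd_eq[OF has_derivative_add[OF pd_has_derivative[OF d(1)] pd_has_derivative[OF d(2)]], of i] by simp
  with d Cons show ?case by (auto intro: differentiable_add)
qed

text \<open>Every iterated derivative stays a finite sum of members of \<open>X\<close>, because
  each differentiation replaces a member by a finite list of members. Sums are allowed since product
  and chain rules produce several terms, and the empty list stands for 0. Smoothness of products,
  compositions, convolutions and limits thus reduces to a single differentiation.\<close>

lemma smooth_on_coinduct:
  assumes "open U" "f \<in> X"
    and diff: "\<And>f x. f \<in> X \<Longrightarrow> x \<in> U \<Longrightarrow> f differentiable (at x)"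
    and deriv: "\<And>f i. f \<in> X \<Longrightarrow> \<exists>gs. set gs \<subseteq> X \<and> (\<forall>x\<in>U. pd i f x = (\<Sum>g\<leftarrow>gs. g x))"
  shows "smooth_on U f"
proof -
  have *: "\<exists>gs. set gs \<subseteq> X \<and> (\<forall>x\<in>U. foldr pd is f x = (\<Sum>g\<leftarrow>gs. g x))" for "is"
  proof (induction "is")
    case Nil
    show ?case by (rule exI[of _ "[f]"]) (use assms in simp)
  next
    case (Cons i "is")
    then obtain gs where gs: "set gs \<subseteq> X" "\<And>x. x \<in> U \<Longrightarrow> foldr pd is f x = (\<Sum>g\<leftarrow>gs. g x)" by auto
    from deriv[of _ i] obtain G where
      G: "\<And>g. g \<in> X \<Longrightarrow> set (G g) \<subseteq> X \<and> (\<forall>x\<in>U. pd i g x = (\<Sum>h\<leftarrow>G g. h x))" by metis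
    show ?case
    proof (intro exI[of _ "concat (map G gs)"] conjI ballI)
      show "set (concat (map G gs)) \<subseteq> X" using gs G by auto
      fix x assume x: "x \<in> U"
      have "foldr pd (i # is) f x = pd i (\<lambda>x. \<Sum>g\<leftarrow>gs. g x) x"
        using pd_cong[OF assms(1) x gs(2)] by simp
      also have "\<dots> = (\<Sum>g\<leftarrow>gs. pd i g x)"
        using differentiable_sum_list[of gs x i] diff gs(1) x by blast
      also have "\<dots> = (\<Sum>g\<leftarrow>gs. \<Sum>h\<leftarrow>G g. h x)"
        using G gs(1) x by (intro arg_cong[of _ _ sum_list] map_cong) auto
      also have "\<dots> = (\<Sum>h\<leftarrow>concat (map G gs). h x)"
        by (induction gs) auto
      finally show "foldr pd (i # is) f x = (\<Sum>h\<leftarrow>concat (map G gs). h x)" .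
    qed
  qed
  show ?thesis
    unfolding smooth_on_def
  proof safe
    fix "is" x assume x: "x \<in> U"
    from *[of "is"] obtain gs where gs: "set gs \<subseteq> X" "\<And>x. x \<in> U \<Longrightarrow> foldr pd is f x = (\<Sum>g\<leftarrow>gs. g x)" by auto
    have "(\<lambda>x. \<Sum>g\<leftarrow>gs. g x) differentiable (at x)"
      using differentiable_sum_list[of gs x] diff gs(1) x by blast
    from differentiable_cong_open[where f="foldr pd is f" and g="\<lambda>x. \<Sum>g\<leftarrow>gs. g x", OF assms(1) x gs(2) this] show "foldr pd is f differentiable (at x)" by blast
  qed
qed

lemmas smooth_coinduct = smooth_on_coinduct[of UNIV, simplified smooth_on_UNIV, OF open_UNIV]

lemma smooth_on_cong:
  assumes U: "open U" and fg: "\<And>x. x \<in> U \<Longrightarrow> f x = g x" and g: "smooth_on U g"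
  shows "smooth_on U f"
proof -
  have eq: "foldr pd is f x = foldr pd is g x" if "x \<in> U" for "is" x
    using that by (induction "is" arbitrary: x) (auto simp: fg intro: pd_cong[OF U])
  show ?thesis
    unfolding smooth_on_def
  proof safe
    fix "is" x assume x: "x \<in> U"
    have "foldr pd is g differentiable (at x)" using g x by (simp add: smooth_on_def)
    from differentiable_cong_open[where f="foldr pd is f" and g="foldr pd is g", OF U x eq this]
    show "foldr pd is f differentiable (at x)" .
  qed
qed

lemma smooth_on_subset: "smooth_on U f \<Longrightarrow> V \<subseteq> U \<Longrightarrow> smooth_on V f"
  by (auto simp: smooth_on_def)

lemma smooth_on_Un: "smooth_on U f \<Longrightarrow> smooth_on V f \<Longrightarrow> smooth_on (U \<union> V) f"
  by (auto simp: smooth_on_def)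

section \<open>Closure properties of smooth functions and rules for partial derivatives\<close>

lemma pd_const [simp]: "pd i (\<lambda>x. c) = (\<lambda>x. 0)"
  by (rule ext, rule pd_eq[where f'="\<lambda>h. 0", simplified]) simp

lemma smooth_const [simp, intro]: "smooth (\<lambda>x. c)"
  by (rule smooth_coinduct[of _ "{\<lambda>x. c, \<lambda>x. 0}"]) (auto intro!: exI[of _ "[]"])

lemma smooth_on_const [simp, intro]: "smooth_on U (\<lambda>x. c)"
  using smooth_const smooth_on_UNIV smooth_on_subset by blast

lemma pd_bounded_linear:
  assumes "bounded_linear T" "f differentiable (at x)"
  shows "pd i (\<lambda>x. T (f x)) x = T (pd i f x)"
  using pd_eq[OF bounded_linear.has_derivative[OF assms(1) pd_has_derivative[OF assms(2)]], of i]
    by simp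

lemma smooth_on_bounded_linear:
  assumes "open U" "bounded_linear T" "smooth_on U f"
  shows "smooth_on U (\<lambda>x. T (f x))"
proof (rule smooth_on_coinduct[of U _ "{\<lambda>x. T (f x) | f. smooth_on U f}"])
  show "h differentiable (at x)" if "h \<in> {\<lambda>x. T (f x) | f. smooth_on U f}" "x \<in> U" for h x
    using that differentiableI[OF bounded_linear.has_derivative[OF assms(2) pd_has_derivative[OF smooth_onD]]]
    by auto
  show "\<exists>gs. set gs \<subseteq> {\<lambda>x. T (f x) | f. smooth_on U f} \<and> (\<forall>x\<in>U. pd i h x = (\<Sum>g\<leftarrow>gs. g x))"
    if "h \<in> {\<lambda>x. T (f x) | f. smooth_on U f}" for h i
  proof -
    from that obtain f where f: "h = (\<lambda>x. T (f x))" "smooth_on U f" by auto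
    then show ?thesis
      using pd_bounded_linear[OF assms(2) smooth_onD[OF f(2)]]
      by (intro exI[of _ "[\<lambda>x. T (pd i f x)]"]) (auto intro: smooth_on_pd)
  qed
qed (use assms in auto)

context bounded_bilinear
begin

lemma pd_prod:
  assumes "f differentiable (at x)" "g differentiable (at x)"
  shows "pd i (\<lambda>x. prod (f x) (g x)) x = prod (pd i f x) (g x) + prod (f x) (pd i g x)"
  using pd_eq[OF FDERIV[OF pd_has_derivative[OF assms(1)] pd_has_derivative[OF assms(2)]], of i]
  by simp

lemma smooth_on_prod:
  assumes "open U" "smooth_on U f" "smooth_on U g"
  shows "smooth_on U (\<lambda>x. prod (f x) (g x))"
proof (rule smooth_on_coinduct[of U _ "{\<lambda>x. prod (f x) (g x) | f g. smooth_on U f \<and> smooth_on U g}"])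
  let ?X = "{\<lambda>x. prod (f x) (g x) | f g. smooth_on U f \<and> smooth_on U g}"
  show "h differentiable (at x)" if "h \<in> ?X" "x \<in> U" for h x
    using that differentiableI[OF FDERIV[OF pd_has_derivative[OF smooth_onD] pd_has_derivative[OF smooth_onD]]]
    by auto
  show "\<exists>gs. set gs \<subseteq> ?X \<and> (\<forall>x\<in>U. pd i h x = (\<Sum>g\<leftarrow>gs. g x))"
    if "h \<in> ?X" for h i
  proof -
    from that obtain f g where f: "h = (\<lambda>x. prod (f x) (g x))" "smooth_on U f" "smooth_on U g" by auto
    have "\<forall>x\<in>U. pd i h x = (\<Sum>g\<leftarrow>[\<lambda>x. prod (pd i f x) (g x), \<lambda>x. prod (f x) (pd i g x)]. g x)"
      using pd_prod[OF smooth_onD[OF f(2)] smooth_onD[OF f(3)]] f(1) by simp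
    moreover have "set [\<lambda>x. prod (pd i f x) (g x), \<lambda>x. prod (f x) (pd i g x)] \<subseteq> ?X"
      using f(2,3) smooth_on_pd[OF f(2), of i] smooth_on_pd[OF f(3), of i] by (simp, blast)
    ultimately show ?thesis by blast
  qed
qed (use assms in auto)

end

lemma pd_add:
  assumes "f differentiable (at x)" "g differentiable (at x)"
  shows "pd i (\<lambda>x. f x + g x) x = pd i f x + pd i g x"
  using differentiable_sum_list[of "[f, g]" x i] assms by auto

lemma smooth_on_add:
  assumes "open U" "smooth_on U f" "smooth_on U g"
  shows "smooth_on U (\<lambda>x. f x + g x)"
proof (rule smooth_on_coinduct[of U _ "{\<lambda>x. f x + g x | f g. smooth_on U f \<and> smooth_on U g}"])
  let ?X = "{\<lambda>x. f x + g x | f g. smooth_on U f \<and> smooth_on U g}"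
  show "h differentiable (at x)" if "h \<in> ?X" "x \<in> U" for h x
  proof -
    from that obtain f g where "h = (\<lambda>x. f x + g x)" "smooth_on U f" "smooth_on U g" by auto
    with that(2) show ?thesis by (metis differentiable_add smooth_onD)
  qed
  show "\<exists>gs. set gs \<subseteq> ?X \<and> (\<forall>x\<in>U. pd i h x = (\<Sum>g\<leftarrow>gs. g x))"
    if "h \<in> ?X" for h i
  proof -
    from that obtain f g where f: "h = (\<lambda>x. f x + g x)" "smooth_on U f" "smooth_on U g" by auto
    have "\<forall>x\<in>U. pd i h x = (\<Sum>g\<leftarrow>[\<lambda>x. pd i f x + pd i g x]. g x)"
      using pd_add[OF smooth_onD[OF f(2)] smooth_onD[OF f(3)]] f(1) by simp
    moreover have "set [\<lambda>x. pd i f x + pd i g x] \<subseteq> ?X"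
      using smooth_on_pd[OF f(2), of i] smooth_on_pd[OF f(3), of i] by (simp, blast)
    ultimately show ?thesis by blast
  qed
qed (use assms in auto)

lemmas smooth_bounded_linear = smooth_on_bounded_linear[of UNIV, simplified smooth_on_UNIV, OF open_UNIV]
lemmas smooth_add [intro] = smooth_on_add[of UNIV, simplified smooth_on_UNIV, OF open_UNIV]
lemmas smooth_scaleR [intro] = bounded_bilinear.smooth_on_prod[OF bounded_bilinear_scaleR, of UNIV, simplified smooth_on_UNIV, OF open_UNIV]
lemmas smooth_mult [intro] =
  bounded_bilinear.smooth_on_prod[OF bounded_bilinear_mult, of UNIV, simplified smooth_on_UNIV, OF open_UNIV]
lemmas smooth_inner [intro] =
  bounded_bilinear.smooth_on_prod[OF bounded_bilinear_inner, of UNIV, simplified smooth_on_UNIV, OF open_UNIV]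
lemmas smooth_minus [intro] = smooth_bounded_linear[OF bounded_linear_minus[OF bounded_linear_ident]]
lemmas smooth_of_real = smooth_bounded_linear[OF bounded_linear_of_real]
lemmas pd_scaleR = bounded_bilinear.pd_prod[OF bounded_bilinear_scaleR]
lemmas pd_mult = bounded_bilinear.pd_prod[OF bounded_bilinear_mult]
lemmas pd_inner = bounded_bilinear.pd_prod[OF bounded_bilinear_inner]
lemmas pd_minus = pd_bounded_linear[OF bounded_linear_minus[OF bounded_linear_ident]]

lemma smooth_diff [intro]: "smooth f \<Longrightarrow> smooth g \<Longrightarrow> smooth (\<lambda>x. f x - g x)"
  using smooth_add[of f "\<lambda>x. - g x"] by auto

lemma pd_diff:
  assumes "f differentiable (at x)" "g differentiable (at x)"
  shows "pd i (\<lambda>x. f x - g x) x = pd i f x - pd i g x"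
  using pd_add[of f x "\<lambda>x. - g x" i] pd_minus[of g x i] assms by (simp add: differentiable_minus)

lemma smooth_sum [intro]: "(\<And>k. k \<in> K \<Longrightarrow> smooth (f k)) \<Longrightarrow> smooth (\<lambda>x. \<Sum>k\<in>K. f k x)"
  by (induction K rule: infinite_finite_induct) auto

lemma pd_linear: "bounded_linear T \<Longrightarrow> pd i T x = T (axis i 1)"
  by (rule pd_eq[OF bounded_linear_imp_has_derivative])

lemma smooth_linear: "bounded_linear T \<Longrightarrow> smooth T"
proof (rule smooth_coinduct[of _ "insert T (range (\<lambda>c x. c))"])
  fix h i assume T: "bounded_linear T" "h \<in> insert T (range (\<lambda>c x. c))"
  show "\<exists>gs. set gs \<subseteq> insert T (range (\<lambda>c x. c)) \<and> (\<forall>x\<in>UNIV. pd i h x = (\<Sum>g\<leftarrow>gs. g x))"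
  proof (cases "h = T")
    case True
    then show ?thesis using T pd_linear by (intro exI[of _ "[\<lambda>x. T (axis i 1)]"]) auto
  next
    case False
    then have "pd i h = (\<lambda>x. 0)" using T by auto
    then show ?thesis by (intro exI[of _ "[]"]) auto
  qed
qed (auto simp: linear_imp_differentiable bounded_linear.linear)

lemma pd_compose_linear:
  fixes A :: "real^2 \<Rightarrow> real^2"
  assumes "bounded_linear A" "f differentiable (at (A x))"
  shows "pd i (\<lambda>x. f (A x)) x = (\<Sum>j\<in>UNIV. (A (axis i 1) $ j) *\<^sub>R pd j f (A x))"
  using pd_eq[OF has_derivative_compose[OF bounded_linear_imp_has_derivative[OF assms(1)] pd_has_derivative[OF assms(2)]], of i]
  by simp

text \<open>As in \<open>pd_cong\<close>, the two sides choose from the same set of derivatives, so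
  the equation also holds where \<open>f\<close> is not differentiable.\<close>

lemma pd_translate:
  "pd i (\<lambda>x. f (x - z)) x = pd i f (x - z)"
proof -
  have 1: "((\<lambda>x. f (x - z)) has_derivative D) (at x) \<longleftrightarrow> (f has_derivative D) (at (x - z))" for D
  proof -
    have a: "((\<lambda>x. f (x - z)) has_derivative D) (at x)" if "(f has_derivative D) (at (x - z))"
    proof -
      have "((\<lambda>x. x - z) has_derivative (\<lambda>h. h)) (at x)" by (auto intro!: derivative_eq_intros)
      from has_derivative_compose[OF this that] show ?thesis by simp
    qed
    have b: "(f has_derivative D) (at (x - z))" if "((\<lambda>x. f (x - z)) has_derivative D) (at x)"
    proof -
      have "((\<lambda>x. x + z) has_derivative (\<lambda>h. h)) (at (x - z))" by (auto intro!: derivative_eq_intros)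
      from has_derivative_compose[OF this, of "\<lambda>x. f (x - z)" D] that show ?thesis by simp
    qed
    from a b show ?thesis by blast
  qed
  show ?thesis by (simp add: pd_def frechet_derivative_def 1)
qed

text \<open>The scalar factor in the family absorbs the matrix entries of \<open>A\<close> that the
  chain rule produces.\<close>

lemma smooth_compose_linear:
  fixes A :: "real^2 \<Rightarrow> real^2"
  assumes "bounded_linear A" "smooth f"
  shows "smooth (\<lambda>x. f (A x))"
proof (rule smooth_coinduct[of _ "{\<lambda>x. c *\<^sub>R f (A x) | c f. smooth f}"])
  let ?X = "{\<lambda>x. c *\<^sub>R f (A x) | c f. smooth f}"
  have d: "(\<lambda>x. f (A x)) differentiable (at x)" if "smooth f" for f x
    by (rule differentiableI[OF has_derivative_compose[OF bounded_linear_imp_has_derivative[OF assms(1)] smooth_has_derivative[OF that]]])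
  show "(\<lambda>x. f (A x)) \<in> ?X" using assms(2) by (auto intro!: exI[of _ 1])
  show "h differentiable (at x)" if "h \<in> ?X" "x \<in> UNIV" for h x
  proof -
    from that obtain c f where f: "h = (\<lambda>x. c *\<^sub>R f (A x))" "smooth f" by auto
    from d[OF f(2), of x] obtain D where "((\<lambda>x. f (A x)) has_derivative D) (at x)"
      unfolding differentiable_def by blast
    from differentiableI[OF has_derivative_scaleR_right[OF this]] f(1) show ?thesis by simp
  qed
  show "\<exists>gs. set gs \<subseteq> ?X \<and> (\<forall>x\<in>UNIV. pd i h x = (\<Sum>g\<leftarrow>gs. g x))"
    if "h \<in> ?X" for h i
  proof -
    from that obtain c f where f: "h = (\<lambda>x. c *\<^sub>R f (A x))" "smooth f" by auto
    have "pd i h x = c *\<^sub>R (\<Sum>j\<in>UNIV. (A (axis i 1) $ j) *\<^sub>R pd j f (A x))" for x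
      unfolding f using pd_compose_linear[OF assms(1) smoothD[OF f(2)], of i x]
        pd_bounded_linear[OF bounded_linear_scaleR_right[of c] d[OF f(2)], of i x] by simp
    then have "\<forall>x\<in>UNIV. pd i h x = (\<Sum>g\<leftarrow>[\<lambda>x. (c * A (axis i 1) $ 1) *\<^sub>R pd 1 f (A x), \<lambda>x. (c * A (axis i 1) $ 2) *\<^sub>R pd 2 f (A x)]. g x)"
      by (simp add: sum_2 scaleR_add_right)
    moreover have "set [\<lambda>x. (c * A (axis i 1) $ 1) *\<^sub>R pd 1 f (A x), \<lambda>x. (c * A (axis i 1) $ 2) *\<^sub>R pd 2 f (A x)] \<subseteq> ?X"
      using f smooth_pd by auto
    ultimately show ?thesis by blast
  qed
qed

lemma smooth_translate:
  assumes "smooth f"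
  shows "smooth (\<lambda>x. f (x - z))"
proof (rule smooth_coinduct[of _ "{\<lambda>x. f (x - z) | f. smooth f}"])
  show "h differentiable (at x)" if "h \<in> {\<lambda>x. f (x - z) | f. smooth f}" for h x
  proof -
    from that obtain f where f: "h = (\<lambda>x. f (x - z))" "smooth f" by auto
    have "((\<lambda>x. x - z) has_derivative (\<lambda>h. h)) (at x)" by (auto intro!: derivative_eq_intros)
    from differentiableI[OF has_derivative_compose[OF this smooth_has_derivative[OF f(2)]]] f show ?thesis
      by simp
  qed
  show "\<exists>gs. set gs \<subseteq> {\<lambda>x. f (x - z) | f. smooth f} \<and> (\<forall>x\<in>UNIV. pd i h x = (\<Sum>g\<leftarrow>gs. g x))"
    if "h \<in> {\<lambda>x. f (x - z) | f. smooth f}" for h i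
  proof -
    from that obtain f where f: "h = (\<lambda>x. f (x - z))" "smooth f" by auto
    then show ?thesis
      by (intro exI[of _ "[\<lambda>x. pd i f (x - z)]"]) (auto simp: pd_translate intro: smooth_pd)
  qed
qed (use assms in auto)

lemma pd_compose_real:
  assumes "q differentiable (at x)" "(H has_real_derivative D) (at (q x))"
  shows "pd i (\<lambda>x. H (q x)) x = D * pd i q x" "(\<lambda>x. H (q x)) differentiable (at x)"
proof -
  have *: "((\<lambda>x. H (q x)) has_derivative (\<lambda>h. D * (\<Sum>i\<in>UNIV. (h $ i) *\<^sub>R pd i q x))) (at x)"
    using has_derivative_compose[OF pd_has_derivative[OF assms(1)] assms(2)[THEN has_field_derivative_imp_has_derivative]] by simp
  show "pd i (\<lambda>x. H (q x)) x = D * pd i q x"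
    using pd_eq[OF *, of i] by simp
  show "(\<lambda>x. H (q x)) differentiable (at x)" by (rule differentiableI[OF *])
qed

text \<open>The sequence \<open>H\<close> supplies all derivatives of the outer function, so the
  products of a smooth factor with some \<open>H n (q x)\<close> are closed under the product and
  chain rules.\<close>

lemma smooth_compose_real:
  fixes H :: "nat \<Rightarrow> real \<Rightarrow> real"
  assumes "\<And>n t. (H n has_real_derivative H (Suc n) t) (at t)" "smooth q"
  shows "smooth (\<lambda>x. H n (q x))"
proof (rule smooth_coinduct[of _ "{\<lambda>x. c x * H n (q x) | c n. smooth c}"])
  let ?X = "{\<lambda>x. c x * H n (q x) | c n. smooth c}"
  note H = pd_compose_real[OF smoothD[OF assms(2)] assms(1)]
  show "(\<lambda>x. H n (q x)) \<in> ?X" by (auto intro!: exI[of _ "\<lambda>x. 1"])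
  show "h differentiable (at x)" if "h \<in> ?X" for h x
  proof -
    from that obtain c n where "h = (\<lambda>x. c x * H n (q x))" "smooth c" by auto
    then show ?thesis by (auto intro!: differentiable_mult H(2) smoothD[of c])
  qed
  show "\<exists>gs. set gs \<subseteq> ?X \<and> (\<forall>x\<in>UNIV. pd i h x = (\<Sum>g\<leftarrow>gs. g x))"
    if "h \<in> ?X" for h i
  proof -
    from that obtain c n where f: "h = (\<lambda>x. c x * H n (q x))" "smooth c" by auto
    let ?gs = "[\<lambda>x. pd i c x * H n (q x), \<lambda>x. (c x * pd i q x) * H (Suc n) (q x)]"
    have "\<forall>x\<in>UNIV. pd i h x = (\<Sum>g\<leftarrow>?gs. g x)"
      unfolding f using pd_mult[OF smoothD[OF f(2)] H(2)] H(1) by (auto simp: algebra_simps)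
    moreover have "set ?gs \<subseteq> ?X"
    proof -
      have "(\<lambda>x. pd i c x * H n (q x)) \<in> ?X"
        by (rule CollectI, intro exI[of _ "pd i c"] exI[of _ n] conjI refl smooth_pd f(2))
      moreover have "(\<lambda>x. (c x * pd i q x) * H (Suc n) (q x)) \<in> ?X"
        by (rule CollectI, intro exI[of _ "\<lambda>x. c x * pd i q x"] exI[of _ "Suc n"] conjI refl
            smooth_mult smooth_pd f(2) assms(2))
      ultimately show ?thesis by simp
    qed
    ultimately show ?thesis by blast
  qed
qed

lemma smooth_exp: "smooth q \<Longrightarrow> smooth (\<lambda>x. exp (q x :: real))"
  using smooth_compose_real[of "\<lambda>n. exp" q 0] by (auto simp: DERIV_exp)

lemma pd_exp: "smooth q \<Longrightarrow> pd i (\<lambda>x. exp (q x :: real)) x = exp (q x) * pd i q x"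
  by (rule pd_compose_real) (auto intro: smoothD DERIV_exp)

text \<open>The second difference is symmetric in \<open>i\<close> and \<open>j\<close>, so
  identifying its limit as one mixed derivative shows at once that both mixed derivatives agree. The
  proof uses total differentiability of the first partial derivative at the single point
  \<open>x\<close>.\<close>

lemma second_difference_limit:
  fixes f :: "real^2 \<Rightarrow> 'b::real_normed_vector"
  assumes f: "smooth f"
  shows "((\<lambda>h. (f (x + h *\<^sub>R axis i 1 + h *\<^sub>R axis j 1) - f (x + h *\<^sub>R axis i 1)
            - f (x + h *\<^sub>R axis j 1) + f x) /\<^sub>R h\<^sup>2) \<longlongrightarrow> pd j (pd i f) x) (at_right 0)"
    (is "((\<lambda>h. ?S h /\<^sub>R h\<^sup>2) \<longlongrightarrow> ?l) _")
proof (rule tendstoI)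
  fix e :: real assume "e > 0"
  define a where "a = axis i (1::real)"
  define b where "b = axis j (1::real)"
  have na: "norm a = 1" "norm b = 1" by (auto simp: a_def b_def)
  let ?A = "pd i f"
  define DA where "DA = (\<lambda>h::real^2. \<Sum>k\<in>UNIV. (h $ k) *\<^sub>R pd k ?A x)"
  have DA: "(?A has_derivative DA) (at x)"
    unfolding DA_def by (rule smooth_has_derivative[OF smooth_pd[OF f]])
  then interpret DA: bounded_linear DA by (rule has_derivative_bounded_linear)
  have DAb: "DA b = ?l" by (simp add: DA_def b_def)
  define e' where "e' = e / 4"
  have e': "e' > 0" using \<open>e > 0\<close> by (simp add: e'_def)
  obtain d where d: "d > 0" "\<And>y. norm (y - x) < d \<Longrightarrow> norm (?A y - ?A x - DA (y - x)) \<le> e' * norm (y - x)"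
    using DA e' unfolding has_derivative_at_alt by blast
  show "\<forall>\<^sub>F h in at_right 0. dist (?S h /\<^sub>R h\<^sup>2) ?l < e"
    unfolding eventually_at_right_field
  proof (intro exI[of _ "d / 2"] conjI allI impI)
    fix h :: real assume h: "0 < h" "h < d / 2"
    \<comment> \<open>\<open>g\<close> is the increment of \<open>f\<close> in direction
      \<open>b\<close>, as a function of the position \<open>t\<close> along \<open>a\<close>, minus
      the linear growth predicted by \<open>DA\<close>. Then \<open>g h - g 0\<close> is the error
      to be estimated, and the mean value inequality bounds it through \<open>g'\<close>.\<close>
    define g where "g t = f (x + t *\<^sub>R a + h *\<^sub>R b) - f (x + t *\<^sub>R a) - (t * h) *\<^sub>R DA b" for t
    define g' where "g' t = ?A (x + t *\<^sub>R a + h *\<^sub>R b) - ?A (x + t *\<^sub>R a) - h *\<^sub>R DA b" for t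
    have der: "(g has_derivative (\<lambda>u. u *\<^sub>R g' t)) (at t within {0..h})" for t
    proof -
      have l: "((\<lambda>t. c + t *\<^sub>R a) has_derivative (\<lambda>u. u *\<^sub>R a)) (at t within {0..h})" for c
        by (auto intro!: derivative_eq_intros)
      have 1: "((\<lambda>t. f (c + t *\<^sub>R a)) has_derivative (\<lambda>u. u *\<^sub>R ?A (c + t *\<^sub>R a))) (at t within {0..h})" for c
        using has_derivative_compose[OF l smooth_has_derivative[OF f]]
        by (simp add: a_def scaleR_sum_right[symmetric] scaleR_scaleR[symmetric] del: scaleR_scaleR)
      have "(g has_derivative (\<lambda>u. u *\<^sub>R ?A (x + h *\<^sub>R b + t *\<^sub>R a) - u *\<^sub>R ?A (x + t *\<^sub>R a) - (u * h) *\<^sub>R DA b)) (at t within {0..h})"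
        unfolding g_def add.commute[of "x + _ *\<^sub>R a" "h *\<^sub>R b"] add.assoc[symmetric] add.commute[of "h *\<^sub>R b" x]
        by (intro has_derivative_diff 1 derivative_eq_intros) (auto)
      then show ?thesis
        by (simp add: g'_def algebra_simps scaleR_diff_right)
    qed
    \<comment> \<open>\<open>g' t\<close> is the difference of two first-order remainders of
      \<open>pd i f\<close> at \<open>x\<close>, for displacements of length at most
      \<open>2 * h\<close> and \<open>h\<close>; hence the factor 3, which stays below the 4 in the
      choice of \<open>e'\<close>.\<close>
    have bd: "onorm (\<lambda>u. u *\<^sub>R g' t) \<le> 3 * e' * h" if t: "t \<in> {0..h}" for t
    proof -
      have n1: "norm (t *\<^sub>R a + h *\<^sub>R b) \<le> 2 * h"
        using norm_triangle_ineq[of "t *\<^sub>R a" "h *\<^sub>R b"] t h na by simp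
      have n2: "norm (t *\<^sub>R a) \<le> h" using t h na by simp
      have i1: "norm (?A (x + t *\<^sub>R a + h *\<^sub>R b) - ?A x - DA (t *\<^sub>R a + h *\<^sub>R b)) \<le> e' * (2 * h)"
      proof -
        have "norm (?A (x + t *\<^sub>R a + h *\<^sub>R b) - ?A x - DA (t *\<^sub>R a + h *\<^sub>R b))
            \<le> e' * norm (t *\<^sub>R a + h *\<^sub>R b)"
          using d(2)[of "x + t *\<^sub>R a + h *\<^sub>R b"] n1 h by (simp add: add.assoc)
        also have "\<dots> \<le> e' * (2 * h)" using n1 e' by (intro mult_left_mono) auto
        finally show ?thesis .
      qed
      have i2: "norm (?A (x + t *\<^sub>R a) - ?A x - DA (t *\<^sub>R a)) \<le> e' * h"
      proof -
        have "norm (?A (x + t *\<^sub>R a) - ?A x - DA (t *\<^sub>R a)) \<le> e' * norm (t *\<^sub>R a)"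
          using d(2)[of "x + t *\<^sub>R a"] n2 h by simp
        also have "\<dots> \<le> e' * h" using n2 e' by (intro mult_left_mono) auto
        finally show ?thesis .
      qed
      have "g' t = (?A (x + t *\<^sub>R a + h *\<^sub>R b) - ?A x - DA (t *\<^sub>R a + h *\<^sub>R b))
          - (?A (x + t *\<^sub>R a) - ?A x - DA (t *\<^sub>R a))"
        by (simp add: g'_def DA.add DA.scale)
      then have "norm (g' t) \<le> 3 * e' * h"
        using norm_triangle_ineq4[of "?A (x + t *\<^sub>R a + h *\<^sub>R b) - ?A x - DA (t *\<^sub>R a + h *\<^sub>R b)"
           "?A (x + t *\<^sub>R a) - ?A x - DA (t *\<^sub>R a)"] i1 i2 by simp
      then show ?thesis
        using mult_right_mono[of "norm (g' t)" "3 * e' * h"]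
        by (intro onorm_le) (simp add: mult.commute[of "\<bar>_\<bar>"])
    qed
    have "norm (g h - g 0) \<le> 3 * e' * h * norm (h - 0)"
      by (rule differentiable_bound[OF convex_real_interval(5) der bd]) (use h in auto)
    moreover have "g h - g 0 = ?S h - h\<^sup>2 *\<^sub>R ?l"
      by (simp add: g_def DAb[unfolded b_def] a_def b_def power2_eq_square)
    ultimately have "norm (?S h - h\<^sup>2 *\<^sub>R ?l) \<le> 3 * e' * h\<^sup>2"
      using h by (simp add: power2_eq_square)
    moreover have "?S h /\<^sub>R h\<^sup>2 - ?l = (?S h - h\<^sup>2 *\<^sub>R ?l) /\<^sub>R h\<^sup>2"
      using h by (simp add: scaleR_diff_right)
    moreover have "norm (X /\<^sub>R h\<^sup>2) \<le> 3 * e'" if "norm X \<le> 3 * e' * h\<^sup>2" for X :: 'b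
      using h that by (simp add: divide_simps)
    ultimately have "norm (?S h /\<^sub>R h\<^sup>2 - ?l) \<le> 3 * e'"
      by (simp only:)
    then show "dist (?S h /\<^sub>R h\<^sup>2) ?l < e"
      using e' by (simp add: dist_norm e'_def)
  qed (use d in auto)
qed

lemma pd_commute:
  assumes "smooth f"
  shows "pd i (pd j f) x = pd j (pd i f) x"
proof -
  have eq: "(\<lambda>h. (f (x + h *\<^sub>R axis i 1 + h *\<^sub>R axis j 1) - f (x + h *\<^sub>R axis i 1)
            - f (x + h *\<^sub>R axis j 1) + f x) /\<^sub>R h\<^sup>2)
    = (\<lambda>h. (f (x + h *\<^sub>R axis j 1 + h *\<^sub>R axis i 1) - f (x + h *\<^sub>R axis j 1)
            - f (x + h *\<^sub>R axis i 1) + f x) /\<^sub>R h\<^sup>2)"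
    by (rule ext) (simp add: algebra_simps)
  show ?thesis
    by (rule tendsto_unique[OF trivial_limit_at_right_real second_difference_limit[OF assms, of x j i]
          second_difference_limit[OF assms, of x i j, unfolded eq]])
qed

text \<open>In the plane a bounded support has compact closure; boundedness passes more easily
  through sums, products and derivatives than compactness of the closure.\<close>

abbreviation bsupp :: "(real^2 \<Rightarrow> 'b::zero) \<Rightarrow> bool" where
  "bsupp F \<equiv> bounded {x. F x \<noteq> 0}"

lemma pd_zero_outside:
  assumes "\<And>x. x \<notin> K \<Longrightarrow> F x = 0" "closed K" "x \<notin> K"
  shows "pd i F x = 0"
  using pd_cong[of "- K" x F "\<lambda>x. 0" i] assms by auto

lemma pd_zero_off_closure: "x \<notin> closure {x. F x \<noteq> 0} \<Longrightarrow> pd i F x = 0"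
  by (rule pd_zero_outside[of "closure {x. F x \<noteq> 0}"]) (use closure_subset[of "{x. F x \<noteq> 0}"] in auto)

lemma bsupp_pd: "bsupp F \<Longrightarrow> bsupp (pd i F)"
  by (rule bounded_subset[OF bounded_closure]) (use pd_zero_off_closure in auto)

lemma bsupp_mono: "bsupp F \<Longrightarrow> (\<And>x. F x = 0 \<Longrightarrow> G x = 0) \<Longrightarrow> bsupp G"
  by (erule bounded_subset) auto

lemma bsupp_add: "bsupp F \<Longrightarrow> bsupp G \<Longrightarrow> bsupp (\<lambda>x. F x + G x :: 'b::monoid_add)"
  by (rule bounded_subset[of "{x. F x \<noteq> 0} \<union> {x. G x \<noteq> 0}"]) auto

lemma bsuppE:
  assumes "bsupp F"
  obtains R where "R > 0" "\<And>x. norm x \<ge> R \<Longrightarrow> F x = 0"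
proof -
  from assms obtain B where "B > 0" and B: "\<forall>x\<in>{x. F x \<noteq> 0}. norm x < B"
    using bounded_pos_less by blast
  with that[of B] show ?thesis by fastforce
qed

lemma integrable_bsupp:
  fixes F :: "real^2 \<Rightarrow> 'b::{banach, second_countable_topology}"
  assumes "continuous_on UNIV F" "bsupp F"
  shows "integrable lborel F"
proof -
  obtain R where R: "\<And>x. norm x \<ge> R \<Longrightarrow> F x = 0" using bsuppE[OF assms(2)] by blast
  have "integrable lborel (\<lambda>x. indicator (cball 0 R) x *\<^sub>R F x)"
    by (rule borel_integrable_compact) (auto intro: continuous_on_subset[OF assms(1)])
  also have "(\<lambda>x. indicator (cball 0 R) x *\<^sub>R F x) = F"
    using R by (auto simp: indicator_def fun_eq_iff)
  finally show ?thesis .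
qed

lemma smooth_borel [measurable]: "smooth (F :: real^2 \<Rightarrow> 'b::real_normed_vector) \<Longrightarrow> F \<in> borel_measurable borel"
  by (intro borel_measurable_continuous_onI smooth_continuous)

lemma integrable_smooth:
  fixes F :: "real^2 \<Rightarrow> 'b::{banach, second_countable_topology}"
  shows "smooth F \<Longrightarrow> bsupp F \<Longrightarrow> integrable lborel F"
  by (intro integrable_bsupp smooth_continuous)

section \<open>Integration by parts on the plane and on cones\<close>

definition perp :: "real^2 \<Rightarrow> real^2" where "perp e = vector [- (e $ 2), e $ 1]"

lemma perp_nth [simp]: "perp e $ 1 = - (e $ 2)" "perp e $ 2 = e $ 1"
  by (simp_all add: perp_def)

lemma inner_vec2: "(x :: real^2) \<bullet> y = x $ 1 * y $ 1 + x $ 2 * y $ 2"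
  by (simp add: inner_vec_def sum_2)

lemma vec2_eq_iff: "(x :: 'b^2) = y \<longleftrightarrow> x $ 1 = y $ 1 \<and> x $ 2 = y $ 2"
  by (simp add: vec_eq_iff forall_2)

definition cone :: "real^2 \<Rightarrow> real^2 \<Rightarrow> (real^2) set" where
  "cone e f = {s *\<^sub>R e + t *\<^sub>R f | s t. s > 0 \<and> t > 0}"

text \<open>Both measures give every box the product of its side lengths. This makes Fubini's
  theorem for pairs of reals available on \<open>real^2\<close>.\<close>

lemma lborel_vec2: "distr (lborel \<Otimes>\<^sub>M lborel) borel (\<lambda>(s, t). vector [s, t] :: real^2) = lborel"
proof (rule sym, rule lborel_eqI)
  have m: "(\<lambda>(s, t). vector [s, t] :: real^2) \<in> borel_measurable (lborel \<Otimes>\<^sub>M lborel)"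
  proof -
    have "(\<lambda>p. fst p *\<^sub>R axis 1 1 + snd p *\<^sub>R axis 2 (1::real)) \<in> borel_measurable (lborel \<Otimes>\<^sub>M lborel)"
      by measurable
    also have "(\<lambda>p. fst p *\<^sub>R axis 1 1 + snd p *\<^sub>R axis 2 (1::real)) = (\<lambda>(s, t). vector [s, t] :: real^2)"
      by (auto simp: fun_eq_iff vec2_eq_iff axis_def)
    finally show ?thesis .
  qed
  fix l u :: "real^2" assume lu: "\<And>b. b \<in> Basis \<Longrightarrow> l \<bullet> b \<le> u \<bullet> b"
  then have lu': "l $ i \<le> u $ i" for i using lu[of "axis i 1"] by (simp add: inner_axis)
  have "(\<lambda>(s, t). vector [s, t] :: real^2) -` box l u \<inter> space (lborel \<Otimes>\<^sub>M lborel)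
      = {l $ 1<..<u $ 1} \<times> {l $ 2<..<u $ 2}"
    by (auto simp: mem_box_cart forall_2 space_pair_measure)
  then have "emeasure (distr (lborel \<Otimes>\<^sub>M lborel) borel (\<lambda>(s, t). vector [s, t] :: real^2)) (box l u)
      = ennreal (u $ 1 - l $ 1) * ennreal (u $ 2 - l $ 2)"
    using m lu' by (simp add: emeasure_distr lborel.emeasure_pair_measure_Times)
  also have "\<dots> = (\<Prod>b\<in>Basis. (u - l) \<bullet> b)"
  proof -
    have B: "(Basis :: (real^2) set) = {axis 1 1, axis 2 1}" by (auto simp: Basis_vec_def UNIV_2)
    have ne: "axis (1::2) (1::real) \<noteq> axis 2 1" by (auto simp: axis_eq_axis)
    have "ennreal (u $ 1 - l $ 1) * ennreal (u $ 2 - l $ 2) = ennreal ((u $ 1 - l $ 1) * (u $ 2 - l $ 2))"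
      using lu'[of 1] lu'[of 2] by (simp add: ennreal_mult')
    moreover have "(\<Prod>b\<in>Basis. (u - l) \<bullet> b) = ((u - l) \<bullet> axis 1 1) * ((u - l) \<bullet> axis 2 1)"
      by (subst B, subst prod.insert) (use ne in auto)
    ultimately show ?thesis by (simp only:) (simp add: inner_axis)
  qed
  finally show "emeasure (distr (lborel \<Otimes>\<^sub>M lborel) borel (\<lambda>(s, t). vector [s, t] :: real^2)) (box l u)
      = (\<Prod>b\<in>Basis. (u - l) \<bullet> b)" .
qed simp

text \<open>Change of variables to coordinates along \<open>e\<close> and \<open>f\<close>, with
  Jacobian \<open>\<bar>D\<bar>\<close>. In these coordinates a cone becomes a quadrant, to which
  Fubini and the fundamental theorem of calculus apply directly.\<close>

lemma lborel_oblique: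
  fixes e f :: "real^2"
  assumes D: "D = e $ 1 * f $ 2 - e $ 2 * f $ 1" "D \<noteq> 0"
  shows "density (distr (lborel \<Otimes>\<^sub>M lborel) borel (\<lambda>(s, t). s *\<^sub>R e + t *\<^sub>R f)) (\<lambda>_. ennreal \<bar>D\<bar>) = lborel"
proof (rule sym, rule lborel_eqI)
  let ?T = "\<lambda>(s, t). s *\<^sub>R e + t *\<^sub>R f"
  define L where "L = (\<lambda>x::real^2. x $ 1 *\<^sub>R e + x $ 2 *\<^sub>R f)"
  \<comment> \<open>\<open>K\<close> inverts \<open>L\<close> by Cramer's rule. The preimage of a
    box under \<open>L\<close> is then its image under \<open>K\<close>, and linear images scale
    measure by the determinant \<open>1 / D\<close>.\<close>
  define K where "K = (\<lambda>x::real^2. vector [(x $ 1 * f $ 2 - x $ 2 * f $ 1) / D, (e $ 1 * x $ 2 - e $ 2 * x $ 1) / D] :: real^2)"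
  have KL: "K (L x) = x" for x
  proof -
    have "(x $ 1 * e $ 1 + x $ 2 * f $ 1) * f $ 2 - (x $ 1 * e $ 2 + x $ 2 * f $ 2) * f $ 1 = x $ 1 * D"
      "e $ 1 * (x $ 1 * e $ 2 + x $ 2 * f $ 2) - e $ 2 * (x $ 1 * e $ 1 + x $ 2 * f $ 1) = x $ 2 * D"
      by (simp_all add: D(1) algebra_simps)
    then show ?thesis using D(2) by (simp add: K_def L_def vec2_eq_iff)
  qed
  have LK: "L (K x) = x" for x
  proof -
    have "(x $ 1 * f $ 2 - x $ 2 * f $ 1) * e $ i + (e $ 1 * x $ 2 - e $ 2 * x $ 1) * f $ i = x $ i * D"
      if "i = 1 \<or> i = 2" for i :: 2
      using that by (auto simp: D(1) algebra_simps)
    from this[of 1] this[of 2] show ?thesis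
      using D(2) by (simp add: K_def L_def vec2_eq_iff add_divide_distrib[symmetric] times_divide_eq_left)
  qed
  have linK: "linear K"
    by (rule linearI) (simp_all add: K_def vec2_eq_iff algebra_simps add_divide_distrib diff_divide_distrib)
  have detK: "det (matrix K) = 1 / D"
  proof -
    have "det (matrix K) = (f $ 2 * e $ 1 - f $ 1 * e $ 2) / (D * D)"
      by (simp add: det_2 matrix_def K_def axis_def diff_divide_distrib)
    also have "f $ 2 * e $ 1 - f $ 1 * e $ 2 = D" by (simp add: D(1))
    finally show ?thesis using D(2) by simp
  qed
  have mT: "?T \<in> borel_measurable (lborel \<Otimes>\<^sub>M lborel)" by measurable
  have mL: "L \<in> borel_measurable borel"
    unfolding L_def by (intro borel_measurable_continuous_onI continuous_intros)
  have dT: "distr (lborel \<Otimes>\<^sub>M lborel) borel ?T = distr lborel borel L"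
  proof -
    have mv: "(\<lambda>(s, t). vector [s, t] :: real^2) \<in> borel_measurable (lborel \<Otimes>\<^sub>M lborel)"
    proof -
      have "(\<lambda>p. fst p *\<^sub>R axis 1 1 + snd p *\<^sub>R axis 2 (1::real)) \<in> borel_measurable (lborel \<Otimes>\<^sub>M lborel)"
        by measurable
      also have "(\<lambda>p. fst p *\<^sub>R axis 1 1 + snd p *\<^sub>R axis 2 (1::real)) = (\<lambda>(s, t). vector [s, t] :: real^2)"
        by (auto simp: fun_eq_iff vec2_eq_iff axis_def)
      finally show ?thesis .
    qed
    have "distr lborel borel L = distr (distr (lborel \<Otimes>\<^sub>M lborel) borel (\<lambda>(s, t). vector [s, t] :: real^2)) borel L"
      by (simp add: lborel_vec2)
    also have "\<dots> = distr (lborel \<Otimes>\<^sub>M lborel) borel (L \<circ> (\<lambda>(s, t). vector [s, t]))"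
      by (rule distr_distr[OF mL mv])
    also have "L \<circ> (\<lambda>(s, t). vector [s, t]) = ?T" by (auto simp: fun_eq_iff L_def)
    finally show ?thesis by simp
  qed
  fix l u :: "real^2" assume lu: "\<And>b. b \<in> Basis \<Longrightarrow> l \<bullet> b \<le> u \<bullet> b"
  have im: "L -` box l u = K ` box l u"
  proof safe
    fix x assume "L x \<in> box l u"
    then show "x \<in> K ` box l u" using KL[of x] by (intro image_eqI[of _ _ "L x"]) auto
  qed (simp add: LK)
  have bm: "L -` box l u \<in> sets borel"
    using measurable_sets[OF mL, of "box l u"] by simp
  have lm: "box l u \<in> lmeasurable" by simp
  have "emeasure lborel (L -` box l u) = emeasure lebesgue (K ` box l u)"
    using bm by (simp add: im)
  also have "\<dots> = measure lebesgue (K ` box l u)"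
    using measurable_linear_image[OF linK lm] by (simp add: emeasure_eq_measure2 fmeasurableD2)
  also have "\<dots> = \<bar>1 / D\<bar> * measure lebesgue (box l u)"
    by (simp add: measure_linear_image[OF linK lm] detK)
  also have "measure lebesgue (box l u) = (\<Prod>b\<in>Basis. (u - l) \<bullet> b)"
    using lu by (simp add: measure_lborel_box_eq)
  finally have *: "emeasure lborel (L -` box l u) = ennreal (\<bar>1 / D\<bar> * (\<Prod>b\<in>Basis. (u - l) \<bullet> b))" .
  have "emeasure (density (distr lborel borel L) (\<lambda>_. ennreal \<bar>D\<bar>)) (box l u) = ennreal \<bar>D\<bar> * emeasure (distr lborel borel L) (box l u)"
    by (subst emeasure_density_const) auto
  also have "\<dots> = (\<Prod>b\<in>Basis. (u - l) \<bullet> b)"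
    using mL D(2) by (simp add: emeasure_distr * ennreal_mult'[symmetric] abs_divide)
  finally show "emeasure (density (distr (lborel \<Otimes>\<^sub>M lborel) borel ?T) (\<lambda>_. ennreal \<bar>D\<bar>)) (box l u)
      = (\<Prod>b\<in>Basis. (u - l) \<bullet> b)"
    by (simp add: dT)
qed simp

lemma oblique_integral:
  fixes e f :: "real^2" and F :: "real^2 \<Rightarrow> 'b::{banach, second_countable_topology}"
  assumes D: "D = e $ 1 * f $ 2 - e $ 2 * f $ 1" "D \<noteq> 0" and F: "integrable lborel F"
  shows "integrable (lborel \<Otimes>\<^sub>M lborel) (\<lambda>(s, t). F (s *\<^sub>R e + t *\<^sub>R f))"
    and "(LINT x|lborel. F x) = \<bar>D\<bar> *\<^sub>R (LINT t|lborel. LINT s|lborel. F (s *\<^sub>R e + t *\<^sub>R f))"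
    and "(LINT x|lborel. F x) = \<bar>D\<bar> *\<^sub>R (LINT s|lborel. LINT t|lborel. F (s *\<^sub>R e + t *\<^sub>R f))"
proof -
  let ?T = "\<lambda>(s, t). s *\<^sub>R e + t *\<^sub>R f"
  have mT: "?T \<in> borel_measurable (lborel \<Otimes>\<^sub>M lborel)" by measurable
  have mF: "F \<in> borel_measurable borel" using F by (auto dest: borel_measurable_integrable)
  note l = lborel_oblique[OF D, symmetric]
  have "integrable (distr (lborel \<Otimes>\<^sub>M lborel) borel ?T) (\<lambda>x. \<bar>D\<bar> *\<^sub>R F x)"
    using F mF by (subst (asm) l) (simp add: integrable_density)
  then have "integrable (distr (lborel \<Otimes>\<^sub>M lborel) borel ?T) F"
    using D(2) integrable_scaleR_right[of "inverse \<bar>D\<bar>" "distr (lborel \<Otimes>\<^sub>M lborel) borel ?T" "\<lambda>x. \<bar>D\<bar> *\<^sub>R F x"]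
    by (simp del: integrable_scaleR_right)
  then show i: "integrable (lborel \<Otimes>\<^sub>M lborel) (\<lambda>(s, t). F (s *\<^sub>R e + t *\<^sub>R f))"
    using integrable_distr_eq[OF mT mF] by (simp add: case_prod_unfold)
  have "(LINT x|lborel. F x) = \<bar>D\<bar> *\<^sub>R (LINT p|(lborel \<Otimes>\<^sub>M lborel). F (?T p))"
    using mF mT by (subst l) (simp add: integral_density integral_distr)
  then have *: "(LINT x|lborel. F x) = \<bar>D\<bar> *\<^sub>R (LINT p|(lborel \<Otimes>\<^sub>M lborel). (\<lambda>(s, t). F (s *\<^sub>R e + t *\<^sub>R f)) p)"
    by (simp add: case_prod_unfold)
  show "(LINT x|lborel. F x) = \<bar>D\<bar> *\<^sub>R (LINT t|lborel. LINT s|lborel. F (s *\<^sub>R e + t *\<^sub>R f))"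
    using lborel_pair.integral_snd[OF i] * by simp
  show "(LINT x|lborel. F x) = \<bar>D\<bar> *\<^sub>R (LINT s|lborel. LINT t|lborel. F (s *\<^sub>R e + t *\<^sub>R f))"
    using lborel_pair.integral_fst[OF i] * by simp
qed

text \<open>The directional derivative, written through partial derivatives so that it is linear in
  \<open>a\<close> for every \<open>F\<close>; \<open>dd_eq\<close> identifies it where
  \<open>F\<close> is differentiable.\<close>

definition dd :: "real^2 \<Rightarrow> (real^2 \<Rightarrow> 'b::real_normed_vector) \<Rightarrow> real^2 \<Rightarrow> 'b" where
  "dd a F x = (\<Sum>j\<in>UNIV. (a $ j) *\<^sub>R pd j F x)"

lemma dd_axis [simp]: "dd (axis i 1) F x = pd i F x"
  by (simp add: dd_def)

lemma dd_eq:
  assumes "(F has_derivative F') (at x)"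
  shows "dd a F x = F' a"
  using fun_cong[OF has_derivative_unique[OF assms pd_has_derivative[OF differentiableI[OF assms]]], of a]
  by (simp add: dd_def)

lemma dd_add: "dd (a + b) F x = dd a F x + dd b F x"
  by (simp add: dd_def scaleR_add_left sum.distrib)

lemma dd_scale: "dd (c *\<^sub>R a) F x = c *\<^sub>R dd a F x"
  by (simp add: dd_def scaleR_sum_right)

lemma smooth_dd: "smooth F \<Longrightarrow> smooth (dd a F)"
  unfolding dd_def by (intro smooth_sum smooth_scaleR smooth_const smooth_pd)

lemma bsupp_dd: "bsupp F \<Longrightarrow> bsupp (dd a F)"
proof (rule bounded_subset[OF bounded_closure])
  show "{x. dd a F x \<noteq> 0} \<subseteq> closure {x. F x \<noteq> 0}"
  proof
    fix x assume "x \<in> {x. dd a F x \<noteq> 0}"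
    then show "x \<in> closure {x. F x \<noteq> 0}"
      using pd_zero_off_closure[of x F] by (cases "x \<in> closure {x. F x \<noteq> 0}") (auto simp: dd_def)
  qed
qed

lemma dd_vector_derivative:
  assumes "smooth F"
  shows "((\<lambda>t. F (p + t *\<^sub>R a)) has_vector_derivative dd a F (p + t *\<^sub>R a)) (at t within S)"
proof -
  have "((\<lambda>t. p + t *\<^sub>R a) has_derivative (\<lambda>u. u *\<^sub>R a)) (at t within S)"
    by (auto intro!: derivative_eq_intros)
  from has_derivative_compose[OF this smooth_has_derivative[OF assms]]
  show ?thesis
    by (simp add: has_vector_derivative_def dd_def scaleR_sum_right)
qed

section \<open>The fundamental theorem of calculus along lines\<close>

lemma half_line_FTC:
  fixes q :: "real \<Rightarrow> 'b::euclidean_space"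
  assumes q: "\<And>t. (q has_vector_derivative q' t) (at t)" "continuous_on UNIV q'"
    and R: "\<And>t. t \<ge> R \<Longrightarrow> q t = 0" "\<And>t. t \<ge> R \<Longrightarrow> q' t = 0"
  shows "(LINT t|lborel. indicator {c<..} t *\<^sub>R q' t) = - q c"
proof -
  \<comment> \<open>The interval from \<open>c\<close> to \<open>r\<close> contains every point to
    the right of \<open>c\<close> at which \<open>q'\<close> can be nonzero, and
    \<open>q r = 0\<close>.\<close>
  define r where "r = max R c"
  have m: "q' \<in> borel_measurable borel" using q(2) by (rule borel_measurable_continuous_onI)
  have "(LINT t|lborel. indicator {c<..} t *\<^sub>R q' t) = (LINT t|lborel. indicator {c..r} t *\<^sub>R q' t)"
  proof (rule integral_cong_AE)
    show "AE t in lborel. indicator {c<..} t *\<^sub>R q' t = indicator {c..r} t *\<^sub>R q' t"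
      using AE_lborel_singleton[of c]
    proof eventually_elim
      case (elim t)
      then show ?case using R(2)[of t] by (auto simp: indicator_def r_def max_def split: if_splits)
    qed
  qed (use m in measurable)
  also have "\<dots> = q r - q c"
    by (rule integral_FTC_Icc) (auto simp: r_def intro: has_vector_derivative_at_within q(1) continuous_on_subset[OF q(2)])
  also have "q r = 0" by (rule R) (simp add: r_def)
  finally show ?thesis by simp
qed

lemma half_line_integrable:
  fixes q' :: "real \<Rightarrow> 'b::euclidean_space"
  assumes "continuous_on UNIV q'" "\<And>t. \<bar>t\<bar> \<ge> R \<Longrightarrow> q' t = 0"
  shows "integrable lborel q'"
proof -
  have "integrable lborel (\<lambda>x. indicator {-R..R} x *\<^sub>R q' x)"
    by (rule borel_integrable_compact) (auto intro: continuous_on_subset[OF assms(1)])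
  also have "(\<lambda>x. indicator {-R..R} x *\<^sub>R q' x) = q'"
  proof
    fix t show "indicator {-R..R} t *\<^sub>R q' t = q' t"
      using assms(2)[of t] by (cases "\<bar>t\<bar> \<ge> R") (auto simp: indicator_def)
  qed
  finally show ?thesis .
qed

lemma line_FTC:
  fixes q :: "real \<Rightarrow> 'b::euclidean_space"
  assumes q: "\<And>t. (q has_vector_derivative q' t) (at t)" "continuous_on UNIV q'"
    and R: "\<And>t. \<bar>t\<bar> \<ge> R \<Longrightarrow> q t = 0" "\<And>t. \<bar>t\<bar> \<ge> R \<Longrightarrow> q' t = 0"
  shows "(LINT t|lborel. q' t) = 0" "norm (q c) \<le> (LINT t|lborel. norm (q' t))"
proof -
  define r where "r = \<bar>R\<bar> + 1"
  have "(LINT t|lborel. indicator {-r<..} t *\<^sub>R q' t) = - q (- r)"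
    by (rule half_line_FTC[of _ _ "\<bar>R\<bar>"]) (use q R in auto)
  moreover have "indicator {-r<..} t *\<^sub>R q' t = q' t" for t
    using R(2)[of t] by (cases "t > - r") (auto simp: r_def)
  moreover have "q (- r) = 0" by (rule R) (simp add: r_def)
  ultimately show "(LINT t|lborel. q' t) = 0" by simp
  have int: "integrable lborel q'" by (rule half_line_integrable) (use q R in auto)
  have m: "q' \<in> borel_measurable borel" using q(2) by (rule borel_measurable_continuous_onI)
  have "(LINT t|lborel. indicator {c<..} t *\<^sub>R q' t) = - q c"
    by (rule half_line_FTC[of _ _ "\<bar>R\<bar>"]) (use q R in auto)
  then have "norm (q c) = norm (LINT t|lborel. indicator {c<..} t *\<^sub>R q' t)" by simp
  also have "\<dots> \<le> (LINT t|lborel. norm (indicator {c<..} t *\<^sub>R q' t))"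
    by (rule integral_norm_bound)
  also have "\<dots> \<le> (LINT t|lborel. norm (q' t))"
    using int m by (intro integral_mono integrable_norm integrable_mult_indicator) (auto simp: indicator_def)
  finally show "norm (q c) \<le> (LINT t|lborel. norm (q' t))" .
qed

lemma smooth_line_continuous: "smooth F \<Longrightarrow> continuous_on S (\<lambda>t. F (p + t *\<^sub>R a))"
  by (rule continuous_on_compose2[OF smooth_continuous[of F UNIV]]) (auto intro!: continuous_intros)

lemma bsupp_line:
  assumes "bsupp F" "a \<noteq> 0"
  obtains R where "\<And>t. \<bar>t\<bar> \<ge> R \<Longrightarrow> F (p + t *\<^sub>R a) = 0 \<and> dd a F (p + t *\<^sub>R a) = 0"
proof -
  obtain R1 where R1: "\<And>x. norm x \<ge> R1 \<Longrightarrow> F x = 0" using bsuppE[OF assms(1)] by blast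
  obtain R2 where R2: "\<And>x. norm x \<ge> R2 \<Longrightarrow> dd a F x = 0" using bsuppE[OF bsupp_dd[OF assms(1)]] by blast
  show ?thesis
  proof (rule that[of "(max R1 R2 + norm p) / norm a"])
    fix t :: real assume "\<bar>t\<bar> \<ge> (max R1 R2 + norm p) / norm a"
    then have "norm (t *\<^sub>R a) \<ge> max R1 R2 + norm p" using assms(2) by (simp add: field_simps)
    then have "norm (p + t *\<^sub>R a) \<ge> max R1 R2"
      using norm_triangle_ineq2[of "t *\<^sub>R a" "- p"] by (simp add: add.commute) linarith
    then show "F (p + t *\<^sub>R a) = 0 \<and> dd a F (p + t *\<^sub>R a) = 0" using R1 R2 by simp
  qed
qed

lemma smooth_line_FTC:
  fixes F :: "real^2 \<Rightarrow> 'b::euclidean_space"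
  assumes F: "smooth F" "bsupp F" and a: "a \<noteq> 0"
  shows "(LINT t|lborel. dd a F (p + t *\<^sub>R a)) = 0"
    and "norm (F (p + c *\<^sub>R a)) \<le> (LINT t|lborel. norm (dd a F (p + t *\<^sub>R a)))"
    and "(LINT t|lborel. indicator {0<..} t *\<^sub>R dd a F (p + t *\<^sub>R a)) = - F p"
    and "integrable lborel (\<lambda>t. dd a F (p + t *\<^sub>R a))"
    and "integrable lborel (\<lambda>t. F (p + t *\<^sub>R a))"
proof -
  obtain R where R: "\<And>t. \<bar>t\<bar> \<ge> R \<Longrightarrow> F (p + t *\<^sub>R a) = 0 \<and> dd a F (p + t *\<^sub>R a) = 0"
    using bsupp_line[OF F(2) a] by blast
  note v = dd_vector_derivative[OF F(1)] and c = smooth_line_continuous[OF smooth_dd[OF F(1)]]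
  show "(LINT t|lborel. dd a F (p + t *\<^sub>R a)) = 0"
    by (rule line_FTC(1)[OF v c, where R=R]) (use R in auto)
  show "norm (F (p + c *\<^sub>R a)) \<le> (LINT t|lborel. norm (dd a F (p + t *\<^sub>R a)))"
    by (rule line_FTC(2)[OF v c, where R=R]) (use R in auto)
  show "(LINT t|lborel. indicator {0<..} t *\<^sub>R dd a F (p + t *\<^sub>R a)) = - F p"
    using half_line_FTC[OF v c, where R="\<bar>R\<bar>" and c=0] R by simp
  show "integrable lborel (\<lambda>t. dd a F (p + t *\<^sub>R a))"
    by (rule half_line_integrable[OF c]) (use R in auto)
  show "integrable lborel (\<lambda>t. F (p + t *\<^sub>R a))"
    by (rule half_line_integrable[OF smooth_line_continuous[OF F(1)]]) (use R in auto)
qed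

lemma perp_det: "e $ 1 * perp e $ 2 - e $ 2 * perp e $ 1 = e \<bullet> e"
  by (simp add: inner_vec2)

lemma integral_pd_zero:
  fixes F :: "real^2 \<Rightarrow> 'b::euclidean_space"
  assumes F: "smooth F" "bsupp F"
  shows "(LINT x|lborel. pd i F x) = 0"
proof -
  let ?e = "axis i (1::real)"
  have "(LINT x|lborel. pd i F x) = \<bar>1\<bar> *\<^sub>R (LINT t|lborel. LINT s|lborel. pd i F (s *\<^sub>R ?e + t *\<^sub>R perp ?e))"
    by (rule oblique_integral(2)) (use perp_det[of ?e] F in \<open>auto intro: integrable_smooth smooth_pd bsupp_pd simp: inner_axis\<close>)
  also have "\<dots> = 0"
  proof -
    have "(LINT s|lborel. pd i F (s *\<^sub>R ?e + t *\<^sub>R perp ?e)) = 0" for t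
      using smooth_line_FTC(1)[OF F, of ?e "t *\<^sub>R perp ?e"] by (simp add: add.commute)
    then show ?thesis by simp
  qed
  finally show ?thesis .
qed

lemma bsupp_scaleR: "bsupp f \<Longrightarrow> bsupp (\<lambda>x. f x *\<^sub>R (g x :: 'b::real_normed_vector))"
  by (erule bounded_subset) auto

lemma bsupp_scaleR': "bsupp g \<Longrightarrow> bsupp (\<lambda>x. f x *\<^sub>R (g x :: 'b::real_normed_vector))"
  by (erule bounded_subset) auto

lemma ibp:
  fixes u :: "real^2 \<Rightarrow> 'b::euclidean_space"
  assumes "smooth \<phi>" "smooth u" "bsupp \<phi>"
  shows "(LINT x|lborel. pd i \<phi> x *\<^sub>R u x) = - (LINT x|lborel. \<phi> x *\<^sub>R pd i u x)"
proof -
  have "0 = (LINT x|lborel. pd i (\<lambda>x. \<phi> x *\<^sub>R u x) x)"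
    by (rule integral_pd_zero[symmetric, OF smooth_scaleR[OF assms(1,2)] bsupp_scaleR[OF assms(3)]])
  also have "\<dots> = (LINT x|lborel. pd i \<phi> x *\<^sub>R u x + \<phi> x *\<^sub>R pd i u x)"
    using pd_scaleR[OF smoothD[OF assms(1)] smoothD[OF assms(2)]] by simp
  also have "\<dots> = (LINT x|lborel. pd i \<phi> x *\<^sub>R u x) + (LINT x|lborel. \<phi> x *\<^sub>R pd i u x)"
    by (intro Bochner_Integration.integral_add integrable_smooth smooth_scaleR smooth_pd assms bsupp_scaleR bsupp_pd)
  finally show ?thesis by (simp add: eq_neg_iff_add_eq_0)
qed

text \<open>Integrating the mixed derivative along both axes recovers \<open>F\<close>, since
  \<open>F\<close> vanishes far away. This simplest Sobolev embedding is what later turns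
  square-integral bounds on derivatives into pointwise ones.\<close>

lemma sobolev_sup:
  fixes F :: "real^2 \<Rightarrow> 'b::euclidean_space"
  assumes F: "smooth F" "bsupp F"
  shows "norm (F x) \<le> (LINT y|lborel. norm (pd 1 (pd 2 F) y))"
proof -
  let ?a = "axis 1 (1::real) :: real^2" and ?b = "axis 2 (1::real) :: real^2"
  let ?G = "\<lambda>y. norm (pd 1 (pd 2 F) y)"
  have sG: "smooth (pd 1 (pd 2 F))" "bsupp (pd 1 (pd 2 F))" using F by (auto intro: smooth_pd bsupp_pd)
  have iG: "integrable lborel ?G"
    by (rule integrable_norm, rule integrable_smooth[OF sG])
  have D: "1 = ?a $ 1 * ?b $ 2 - ?a $ 2 * ?b $ 1" "(1::real) \<noteq> 0" by (auto simp: axis_def)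
  have x: "x = (x $ 1) *\<^sub>R ?a + (x $ 2) *\<^sub>R ?b" by (auto simp: vec2_eq_iff axis_def)
  have "norm (F x) \<le> (LINT t|lborel. norm (pd 2 F ((x $ 1) *\<^sub>R ?a + t *\<^sub>R ?b)))"
    using smooth_line_FTC(2)[OF F, of ?b "(x $ 1) *\<^sub>R ?a" "x $ 2"] x by simp
  also have "\<dots> \<le> (LINT t|lborel. LINT s|lborel. ?G (s *\<^sub>R ?a + t *\<^sub>R ?b))"
  proof (rule integral_mono)
    show "integrable lborel (\<lambda>t. norm (pd 2 F ((x $ 1) *\<^sub>R ?a + t *\<^sub>R ?b)))"
      using smooth_line_FTC(4)[OF F, of ?b "(x $ 1) *\<^sub>R ?a"] by simp
    show "integrable lborel (\<lambda>t. LINT s|lborel. ?G (s *\<^sub>R ?a + t *\<^sub>R ?b))"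
      using lborel_pair.integrable_snd[OF oblique_integral(1)[OF D iG]] by simp
    fix t
    show "norm (pd 2 F ((x $ 1) *\<^sub>R ?a + t *\<^sub>R ?b)) \<le> (LINT s|lborel. ?G (s *\<^sub>R ?a + t *\<^sub>R ?b))"
      using smooth_line_FTC(2)[OF smooth_pd[OF F(1), of 2] bsupp_pd[OF F(2), of 2], of ?a "t *\<^sub>R ?b" "x $ 1"]
      by (simp add: add.commute)
  qed
  also have "\<dots> = (LINT y|lborel. ?G y)"
    using oblique_integral(2)[OF D iG] by simp
  finally show ?thesis .
qed

text \<open>In coordinates along \<open>e\<close> and \<open>f\<close> the cone is a quadrant. The
  derivative along \<open>e\<close> integrates to values on the ray of \<open>f\<close>, which
  vanish by assumption; the derivative along \<open>f\<close> integrates to values on the ray of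
  \<open>e\<close>. Splitting the coordinate direction along \<open>e\<close> and \<open>f\<close>
  and pairing with \<open>\<nu>\<close>, which is orthogonal to \<open>e\<close>, produces the
  component of the normal.\<close>

lemma cone_green:
  fixes F :: "real^2 \<Rightarrow> 'b::euclidean_space"
  assumes F: "smooth F" "bsupp F" and e: "norm e = 1"
    and \<nu>: "\<nu> = perp e \<or> \<nu> = - perp e" "\<nu> \<bullet> f < 0"
    and ray: "\<And>t. t \<ge> 0 \<Longrightarrow> F (t *\<^sub>R f) = 0"
  shows "(LINT x|lborel. indicator (cone e f) x *\<^sub>R pd i F x)
    = (\<nu> $ i) *\<^sub>R (LINT s|lborel. indicator {0<..} s *\<^sub>R F (s *\<^sub>R e))"
proof -
  define D where "D = e $ 1 * f $ 2 - e $ 2 * f $ 1"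
  \<comment> \<open>\<open>D\<close> equals \<open>perp e \<bullet> f\<close>, so it is
    \<open>\<nu> \<bullet> f\<close> up to sign. That \<open>\<nu>\<close> points out of the cone
    makes this inner product negative and fixes the sign in the formula.\<close>
  have D': "\<bar>D\<bar> = - (\<nu> \<bullet> f)" "D \<noteq> 0"
    using \<nu> by (auto simp: D_def inner_vec2 algebra_simps)
  have ne: "e \<noteq> 0" "f \<noteq> 0" using e \<nu>(2) by auto
  have e1: "e $ 1 * e $ 1 + e $ 2 * e $ 2 = 1"
    using e norm_eq_1[of e] by (simp add: inner_vec2)
  have ind: "indicator (cone e f) (s *\<^sub>R e + t *\<^sub>R f) = indicator {0<..} s * (indicator {0<..} t :: real)" for s t
  proof -
    have "s *\<^sub>R e + t *\<^sub>R f \<in> cone e f \<longleftrightarrow> s > 0 \<and> t > 0"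
    proof
      assume "s *\<^sub>R e + t *\<^sub>R f \<in> cone e f"
      then obtain s' t' where *: "s *\<^sub>R e + t *\<^sub>R f = s' *\<^sub>R e + t' *\<^sub>R f" "s' > 0" "t' > 0"
        unfolding cone_def by blast
      then have c: "(s - s') * e $ k + (t - t') * f $ k = 0" for k
        by (auto simp: vec_eq_iff algebra_simps)
      have "(s - s') * D = ((s - s') * e $ 1 + (t - t') * f $ 1) * f $ 2 - ((s - s') * e $ 2 + (t - t') * f $ 2) * f $ 1"
        "(t - t') * D = ((s - s') * e $ 2 + (t - t') * f $ 2) * e $ 1 - ((s - s') * e $ 1 + (t - t') * f $ 1) * e $ 2"
        by (simp_all add: D_def algebra_simps)
      then have "(s - s') * D = 0" "(t - t') * D = 0" unfolding c by simp_all
      then have "s = s'" "t = t'" using D'(2) by auto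
      with * show "s > 0 \<and> t > 0" by simp
    qed (auto simp: cone_def)
    then show ?thesis by (auto simp: indicator_def)
  qed
  have mc: "cone e f \<in> sets borel"
  proof -
    have "cone e f = {x. (x $ 1 * f $ 2 - x $ 2 * f $ 1) / D > 0 \<and> (e $ 1 * x $ 2 - e $ 2 * x $ 1) / D > 0}"
    proof (intro equalityI subsetI)
      fix x assume "x \<in> cone e f"
      then obtain s t where x: "x = s *\<^sub>R e + t *\<^sub>R f" "s > 0" "t > 0" unfolding cone_def by blast
      have "x $ 1 * f $ 2 - x $ 2 * f $ 1 = s * D" "e $ 1 * x $ 2 - e $ 2 * x $ 1 = t * D"
        by (simp_all add: x D_def algebra_simps)
      with x D' show "x \<in> {x. (x $ 1 * f $ 2 - x $ 2 * f $ 1) / D > 0 \<and> (e $ 1 * x $ 2 - e $ 2 * x $ 1) / D > 0}"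
        by simp
    next
      fix x :: "real^2" assume x: "x \<in> {x. (x $ 1 * f $ 2 - x $ 2 * f $ 1) / D > 0 \<and> (e $ 1 * x $ 2 - e $ 2 * x $ 1) / D > 0}"
      have "(x $ 1 * f $ 2 - x $ 2 * f $ 1) * e $ k + (e $ 1 * x $ 2 - e $ 2 * x $ 1) * f $ k = x $ k * D" if "k = 1 \<or> k = 2" for k
        using that by (auto simp: D_def algebra_simps)
      then have "x = ((x $ 1 * f $ 2 - x $ 2 * f $ 1) / D) *\<^sub>R e + ((e $ 1 * x $ 2 - e $ 2 * x $ 1) / D) *\<^sub>R f"
        using D'(2) by (simp add: vec2_eq_iff add_divide_distrib[symmetric])
      with x show "x \<in> cone e f" unfolding cone_def by blast
    qed
    also have "\<dots> \<in> sets borel" by measurable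
    finally show ?thesis .
  qed
  have int: "integrable lborel (\<lambda>x. indicator (cone e f) x *\<^sub>R dd a F x)" for a
    by (rule integrable_mult_indicator) (use mc F in \<open>auto intro: integrable_smooth smooth_dd bsupp_dd\<close>)
  have ie: "(LINT x|lborel. indicator (cone e f) x *\<^sub>R dd e F x) = 0"
  proof -
    have "(LINT s|lborel. indicator (cone e f) (s *\<^sub>R e + t *\<^sub>R f) *\<^sub>R dd e F (s *\<^sub>R e + t *\<^sub>R f)) = 0" for t
    proof -
      have "(LINT s|lborel. indicator (cone e f) (s *\<^sub>R e + t *\<^sub>R f) *\<^sub>R dd e F (s *\<^sub>R e + t *\<^sub>R f))
        = (LINT s|lborel. indicator {0<..} t *\<^sub>R (indicator {0<..} s *\<^sub>R dd e F (t *\<^sub>R f + s *\<^sub>R e)))"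
        unfolding ind by (simp add: add.commute mult.commute)
      then show ?thesis
        using smooth_line_FTC(3)[OF F ne(1), of "t *\<^sub>R f"] ray[of t] by (simp add: indicator_def)
    qed
    then show ?thesis
      by (subst oblique_integral(2)[OF D_def D'(2) int]) simp
  qed
  have iF: "(LINT x|lborel. indicator (cone e f) x *\<^sub>R dd f F x)
      = (\<nu> \<bullet> f) *\<^sub>R (LINT s|lborel. indicator {0<..} s *\<^sub>R F (s *\<^sub>R e))"
  proof -
    have "(LINT t|lborel. indicator {0<..} s *\<^sub>R indicator {0<..} t *\<^sub>R dd f F (s *\<^sub>R e + t *\<^sub>R f))
      = - (indicator {0<..} s *\<^sub>R F (s *\<^sub>R e))" for s
      using smooth_line_FTC(3)[OF F ne(2), of "s *\<^sub>R e"] by (cases "s > 0") simp_all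
    then show ?thesis
      by (subst oblique_integral(3)[OF D_def D'(2) int]) (simp add: ind D'(1))
  qed
  \<comment> \<open>Cramer's rule once more: the coordinates of the basis vector with respect to
    \<open>e\<close> and \<open>f\<close>.\<close>
  define \<alpha> where "\<alpha> = (axis i (1::real) $ 1 * f $ 2 - axis i 1 $ 2 * f $ 1) / D"
  define \<beta> where "\<beta> = (e $ 1 * axis i (1::real) $ 2 - e $ 2 * axis i 1 $ 1) / D"
  have ax: "axis i 1 = \<alpha> *\<^sub>R e + \<beta> *\<^sub>R f"
  proof -
    have "(x $ 1 * f $ 2 - x $ 2 * f $ 1) * e $ k + (e $ 1 * x $ 2 - e $ 2 * x $ 1) * f $ k = x $ k * D" if "k = 1 \<or> k = 2" for k and x :: "real^2"
      using that by (auto simp: D_def algebra_simps)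
    then show ?thesis
      using D'(2) by (simp add: vec2_eq_iff \<alpha>_def \<beta>_def add_divide_distrib[symmetric])
  qed
  have "\<nu> \<bullet> e = 0" using \<nu>(1) by (auto simp: inner_vec2)
  then have nu: "\<beta> * (\<nu> \<bullet> f) = \<nu> $ i"
    using arg_cong[OF ax, of "\<lambda>x. \<nu> \<bullet> x"] by (simp add: inner_add_right inner_axis)
  have "(LINT x|lborel. indicator (cone e f) x *\<^sub>R pd i F x)
     = (LINT x|lborel. \<alpha> *\<^sub>R (indicator (cone e f) x *\<^sub>R dd e F x) + \<beta> *\<^sub>R (indicator (cone e f) x *\<^sub>R dd f F x))"
    by (subst dd_axis[symmetric], subst ax) (simp add: dd_add dd_scale scaleR_add_right mult.commute)
  also have "\<dots> = \<alpha> *\<^sub>R (LINT x|lborel. indicator (cone e f) x *\<^sub>R dd e F x) + \<beta> *\<^sub>R (LINT x|lborel. indicator (cone e f) x *\<^sub>R dd f F x)"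
    by (subst Bochner_Integration.integral_add[OF integrable_scaleR_right[OF int] integrable_scaleR_right[OF int]])
      (simp only: integral_scaleR_right)
  finally show ?thesis by (simp add: ie iF nu)
qed

section \<open>Bump functions and mollifying kernels\<close>

primrec bump_poly :: "nat \<Rightarrow> real poly" where
  "bump_poly 0 = 1"
| "bump_poly (Suc n) = [:0, 0, 1:] * (bump_poly n - pderiv (bump_poly n))"

text \<open>The \<open>n\<close>-th derivative of \<open>exp (- 1 / t)\<close> for positive
  \<open>t\<close>, extended by 0. With \<open>s = 1 / t\<close>, differentiating
  \<open>p s * exp (- s)\<close> in \<open>t\<close> gives
  \<open>s^2 * (p s - p' s) * exp (- s)\<close>, which is the recursion of
  \<open>bump_poly\<close>.\<close>

definition bump_deriv :: "nat \<Rightarrow> real \<Rightarrow> real" where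
  "bump_deriv n t = (if t > 0 then poly (bump_poly n) (1 / t) * exp (- 1 / t) else 0)"

lemma poly_exp_tendsto_0: "((\<lambda>s. poly p s * exp (- s)) \<longlongrightarrow> 0) (at_top :: real filter)"
proof -
  have "((\<lambda>s. coeff p k * s ^ k * exp (- s)) \<longlongrightarrow> 0) at_top" for k
  proof -
    have "((\<lambda>s::real. coeff p k * (s ^ k / exp s)) \<longlongrightarrow> coeff p k * 0) at_top"
      by (intro tendsto_intros tendsto_power_div_exp_0)
    then show ?thesis by (simp add: exp_minus field_simps)
  qed
  then have "((\<lambda>s. \<Sum>k\<le>degree p. coeff p k * s ^ k * exp (- s)) \<longlongrightarrow> (\<Sum>k\<le>degree p. 0)) at_top"
    by (rule tendsto_sum)
  then show ?thesis by (simp add: poly_altdef sum_distrib_right)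
qed

lemma bump_deriv_has_derivative:
  "(bump_deriv n has_real_derivative bump_deriv (Suc n) t) (at t)"
proof -
  consider "t > 0" | "t < 0" | "t = 0" by linarith
  then show ?thesis
  proof cases
    case 1
    have "((\<lambda>t. poly (bump_poly n) (1 / t) * exp (- 1 / t)) has_real_derivative bump_deriv (Suc n) t) (at t)"
      using 1 by (auto intro!: derivative_eq_intros DERIV_chain2[OF poly_DERIV]
          simp: bump_deriv_def field_simps power2_eq_square)
    then show ?thesis
      by (rule has_field_derivative_transform_within_open[where S="{0<..}"]) (use 1 in \<open>auto simp: bump_deriv_def\<close>)
  next
    case 2
    have "((\<lambda>t. 0) has_real_derivative bump_deriv (Suc n) t) (at t)"
      using 2 by (simp add: bump_deriv_def)
    then show ?thesis
      by (rule has_field_derivative_transform_within_open[where S="{..<0}"]) (use 2 in \<open>auto simp: bump_deriv_def\<close>)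
  next
    case 3
    \<comment> \<open>With \<open>s = 1 / y\<close> the difference quotient at 0 from the right is
      \<open>s\<close> times a polynomial in \<open>s\<close> times \<open>exp (- s)\<close>; the
      extra factor \<open>s\<close> comes from dividing by \<open>y\<close>. From the left the
      quotient is 0.\<close>
    have "((\<lambda>s. poly ([:0, 1:] * bump_poly n) s * exp (- s)) \<longlongrightarrow> 0) at_top"
      by (rule poly_exp_tendsto_0)
    then have "((\<lambda>y. poly ([:0, 1:] * bump_poly n) (inverse y) * exp (- inverse y)) \<longlongrightarrow> 0) (at_right 0)"
      by (rule filterlim_compose) (rule filterlim_inverse_at_top_right)
    then have r: "((\<lambda>y. (bump_deriv n y - bump_deriv n 0) / (y - 0)) \<longlongrightarrow> 0) (at_right 0)"
      by (rule Lim_transform_eventually)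
        (auto simp: eventually_at_right_field bump_deriv_def field_simps intro!: exI[of _ 1])
    have "((\<lambda>y. 0) \<longlongrightarrow> 0) (at_left (0::real))" by simp
    then have l: "((\<lambda>y. (bump_deriv n y - bump_deriv n 0) / (y - 0)) \<longlongrightarrow> 0) (at_left 0)"
      by (rule Lim_transform_eventually)
        (auto simp: eventually_at_left_field bump_deriv_def intro!: exI[of _ "-1"])
    from l r have "((\<lambda>y. (bump_deriv n y - bump_deriv n 0) / (y - 0)) \<longlongrightarrow> 0) (at 0)"
      by (rule filterlim_split_at)
    then show ?thesis
      using 3 by (simp add: has_field_derivative_iff bump_deriv_def)
  qed
qed

lemma mollifier_exists:
  assumes "\<epsilon> > 0"
  obtains \<rho> :: "real^2 \<Rightarrow> real" where "smooth \<rho>" "\<And>x. \<rho> x \<ge> 0" "\<And>x. norm x \<ge> \<epsilon> \<Longrightarrow> \<rho> x = 0"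
    "bsupp \<rho>" "(LINT x|lborel. \<rho> x) = 1"
proof -
  \<comment> \<open>The argument is a polynomial in the coordinates, so that no singularity arises
    at the origin; it is positive exactly inside the ball of radius
    \<open>\<epsilon>\<close>.\<close>
  define g where "g = (\<lambda>x::real^2. bump_deriv 0 (\<epsilon>\<^sup>2 - x \<bullet> x))"
  have sg: "smooth g"
    unfolding g_def
    by (rule smooth_compose_real[where H=bump_deriv and n=0, OF bump_deriv_has_derivative])
      (intro smooth_diff smooth_const smooth_inner smooth_linear bounded_linear_ident)
  have pos: "g x > 0" if "norm x < \<epsilon>" for x
  proof -
    have "x \<bullet> x < \<epsilon>\<^sup>2" using that assms by (simp add: power2_norm_eq_inner[symmetric] power_strict_mono)
    then show ?thesis by (simp add: g_def bump_deriv_def)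
  qed
  have nn: "g x \<ge> 0" for x by (simp add: g_def bump_deriv_def)
  have z: "g x = 0" if "norm x \<ge> \<epsilon>" for x
  proof -
    have "x \<bullet> x \<ge> \<epsilon>\<^sup>2" using that assms by (simp add: power2_norm_eq_inner[symmetric] power_mono)
    then show ?thesis by (simp add: g_def bump_deriv_def)
  qed
  have bg: "bsupp g"
    by (rule bounded_subset[OF bounded_ball[of 0 \<epsilon>]]) (use z in \<open>force simp: not_less\<close>)
  have ig: "integrable lborel g" by (rule integrable_smooth[OF sg bg])
  have "(LINT x|lborel. g x) \<noteq> 0"
  proof
    assume "(LINT x|lborel. g x) = 0"
    then have "AE x in lborel. g x = 0"
      using integral_nonneg_eq_0_iff_AE[OF ig] nn by simp
    then have "AE x in lborel. x \<notin> ball (0::real^2) \<epsilon>"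
    proof eventually_elim
      case (elim x)
      then show ?case using pos[of x] by (cases "norm x < \<epsilon>") auto
    qed
    then have "ball (0::real^2) \<epsilon> \<in> null_sets lborel"
      by (subst (asm) AE_iff_null_sets[symmetric]) auto
    then have "negligible (ball (0::real^2) \<epsilon>)"
      using negligible_iff_null_sets null_sets_completionI by blast
    then show False using open_not_negligible[of "ball (0::real^2) \<epsilon>"] assms by auto
  qed
  moreover have "(LINT x|lborel. g x) \<ge> 0" using nn by simp
  ultimately have I: "(LINT x|lborel. g x) > 0" by simp
  show ?thesis
  proof (rule that[of "\<lambda>x. g x / (LINT x|lborel. g x)"])
    show "smooth (\<lambda>x. g x / (LINT x|lborel. g x))"
      using smooth_mult[OF sg smooth_const[of "1 / (LINT x|lborel. g x)"]] by simp
    show "bsupp (\<lambda>x. g x / (LINT x|lborel. g x))"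
      by (rule bsupp_mono[OF bg]) simp
  qed (use I nn z in auto)
qed

section \<open>Square-integrable functions and mollification\<close>

abbreviation sqn :: "(real^2 \<Rightarrow> complex) \<Rightarrow> real" where
  "sqn u \<equiv> LINT x|lborel. (norm (u x))\<^sup>2"

lemma norm_sum_squared:
  fixes a b :: "'a::real_normed_vector"
  shows "(norm (a + b))\<^sup>2 \<le> 2 * (norm a)\<^sup>2 + 2 * (norm b)\<^sup>2"
proof -
  have "(norm (a + b))\<^sup>2 \<le> (norm a + norm b)\<^sup>2"
    by (intro power_mono norm_triangle_ineq) auto
  also have "\<dots> \<le> 2 * (norm a)\<^sup>2 + 2 * (norm b)\<^sup>2"
    using zero_le_power2[of "norm a - norm b"] by (simp add: power2_eq_square algebra_simps)
  finally show ?thesis .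
qed

lemma norm_diff_squared:
  fixes a b :: "'a::real_normed_vector"
  shows "(norm (a - b))\<^sup>2 \<le> 2 * (norm a)\<^sup>2 + 2 * (norm b)\<^sup>2"
  using norm_sum_squared[of a "- b"] by simp

lemma L2_D:
  assumes "u \<in> L2 M"
  shows "u \<in> borel_measurable M" "integrable M (\<lambda>x. (norm (u x))\<^sup>2)"
  using assms by (auto simp: L2_def)

lemma L2_bound:
  assumes "u \<in> borel_measurable M" "integrable M g" "\<And>x. (norm (u x))\<^sup>2 \<le> g x"
  shows "u \<in> L2 M"
proof -
  have [measurable]: "u \<in> borel_measurable M" by fact
  have "norm ((norm (u x))\<^sup>2) \<le> norm (g x)" for x
    using assms(3)[of x] zero_le_power2[of "norm (u x)"] by simp
  then have "integrable M (\<lambda>x. (norm (u x))\<^sup>2)"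
    by (intro Bochner_Integration.integrable_bound[OF assms(2)]) auto
  then show ?thesis by (simp add: L2_def)
qed

lemma L2_add: "u \<in> L2 M \<Longrightarrow> v \<in> L2 M \<Longrightarrow> (\<lambda>x. u x + v x) \<in> L2 M"
  by (rule L2_bound[where g="\<lambda>x. 2 * (norm (u x))\<^sup>2 + 2 * (norm (v x))\<^sup>2"])
    (use L2_D[of u M] L2_D[of v M] norm_sum_squared in auto)

lemma L2_diff: "u \<in> L2 M \<Longrightarrow> v \<in> L2 M \<Longrightarrow> (\<lambda>x. u x - v x) \<in> L2 M"
  by (rule L2_bound[where g="\<lambda>x. 2 * (norm (u x))\<^sup>2 + 2 * (norm (v x))\<^sup>2"])
    (use L2_D[of u M] L2_D[of v M] norm_diff_squared in auto)

lemma L2_0 [simp]: "(\<lambda>x. 0) \<in> L2 M"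
  by (simp add: L2_def)

lemma L2_sum: "(\<And>k. k \<in> K \<Longrightarrow> u k \<in> L2 M) \<Longrightarrow> (\<lambda>x. \<Sum>k\<in>K. u k x) \<in> L2 M"
  by (induction K rule: infinite_finite_induct) (auto intro: L2_add)

lemma L2_scaleR_bounded:
  assumes "u \<in> L2 M" "c \<in> borel_measurable M" "\<And>x. \<bar>c x\<bar> \<le> B"
  shows "(\<lambda>x. c x *\<^sub>R u x) \<in> L2 M"
proof (rule L2_bound[where g="\<lambda>x. B\<^sup>2 * (norm (u x))\<^sup>2"])
  show "(\<lambda>x. c x *\<^sub>R u x) \<in> borel_measurable M"
    using assms L2_D[OF assms(1)] by measurable
  show "(norm (c x *\<^sub>R u x))\<^sup>2 \<le> B\<^sup>2 * (norm (u x))\<^sup>2" for x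
    using assms(3)[of x] by (simp add: power_mult_distrib abs_le_square_iff[symmetric] mult_right_mono)
qed (use L2_D[OF assms(1)] in auto)

lemma L2_cmult: "u \<in> L2 M \<Longrightarrow> (\<lambda>x. c * u x) \<in> L2 M"
  by (rule L2_bound[where g="\<lambda>x. (norm c)\<^sup>2 * (norm (u x))\<^sup>2"])
    (use L2_D[of u M] in \<open>auto simp: norm_mult power_mult_distrib\<close>)

lemma L2_indicator: "u \<in> L2 M \<Longrightarrow> A \<in> sets M \<Longrightarrow> (\<lambda>x. indicator A x *\<^sub>R u x) \<in> L2 M"
  by (rule L2_scaleR_bounded[where B=1]) (auto simp: indicator_def)

lemma L2_mult_integrable:
  fixes c :: "'a \<Rightarrow> real"
  assumes "u \<in> L2 M" "c \<in> borel_measurable M" "integrable M (\<lambda>x. (c x)\<^sup>2)"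
  shows "integrable M (\<lambda>x. c x *\<^sub>R u x)"
proof (rule Bochner_Integration.integrable_bound)
  show "integrable M (\<lambda>x. (c x)\<^sup>2 + (norm (u x))\<^sup>2)"
    using assms L2_D[OF assms(1)] by auto
  show "(\<lambda>x. c x *\<^sub>R u x) \<in> borel_measurable M" using assms L2_D[OF assms(1)] by measurable
  show "AE x in M. norm (c x *\<^sub>R u x) \<le> norm ((c x)\<^sup>2 + (norm (u x))\<^sup>2)"
  proof (rule AE_I2)
    fix x
    have "2 * (\<bar>c x\<bar> * norm (u x)) \<le> (c x)\<^sup>2 + (norm (u x))\<^sup>2"
      using zero_le_power2[of "\<bar>c x\<bar> - norm (u x)"] by (simp add: power2_diff)
    moreover have "0 \<le> \<bar>c x\<bar> * norm (u x)" by simp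
    ultimately have "\<bar>c x\<bar> * norm (u x) \<le> (c x)\<^sup>2 + (norm (u x))\<^sup>2" by linarith
    then show "norm (c x *\<^sub>R u x) \<le> norm ((c x)\<^sup>2 + (norm (u x))\<^sup>2)" by simp
  qed
qed

lemma L2_bsupp:
  assumes "continuous_on UNIV u" "bsupp u"
  shows "u \<in> L2 lborel"
proof -
  have "integrable lborel (\<lambda>x. (norm (u x))\<^sup>2)"
    by (rule integrable_bsupp) (use assms in \<open>auto intro!: continuous_intros\<close>)
  then show ?thesis using assms(1) by (simp add: L2_def borel_measurable_continuous_onI)
qed

lemma L2_smooth: "smooth u \<Longrightarrow> bsupp u \<Longrightarrow> u \<in> L2 lborel"
  by (intro L2_bsupp smooth_continuous)

lemma bounded_bsupp:
  fixes f :: "real^2 \<Rightarrow> 'b::real_normed_vector"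
  assumes "continuous_on UNIV f" "bsupp f"
  obtains B where "B \<ge> 0" "\<And>x. norm (f x) \<le> B"
proof -
  obtain R where R: "\<And>x. norm x \<ge> R \<Longrightarrow> f x = 0" using bsuppE[OF assms(2)] by blast
  have "compact (f ` cball 0 R)"
    by (intro compact_continuous_image continuous_on_subset[OF assms(1)]) auto
  then obtain B where B: "\<And>x. x \<in> cball 0 R \<Longrightarrow> norm (f x) \<le> B"
    by (metis bounded_iff compact_imp_bounded imageI)
  show ?thesis
  proof (rule that[of "max B 0"])
    fix x show "norm (f x) \<le> max B 0"
      using B[of x] R[of x] by (cases "norm x \<le> R") auto
  qed simp
qed

lemma smooth_mult_integrable:
  fixes c :: "real^2 \<Rightarrow> real"
  assumes "u \<in> L2 lborel" "smooth c" "bsupp c"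
  shows "integrable lborel (\<lambda>x. c x *\<^sub>R u x)"
proof (rule L2_mult_integrable[OF assms(1)])
  show "c \<in> borel_measurable lborel" using smooth_borel[OF assms(2)] by simp
  show "integrable lborel (\<lambda>x. (c x)\<^sup>2)"
    by (rule integrable_bsupp) (use assms smooth_continuous[of c UNIV] in \<open>auto intro!: continuous_intros\<close>)
qed

lemma L2_integrable_bounded_set:
  assumes "u \<in> L2 lborel" "bsupp u"
  shows "integrable lborel u"
proof -
  obtain R where R: "\<And>x. norm x \<ge> R \<Longrightarrow> u x = 0" using bsuppE[OF assms(2)] by blast
  have "integrable lborel (\<lambda>x. indicator (cball 0 R) x *\<^sub>R u x)"
  proof (rule L2_mult_integrable[OF assms(1)])
    have "integrable lborel (indicator (cball (0::real^2) R) :: _ \<Rightarrow> real)"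
      using emeasure_lborel_cball_finite[of "0::real^2" R] by (intro integrable_real_indicator) auto
    moreover have "(indicator (cball (0::real^2) R) x :: real)\<^sup>2 = indicator (cball 0 R) x" for x
      by (simp add: indicator_def)
    ultimately show "integrable lborel (\<lambda>x. (indicator (cball (0::real^2) R) x :: real)\<^sup>2)" by simp
  qed (simp add: borel_measurable_indicator)
  also have "(\<lambda>x. indicator (cball 0 R) x *\<^sub>R u x) = u"
    using R by (auto simp: indicator_def fun_eq_iff)
  finally show ?thesis .
qed

lemma lborel_reflect:
  fixes F :: "real^2 \<Rightarrow> 'b::{banach, second_countable_topology}"
  assumes [measurable]: "F \<in> borel_measurable borel"
  shows "(LINT y|lborel. F (x - y)) = (LINT y|lborel. F y)"
    and "(\<integral>\<^sup>+y. ennreal (norm (F (x - y))) \<partial>lborel) = (\<integral>\<^sup>+y. ennreal (norm (F y)) \<partial>lborel)"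
    and "integrable lborel F \<Longrightarrow> integrable lborel (\<lambda>y. F (x - y))"
proof -
  have l: "lborel = distr lborel borel (\<lambda>y. x - y)"
    using lborel_affine[of "-1" x] by (simp add: density_1)
  have m: "(\<lambda>y. x - y) \<in> lborel \<rightarrow>\<^sub>M borel" by simp
  show "(LINT y|lborel. F (x - y)) = (LINT y|lborel. F y)"
    by (subst (2) l) (simp add: integral_distr)
  show "(\<integral>\<^sup>+y. ennreal (norm (F (x - y))) \<partial>lborel) = (\<integral>\<^sup>+y. ennreal (norm (F y)) \<partial>lborel)"
    by (subst (2) l) (simp add: nn_integral_distr)
  show "integrable lborel (\<lambda>y. F (x - y))" if "integrable lborel F"
    using that by (subst (asm) l) (simp add: integrable_distr_eq)
qed

lemma lborel_shift:
  fixes F :: "real^2 \<Rightarrow> 'b::{banach, second_countable_topology}"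
  assumes [measurable]: "F \<in> borel_measurable borel"
  shows "(LINT y|lborel. F (y - x)) = (LINT y|lborel. F y)"
    and "integrable lborel F \<Longrightarrow> integrable lborel (\<lambda>y. F (y - x))"
proof -
  have l: "lborel = distr lborel borel (\<lambda>y. y - x)"
    using lborel_affine[of "1" "- x"] by (simp add: density_1)
  show "(LINT y|lborel. F (y - x)) = (LINT y|lborel. F y)"
    by (subst (2) l) (simp add: integral_distr)
  show "integrable lborel (\<lambda>y. F (y - x))" if "integrable lborel F"
    using that by (subst (asm) l) (simp add: integrable_distr_eq)
qed

text \<open>Dominated convergence is used twice. Truncating \<open>u\<close> both in value and in
  position leaves a bounded function of bounded support; this is an almost everywhere limit of
  continuous functions, which must first be forced under a common bound and a common
  support.\<close>

lemma L2_dense_continuous: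
  assumes u: "u \<in> L2 lborel" and "e > 0"
  obtains c where "continuous_on UNIV c" "bsupp c" "sqn (\<lambda>x. u x - c x) < e"
proof -
  have [measurable]: "u \<in> borel_measurable borel" using L2_D(1)[OF u] by simp
  define un where "un n x = (if norm x \<le> real n \<and> norm (u x) \<le> real n then u x else 0)" for n x
  have [measurable]: "un n \<in> borel_measurable borel" for n unfolding un_def by measurable
  have "(\<lambda>n. sqn (\<lambda>x. u x - un n x)) \<longlonglongrightarrow> sqn (\<lambda>x. 0)"
  proof (rule integral_dominated_convergence[where w="\<lambda>x. (norm (u x))\<^sup>2"])
    show "AE x in lborel. (\<lambda>n. (norm (u x - un n x))\<^sup>2) \<longlonglongrightarrow> (norm (0::complex))\<^sup>2"
    proof (rule AE_I2)
      fix x :: "real^2"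
      obtain N where N: "real N \<ge> max (norm x) (norm (u x))" using real_arch_simple by blast
      have "\<forall>\<^sub>F n in sequentially. (norm (u x - un n x))\<^sup>2 = (norm (0::complex))\<^sup>2"
        using eventually_ge_at_top[of N]
      proof eventually_elim
        case (elim n)
        then have "real N \<le> real n" by simp
        with N show ?case by (auto simp: un_def)
      qed
      then show "(\<lambda>n. (norm (u x - un n x))\<^sup>2) \<longlonglongrightarrow> (norm (0::complex))\<^sup>2"
        by (rule tendsto_eventually)
    qed
    show "AE x in lborel. norm ((norm (u x - un n x))\<^sup>2) \<le> (norm (u x))\<^sup>2" for n
      by (rule AE_I2) (simp add: un_def)
  qed (use L2_D[OF u] in auto)
  then have "(\<lambda>n. sqn (\<lambda>x. u x - un n x)) \<longlonglongrightarrow> 0" by simp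
  then have "\<forall>\<^sub>F n in sequentially. sqn (\<lambda>x. u x - un n x) < e / 4"
    using \<open>e > 0\<close> by (intro order_tendstoD(2)) auto
  then have "\<forall>\<^sub>F n in sequentially. sqn (\<lambda>x. u x - un n x) < e / 4 \<and> n \<ge> 1"
    using eventually_ge_at_top[of 1] by eventually_elim auto
  then obtain n where n: "sqn (\<lambda>x. u x - un n x) < e / 4" "n \<ge> 1"
    using eventually_happens'[OF sequentially_bot] by blast
  have "un n measurable_on UNIV"
    by (rule lebesgue_measurable_imp_measurable_on) (auto intro: measurable_completion)
  then obtain N g where N: "negligible N" and g: "\<And>k. continuous_on UNIV (g k)"
    "\<And>x. x \<notin> N \<Longrightarrow> (\<lambda>k. g k x) \<longlonglongrightarrow> un n x"
    unfolding measurable_on_def by auto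
  \<comment> \<open>\<open>clip\<close> is the radial retraction onto the disc of radius
    \<open>n\<close> and \<open>cut\<close> a cutoff that falls from 1 to 0 between the radii
    \<open>n\<close> and \<open>n + 1\<close>. Both are continuous and leave \<open>un n\<close>
    unchanged, so convergence survives them.\<close>
  define clip where "clip z = (real n / max (real n) (norm z)) *\<^sub>R z" for z :: complex
  define cut where "cut x = max 0 (min 1 (real n + 1 - norm x))" for x :: "real^2"
  define c where "c k x = cut x *\<^sub>R clip (g k x)" for k x
  have mpos: "0 < max (real n) (norm z)" for z :: complex using n(2) by (simp add: less_max_iff_disj)
  have contclip: "continuous_on UNIV clip"
    unfolding clip_def by (intro continuous_intros ballI) (use mpos in \<open>simp only: less_imp_neq[THEN not_sym] not_False_eq_True\<close>)
  have clip_le: "norm (clip z) \<le> real n" for z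
  proof -
    have "norm (clip z) = real n * (norm z / max (real n) (norm z))"
      using mpos[of z] by (simp add: clip_def)
    also have "\<dots> \<le> real n * 1"
      by (rule mult_left_mono) (use mpos[of z] in \<open>simp_all add: pos_divide_le_eq\<close>)
    finally show ?thesis by simp
  qed
  have clip_id: "clip z = z" if "norm z \<le> real n" for z
    using that n(2) by (simp add: clip_def max_absorb1)
  have cc: "continuous_on UNIV (c k)" for k
    unfolding c_def cut_def
    by (intro continuous_intros continuous_on_compose2[OF contclip g(1)]) auto
  have [measurable]: "c k \<in> borel_measurable borel" for k
    using cc by (rule borel_measurable_continuous_onI)
  have c0: "c k x = 0" if "norm x \<ge> real n + 1" for k x
    using that by (simp add: c_def cut_def)
  have cb: "bsupp (c k)" for k
    by (rule bounded_subset[OF bounded_cball[of 0 "real n + 1"]]) (use c0 in force)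
  have cn: "norm (c k x) \<le> real n" for k x
  proof -
    have "norm (c k x) \<le> 1 * real n"
      unfolding c_def norm_scaleR by (intro mult_mono clip_le) (auto simp: cut_def)
    then show ?thesis by simp
  qed
  have un_le: "norm (un n x) \<le> real n" for x by (simp add: un_def)
  have "(\<lambda>k. sqn (\<lambda>x. un n x - c k x)) \<longlonglongrightarrow> sqn (\<lambda>x. 0)"
  proof (rule integral_dominated_convergence[where w="\<lambda>x. (2 * real n)\<^sup>2 * indicator (cball 0 (real n + 1)) x"])
    have "AE x in lborel. x \<notin> N"
    proof -
      obtain N' where "N' \<in> null_sets lborel" "N \<subseteq> N'"
        using N null_sets_completion_iff2[of N lborel] by (auto simp: negligible_iff_null_sets)
      then show ?thesis by (intro AE_I'[of N']) auto
    qed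
    then show "AE x in lborel. (\<lambda>k. (norm (un n x - c k x))\<^sup>2) \<longlonglongrightarrow> (norm (0::complex))\<^sup>2"
    proof eventually_elim
      case (elim x)
      have "(\<lambda>k. clip (g k x)) \<longlonglongrightarrow> clip (un n x)"
        using contclip g(2)[OF elim] by (intro continuous_on_tendsto_compose[of UNIV clip]) auto
      then have "(\<lambda>k. c k x) \<longlonglongrightarrow> cut x *\<^sub>R un n x"
        unfolding c_def clip_id[OF un_le] by (intro tendsto_intros)
      moreover have "cut x *\<^sub>R un n x = un n x"
        by (auto simp: un_def cut_def)
      ultimately have "(\<lambda>k. norm (un n x - c k x)) \<longlonglongrightarrow> norm (un n x - un n x)"
        by (intro tendsto_intros) simp
      then show ?case by (intro tendsto_power) simp
    qed
    show "AE x in lborel. norm ((norm (un n x - c k x))\<^sup>2) \<le> (2 * real n)\<^sup>2 * indicator (cball 0 (real n + 1)) x" for k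
    proof (rule AE_I2)
      fix x :: "real^2"
      have "norm (un n x - c k x) \<le> 2 * real n"
        using norm_triangle_ineq4[of "un n x" "c k x"] cn[of k x] un_le[of x] by simp
      then have "(norm (un n x - c k x))\<^sup>2 \<le> (2 * real n)\<^sup>2" by (intro power_mono) auto
      moreover have "un n x - c k x = 0" if "x \<notin> cball 0 (real n + 1)"
        using that c0[of x k] by (auto simp: un_def)
      ultimately show "norm ((norm (un n x - c k x))\<^sup>2) \<le> (2 * real n)\<^sup>2 * indicator (cball 0 (real n + 1)) x"
        by (auto simp: indicator_def)
    qed
    show "integrable lborel (\<lambda>x. (2 * real n)\<^sup>2 * indicator (cball (0::real^2) (real n + 1)) x)"
      using emeasure_lborel_cball_finite[of "0::real^2" "real n + 1"]
      by (intro integrable_mult_right integrable_real_indicator) auto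
  qed auto
  then have "(\<lambda>k. sqn (\<lambda>x. un n x - c k x)) \<longlonglongrightarrow> 0" by simp
  then have "\<forall>\<^sub>F k in sequentially. sqn (\<lambda>x. un n x - c k x) < e / 4"
    using \<open>e > 0\<close> by (intro order_tendstoD(2)) auto
  then obtain k where k: "sqn (\<lambda>x. un n x - c k x) < e / 4"
    using eventually_happens'[OF sequentially_bot] by blast
  have L: "(\<lambda>x. u x - un n x) \<in> L2 lborel"
    by (rule L2_bound[where g="\<lambda>x. (norm (u x))\<^sup>2"]) (use L2_D[OF u] in \<open>auto simp: un_def\<close>)
  have "un n \<in> L2 lborel"
    by (rule L2_bound[where g="\<lambda>x. (norm (u x))\<^sup>2"]) (use L2_D[OF u] in \<open>auto simp: un_def\<close>)
  from L2_diff[OF this L2_bsupp[OF cc cb]] have L': "(\<lambda>x. un n x - c k x) \<in> L2 lborel" .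
  have "sqn (\<lambda>x. u x - c k x) \<le> (LINT x|lborel. 2 * (norm (u x - un n x))\<^sup>2 + 2 * (norm (un n x - c k x))\<^sup>2)"
  proof (rule integral_mono)
    show "integrable lborel (\<lambda>x. (norm (u x - c k x))\<^sup>2)"
      using L2_D(2)[OF L2_diff[OF u L2_bsupp[OF cc cb]]] .
    show "integrable lborel (\<lambda>x. 2 * (norm (u x - un n x))\<^sup>2 + 2 * (norm (un n x - c k x))\<^sup>2)"
      using L2_D(2)[OF L] L2_D(2)[OF L'] by simp
    show "(norm (u x - c k x))\<^sup>2 \<le> 2 * (norm (u x - un n x))\<^sup>2 + 2 * (norm (un n x - c k x))\<^sup>2" for x
      using norm_sum_squared[of "u x - un n x" "un n x - c k x"] by simp
  qed
  also have "\<dots> = 2 * sqn (\<lambda>x. u x - un n x) + 2 * sqn (\<lambda>x. un n x - c k x)"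
    using L2_D(2)[OF L] L2_D(2)[OF L'] by simp
  also have "\<dots> < e" using n(1) k by simp
  finally show ?thesis using that[OF cc cb] by blast
qed

lemma L2_shift:
  assumes "u \<in> L2 lborel"
  shows "(\<lambda>x. u (x - h)) \<in> L2 lborel" "sqn (\<lambda>x. u (x - h)) = sqn u"
proof -
  have [measurable]: "u \<in> borel_measurable borel" using L2_D(1)[OF assms] by simp
  show "(\<lambda>x. u (x - h)) \<in> L2 lborel"
    using lborel_shift(2)[of "\<lambda>x. (norm (u x))\<^sup>2" h] L2_D[OF assms] by (simp add: L2_def)
  show "sqn (\<lambda>x. u (x - h)) = sqn u"
    using lborel_shift(1)[of "\<lambda>x. (norm (u x))\<^sup>2" h] by simp
qed

lemma sqn_le3:
  assumes "a \<in> L2 lborel" "b \<in> L2 lborel" "c \<in> L2 lborel"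
  shows "sqn (\<lambda>x. a x + b x + c x) \<le> 4 * sqn a + 4 * sqn b + 2 * sqn c"
proof -
  note D = L2_D(2)[OF assms(1)] L2_D(2)[OF assms(2)] L2_D(2)[OF assms(3)]
  have "sqn (\<lambda>x. a x + b x + c x) \<le> (LINT x|lborel. 4 * (norm (a x))\<^sup>2 + 4 * (norm (b x))\<^sup>2 + 2 * (norm (c x))\<^sup>2)"
  proof (rule integral_mono)
    show "integrable lborel (\<lambda>x. (norm (a x + b x + c x))\<^sup>2)"
      using L2_D(2)[OF L2_add[OF L2_add[OF assms(1,2)] assms(3)]] .
    show "(norm (a x + b x + c x))\<^sup>2 \<le> 4 * (norm (a x))\<^sup>2 + 4 * (norm (b x))\<^sup>2 + 2 * (norm (c x))\<^sup>2" for x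
      using norm_sum_squared[of "a x + b x" "c x"] norm_sum_squared[of "a x" "b x"] by simp
  qed (use D in auto)
  also have "\<dots> = 4 * sqn a + 4 * sqn b + 2 * sqn c" using D by simp
  finally show ?thesis .
qed

text \<open>For a continuous function of bounded support this is uniform continuity, and translation
  preserves the norm, so an approximation of \<open>u\<close> suffices. The error splits as
  \<open>8 * (e / 16) + 2 * (e / 4) = e\<close>.\<close>

lemma L2_translation_continuous:
  assumes u: "u \<in> L2 lborel" and "e > 0"
  obtains d where "d > 0" "\<And>h. norm h < d \<Longrightarrow> sqn (\<lambda>x. u (x - h) - u x) < e"
proof -
  obtain c where c: "continuous_on UNIV c" "bsupp c" "sqn (\<lambda>x. u x - c x) < e / 16"
    using L2_dense_continuous[OF u, of "e / 16"] \<open>e > 0\<close> by auto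
  obtain R where R: "R > 0" "\<And>x. norm x \<ge> R \<Longrightarrow> c x = 0" using bsuppE[OF c(2)] by blast
  have cL: "c \<in> L2 lborel" by (rule L2_bsupp[OF c(1,2)])
  define K where "K = measure lborel (cball (0::real^2) (R + 1))"
  have K0: "K \<ge> 0" by (simp add: K_def)
  \<comment> \<open>For shifts shorter than 1 the difference of \<open>c\<close> lives in the ball
    of radius \<open>R + 1\<close>, whose area is \<open>K\<close>; the choice makes
    \<open>e1^2 * K\<close> at most \<open>e / 4\<close>, and adding 1 avoids a zero
    denominator.\<close>
  define e1 where "e1 = sqrt (e / (4 * (K + 1)))"
  have e1: "e1 > 0" using \<open>e > 0\<close> K0 by (simp add: e1_def)
  have "uniformly_continuous_on (cball 0 (R + 2)) c"
    by (rule compact_uniformly_continuous) (auto intro: continuous_on_subset[OF c(1)])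
  then obtain d0 where d0: "d0 > 0"
    "\<And>x y. x \<in> cball 0 (R + 2) \<Longrightarrow> y \<in> cball 0 (R + 2) \<Longrightarrow> dist y x < d0 \<Longrightarrow> dist (c y) (c x) < e1"
    unfolding uniformly_continuous_on_def using e1 by meson
  show ?thesis
  proof (rule that[of "min d0 1"])
    fix h :: "real^2" assume h: "norm h < min d0 1"
    have pt: "(norm (c (x - h) - c x))\<^sup>2 \<le> e1\<^sup>2 * indicator (cball 0 (R + 1)) x" for x
    proof (cases "norm x \<le> R + 1")
      case True
      have "norm (x - h) \<le> R + 2" using norm_triangle_ineq4[of x h] h True by simp
      then have "dist (c (x - h)) (c x) < e1"
        using d0(2)[of x "x - h"] True h by (simp add: dist_norm norm_minus_commute)
      then have "(norm (c (x - h) - c x))\<^sup>2 \<le> e1\<^sup>2" by (intro power_mono) (auto simp: dist_norm)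
      then show ?thesis using True by simp
    next
      case False
      then have "norm (x - h) \<ge> R" using norm_triangle_ineq2[of x h] h by simp
      then have "c (x - h) = 0" "c x = 0" using R False by auto
      then show ?thesis by simp
    qed
    have "sqn (\<lambda>x. c (x - h) - c x) \<le> (LINT x|lborel. e1\<^sup>2 * indicator (cball (0::real^2) (R + 1)) x)"
    proof (rule integral_mono[OF _ _ pt])
      show "integrable lborel (\<lambda>x. (norm (c (x - h) - c x))\<^sup>2)"
        using L2_D(2)[OF L2_diff[OF L2_shift(1)[OF cL] cL]] .
      show "integrable lborel (\<lambda>x. e1\<^sup>2 * indicator (cball (0::real^2) (R + 1)) x)"
        using emeasure_lborel_cball_finite[of "0::real^2" "R + 1"]
        by (intro integrable_mult_right integrable_real_indicator) auto
    qed
    also have "\<dots> = e1\<^sup>2 * K" by (simp add: K_def)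
    also have "\<dots> \<le> e / 4"
    proof -
      have "e1\<^sup>2 = e / (4 * (K + 1))" using \<open>e > 0\<close> K0 by (simp add: e1_def)
      then have "e1\<^sup>2 * (4 * (K + 1)) = e" using K0 by simp
      then have "4 * (e1\<^sup>2 * K) = e - 4 * e1\<^sup>2" by (simp add: algebra_simps)
      moreover have "0 \<le> e1\<^sup>2" by simp
      ultimately show ?thesis by linarith
    qed
    finally have m: "sqn (\<lambda>x. c (x - h) - c x) \<le> e / 4" .
    have D: "(\<lambda>x. u x - c x) \<in> L2 lborel" by (rule L2_diff[OF u cL])
    have D': "(\<lambda>x. c x - u x) \<in> L2 lborel" by (rule L2_diff[OF cL u])
    have "sqn (\<lambda>x. u (x - h) - u x) = sqn (\<lambda>x. (u (x - h) - c (x - h)) + (c x - u x) + (c (x - h) - c x))"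
      by simp
    also have "\<dots> \<le> 4 * sqn (\<lambda>x. u (x - h) - c (x - h)) + 4 * sqn (\<lambda>x. c x - u x) + 2 * sqn (\<lambda>x. c (x - h) - c x)"
      by (rule sqn_le3[OF L2_shift(1)[OF D] D' L2_diff[OF L2_shift(1)[OF cL] cL]])
    also have "sqn (\<lambda>x. u (x - h) - c (x - h)) = sqn (\<lambda>x. u x - c x)"
      by (rule L2_shift(2)[OF D])
    also have "sqn (\<lambda>x. c x - u x) = sqn (\<lambda>x. u x - c x)"
      by (simp add: norm_minus_commute)
    finally show "sqn (\<lambda>x. u (x - h) - u x) < e" using c(3) m by simp
  qed (use d0 in auto)
qed

section \<open>Uniform Lipschitz and Taylor bounds\<close>

lemma norm_pd_sum_le:
  assumes "\<And>j. norm (a j) \<le> B j"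
  shows "norm (\<Sum>j\<in>UNIV. ((h :: real^2) $ j) *\<^sub>R a j) \<le> (\<Sum>j\<in>UNIV. B j) * norm h"
proof -
  have "norm (\<Sum>j\<in>UNIV. (h $ j) *\<^sub>R a j) \<le> (\<Sum>j\<in>UNIV. B j * norm h)"
  proof (rule sum_norm_le)
    fix j
    have "\<bar>h $ j\<bar> * norm (a j) \<le> norm h * B j"
      by (intro mult_mono component_le_norm_cart assms) auto
    then show "norm ((h $ j) *\<^sub>R a j) \<le> B j * norm h" by (simp add: mult.commute)
  qed
  then show ?thesis by (simp add: sum_distrib_right)
qed

lemma smooth_lipschitz:
  assumes f: "smooth f" "bsupp f"
  obtains L where "L \<ge> 0" "\<And>x y. norm (f x - f y) \<le> L * norm (x - y)"
proof -
  have "\<exists>B. \<forall>x. norm (pd j f x) \<le> B" for j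
    using bounded_bsupp[OF smooth_continuous[OF smooth_pd[OF f(1)]] bsupp_pd[OF f(2)], of j] by metis
  then obtain B where B: "\<And>j x. norm (pd j f x) \<le> B j" by metis
  have B0: "(\<Sum>j\<in>UNIV. B j) \<ge> 0" by (rule sum_nonneg) (use B norm_ge_zero order_trans in blast)
  show ?thesis
  proof (rule that[OF B0])
    fix x y
    show "norm (f x - f y) \<le> (\<Sum>j\<in>UNIV. B j) * norm (x - y)"
    proof (rule differentiable_bound[OF convex_UNIV])
      show "(f has_derivative (\<lambda>h. \<Sum>j\<in>UNIV. (h $ j) *\<^sub>R pd j f x)) (at x within UNIV)" for x
        using smooth_has_derivative[OF f(1)] by simp
      show "onorm (\<lambda>h. \<Sum>j\<in>UNIV. (h $ j) *\<^sub>R pd j f x) \<le> (\<Sum>j\<in>UNIV. B j)" for x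
        by (rule onorm_le, rule norm_pd_sum_le, rule B)
    qed auto
  qed
qed

text \<open>The partial derivatives are Lipschitz, which gives a quadratic remainder with a constant
  independent of the base point. This uniformity is what permits differentiation under an integral
  sign below.\<close>

lemma smooth_remainder:
  assumes f: "smooth f" "bsupp f"
  obtains C where "C \<ge> 0"
    "\<And>x h. norm (f (x + h) - f x - (\<Sum>j\<in>UNIV. (h $ j) *\<^sub>R pd j f x)) \<le> C * (norm h)\<^sup>2"
proof -
  have "\<exists>L\<ge>0. \<forall>x y. norm (pd j f x - pd j f y) \<le> L * norm (x - y)" for j
    using smooth_lipschitz[OF smooth_pd[OF f(1)] bsupp_pd[OF f(2)], of j] by metis
  then obtain L where L: "\<And>j. L j \<ge> 0" "\<And>j x y. norm (pd j f x - pd j f y) \<le> L j * norm (x - y)" by metis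
  have L0: "(\<Sum>j\<in>UNIV. L j) \<ge> 0" by (rule sum_nonneg) (use L in auto)
  show ?thesis
  proof (rule that[OF L0])
    fix x h
    let ?D = "\<lambda>y h. \<Sum>j\<in>UNIV. (h $ j) *\<^sub>R pd j f y"
    have "norm (f (x + h) - f x - ?D x (x + h - x)) \<le> norm (x + h - x) * ((\<Sum>j\<in>UNIV. L j) * norm h)"
    proof (rule differentiable_bound_linearization[where S="cball x (norm h)"])
      show "x + t *\<^sub>R (x + h - x) \<in> cball x (norm h)" if "t \<in> {0..1}" for t
        using that by (simp add: dist_norm mult_left_le_one_le)
      show "(f has_derivative ?D y) (at y within cball x (norm h))" for y
        by (rule has_derivative_at_withinI[OF smooth_has_derivative[OF f(1)]])
      fix y assume "y \<in> cball x (norm h)"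
      then have y: "norm (y - x) \<le> norm h" by (simp add: dist_norm norm_minus_commute)
      show "onorm (?D y - ?D x) \<le> (\<Sum>j\<in>UNIV. L j) * norm h"
      proof (rule onorm_le)
        fix k :: "real^2"
        have "(?D y - ?D x) k = (\<Sum>j\<in>UNIV. (k $ j) *\<^sub>R (pd j f y - pd j f x))"
          by (simp add: scaleR_diff_right sum_subtractf)
        also have "norm \<dots> \<le> (\<Sum>j\<in>UNIV. L j * norm h) * norm k"
        proof (rule norm_pd_sum_le)
          fix j show "norm (pd j f y - pd j f x) \<le> L j * norm h"
            using L(2)[of j y x] mult_left_mono[OF y L(1)[of j]] by linarith
        qed
        finally show "norm ((?D y - ?D x) k) \<le> (\<Sum>j\<in>UNIV. L j) * norm h * norm k"
          by (simp add: sum_distrib_right)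
      qed
    qed auto
    then show "norm (f (x + h) - f x - ?D x h) \<le> (\<Sum>j\<in>UNIV. L j) * (norm h)\<^sup>2"
      by (simp add: power2_eq_square mult_ac)
  qed
qed

section \<open>Convolution with a smooth kernel\<close>

definition conv :: "(real^2 \<Rightarrow> real) \<Rightarrow> (real^2 \<Rightarrow> complex) \<Rightarrow> real^2 \<Rightarrow> complex" where
  "conv \<rho> u x = (LINT y|lborel. \<rho> (x - y) *\<^sub>R u y)"

lemma conv_integrable:
  fixes u :: "real^2 \<Rightarrow> complex"
  assumes \<rho>: "smooth \<rho>" "bsupp \<rho>" and u: "integrable lborel u"
  shows "integrable lborel (\<lambda>y. \<rho> (x - y) *\<^sub>R u y)"
proof -
  obtain B where B: "B \<ge> 0" "\<And>x. norm (\<rho> x) \<le> B"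
    using bounded_bsupp[OF smooth_continuous[OF \<rho>(1)] \<rho>(2)] by blast
  have [measurable]: "\<rho> \<in> borel_measurable borel" "u \<in> borel_measurable borel"
    using smooth_borel[OF \<rho>(1)] u by auto
  have "integrable lborel (\<lambda>y. B *\<^sub>R norm (u y))" by (intro integrable_scaleR_right integrable_norm u)
  moreover have "AE y in lborel. norm (\<rho> (x - y) *\<^sub>R u y) \<le> norm (B *\<^sub>R norm (u y))"
    using B by (intro AE_I2) (auto simp: mult_right_mono abs_mult)
  moreover have "(\<lambda>y. \<rho> (x - y) *\<^sub>R u y) \<in> borel_measurable lborel" by simp
  ultimately show ?thesis using Bochner_Integration.integrable_bound by blast
qed

text \<open>The quadratic remainder of the kernel, integrated against \<open>|u|\<close>, is at most
  \<open>C * N * |h|^2\<close>, hence of smaller order than \<open>h\<close>.\<close>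

lemma conv_has_derivative:
  assumes \<rho>: "smooth \<rho>" "bsupp \<rho>" and u: "integrable lborel u"
  shows "(conv \<rho> u has_derivative (\<lambda>h. \<Sum>j\<in>UNIV. (h $ j) *\<^sub>R conv (pd j \<rho>) u x)) (at x)"
proof -
  obtain C where C: "C \<ge> 0"
    "\<And>x h. norm (\<rho> (x + h) - \<rho> x - (\<Sum>j\<in>UNIV. (h $ j) *\<^sub>R pd j \<rho> x)) \<le> C * (norm h)\<^sup>2"
    using smooth_remainder[OF \<rho>] by blast
  define N where "N = (LINT y|lborel. norm (u y))"
  let ?D = "\<lambda>h::real^2. \<Sum>j\<in>UNIV. (h $ j) *\<^sub>R conv (pd j \<rho>) u x"
  show ?thesis
  proof (rule has_derivativeI_sandwich[where e=1 and H="\<lambda>y. C * N * norm (y - x)"])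
    show "bounded_linear ?D"
      by (intro bounded_linear_sum bounded_linear_scaleR_const bounded_linear_vec_nth)
    have "((\<lambda>y. C * N * norm (y - x)) \<longlongrightarrow> C * N * norm (x - x)) (at x)"
      by (intro tendsto_intros)
    then show "((\<lambda>y. C * N * norm (y - x)) \<longlongrightarrow> 0) (at x)" by simp
    fix y assume "y \<noteq> x"
    define h where "h = y - x"
    have h: "h \<noteq> 0" "y = x + h" using \<open>y \<noteq> x\<close> by (auto simp: h_def)
    have ij: "integrable lborel (\<lambda>z. (h $ j) *\<^sub>R (pd j \<rho> (x - z) *\<^sub>R u z))" for j
      by (rule integrable_scaleR_right[OF conv_integrable[OF smooth_pd[OF \<rho>(1)] bsupp_pd[OF \<rho>(2)] u]])
    have i: "integrable lborel (\<lambda>z. \<rho> (w - z) *\<^sub>R u z)" for w by (rule conv_integrable[OF \<rho> u])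
    have "conv \<rho> u y - conv \<rho> u x - ?D h
      = (LINT z|lborel. \<rho> (y - z) *\<^sub>R u z - \<rho> (x - z) *\<^sub>R u z - (\<Sum>j\<in>UNIV. (h $ j) *\<^sub>R (pd j \<rho> (x - z) *\<^sub>R u z)))"
      unfolding conv_def integral_scaleR_right[symmetric]
      by (subst Bochner_Integration.integral_diff Bochner_Integration.integral_sum | intro i ij Bochner_Integration.integrable_diff Bochner_Integration.integrable_sum)+ simp
    also have "norm \<dots> \<le> (LINT z|lborel. (C * (norm h)\<^sup>2) * norm (u z))"
    proof (rule order.trans[OF integral_norm_bound integral_mono])
      show "integrable lborel (\<lambda>z. (C * (norm h)\<^sup>2) * norm (u z))" using u by simp
      show "integrable lborel (\<lambda>z. norm (\<rho> (y - z) *\<^sub>R u z - \<rho> (x - z) *\<^sub>R u z - (\<Sum>j\<in>UNIV. (h $ j) *\<^sub>R (pd j \<rho> (x - z) *\<^sub>R u z))))"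
        by (intro integrable_norm i ij Bochner_Integration.integrable_diff Bochner_Integration.integrable_sum)
      fix z
      have "\<rho> (y - z) *\<^sub>R u z - \<rho> (x - z) *\<^sub>R u z - (\<Sum>j\<in>UNIV. (h $ j) *\<^sub>R (pd j \<rho> (x - z) *\<^sub>R u z))
        = (\<rho> ((x - z) + h) - \<rho> (x - z) - (\<Sum>j\<in>UNIV. (h $ j) *\<^sub>R pd j \<rho> (x - z))) *\<^sub>R u z"
        by (simp add: h(2) scaleR_diff_left scaleR_sum_left algebra_simps)
      also have "norm \<dots> \<le> (C * (norm h)\<^sup>2) * norm (u z)"
        unfolding norm_scaleR using C(2)[of "x - z" h] by (intro mult_right_mono) auto
      finally show "norm (\<rho> (y - z) *\<^sub>R u z - \<rho> (x - z) *\<^sub>R u z - (\<Sum>j\<in>UNIV. (h $ j) *\<^sub>R (pd j \<rho> (x - z) *\<^sub>R u z)))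
        \<le> (C * (norm h)\<^sup>2) * norm (u z)" .
    qed
    also have "\<dots> = C * N * norm h * norm h" by (simp add: N_def power2_eq_square)
    finally show "norm ((conv \<rho> u y - conv \<rho> u x) - ?D (y - x)) / norm (y - x) \<le> C * N * norm (y - x)"
      using h by (simp add: pos_divide_le_eq)
  qed simp
qed

lemma pd_conv:
  assumes "smooth \<rho>" "bsupp \<rho>" "integrable lborel u"
  shows "pd i (conv \<rho> u) x = conv (pd i \<rho>) u x"
  using pd_eq[OF conv_has_derivative[OF assms], of i] by simp

lemma smooth_conv:
  assumes "smooth \<rho>" "bsupp \<rho>" "integrable lborel u"
  shows "smooth (conv \<rho> u)"
proof (rule smooth_coinduct[of _ "{conv \<rho> u | \<rho>. smooth \<rho> \<and> bsupp \<rho>}"])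
  let ?X = "{conv \<rho> u | \<rho>. smooth \<rho> \<and> bsupp \<rho>}"
  show "h differentiable (at x)" if "h \<in> ?X" for h x
    using that differentiableI[OF conv_has_derivative[OF _ _ assms(3)]] by auto
  show "\<exists>gs. set gs \<subseteq> ?X \<and> (\<forall>x\<in>UNIV. pd i h x = (\<Sum>g\<leftarrow>gs. g x))" if "h \<in> ?X" for h i
  proof -
    from that obtain \<sigma> where s: "h = conv \<sigma> u" "smooth \<sigma>" "bsupp \<sigma>" by auto
    then show ?thesis
      using pd_conv[OF s(2,3) assms(3), of i] smooth_pd[OF s(2), of i] bsupp_pd[OF s(3), of i]
      by (intro exI[of _ "[conv (pd i \<sigma>) u]"]) auto
  qed
qed (use assms in auto)

lemma conv_zero_outside:
  assumes "\<And>x. norm x \<ge> \<epsilon> \<Longrightarrow> \<rho> x = 0" "\<And>y. dist x y < \<epsilon> \<Longrightarrow> u y = 0"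
  shows "conv \<rho> u x = 0"
proof -
  have "\<rho> (x - y) *\<^sub>R u y = 0" for y
    using assms(1)[of "x - y"] assms(2)[of y] by (cases "dist x y < \<epsilon>") (auto simp: dist_norm)
  then show ?thesis unfolding conv_def by (simp only: integral_zero)
qed

lemma conv_reflect:
  assumes [measurable]: "\<rho> \<in> borel_measurable borel" "u \<in> borel_measurable borel"
  shows "conv \<rho> u x = (LINT y|lborel. \<rho> y *\<^sub>R u (x - y))"
  using lborel_reflect(1)[of "\<lambda>y. \<rho> y *\<^sub>R u (x - y)" x] by (simp add: conv_def)

text \<open>The variance of \<open>g\<close> under the probability density \<open>\<rho>\<close> is
  nonnegative.\<close>

lemma jensen_square:
  fixes \<rho> :: "real^2 \<Rightarrow> real" and g :: "real^2 \<Rightarrow> real"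
  assumes \<rho>: "\<And>y. \<rho> y \<ge> 0" "integrable lborel \<rho>" "(LINT y|lborel. \<rho> y) = 1"
    and g: "integrable lborel (\<lambda>y. \<rho> y * g y)" "integrable lborel (\<lambda>y. \<rho> y * (g y)\<^sup>2)"
  shows "(LINT y|lborel. \<rho> y * g y)\<^sup>2 \<le> (LINT y|lborel. \<rho> y * (g y)\<^sup>2)"
proof -
  define m where "m = (LINT y|lborel. \<rho> y * g y)"
  have "0 \<le> (LINT y|lborel. \<rho> y * (g y - m)\<^sup>2)"
    using \<rho>(1) by (intro integral_nonneg_AE) auto
  also have "\<dots> = (LINT y|lborel. \<rho> y * (g y)\<^sup>2 - (2 * m) * (\<rho> y * g y) + m\<^sup>2 * \<rho> y)"
    by (intro Bochner_Integration.integral_cong) (auto simp: power2_diff algebra_simps)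
  also have "\<dots> = (LINT y|lborel. \<rho> y * (g y)\<^sup>2) - (2 * m) * m + m\<^sup>2 * 1"
    using \<rho> g by (simp add: m_def)
  finally show ?thesis by (simp add: m_def[symmetric] power2_eq_square)
qed

text \<open>The difference of \<open>conv \<rho> u\<close> and \<open>u\<close> is the
  \<open>\<rho>\<close>-average of the differences \<open>u (x - y) - u x\<close> with
  \<open>y\<close> shorter than \<open>d\<close>. Jensen's inequality moves the square inside the
  average, and exchanging the integrals leaves translations of \<open>u\<close>, each bounded by
  \<open>e\<close>.\<close>

lemma mollify_bound:
  assumes \<rho>: "smooth \<rho>" "\<And>x. \<rho> x \<ge> 0" "\<And>x. norm x \<ge> d \<Longrightarrow> \<rho> x = 0" "bsupp \<rho>" "(LINT x|lborel. \<rho> x) = 1"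
    and u: "u \<in> L2 lborel" "integrable lborel u"
    and e: "\<And>h. norm h < d \<Longrightarrow> sqn (\<lambda>x. u (x - h) - u x) \<le> e"
  shows "(\<lambda>x. conv \<rho> u x - u x) \<in> L2 lborel" "sqn (\<lambda>x. conv \<rho> u x - u x) \<le> e"
proof -
  have [measurable]: "u \<in> borel_measurable borel" "\<rho> \<in> borel_measurable borel"
    using L2_D(1)[OF u(1)] smooth_borel[OF \<rho>(1)] by auto
  have [measurable]: "conv \<rho> u \<in> borel_measurable borel"
    by (rule smooth_borel[OF smooth_conv[OF \<rho>(1,4) u(2)]])
  have i\<rho>: "integrable lborel \<rho>" by (rule integrable_smooth[OF \<rho>(1,4)])
  let ?g = "\<lambda>x y. norm (u (x - y) - u x)"
  have pt: "ennreal ((norm (conv \<rho> u x - u x))\<^sup>2) \<le> (\<integral>\<^sup>+y. ennreal (\<rho> y * (?g x y)\<^sup>2) \<partial>lborel)" for x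
  \<comment> \<open>Jensen's inequality is stated for Bochner integrals and needs integrability,
    which holds exactly when the right-hand side is finite; otherwise the bound is trivial.\<close>
  proof (cases "(\<integral>\<^sup>+y. ennreal (\<rho> y * (?g x y)\<^sup>2) \<partial>lborel) < \<infinity>")
    case True
    have g2: "integrable lborel (\<lambda>y. \<rho> y * (?g x y)\<^sup>2)"
      by (rule integrableI_nonneg) (use True \<rho>(2) in auto)
    have iu: "integrable lborel (\<lambda>y. \<rho> y *\<^sub>R u (x - y))"
      using lborel_reflect(3)[OF _ conv_integrable[OF \<rho>(1,4) u(2), of x], of x] by simp
    have i1: "integrable lborel (\<lambda>y. \<rho> y *\<^sub>R (u (x - y) - u x))"
      using iu i\<rho> by (simp add: scaleR_diff_right)
    have g1: "integrable lborel (\<lambda>y. \<rho> y * ?g x y)"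
      using integrable_norm[OF i1] \<rho>(2) by simp
    have "conv \<rho> u x - u x = (LINT y|lborel. \<rho> y *\<^sub>R u (x - y)) - (LINT y|lborel. \<rho> y *\<^sub>R u x)"
      using i\<rho> \<rho>(5) by (simp add: conv_reflect)
    also have "\<dots> = (LINT y|lborel. \<rho> y *\<^sub>R (u (x - y) - u x))"
      using iu i\<rho> by (simp add: scaleR_diff_right)
    finally have "norm (conv \<rho> u x - u x) \<le> (LINT y|lborel. norm (\<rho> y *\<^sub>R (u (x - y) - u x)))"
      by (simp only: integral_norm_bound)
    then have "norm (conv \<rho> u x - u x) \<le> (LINT y|lborel. \<rho> y * ?g x y)"
      using \<rho>(2) by simp
    then have "(norm (conv \<rho> u x - u x))\<^sup>2 \<le> (LINT y|lborel. \<rho> y * ?g x y)\<^sup>2"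
      by (intro power_mono) auto
    also have "\<dots> \<le> (LINT y|lborel. \<rho> y * (?g x y)\<^sup>2)"
      by (rule jensen_square[OF \<rho>(2) i\<rho> \<rho>(5) g1 g2])
    finally have "ennreal ((norm (conv \<rho> u x - u x))\<^sup>2) \<le> ennreal (LINT y|lborel. \<rho> y * (?g x y)\<^sup>2)"
      by (rule ennreal_leI)
    also have "\<dots> = (\<integral>\<^sup>+y. ennreal (\<rho> y * (?g x y)\<^sup>2) \<partial>lborel)"
      by (rule nn_integral_eq_integral[symmetric]) (use g2 \<rho>(2) in auto)
    finally show ?thesis .
  next
    case False
    then have "(\<integral>\<^sup>+y. ennreal (\<rho> y * (?g x y)\<^sup>2) \<partial>lborel) = \<infinity>"
      by (simp only: infinity_ennreal_def less_top[symmetric] not_not)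
    then show ?thesis by (simp only: infinity_ennreal_def top_greatest)
  qed
  have "(\<integral>\<^sup>+x. ennreal ((norm (conv \<rho> u x - u x))\<^sup>2) \<partial>lborel)
      \<le> (\<integral>\<^sup>+x. \<integral>\<^sup>+y. ennreal (\<rho> y * (?g x y)\<^sup>2) \<partial>lborel \<partial>lborel)"
    by (intro nn_integral_mono pt)
  also have "\<dots> = (\<integral>\<^sup>+y. \<integral>\<^sup>+x. ennreal (\<rho> y * (?g x y)\<^sup>2) \<partial>lborel \<partial>lborel)"
    by (rule lborel_pair.Fubini'[symmetric]) simp
  also have "\<dots> \<le> (\<integral>\<^sup>+y. ennreal (\<rho> y) * ennreal e \<partial>lborel)"
  proof (intro nn_integral_mono)
    fix y
    show "(\<integral>\<^sup>+x. ennreal (\<rho> y * (?g x y)\<^sup>2) \<partial>lborel) \<le> ennreal (\<rho> y) * ennreal e"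
    proof (cases "norm y < d")
      case True
      have "(\<integral>\<^sup>+x. ennreal (\<rho> y * (?g x y)\<^sup>2) \<partial>lborel) = ennreal (\<rho> y) * (\<integral>\<^sup>+x. ennreal ((?g x y)\<^sup>2) \<partial>lborel)"
        using \<rho>(2) by (subst nn_integral_cmult[symmetric]) (auto simp: ennreal_mult')
      also have "(\<integral>\<^sup>+x. ennreal ((?g x y)\<^sup>2) \<partial>lborel) = ennreal (sqn (\<lambda>x. u (x - y) - u x))"
        by (rule nn_integral_eq_integral) (use L2_D(2)[OF L2_diff[OF L2_shift(1)[OF u(1)] u(1)]] in auto)
      also have "\<dots> \<le> ennreal e" by (intro ennreal_leI e True)
      finally show ?thesis by (simp add: mult_left_mono)
    next
      case False
      then show ?thesis using \<rho>(3)[of y] by simp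
    qed
  qed
  also have "\<dots> = ennreal e"
    using \<rho>(2,5) i\<rho> by (simp add: nn_integral_multc nn_integral_eq_integral)
  finally have le: "(\<integral>\<^sup>+x. ennreal ((norm (conv \<rho> u x - u x))\<^sup>2) \<partial>lborel) \<le> ennreal e" .
  have int: "integrable lborel (\<lambda>x. (norm (conv \<rho> u x - u x))\<^sup>2)"
    by (rule integrableI_nonneg) (use le in \<open>auto intro: le_less_trans\<close>)
  then show "(\<lambda>x. conv \<rho> u x - u x) \<in> L2 lborel" by (simp add: L2_def)
  \<comment> \<open>\<open>ennreal e\<close> would read a negative \<open>e\<close> as 0, so the
    last step needs \<open>e\<close> to be nonnegative. This follows from the shift by 0, which is
    admissible since a kernel of integral 1 cannot vanish everywhere.\<close>
  have d0: "d > 0"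
  proof (rule ccontr)
    assume "\<not> d > 0"
    then have "\<rho> x = 0" for x using \<rho>(3)[of x] norm_ge_zero[of x] by (meson leI order_trans)
    with \<rho>(5) show False by simp
  qed
  have "e \<ge> 0" using e[of 0] d0 by simp
  moreover have "ennreal (sqn (\<lambda>x. conv \<rho> u x - u x)) \<le> ennreal e"
    using le nn_integral_eq_integral[OF int] by simp
  ultimately show "sqn (\<lambda>x. conv \<rho> u x - u x) \<le> e" by simp
qed

text \<open>Only the shrinking radius of the support matters, so the kernels are chosen
  independently of one another instead of being rescaled copies of one kernel.\<close>

definition mollifier :: "nat \<Rightarrow> real^2 \<Rightarrow> real" where
  "mollifier n = (SOME \<rho>. smooth \<rho> \<and> (\<forall>x. \<rho> x \<ge> 0) \<and> (\<forall>x. norm x \<ge> 1 / (real n + 1) \<longrightarrow> \<rho> x = 0)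
     \<and> bsupp \<rho> \<and> (LINT x|lborel. \<rho> x) = 1)"

lemma mollifier:
  "smooth (mollifier n)" "mollifier n x \<ge> 0" "norm x \<ge> 1 / (real n + 1) \<Longrightarrow> mollifier n x = 0"
  "bsupp (mollifier n)" "(LINT x|lborel. mollifier n x) = 1"
proof -
  obtain \<rho> :: "real^2 \<Rightarrow> real" where "smooth \<rho>" "\<And>x. \<rho> x \<ge> 0" "\<And>x. norm x \<ge> 1 / (real n + 1) \<Longrightarrow> \<rho> x = 0"
    "bsupp \<rho>" "(LINT x|lborel. \<rho> x) = 1"
    using mollifier_exists[of "1 / (real n + 1)"] by (auto simp: add_pos_nonneg)
  then have "\<exists>\<rho>::real^2 \<Rightarrow> real. smooth \<rho> \<and> (\<forall>x. \<rho> x \<ge> 0) \<and> (\<forall>x. norm x \<ge> 1 / (real n + 1) \<longrightarrow> \<rho> x = 0)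
     \<and> bsupp \<rho> \<and> (LINT x|lborel. \<rho> x) = 1" by blast
  from someI_ex[OF this, folded mollifier_def]
  show "smooth (mollifier n)" "mollifier n x \<ge> 0" "norm x \<ge> 1 / (real n + 1) \<Longrightarrow> mollifier n x = 0"
    "bsupp (mollifier n)" "(LINT x|lborel. mollifier n x) = 1" by blast+
qed

lemma mollify_L2:
  assumes u: "u \<in> L2 lborel" "integrable lborel u"
  shows "(\<lambda>n. sqn (\<lambda>x. conv (mollifier n) u x - u x)) \<longlonglongrightarrow> 0"
    and "(\<lambda>x. conv (mollifier n) u x - u x) \<in> L2 lborel"
    and "conv (mollifier n) u \<in> L2 lborel"
proof -
  show d: "(\<lambda>x. conv (mollifier n) u x - u x) \<in> L2 lborel" for n
  \<comment> \<open>The crude bound \<open>4 * sqn u\<close>, valid for every shift, is enough for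
    square integrability; convergence uses small shifts.\<close>
  proof (rule mollify_bound(1)[OF mollifier(1,2,3,4,5) u, where e="4 * sqn u"])
    fix h
    have "sqn (\<lambda>x. u (x - h) - u x) \<le> (LINT x|lborel. 2 * (norm (u (x - h)))\<^sup>2 + 2 * (norm (u x))\<^sup>2)"
      by (rule integral_mono)
        (use L2_D(2)[OF L2_diff[OF L2_shift(1)[OF u(1)] u(1)]] L2_D(2)[OF L2_shift(1)[OF u(1)]] L2_D(2)[OF u(1)]
          norm_diff_squared in auto)
    also have "\<dots> = 4 * sqn u"
      using L2_D(2)[OF L2_shift(1)[OF u(1)]] L2_D(2)[OF u(1)] L2_shift(2)[OF u(1), of h] by simp
    finally show "sqn (\<lambda>x. u (x - h) - u x) \<le> 4 * sqn u" .
  qed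
  show "conv (mollifier n) u \<in> L2 lborel"
    using L2_add[OF d[of n] u(1)] by simp
  show "(\<lambda>n. sqn (\<lambda>x. conv (mollifier n) u x - u x)) \<longlonglongrightarrow> 0"
  proof (rule LIMSEQ_I)
    fix r :: real assume "r > 0"
    obtain d where d: "d > 0" "\<And>h. norm h < d \<Longrightarrow> sqn (\<lambda>x. u (x - h) - u x) < r / 2"
      using L2_translation_continuous[OF u(1), of "r / 2"] \<open>r > 0\<close> by auto
    obtain N :: nat where N: "1 / (real N + 1) < d"
      using d(1) reals_Archimedean[of d] by (auto simp: inverse_eq_divide add.commute)
    show "\<exists>no. \<forall>n\<ge>no. norm (sqn (\<lambda>x. conv (mollifier n) u x - u x) - 0) < r"
    proof (intro exI[of _ N] allI impI)
      fix n assume "n \<ge> N"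
      then have "1 / (real n + 1) \<le> 1 / (real N + 1)" by (intro divide_left_mono) auto
      with N have nd: "1 / (real n + 1) < d" by simp
      have "sqn (\<lambda>x. conv (mollifier n) u x - u x) \<le> r / 2"
        by (rule mollify_bound(2)[OF mollifier(1,2,3,4,5) u]) (use d(2) nd in \<open>auto intro!: less_imp_le\<close>)
      then show "norm (sqn (\<lambda>x. conv (mollifier n) u x - u x) - 0) < r"
        using \<open>r > 0\<close> by simp
    qed
  qed
qed

section \<open>Weak derivatives\<close>

definition lap :: "(real^2 \<Rightarrow> 'b::real_normed_vector) \<Rightarrow> real^2 \<Rightarrow> 'b" where
  "lap f x = (\<Sum>i\<in>UNIV. pd i (pd i f) x)"

lemma smooth_lap: "smooth f \<Longrightarrow> smooth (lap f)"
  unfolding lap_def by (intro smooth_sum smooth_pd)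

lemma test_functions_iff:
  "\<phi> \<in> test_functions U \<longleftrightarrow> smooth \<phi> \<and> bsupp \<phi> \<and> closure {x. \<phi> x \<noteq> 0} \<subseteq> U"
  by (auto simp: test_functions_def supp_def compact_closure)

lemma test_smooth: "\<phi> \<in> test_functions U \<Longrightarrow> smooth \<phi>"
  and test_bsupp: "\<phi> \<in> test_functions U \<Longrightarrow> bsupp \<phi>"
  by (auto simp: test_functions_iff)

lemma test_zero:
  assumes "\<phi> \<in> test_functions U" "x \<notin> U"
  shows "\<phi> x = 0" "pd i \<phi> x = 0" "lap \<phi> x = 0"
proof -
  have x: "x \<notin> closure {x. \<phi> x \<noteq> 0}" using assms by (auto simp: test_functions_iff)
  then show "\<phi> x = 0" using closure_subset[of "{x. \<phi> x \<noteq> 0}"] by auto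
  show z: "pd i \<phi> x = 0" for i by (rule pd_zero_off_closure[OF x])
  have "pd i (pd i \<phi>) x = 0" for i
    by (rule pd_zero_outside[of "closure {x. \<phi> x \<noteq> 0}"]) (use x pd_zero_off_closure in auto)
  then show "lap \<phi> x = 0" by (simp add: lap_def)
qed

lemma test_mono: "\<phi> \<in> test_functions U \<Longrightarrow> U \<subseteq> V \<Longrightarrow> \<phi> \<in> test_functions V"
  by (auto simp: test_functions_iff)

lemma closure_pd_subset: "closure {x. pd i \<phi> x \<noteq> 0} \<subseteq> closure {x. \<phi> x \<noteq> 0}"
  by (rule closure_minimal) (use pd_zero_off_closure[of _ \<phi>] in auto)

lemma test_pd: "\<phi> \<in> test_functions U \<Longrightarrow> pd i \<phi> \<in> test_functions U"
  using closure_pd_subset[of i \<phi>] by (auto simp: test_functions_iff intro: smooth_pd bsupp_pd)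

lemma test_mult:
  assumes "\<phi> \<in> test_functions U" "smooth c"
  shows "(\<lambda>x. \<phi> x * c x) \<in> test_functions U" "(\<lambda>x. c x * \<phi> x) \<in> test_functions U"
proof -
  have "closure {x. \<phi> x * c x \<noteq> 0} \<subseteq> closure {x. \<phi> x \<noteq> 0}"
    by (rule closure_mono) auto
  moreover have "bsupp (\<lambda>x. \<phi> x * c x)"
    by (rule bsupp_mono[of \<phi>]) (use assms in \<open>auto simp: test_functions_iff\<close>)
  ultimately show "(\<lambda>x. \<phi> x * c x) \<in> test_functions U"
    using assms by (auto simp: test_functions_iff)
  then show "(\<lambda>x. c x * \<phi> x) \<in> test_functions U" by (simp add: mult.commute)
qed

lemma lebesgue_on_integral:
  fixes G :: "real^2 \<Rightarrow> 'b::{banach, second_countable_topology}"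
  assumes "G \<in> borel_measurable borel" "U \<in> sets lebesgue" "\<And>x. x \<notin> U \<Longrightarrow> G x = 0"
  shows "(LINT x|lebesgue_on U. G x) = (LINT x|lborel. G x)"
proof -
  have "(LINT x|lebesgue_on U. G x) = (LINT x|lebesgue. indicator U x *\<^sub>R G x)"
    using assms(2) by (subst integral_restrict_space) auto
  also have "(\<lambda>x. indicator U x *\<^sub>R G x) = G"
    using assms(3) by (auto simp: indicator_def fun_eq_iff)
  also have "(LINT x|lebesgue. G x) = (LINT x|lborel. G x)"
    using assms(1) by (subst integral_completion) auto
  finally show ?thesis .
qed

text \<open>A test function vanishes off \<open>U\<close> with its derivatives, so the integrals may
  be taken over the whole plane. Together with Borel measurability this allows the arguments to run
  in \<open>lborel\<close>, where Fubini and translations are at hand.\<close>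

lemma weak_pd_iff:
  assumes "open U" "u \<in> borel_measurable borel" "g \<in> borel_measurable borel"
  shows "has_weak_pd U i u g \<longleftrightarrow> (\<forall>\<phi>\<in>test_functions U.
    (LINT x|lborel. pd i \<phi> x *\<^sub>R u x) = - (LINT x|lborel. \<phi> x *\<^sub>R g x))"
proof -
  have "(LINT x|lebesgue_on U. pd i \<phi> x *\<^sub>R u x) = (LINT x|lborel. pd i \<phi> x *\<^sub>R u x)
    \<and> (LINT x|lebesgue_on U. \<phi> x *\<^sub>R g x) = (LINT x|lborel. \<phi> x *\<^sub>R g x)" if t: "\<phi> \<in> test_functions U" for \<phi>
  proof -
    have [measurable]: "\<phi> \<in> borel_measurable borel" "pd i \<phi> \<in> borel_measurable borel"
      using smooth_borel[OF test_smooth[OF t]] smooth_borel[OF smooth_pd[OF test_smooth[OF t]]] by auto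
    note [measurable] = assms(2,3)
    show ?thesis
      using assms(1) test_zero[OF t]
      by (intro conjI lebesgue_on_integral) (simp_all add: sets_completionI_sets)
  qed
  then show ?thesis by (simp add: has_weak_pd_def)
qed

lemma weak_laplacian_iff:
  assumes "open U" "u \<in> borel_measurable borel" "F \<in> borel_measurable borel"
  shows "has_weak_laplacian U u F \<longleftrightarrow> (\<forall>\<phi>\<in>test_functions U.
    (LINT x|lborel. lap \<phi> x *\<^sub>R u x) = (LINT x|lborel. \<phi> x *\<^sub>R F x))"
proof -
  have "(LINT x|lebesgue_on U. lap \<phi> x *\<^sub>R u x) = (LINT x|lborel. lap \<phi> x *\<^sub>R u x)
    \<and> (LINT x|lebesgue_on U. \<phi> x *\<^sub>R F x) = (LINT x|lborel. \<phi> x *\<^sub>R F x)" if t: "\<phi> \<in> test_functions U" for \<phi>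
  proof -
    have [measurable]: "\<phi> \<in> borel_measurable borel" "lap \<phi> \<in> borel_measurable borel"
      using smooth_borel[OF test_smooth[OF t]] smooth_borel[OF smooth_lap[OF test_smooth[OF t]]] by auto
    note [measurable] = assms(2,3)
    show ?thesis
      using assms(1) test_zero[OF t]
      by (intro conjI lebesgue_on_integral) (simp_all add: sets_completionI_sets)
  qed
  then show ?thesis by (simp add: has_weak_laplacian_def lap_def)
qed

lemma weak_pd_mono: "open U \<Longrightarrow> open V \<Longrightarrow> u \<in> borel_measurable borel \<Longrightarrow> g \<in> borel_measurable borel
  \<Longrightarrow> has_weak_pd U i u g \<Longrightarrow> V \<subseteq> U \<Longrightarrow> has_weak_pd V i u g"
  using test_mono[of _ V U] by (simp add: weak_pd_iff)

lemma weak_laplacian_mono: "open U \<Longrightarrow> open V \<Longrightarrow> u \<in> borel_measurable borel \<Longrightarrow> F \<in> borel_measurable borel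
  \<Longrightarrow> has_weak_laplacian U u F \<Longrightarrow> V \<subseteq> U \<Longrightarrow> has_weak_laplacian V u F"
  using test_mono[of _ V U] by (simp add: weak_laplacian_iff)

lemma smooth_uminus_arg: "smooth f \<Longrightarrow> smooth (\<lambda>y. f (x - y))"
proof -
  assume "smooth f"
  then have "smooth (\<lambda>y. f (- (y - x)))"
    using smooth_translate[OF smooth_compose_linear[OF bounded_linear_minus[OF bounded_linear_ident], of f], of x] by simp
  then show ?thesis by simp
qed

lemma pd_uminus_arg:
  assumes "smooth f"
  shows "pd i (\<lambda>y. f (x - y)) y = - pd i f (x - y)"
proof -
  have "((\<lambda>y. x - y) has_derivative (\<lambda>h. - h)) (at y)" by (auto intro!: derivative_eq_intros)
  from pd_eq[OF has_derivative_compose[OF this smooth_has_derivative[OF assms]], of i]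
  show ?thesis by (simp add: sum_negf)
qed

lemma reflected_test:
  assumes "smooth \<rho>" "\<And>x. norm x \<ge> \<epsilon> \<Longrightarrow> \<rho> x = 0" "cball x \<epsilon> \<subseteq> U"
  shows "(\<lambda>y. \<rho> (x - y)) \<in> test_functions U"
proof -
  have s: "{y. \<rho> (x - y) \<noteq> 0} \<subseteq> cball x \<epsilon>"
    using assms(2) by (force simp: dist_norm)
  have "closure {y. \<rho> (x - y) \<noteq> 0} \<subseteq> cball x \<epsilon>"
    by (rule closure_minimal[OF s]) simp
  then show ?thesis
    using assms smooth_uminus_arg bounded_subset[OF bounded_cball s] by (auto simp: test_functions_iff)
qed

text \<open>All derivatives of the convolution fall on the kernel, and
  \<open>y \<mapsto> \<rho> (x - y)\<close> is a test function on \<open>U\<close> because the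
  closed \<open>\<epsilon>\<close>-ball about \<open>x\<close> lies in \<open>U\<close>. The sign
  from the reflected argument cancels, as two derivatives are taken.\<close>

lemma lap_conv_weak:
  assumes "open U" "u \<in> borel_measurable borel" "F \<in> borel_measurable borel" "has_weak_laplacian U u F"
    and \<rho>: "smooth \<rho>" "bsupp \<rho>" "\<And>x. norm x \<ge> \<epsilon> \<Longrightarrow> \<rho> x = 0" and "cball x \<epsilon> \<subseteq> U" "integrable lborel u"
  shows "lap (conv \<rho> u) x = conv \<rho> F x"
proof -
  have pd2: "pd i (pd i (\<lambda>y. \<rho> (x - y))) y = pd i (pd i \<rho>) (x - y)" for i y
  proof -
    have "pd i (\<lambda>y. \<rho> (x - y)) = (\<lambda>y. - pd i \<rho> (x - y))"
      by (rule ext) (rule pd_uminus_arg[OF \<rho>(1)])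
    then have "pd i (pd i (\<lambda>y. \<rho> (x - y))) y = pd i (\<lambda>y. - pd i \<rho> (x - y)) y" by simp
    also have "\<dots> = - pd i (\<lambda>y. pd i \<rho> (x - y)) y"
      by (rule pd_minus[OF smoothD[OF smooth_uminus_arg[OF smooth_pd[OF \<rho>(1)]]]])
    finally show ?thesis by (simp add: pd_uminus_arg[OF smooth_pd[OF \<rho>(1)]])
  qed
  have i: "integrable lborel (\<lambda>y. pd j (pd k \<rho>) (x - y) *\<^sub>R u y)" for j k
    by (rule conv_integrable[OF smooth_pd[OF smooth_pd[OF \<rho>(1)]] bsupp_pd[OF bsupp_pd[OF \<rho>(2)]] assms(9)])
  have "lap (conv \<rho> u) x = (\<Sum>i\<in>UNIV. conv (pd i (pd i \<rho>)) u x)"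
  proof -
    have "pd i (conv \<rho> u) = conv (pd i \<rho>) u" for i
      by (rule ext) (rule pd_conv[OF \<rho>(1,2) assms(9)])
    then show ?thesis
      by (simp add: lap_def pd_conv[OF smooth_pd[OF \<rho>(1)] bsupp_pd[OF \<rho>(2)] assms(9)])
  qed
  also have "\<dots> = (LINT y|lborel. lap (\<lambda>y. \<rho> (x - y)) y *\<^sub>R u y)"
    using i by (simp add: conv_def lap_def pd2 scaleR_sum_left)
  also have "\<dots> = conv \<rho> F x"
    using assms reflected_test[OF \<rho>(1,3) assms(8)] by (auto simp: weak_laplacian_iff conv_def)
  finally show ?thesis .
qed

section \<open>Cutoff functions and the fundamental lemma of the calculus of variations\<close>

lemma cutoff_exists:
  assumes "0 < a" "a < b"
  obtains c :: "real^2 \<Rightarrow> real" where "c \<in> test_functions (ball z b)" "\<And>x. 0 \<le> c x" "\<And>x. c x \<le> 1"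
    "\<And>x. x \<in> cball z a \<Longrightarrow> c x = 1"
proof -
  \<comment> \<open>The indicator of the ball of radius \<open>a + \<epsilon>\<close> is mollified
    at scale \<open>\<epsilon>\<close>: the result is 1 up to radius \<open>a\<close> and vanishes
    beyond \<open>a + 2 * \<epsilon>\<close>, which is less than \<open>b\<close>.\<close>
  define \<epsilon> where "\<epsilon> = (b - a) / 4"
  have \<epsilon>: "\<epsilon> > 0" using assms by (simp add: \<epsilon>_def)
  obtain \<rho> :: "real^2 \<Rightarrow> real" where \<rho>: "smooth \<rho>" "\<And>x. \<rho> x \<ge> 0" "\<And>x. norm x \<ge> \<epsilon> \<Longrightarrow> \<rho> x = 0"
    "bsupp \<rho>" "(LINT x|lborel. \<rho> x) = 1"
    using mollifier_exists[OF \<epsilon>] by blast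
  define A where "A = cball z (a + \<epsilon>)"
  have [measurable]: "\<rho> \<in> borel_measurable borel" by (rule smooth_borel[OF \<rho>(1)])
  have [measurable]: "A \<in> sets borel" by (simp add: A_def)
  define I where "I = (\<lambda>y. complex_of_real (indicator A y))"
  have iI: "integrable lborel I"
    unfolding I_def A_def using emeasure_lborel_cball_finite[of z "a + \<epsilon>"]
    by (intro integrable_of_real integrable_real_indicator) auto
  define c where "c x = Re (conv \<rho> I x)" for x
  have i: "integrable lborel (\<lambda>y. \<rho> (x - y) * indicator A y)" for x
    using integrable_Re[OF conv_integrable[OF \<rho>(1,4) iI, of x]] by (simp add: I_def)
  have c: "c x = (LINT y|lborel. \<rho> (x - y) * indicator A y)" for x
    using integral_Re[OF conv_integrable[OF \<rho>(1,4) iI, of x]] by (simp add: c_def conv_def I_def)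
  have i\<rho>: "integrable lborel (\<lambda>y. \<rho> (x - y))" "(LINT y|lborel. \<rho> (x - y)) = 1" for x
    using lborel_reflect(1,3)[of \<rho> x] integrable_smooth[OF \<rho>(1,4)] \<rho>(5) by auto
  have sc: "smooth c"
    unfolding c_def by (rule smooth_bounded_linear[OF bounded_linear_Re smooth_conv[OF \<rho>(1,4) iI]])
  have out: "c x = 0" if "x \<notin> cball z (a + 2 * \<epsilon>)" for x
  proof -
    have "conv \<rho> I x = 0"
    proof (rule conv_zero_outside[OF \<rho>(3)])
      fix y assume "dist x y < \<epsilon>"
      then have "y \<notin> A" using that dist_triangle[of z x y] by (auto simp: A_def dist_commute)
      then show "I y = 0" by (simp add: I_def)
    qed auto
    then show ?thesis by (simp add: c_def)
  qed
  show ?thesis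
  proof (rule that)
    have s: "{x. c x \<noteq> 0} \<subseteq> cball z (a + 2 * \<epsilon>)" using out by blast
    have "closure {x. c x \<noteq> 0} \<subseteq> cball z (a + 2 * \<epsilon>)"
      by (rule closure_minimal[OF s]) simp
    also have "\<dots> \<subseteq> ball z b"
    proof -
      have "a + 2 * \<epsilon> < b" using assms by (simp add: \<epsilon>_def field_simps)
      then show ?thesis by auto
    qed
    finally show "c \<in> test_functions (ball z b)"
      using sc bounded_subset[OF bounded_cball s] by (auto simp: test_functions_iff)
    show "0 \<le> c x" for x unfolding c using \<rho>(2) by (intro integral_nonneg_AE) auto
    have "c x \<le> (LINT y|lborel. \<rho> (x - y))" for x
      unfolding c by (intro integral_mono i i\<rho>) (use \<rho>(2) in \<open>auto simp: indicator_def\<close>)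
    then show "c x \<le> 1" for x using i\<rho>(2) by simp
    fix x assume x: "x \<in> cball z a"
    have "\<rho> (x - y) * indicator A y = \<rho> (x - y)" for y
    proof (cases "norm (x - y) < \<epsilon>")
      case True
      then have "y \<in> A" using x dist_triangle[of z y x] by (auto simp: A_def dist_norm)
      then show ?thesis by simp
    next
      case False
      then show ?thesis using \<rho>(3)[of "x - y"] by simp
    qed
    then show "c x = 1" unfolding c using i\<rho>(2) by (simp only:)
  qed
qed

lemma AE_zero_of_sqn:
  assumes "u \<in> L2 lborel" "A \<in> sets borel" "(LINT x|lborel. indicator A x * (norm (u x))\<^sup>2) = 0"
  shows "AE x in lborel. x \<in> A \<longrightarrow> u x = 0"
proof -
  have "integrable lborel (\<lambda>x. indicator A x *\<^sub>R (norm (u x))\<^sup>2)"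
    using L2_D[OF assms(1)] assms(2) by (intro integrable_mult_indicator) auto
  then have "AE x in lborel. indicator A x * (norm (u x))\<^sup>2 = 0"
    using assms(3) by (subst (asm) integral_nonneg_eq_0_iff_AE) auto
  then show ?thesis by eventually_elim (auto simp: indicator_def)
qed

lemma restrict_sqn_le:
  assumes "u \<in> L2 lborel" "A \<in> sets borel"
  shows "(LINT x|lborel. indicator A x * (norm (u x))\<^sup>2) \<le> sqn u"
    "integrable lborel (\<lambda>x. indicator A x * (norm (u x))\<^sup>2)"
proof -
  have "integrable lborel (\<lambda>x. indicator A x *\<^sub>R (norm (u x))\<^sup>2)"
    using L2_D[OF assms(1)] assms(2) by (intro integrable_mult_indicator) auto
  then show i: "integrable lborel (\<lambda>x. indicator A x * (norm (u x))\<^sup>2)" by simp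
  show "(LINT x|lborel. indicator A x * (norm (u x))\<^sup>2) \<le> sqn u"
    by (rule integral_mono[OF i L2_D(2)[OF assms(1)]]) (auto simp: indicator_def)
qed

text \<open>A mollifying kernel reflected and centred at a point well inside \<open>U\<close> is
  itself a test function, so the mollifications of \<open>u\<close> vanish there, while they
  converge to \<open>u\<close> in square mean.\<close>

lemma fundamental_lemma:
  assumes u: "u \<in> L2 lborel" "integrable lborel u" and U: "open U" "U \<noteq> UNIV"
    and z: "\<And>\<phi>. \<phi> \<in> test_functions U \<Longrightarrow> (LINT x|lborel. \<phi> x *\<^sub>R u x) = 0"
  shows "AE x in lborel. x \<in> U \<longrightarrow> u x = 0"
proof -
  \<comment> \<open>The points whose distance to the complement exceeds \<open>1 / (m + 1)\<close>.
    The distance to the empty set is 0 by convention, so \<open>U \<noteq> UNIV\<close> is what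
    makes these sets exhaust \<open>U\<close>.\<close>
  define K where "K m = {x. infdist x (- U) > 1 / (real m + 1)}" for m :: nat
  have Km: "K m \<in> sets borel" for m
    unfolding K_def by (intro borel_open open_Collect_less continuous_intros)
  have sub: "cball x (1 / (real m + 1)) \<subseteq> U" if "x \<in> K m" for x m
  proof
    fix y assume "y \<in> cball x (1 / (real m + 1))"
    then show "y \<in> U"
      using that infdist_le[of y "- U" x] by (auto simp: K_def)
  qed
  have "AE x in lborel. x \<in> K m \<longrightarrow> u x = 0" for m
  proof (rule AE_zero_of_sqn[OF u(1) Km])
    have "(\<lambda>n. sqn (\<lambda>x. conv (mollifier n) u x - u x)) \<longlonglongrightarrow> 0" by (rule mollify_L2(1)[OF u])
    moreover have "\<forall>\<^sub>F n in sequentially. (LINT x|lborel. indicator (K m) x * (norm (u x))\<^sup>2)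
        \<le> sqn (\<lambda>x. conv (mollifier n) u x - u x)"
      using eventually_ge_at_top[of m]
    proof eventually_elim
      case (elim n)
      have "conv (mollifier n) u x = 0" if "x \<in> K m" for x
      proof -
        have "1 / (real n + 1) \<le> 1 / (real m + 1)" using elim by (intro divide_left_mono) auto
        then have "cball x (1 / (real n + 1)) \<subseteq> U"
          using sub[OF that] subset_cball[of "1 / (real n + 1)" "1 / (real m + 1)" x] by (rule_tac order_trans)
        then show ?thesis
          using z[OF reflected_test[OF mollifier(1,3)]] by (simp add: conv_def)
      qed
      then have "(\<lambda>x. indicator (K m) x * (norm (u x))\<^sup>2) = (\<lambda>x. indicator (K m) x * (norm (conv (mollifier n) u x - u x))\<^sup>2)"
        by (auto simp: indicator_def fun_eq_iff)
      then show ?case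
        using restrict_sqn_le(1)[OF mollify_L2(2)[OF u, of n] Km[of m]] by simp
    qed
    ultimately have "(LINT x|lborel. indicator (K m) x * (norm (u x))\<^sup>2) \<le> 0"
      by (rule tendsto_lowerbound) simp
    moreover have "(LINT x|lborel. indicator (K m) x * (norm (u x))\<^sup>2) \<ge> 0"
      by (intro integral_nonneg_AE) auto
    ultimately show "(LINT x|lborel. indicator (K m) x * (norm (u x))\<^sup>2) = 0" by simp
  qed
  then have "AE x in lborel. \<forall>m. x \<in> K m \<longrightarrow> u x = 0"
    by (intro AE_all_countable[THEN iffD2] allI)
  then show ?thesis
  proof eventually_elim
    case (elim x)
    show ?case
    proof
      assume "x \<in> U"
      moreover have "closed (- U)" "- U \<noteq> {}" using U by (auto simp: closed_def)
      ultimately have "infdist x (- U) > 0"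
        using in_closed_iff_infdist_zero[of "- U" x] infdist_nonneg[of x "- U"] by (auto simp: less_le)
      then obtain m :: nat where "1 / (real m + 1) < infdist x (- U)"
        using reals_Archimedean by (auto simp: inverse_eq_divide add.commute)
      then show "u x = 0" using elim by (auto simp: K_def)
    qed
  qed
qed

lemma bounded_ne_UNIV: "bounded (U :: (real^2) set) \<Longrightarrow> U \<noteq> UNIV"
  by (auto simp: not_bounded_UNIV)

lemma weak_pd_unique:
  assumes "open U" "U \<noteq> UNIV" "u \<in> borel_measurable borel"
    "g \<in> L2 lborel" "integrable lborel g" "h \<in> L2 lborel" "integrable lborel h"
    "has_weak_pd U i u g" "has_weak_pd U i u h"
  shows "AE x in lborel. x \<in> U \<longrightarrow> g x = h x"
proof -
  have [measurable]: "g \<in> borel_measurable borel" "h \<in> borel_measurable borel"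
    using L2_D(1)[OF assms(4)] L2_D(1)[OF assms(6)] by auto
  have "AE x in lborel. x \<in> U \<longrightarrow> g x - h x = 0"
  proof (rule fundamental_lemma)
    fix \<phi> assume t: "\<phi> \<in> test_functions U"
    have "(LINT x|lborel. \<phi> x *\<^sub>R (g x - h x)) = (LINT x|lborel. \<phi> x *\<^sub>R g x) - (LINT x|lborel. \<phi> x *\<^sub>R h x)"
      using smooth_mult_integrable[OF assms(4) test_smooth[OF t] test_bsupp[OF t]]
        smooth_mult_integrable[OF assms(6) test_smooth[OF t] test_bsupp[OF t]]
      by (simp add: scaleR_diff_right)
    also have "\<dots> = 0"
      using assms t by (simp add: weak_pd_iff)
    finally show "(LINT x|lborel. \<phi> x *\<^sub>R (g x - h x)) = 0" .
  qed (use assms L2_diff in auto)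
  then show ?thesis by simp
qed

lemma weak_laplacian_unique:
  assumes "open U" "U \<noteq> UNIV" "u \<in> borel_measurable borel"
    "g \<in> L2 lborel" "integrable lborel g" "h \<in> L2 lborel" "integrable lborel h"
    "has_weak_laplacian U u g" "has_weak_laplacian U u h"
  shows "AE x in lborel. x \<in> U \<longrightarrow> g x = h x"
proof -
  have [measurable]: "g \<in> borel_measurable borel" "h \<in> borel_measurable borel"
    using L2_D(1)[OF assms(4)] L2_D(1)[OF assms(6)] by auto
  have "AE x in lborel. x \<in> U \<longrightarrow> g x - h x = 0"
  proof (rule fundamental_lemma)
    fix \<phi> assume t: "\<phi> \<in> test_functions U"
    have "(LINT x|lborel. \<phi> x *\<^sub>R (g x - h x)) = (LINT x|lborel. \<phi> x *\<^sub>R g x) - (LINT x|lborel. \<phi> x *\<^sub>R h x)"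
      using smooth_mult_integrable[OF assms(4) test_smooth[OF t] test_bsupp[OF t]]
        smooth_mult_integrable[OF assms(6) test_smooth[OF t] test_bsupp[OF t]]
      by (simp add: scaleR_diff_right)
    also have "\<dots> = 0"
      using assms t by (simp add: weak_laplacian_iff)
    finally show "(LINT x|lborel. \<phi> x *\<^sub>R (g x - h x)) = 0" .
  qed (use assms L2_diff in auto)
  then show ?thesis by simp
qed

section \<open>Carleman estimate and unique continuation\<close>

text \<open>With \<open>a = \<nabla>\<psi>\<close>, the left-hand operator is minus the formal
  adjoint of the one on the right, so the difference of the squares integrates to a commutator. The
  mixed derivative \<open>g12\<close> cancels; it is inserted to make the two brackets derivatives
  of \<open>g \<bullet> (\<i> * g2)\<close> and \<open>g \<bullet> (\<i> * g1)\<close>.\<close>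

lemma carleman_identity:
  fixes g g1 g2 g12 :: complex and a1 a2 :: real
  shows "(norm (g1 + \<i> * g2 - (of_real a1 + \<i> * of_real a2) / 2 * g))\<^sup>2
    = (norm (g1 - \<i> * g2 + (of_real a1 - \<i> * of_real a2) / 2 * g))\<^sup>2
      + 2 * ((g1 \<bullet> (\<i> * g2) + g \<bullet> (\<i> * g12)) - (g2 \<bullet> (\<i> * g1) + g \<bullet> (\<i> * g12)))
      - (a1 * (g1 \<bullet> g + g \<bullet> g1) + a2 * (g2 \<bullet> g + g \<bullet> g2))"
  unfolding cmod_power2 inner_complex_def
  by (simp add: power2_eq_square) (simp add: field_simps)

lemma bsupp_inner: "bsupp f \<Longrightarrow> bsupp (\<lambda>x. f x \<bullet> (h x :: 'b::real_inner))"
  by (erule bounded_subset) auto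

lemma bsupp_mult: "bsupp f \<Longrightarrow> bsupp (\<lambda>x. h x * (f x :: 'b::real_normed_algebra))"
  by (erule bounded_subset) auto

lemma bsupp_diff: "bsupp F \<Longrightarrow> bsupp G \<Longrightarrow> bsupp (\<lambda>x. F x - G x :: 'b::group_add)"
  by (rule bounded_subset[of "{x. F x \<noteq> 0} \<union> {x. G x \<noteq> 0}"]) auto

text \<open>In the identity the terms \<open>F1\<close>, \<open>F2\<close> and \<open>H\<close> are
  differentiated and integrate to 0. What remains of the commutator is multiplication by
  \<open>lap \<psi>\<close>, and the square of the adjoint operator is dropped. The estimate is
  therefore strong where the weight is strictly subharmonic.\<close>

lemma carleman_conjugated:
  fixes g :: "real^2 \<Rightarrow> complex"
  assumes g: "smooth g" "bsupp g" and \<psi>: "smooth \<psi>"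
  shows "(LINT x|lborel. lap \<psi> x * (norm (g x))\<^sup>2)
    \<le> (LINT x|lborel. (norm (pd 1 g x + \<i> * pd 2 g x - (of_real (pd 1 \<psi> x) + \<i> * of_real (pd 2 \<psi> x)) / 2 * g x))\<^sup>2)"
proof -
  define F1 where "F1 x = g x \<bullet> (\<i> * pd 2 g x)" for x
  define F2 where "F2 x = g x \<bullet> (\<i> * pd 1 g x)" for x
  define H where "H i x = pd i \<psi> x * (g x \<bullet> g x)" for i x
  let ?L1 = "\<lambda>x. pd 1 g x + \<i> * pd 2 g x - (of_real (pd 1 \<psi> x) + \<i> * of_real (pd 2 \<psi> x)) / 2 * g x"
  let ?L2 = "\<lambda>x. pd 1 g x - \<i> * pd 2 g x + (of_real (pd 1 \<psi> x) - \<i> * of_real (pd 2 \<psi> x)) / 2 * g x"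
  have sig: "smooth (\<lambda>x. \<i> * pd i g x)" for i by (intro smooth_mult smooth_const smooth_pd g)
  have sF: "smooth F1" "smooth F2" "bsupp F1" "bsupp F2" unfolding F1_def F2_def
    by (intro smooth_inner sig g bsupp_inner)+
  have sgg: "smooth (\<lambda>x. g x \<bullet> g x)" by (intro smooth_inner g)
  have sH: "smooth (H i)" "bsupp (H i)" for i
    unfolding H_def by (intro smooth_mult smooth_pd sgg \<psi> bsupp_mult bsupp_inner g)+
  have s\<psi>: "smooth (\<lambda>x. complex_of_real (pd i \<psi> x))" for i by (intro smooth_of_real smooth_pd \<psi>)
  have sL: "smooth ?L1" "smooth ?L2"
  proof -
    have "smooth (\<lambda>x. pd 1 g x + \<i> * pd 2 g x - ((of_real (pd 1 \<psi> x) + \<i> * of_real (pd 2 \<psi> x)) * (1 / 2)) * g x)"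
      by (intro smooth_add smooth_diff smooth_mult smooth_const s\<psi> smooth_pd g)
    then show "smooth ?L1" by simp
    have "smooth (\<lambda>x. pd 1 g x - \<i> * pd 2 g x + ((of_real (pd 1 \<psi> x) - \<i> * of_real (pd 2 \<psi> x)) * (1 / 2)) * g x)"
      by (intro smooth_add smooth_diff smooth_mult smooth_const s\<psi> smooth_pd g)
    then show "smooth ?L2" by simp
  qed
  have bL: "bsupp ?L1" "bsupp ?L2"
    by (intro bsupp_add bsupp_diff bsupp_mult bsupp_pd g)+
  have pF1: "pd 1 F1 x = pd 1 g x \<bullet> (\<i> * pd 2 g x) + g x \<bullet> (\<i> * pd 1 (pd 2 g) x)" for x
    unfolding F1_def by (subst pd_inner[OF smoothD[OF g(1)] smoothD[OF sig]])
      (simp add: pd_bounded_linear[OF bounded_linear_mult_right smoothD[OF smooth_pd[OF g(1)]]])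
  have pF2: "pd 2 F2 x = pd 2 g x \<bullet> (\<i> * pd 1 g x) + g x \<bullet> (\<i> * pd 1 (pd 2 g) x)" for x
    unfolding F2_def by (subst pd_inner[OF smoothD[OF g(1)] smoothD[OF sig]])
      (simp add: pd_bounded_linear[OF bounded_linear_mult_right smoothD[OF smooth_pd[OF g(1)]]] pd_commute[OF g(1), of 2 1])
  have pH: "pd i (H i) x = pd i (pd i \<psi>) x * (g x \<bullet> g x) + pd i \<psi> x * (pd i g x \<bullet> g x + g x \<bullet> pd i g x)" for i x
    unfolding H_def by (subst pd_mult[OF smoothD[OF smooth_pd[OF \<psi>]] smoothD[OF sgg]])
      (simp add: pd_inner[OF smoothD[OF g(1)] smoothD[OF g(1)]])
  have id: "(norm (?L1 x))\<^sup>2 = (norm (?L2 x))\<^sup>2 + 2 * (pd 1 F1 x - pd 2 F2 x) - (pd 1 (H 1) x + pd 2 (H 2) x) + lap \<psi> x * (norm (g x))\<^sup>2" for x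
    unfolding pF1 pF2 pH lap_def sum_2 power2_norm_eq_inner[of "g x"]
    by (subst carleman_identity[of _ _ _ _ _ "pd 1 (pd 2 g) x"]) (simp add: algebra_simps)
  have i: "integrable lborel (pd i f)" if "smooth f" "bsupp f" for f :: "real^2 \<Rightarrow> real" and i
    by (intro integrable_smooth smooth_pd bsupp_pd that)
  have i\<psi>: "integrable lborel (\<lambda>x. lap \<psi> x * (norm (g x))\<^sup>2)"
    unfolding power2_norm_eq_inner by (intro integrable_smooth smooth_mult smooth_lap \<psi> sgg bsupp_mult bsupp_inner g)
  note iL = L2_D(2)[OF L2_smooth[OF sL(2) bL(2)]]
  have "(LINT x|lborel. (norm (?L1 x))\<^sup>2) = (LINT x|lborel. (norm (?L2 x))\<^sup>2)
      + 2 * ((LINT x|lborel. pd 1 F1 x) - (LINT x|lborel. pd 2 F2 x))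
      - ((LINT x|lborel. pd 1 (H 1) x) + (LINT x|lborel. pd 2 (H 2) x)) + (LINT x|lborel. lap \<psi> x * (norm (g x))\<^sup>2)"
    unfolding id using iL i\<psi> i sF sH by simp
  also have "\<dots> = (LINT x|lborel. (norm (?L2 x))\<^sup>2) + (LINT x|lborel. lap \<psi> x * (norm (g x))\<^sup>2)"
    using integral_pd_zero[OF sF(1,3), of 1] integral_pd_zero[OF sF(2,4), of 2]
      integral_pd_zero[OF sH, of 1 1] integral_pd_zero[OF sH, of 2 2] by simp
  finally show ?thesis by simp
qed

text \<open>The substitution \<open>g = exp (\<psi> / 2) f\<close> conjugates the Cauchy-Riemann
  operator into the operator of \<open>carleman_conjugated\<close> and turns the plain integrals
  into weighted ones.\<close>

lemma carleman_cr:
  fixes f :: "real^2 \<Rightarrow> complex"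
  assumes f: "smooth f" "bsupp f" and \<psi>: "smooth \<psi>"
  shows "(LINT x|lborel. lap \<psi> x * ((norm (f x))\<^sup>2 * exp (\<psi> x)))
    \<le> (LINT x|lborel. (norm (pd 1 f x + \<i> * pd 2 f x))\<^sup>2 * exp (\<psi> x))"
proof -
  define q where "q x = exp (\<psi> x / 2)" for x
  define g where "g x = q x *\<^sub>R f x" for x
  have s2: "smooth (\<lambda>x. \<psi> x / 2)" using smooth_mult[OF \<psi> smooth_const[of "1 / 2"]] by simp
  have sq: "smooth q" unfolding q_def by (rule smooth_exp[OF s2])
  have pq: "pd i q x = q x * (pd i \<psi> x / 2)" for i x
    unfolding q_def using pd_exp[OF s2] pd_bounded_linear[OF bounded_linear_divide smoothD[OF \<psi>], of i 2 x] by simp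
  have sg: "smooth g" "bsupp g" unfolding g_def by (intro smooth_scaleR sq f bsupp_scaleR')+
  have pg: "pd i g x = q x *\<^sub>R (pd i f x + (pd i \<psi> x / 2) *\<^sub>R f x)" for i x
    unfolding g_def by (subst pd_scaleR[OF smoothD[OF sq] smoothD[OF f(1)]]) (simp add: pq scaleR_add_right)
  have q2: "(q x)\<^sup>2 = exp (\<psi> x)" "q x > 0" for x
    by (simp_all add: q_def power2_eq_square exp_add[symmetric])
  have L: "pd 1 g x + \<i> * pd 2 g x - (of_real (pd 1 \<psi> x) + \<i> * of_real (pd 2 \<psi> x)) / 2 * g x
      = q x *\<^sub>R (pd 1 f x + \<i> * pd 2 f x)" for x
    unfolding pg g_def scaleR_conv_of_real by (simp add: field_simps)
  show ?thesis
    using carleman_conjugated[OF sg \<psi>] unfolding L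
    by (simp add: g_def power_mult_distrib q2 mult.commute)
qed

text \<open>Complex conjugation exchanges the two Cauchy-Riemann operators and preserves
  moduli.\<close>

lemma carleman_cr_cnj:
  fixes f :: "real^2 \<Rightarrow> complex"
  assumes f: "smooth f" "bsupp f" and \<psi>: "smooth \<psi>"
  shows "(LINT x|lborel. lap \<psi> x * ((norm (f x))\<^sup>2 * exp (\<psi> x)))
    \<le> (LINT x|lborel. (norm (pd 1 f x - \<i> * pd 2 f x))\<^sup>2 * exp (\<psi> x))"
proof -
  let ?f = "\<lambda>x. cnj (f x)"
  have s: "smooth ?f" "bsupp ?f"
    using smooth_bounded_linear[OF bounded_linear_cnj f(1)] f(2) by auto
  have p: "pd i ?f x = cnj (pd i f x)" for i x
    by (rule pd_bounded_linear[OF bounded_linear_cnj smoothD[OF f(1)]])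
  have "pd 1 ?f x + \<i> * pd 2 ?f x = cnj (pd 1 f x - \<i> * pd 2 f x)" for x
    by (simp add: p)
  then have "norm (pd 1 ?f x + \<i> * pd 2 ?f x) = norm (pd 1 f x - \<i> * pd 2 f x)" for x
    by (simp only: complex_mod_cnj)
  with carleman_cr[OF s \<psi>] show ?thesis by (simp only: complex_mod_cnj)
qed

section \<open>Weighted estimates for the Laplacian\<close>

lemma weighted_integrable:
  assumes "u \<in> L2 lborel" "W \<in> borel_measurable borel" "\<And>x. 0 \<le> W x" "\<And>x. W x \<le> (B :: real)"
  shows "integrable lborel (\<lambda>x. (norm (u x))\<^sup>2 * W x)"
proof -
  have "integrable lborel (\<lambda>x. B * (norm (u x))\<^sup>2)" using L2_D(2)[OF assms(1)] by simp
  moreover have "AE x in lborel. norm ((norm (u x))\<^sup>2 * W x) \<le> norm (B * (norm (u x))\<^sup>2)"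
  proof (rule AE_I2)
    fix x
    have "B \<ge> 0" using assms(3,4)[of x] by linarith
    then show "norm ((norm (u x))\<^sup>2 * W x) \<le> norm (B * (norm (u x))\<^sup>2)"
      using mult_right_mono[OF assms(4)[of x], of "(norm (u x))\<^sup>2"] assms(3)[of x]
      by (simp add: abs_mult mult.commute)
  qed
  moreover have "(\<lambda>x. (norm (u x))\<^sup>2 * W x) \<in> borel_measurable lborel"
    using L2_D(1)[OF assms(1)] assms(2) by simp
  ultimately show ?thesis using Bochner_Integration.integrable_bound by blast
qed

lemma smooth_weighted_integrable:
  fixes f :: "real^2 \<Rightarrow> complex"
  assumes "smooth f" "bsupp f" "smooth W"
  shows "integrable lborel (\<lambda>x. (norm (f x))\<^sup>2 * W x)"
  unfolding power2_norm_eq_inner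
proof (rule integrable_smooth)
  show "smooth (\<lambda>x. f x \<bullet> f x * W x)" by (intro smooth_mult smooth_inner assms)
  show "bsupp (\<lambda>x. f x \<bullet> f x * W x)" by (rule bounded_subset[OF assms(2)]) auto
qed

lemma carleman_lower:
  fixes f :: "real^2 \<Rightarrow> complex"
  assumes f: "smooth f" "bsupp f" and \<psi>: "smooth \<psi>" and c: "\<And>x. x \<in> K \<Longrightarrow> c \<le> lap \<psi> x"
    and K: "\<And>x. x \<notin> K \<Longrightarrow> f x = 0"
  shows "c * (LINT x|lborel. (norm (f x))\<^sup>2 * exp (\<psi> x)) \<le> (LINT x|lborel. lap \<psi> x * ((norm (f x))\<^sup>2 * exp (\<psi> x)))"
proof -
  have s1: "integrable lborel (\<lambda>x. (norm (f x))\<^sup>2 * exp (\<psi> x))"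
    by (rule smooth_weighted_integrable[OF f smooth_exp[OF \<psi>]])
  have "integrable lborel (\<lambda>x. (norm (f x))\<^sup>2 * (lap \<psi> x * exp (\<psi> x)))"
    by (rule smooth_weighted_integrable[OF f smooth_mult[OF smooth_lap[OF \<psi>] smooth_exp[OF \<psi>]]])
  then have s2: "integrable lborel (\<lambda>x. lap \<psi> x * ((norm (f x))\<^sup>2 * exp (\<psi> x)))"
    by (simp add: mult_ac)
  have "(LINT x|lborel. c * ((norm (f x))\<^sup>2 * exp (\<psi> x))) \<le> (LINT x|lborel. lap \<psi> x * ((norm (f x))\<^sup>2 * exp (\<psi> x)))"
  proof (rule integral_mono[OF _ s2])
    show "integrable lborel (\<lambda>x. c * ((norm (f x))\<^sup>2 * exp (\<psi> x)))" using s1 by simp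
    fix x show "c * ((norm (f x))\<^sup>2 * exp (\<psi> x)) \<le> lap \<psi> x * ((norm (f x))\<^sup>2 * exp (\<psi> x))"
      using c[of x] K[of x] by (cases "x \<in> K") (auto intro: mult_right_mono)
  qed
  then show ?thesis by simp
qed

text \<open>Since \<open>\<Delta> = (\<partial>\<^sub>1 - \<i>\<partial>\<^sub>2)(\<partial>\<^sub>1 + \<i>\<partial>\<^sub>2)\<close>, the first-order estimates apply twice.\<close>

lemma carleman_smooth:
  fixes f :: "real^2 \<Rightarrow> complex"
  assumes f: "smooth f" "bsupp f" and \<psi>: "smooth \<psi>" and c: "\<And>x. x \<in> K \<Longrightarrow> c \<le> lap \<psi> x" "0 \<le> c"
    and K: "closed K" "\<And>x. x \<notin> K \<Longrightarrow> f x = 0"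
  shows "c\<^sup>2 * (LINT x|lborel. (norm (f x))\<^sup>2 * exp (\<psi> x)) \<le> (LINT x|lborel. (norm (lap f x))\<^sup>2 * exp (\<psi> x))"
proof -
  define h where "h x = pd 1 f x + \<i> * pd 2 f x" for x
  have sh: "smooth h" "bsupp h"
    unfolding h_def by (intro smooth_add smooth_mult smooth_const smooth_pd f bsupp_add bsupp_mult bsupp_pd)+
  have hK: "h x = 0" if "x \<notin> K" for x
    using pd_zero_outside[OF K(2,1) that] by (simp add: h_def)
  have lap: "pd 1 h x - \<i> * pd 2 h x = lap f x" for x
  proof -
    have "pd i h x = pd i (pd 1 f) x + \<i> * pd i (pd 2 f) x" for i
      unfolding h_def
      by (subst pd_add) (auto intro!: smoothD smooth_mult smooth_pd f
          simp: pd_bounded_linear[OF bounded_linear_mult_right smoothD[OF smooth_pd[OF f(1)]]])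
    then show ?thesis
      by (simp add: lap_def sum_2 pd_commute[OF f(1), of 2 1] algebra_simps)
  qed
  have "c * (c * (LINT x|lborel. (norm (f x))\<^sup>2 * exp (\<psi> x))) \<le> c * (LINT x|lborel. (norm (h x))\<^sup>2 * exp (\<psi> x))"
    using order_trans[OF carleman_lower[OF f \<psi> c(1) K(2)] carleman_cr[OF f \<psi>]] c(2)
    by (intro mult_left_mono) (auto simp: h_def)
  also have "\<dots> \<le> (LINT x|lborel. (norm (pd 1 h x - \<i> * pd 2 h x))\<^sup>2 * exp (\<psi> x))"
    by (rule order_trans[OF carleman_lower[OF sh \<psi> c(1) hK] carleman_cr_cnj[OF sh \<psi>]])
  finally show ?thesis by (simp add: lap power2_eq_square mult.assoc)
qed

lemma weighted_triangle:
  assumes "u \<in> L2 lborel" "w \<in> L2 lborel" "W \<in> borel_measurable borel" "\<And>x. 0 \<le> W x" "\<And>x. W x \<le> (B :: real)"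
  shows "(LINT x|lborel. (norm (u x))\<^sup>2 * W x) \<le> 2 * (LINT x|lborel. (norm (w x))\<^sup>2 * W x) + 2 * B * sqn (\<lambda>x. w x - u x)"
proof -
  note i = weighted_integrable[OF assms(1,3,4,5)] weighted_integrable[OF assms(2,3,4,5)]
    L2_D(2)[OF L2_diff[OF assms(2,1)]]
  have "(LINT x|lborel. (norm (u x))\<^sup>2 * W x) \<le> (LINT x|lborel. 2 * ((norm (w x))\<^sup>2 * W x) + 2 * B * (norm (w x - u x))\<^sup>2)"
  proof (rule integral_mono)
    fix x
    have "(norm (u x))\<^sup>2 * W x \<le> (2 * (norm (w x))\<^sup>2 + 2 * (norm (w x - u x))\<^sup>2) * W x"
      using norm_diff_squared[of "w x" "w x - u x"] assms(4)[of x] by (intro mult_right_mono) simp_all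
    also have "\<dots> = 2 * ((norm (w x))\<^sup>2 * W x) + 2 * (W x * (norm (w x - u x))\<^sup>2)" by (simp add: algebra_simps)
    also have "\<dots> \<le> 2 * ((norm (w x))\<^sup>2 * W x) + 2 * (B * (norm (w x - u x))\<^sup>2)"
      using mult_right_mono[OF assms(5)[of x], of "(norm (w x - u x))\<^sup>2"] by simp
    finally show "(norm (u x))\<^sup>2 * W x \<le> 2 * ((norm (w x))\<^sup>2 * W x) + 2 * B * (norm (w x - u x))\<^sup>2" by simp
  qed (use i in auto)
  also have "\<dots> = 2 * (LINT x|lborel. (norm (w x))\<^sup>2 * W x) + 2 * B * sqn (\<lambda>x. w x - u x)"
    using i by simp
  finally show ?thesis .
qed

text \<open>Mollifying at a scale below \<open>min (r / 2) 1\<close> enlarges the annulus from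
  \<open>r\<close> to \<open>R\<close> into the one from \<open>r / 2\<close> to
  \<open>R + 1\<close>, where the lower bound on \<open>lap \<psi>\<close> is required. Passing from
  \<open>f\<close> to its mollification and from the mollified source back to \<open>F\<close> costs
  a factor 2 each, hence the 4; the errors tend to 0 because the weight is bounded by
  \<open>exp T\<close>.\<close>

lemma carleman_weak:
  assumes f: "f \<in> L2 lborel" "bsupp f" and F: "F \<in> L2 lborel" "bsupp F"
    and w: "has_weak_laplacian UNIV f F"
    and \<psi>: "smooth \<psi>" "\<And>x. \<psi> x \<le> T"
    and c: "\<And>x. r / 2 \<le> dist z x \<Longrightarrow> dist z x \<le> R + 1 \<Longrightarrow> c \<le> lap \<psi> x" "0 \<le> c"
    and r: "r > 0" and supp: "\<And>x. dist z x < r \<or> dist z x > R \<Longrightarrow> f x = 0"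
  shows "c\<^sup>2 * (LINT x|lborel. (norm (f x))\<^sup>2 * exp (\<psi> x)) \<le> 4 * (LINT x|lborel. (norm (F x))\<^sup>2 * exp (\<psi> x))"
proof -
  let ?W = "\<lambda>x. exp (\<psi> x)"
  let ?f = "\<lambda>n. conv (mollifier n) f" and ?F = "\<lambda>n. conv (mollifier n) F"
  have W: "?W \<in> borel_measurable borel" "\<And>x. 0 \<le> ?W x" "\<And>x. ?W x \<le> exp T"
    using smooth_borel[OF smooth_exp[OF \<psi>(1)]] \<psi>(2) by auto
  have fi: "integrable lborel f" "integrable lborel F"
    by (intro L2_integrable_bounded_set f F)+
  have m: "f \<in> borel_measurable borel" "F \<in> borel_measurable borel"
    using L2_D(1)[OF f(1)] L2_D(1)[OF F(1)] by auto
  have main: "c\<^sup>2 * (LINT x|lborel. (norm (f x))\<^sup>2 * ?W x) \<le> 4 * (LINT x|lborel. (norm (F x))\<^sup>2 * ?W x)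
     + (4 * exp T * sqn (\<lambda>x. ?F n x - F x) + 2 * c\<^sup>2 * exp T * sqn (\<lambda>x. ?f n x - f x))"
    if n: "1 / (real n + 1) \<le> min (r / 2) 1" for n
  proof -
    define K where "K = cball z (R + 1) - ball z (r / 2)"
    have cK: "closed K" unfolding K_def by (intro closed_Diff) auto
    have fK: "?f n x = 0" if "x \<notin> K" for x
    proof (rule conv_zero_outside[OF mollifier(3)])
      fix y assume "dist x y < 1 / (real n + 1)"
      moreover from n have "1 / (real n + 1) \<le> r / 2 \<and> 1 / (real n + 1) \<le> 1" by (simp only: min.bounded_iff)
      ultimately have d: "dist x y < r / 2" "dist x y < 1" by linarith+
      from \<open>x \<notin> K\<close> have "dist z x > R + 1 \<or> dist z x < r / 2" by (auto simp: K_def)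
      then have "dist z y < r \<or> dist z y > R"
        using d dist_triangle[of z y x] dist_triangle[of z x y] by (auto simp: dist_commute)
      then show "f y = 0" by (rule supp)
    qed
    have bK: "bounded K" unfolding K_def by (rule bounded_subset[OF bounded_cball]) auto
    have bf: "bsupp (?f n)" by (rule bounded_subset[OF bK]) (use fK in auto)
    have sf: "smooth (?f n)" by (rule smooth_conv[OF mollifier(1,4) fi(1)])
    have lp: "lap (?f n) x = ?F n x" for x
      by (rule lap_conv_weak[OF open_UNIV m w mollifier(1,4,3) subset_UNIV fi(1)])
    have "c\<^sup>2 * (LINT x|lborel. (norm (f x))\<^sup>2 * ?W x)
      \<le> c\<^sup>2 * (2 * (LINT x|lborel. (norm (?f n x))\<^sup>2 * ?W x) + 2 * exp T * sqn (\<lambda>x. ?f n x - f x))"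
      by (intro mult_left_mono weighted_triangle[OF f(1) mollify_L2(3)[OF f(1) fi(1)] W]) auto
    also have "\<dots> = 2 * (c\<^sup>2 * (LINT x|lborel. (norm (?f n x))\<^sup>2 * ?W x)) + 2 * c\<^sup>2 * exp T * sqn (\<lambda>x. ?f n x - f x)"
      by (simp add: algebra_simps)
    also have "c\<^sup>2 * (LINT x|lborel. (norm (?f n x))\<^sup>2 * ?W x) \<le> (LINT x|lborel. (norm (lap (?f n) x))\<^sup>2 * ?W x)"
      by (rule carleman_smooth[OF sf bf \<psi>(1) _ c(2) cK fK]) (auto simp: K_def intro!: c(1))
    also have "\<dots> = (LINT x|lborel. (norm (?F n x))\<^sup>2 * ?W x)" by (simp add: lp)
    also have "\<dots> \<le> 2 * (LINT x|lborel. (norm (F x))\<^sup>2 * ?W x) + 2 * exp T * sqn (\<lambda>x. F x - ?F n x)"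
      by (rule weighted_triangle[OF mollify_L2(3)[OF F(1) fi(2)] F(1) W])
    also have "sqn (\<lambda>x. F x - ?F n x) = sqn (\<lambda>x. ?F n x - F x)" by (simp add: norm_minus_commute)
    finally show ?thesis by (simp add: algebra_simps)
  qed
  have "(\<lambda>n. 4 * (LINT x|lborel. (norm (F x))\<^sup>2 * ?W x)
     + (4 * exp T * sqn (\<lambda>x. ?F n x - F x) + 2 * c\<^sup>2 * exp T * sqn (\<lambda>x. ?f n x - f x)))
     \<longlonglongrightarrow> 4 * (LINT x|lborel. (norm (F x))\<^sup>2 * ?W x) + (4 * exp T * 0 + 2 * c\<^sup>2 * exp T * 0)"
    by (intro tendsto_intros mollify_L2(1) f F fi)
  moreover have "\<forall>\<^sub>F n in sequentially. c\<^sup>2 * (LINT x|lborel. (norm (f x))\<^sup>2 * ?W x) \<le> 4 * (LINT x|lborel. (norm (F x))\<^sup>2 * ?W x)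
     + (4 * exp T * sqn (\<lambda>x. ?F n x - F x) + 2 * c\<^sup>2 * exp T * sqn (\<lambda>x. ?f n x - f x))"
  proof -
    obtain N :: nat where N: "1 / (real N + 1) < min (r / 2) 1"
      using reals_Archimedean[of "min (r / 2) 1"] r by (auto simp: inverse_eq_divide add.commute)
    show ?thesis
      using eventually_ge_at_top[of N]
    proof eventually_elim
      case (elim n)
      then have "1 / (real n + 1) \<le> 1 / (real N + 1)" by (intro divide_left_mono) auto
      with N show ?case by (intro main) linarith
    qed
  qed
  ultimately have "c\<^sup>2 * (LINT x|lborel. (norm (f x))\<^sup>2 * ?W x) \<le> 4 * (LINT x|lborel. (norm (F x))\<^sup>2 * ?W x) + (4 * exp T * 0 + 2 * c\<^sup>2 * exp T * 0)"
    by (rule tendsto_lowerbound) simp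
  then show ?thesis by simp
qed

section \<open>From the Carleman estimate to unique continuation\<close>

lemma weak_laplacian_cong_AE:
  assumes "open U" "u \<in> borel_measurable borel" "u' \<in> borel_measurable borel" "F \<in> borel_measurable borel"
    "AE x in lborel. u x = u' x" "has_weak_laplacian U u F"
  shows "has_weak_laplacian U u' F"
proof -
  have "(LINT x|lborel. lap \<phi> x *\<^sub>R u x) = (LINT x|lborel. lap \<phi> x *\<^sub>R u' x)" if t: "\<phi> \<in> test_functions U" for \<phi>
  proof (rule integral_cong_AE)
    have [measurable]: "lap \<phi> \<in> borel_measurable borel" by (rule smooth_borel[OF smooth_lap[OF test_smooth[OF t]]])
    show "(\<lambda>x. lap \<phi> x *\<^sub>R u x) \<in> borel_measurable lborel" "(\<lambda>x. lap \<phi> x *\<^sub>R u' x) \<in> borel_measurable lborel"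
      using assms(2,3) by simp_all
    show "AE x in lborel. lap \<phi> x *\<^sub>R u x = lap \<phi> x *\<^sub>R u' x"
      using assms(5) by eventually_elim simp
  qed
  then show ?thesis using assms by (simp add: weak_laplacian_iff)
qed

text \<open>The Leibniz rule for a test function times an object known only weakly. Testing the weak
  Laplacian with \<open>\<phi> * c\<close> leaves cross terms containing derivatives of both
  factors; testing the weak gradient with \<open>\<phi> * pd i c\<close> trades them for terms
  without derivatives of \<open>\<phi>\<close>.\<close>

lemma product_weak_laplacian:
  assumes U: "open U" and u: "u \<in> L2 lborel" "\<And>i. g i \<in> L2 lborel" "F \<in> L2 lborel"
    and w: "\<And>i. has_weak_pd U i u (g i)" "has_weak_laplacian U u F" and c: "c \<in> test_functions U"
  shows "has_weak_laplacian UNIV (\<lambda>x. c x *\<^sub>R u x)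
    (\<lambda>x. c x *\<^sub>R F x + 2 *\<^sub>R (\<Sum>i\<in>UNIV. pd i c x *\<^sub>R g i x) + lap c x *\<^sub>R u x)"
proof -
  have sc: "smooth c" and bc: "bsupp c" using c by (auto simp: test_functions_iff)
  have [measurable]: "u \<in> borel_measurable borel" "g i \<in> borel_measurable borel" "F \<in> borel_measurable borel"
    "c \<in> borel_measurable borel" "pd i c \<in> borel_measurable borel" "lap c \<in> borel_measurable borel" for i
    using L2_D(1)[OF u(1)] L2_D(1)[OF u(2)] L2_D(1)[OF u(3)] smooth_borel[OF sc] smooth_borel[OF smooth_pd[OF sc]]
      smooth_borel[OF smooth_lap[OF sc]] by auto
  show ?thesis
  proof (subst weak_laplacian_iff[OF open_UNIV], simp, simp, rule ballI)
    fix \<phi> :: "real^2 \<Rightarrow> real" assume "\<phi> \<in> test_functions UNIV"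
    then have sp: "smooth \<phi>" and bp: "bsupp \<phi>" by (auto simp: test_functions_iff)
    have I: "integrable lborel (\<lambda>x. (a x * b x) *\<^sub>R y x)"
      if "smooth a" "smooth b" "bsupp a \<or> bsupp b" "y \<in> L2 lborel" for a b :: "real^2 \<Rightarrow> real" and y
    proof (rule smooth_mult_integrable[OF that(4) smooth_mult[OF that(1,2)]])
      show "bsupp (\<lambda>x. a x * b x)"
        using that(3) bounded_subset[of "{x. a x \<noteq> 0}" "{x. a x * b x \<noteq> 0}"]
          bounded_subset[of "{x. b x \<noteq> 0}" "{x. a x * b x \<noteq> 0}"] by auto
    qed
    have bl: "bsupp (lap c)" using bsupp_add[OF bsupp_pd[OF bsupp_pd[OF bc, of 1], of 1] bsupp_pd[OF bsupp_pd[OF bc, of 2], of 2]]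
      by (simp add: lap_def[abs_def] sum_2)
    define A where "A i = (LINT x|lborel. (pd i \<phi> x * pd i c x) *\<^sub>R u x)" for i
    define B where "B i = (LINT x|lborel. (\<phi> x * pd i c x) *\<^sub>R g i x)" for i
    define C where "C i = (LINT x|lborel. (\<phi> x * pd i (pd i c) x) *\<^sub>R u x)" for i
    have iA: "integrable lborel (\<lambda>x. (pd i \<phi> x * pd i c x) *\<^sub>R u x)" for i
      by (intro I smooth_pd sp sc disjI2 bsupp_pd bc u)
    have iB: "integrable lborel (\<lambda>x. (\<phi> x * pd i c x) *\<^sub>R g i x)" for i
      by (intro I smooth_pd sp sc disjI2 bsupp_pd bc u)
    have iC: "integrable lborel (\<lambda>x. (\<phi> x * pd i (pd i c) x) *\<^sub>R u x)" for i
      by (intro I smooth_pd sp sc disjI2 bsupp_pd bc u)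
    have iL: "integrable lborel (\<lambda>x. (lap \<phi> x * c x) *\<^sub>R u x)"
      by (intro I smooth_lap sp sc disjI2 bc u)
    have iF: "integrable lborel (\<lambda>x. (\<phi> x * c x) *\<^sub>R F x)"
      by (intro I sp sc disjI2 bc u)
    \<comment> \<open>This is where the weak gradient is used: it removes the derivative from
      \<open>\<phi>\<close> in the cross term \<open>A i\<close>.\<close>
    have AB: "A i + C i = - B i" for i
    proof -
      have t: "(\<lambda>x. \<phi> x * pd i c x) \<in> test_functions U" by (rule test_mult(2)[OF test_pd[OF c] sp])
      have "(LINT x|lborel. pd i (\<lambda>x. \<phi> x * pd i c x) x *\<^sub>R u x) = - B i"
        using w(1)[of i] t U by (simp add: weak_pd_iff B_def)
      moreover have "pd i (\<lambda>x. \<phi> x * pd i c x) x = pd i \<phi> x * pd i c x + \<phi> x * pd i (pd i c) x" for x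
        by (rule pd_mult[OF smoothD[OF sp] smoothD[OF smooth_pd[OF sc]]])
      ultimately show ?thesis using iA iC by (simp add: A_def C_def scaleR_add_left)
    qed
    have lp: "lap (\<lambda>x. \<phi> x * c x) x = lap \<phi> x * c x + (\<Sum>i\<in>UNIV. 2 * (pd i \<phi> x * pd i c x) + \<phi> x * pd i (pd i c) x)" for x
    proof -
      have "pd i (\<lambda>x. \<phi> x * c x) = (\<lambda>x. pd i \<phi> x * c x + \<phi> x * pd i c x)" for i
        by (rule ext) (rule pd_mult[OF smoothD[OF sp] smoothD[OF sc]])
      moreover have "pd i (\<lambda>x. pd i \<phi> x * c x + \<phi> x * pd i c x) x
          = (pd i (pd i \<phi>) x * c x + pd i \<phi> x * pd i c x) + (pd i \<phi> x * pd i c x + \<phi> x * pd i (pd i c) x)" for i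
        by (simp add: pd_add[OF smoothD[OF smooth_mult[OF smooth_pd[OF sp] sc]] smoothD[OF smooth_mult[OF sp smooth_pd[OF sc]]]]
            pd_mult[OF smoothD[OF sp] smoothD[OF smooth_pd[OF sc]]] pd_mult[OF smoothD[OF smooth_pd[OF sp]] smoothD[OF sc]])
      ultimately show ?thesis by (simp add: lap_def sum_2 algebra_simps)
    qed
    have "(LINT x|lborel. (\<phi> x * c x) *\<^sub>R F x) = (LINT x|lborel. lap (\<lambda>x. \<phi> x * c x) x *\<^sub>R u x)"
      using w(2) test_mult(2)[OF c sp] U by (simp add: weak_laplacian_iff)
    also have "\<dots> = (LINT x|lborel. (lap \<phi> x * c x) *\<^sub>R u x + (\<Sum>i\<in>UNIV. 2 *\<^sub>R ((pd i \<phi> x * pd i c x) *\<^sub>R u x) + (\<phi> x * pd i (pd i c) x) *\<^sub>R u x))"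
      unfolding lp by (intro Bochner_Integration.integral_cong) (auto simp: scaleR_add_left scaleR_sum_left)
    also have "\<dots> = (LINT x|lborel. (lap \<phi> x * c x) *\<^sub>R u x) + (\<Sum>i\<in>UNIV. 2 *\<^sub>R A i + C i)"
    proof -
      have "integrable lborel (\<lambda>x. 2 *\<^sub>R ((pd i \<phi> x * pd i c x) *\<^sub>R u x) + (\<phi> x * pd i (pd i c) x) *\<^sub>R u x)" for i
        by (intro Bochner_Integration.integrable_add integrable_scaleR_right iA iC)
      moreover have "(LINT x|lborel. 2 *\<^sub>R ((pd i \<phi> x * pd i c x) *\<^sub>R u x) + (\<phi> x * pd i (pd i c) x) *\<^sub>R u x) = 2 *\<^sub>R A i + C i" for i
        by (subst Bochner_Integration.integral_add[OF integrable_scaleR_right[OF iA] iC]) (simp only: integral_scaleR_right A_def C_def)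
      ultimately show ?thesis
        by (subst Bochner_Integration.integral_add[OF iL Bochner_Integration.integrable_sum]) (simp_all only: Bochner_Integration.integral_sum)
    qed
    finally have 1: "(LINT x|lborel. (lap \<phi> x * c x) *\<^sub>R u x) = (LINT x|lborel. (\<phi> x * c x) *\<^sub>R F x) - (\<Sum>i\<in>UNIV. 2 *\<^sub>R A i + C i)"
      by simp
    have A: "A i = - B i - C i" for i using AB[of i] by (simp add: algebra_simps eq_neg_iff_add_eq_0)
    have "(LINT x|lborel. \<phi> x *\<^sub>R (c x *\<^sub>R F x + 2 *\<^sub>R (\<Sum>i\<in>UNIV. pd i c x *\<^sub>R g i x) + lap c x *\<^sub>R u x))
      = (LINT x|lborel. (\<phi> x * c x) *\<^sub>R F x + (\<Sum>i\<in>UNIV. 2 *\<^sub>R ((\<phi> x * pd i c x) *\<^sub>R g i x) + (\<phi> x * pd i (pd i c) x) *\<^sub>R u x))"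
      by (intro Bochner_Integration.integral_cong) (auto simp: lap_def sum_2 algebra_simps)
    also have "\<dots> = (LINT x|lborel. (\<phi> x * c x) *\<^sub>R F x) + (\<Sum>i\<in>UNIV. 2 *\<^sub>R B i + C i)"
    proof -
      have "integrable lborel (\<lambda>x. 2 *\<^sub>R ((\<phi> x * pd i c x) *\<^sub>R g i x) + (\<phi> x * pd i (pd i c) x) *\<^sub>R u x)" for i
        by (intro Bochner_Integration.integrable_add integrable_scaleR_right iB iC)
      moreover have "(LINT x|lborel. 2 *\<^sub>R ((\<phi> x * pd i c x) *\<^sub>R g i x) + (\<phi> x * pd i (pd i c) x) *\<^sub>R u x) = 2 *\<^sub>R B i + C i" for i
        by (subst Bochner_Integration.integral_add[OF integrable_scaleR_right[OF iB] iC]) (simp only: integral_scaleR_right B_def C_def)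
      ultimately show ?thesis
        by (subst Bochner_Integration.integral_add[OF iF Bochner_Integration.integrable_sum]) (simp_all only: Bochner_Integration.integral_sum)
    qed
    finally have 2: "(LINT x|lborel. \<phi> x *\<^sub>R (c x *\<^sub>R F x + 2 *\<^sub>R (\<Sum>i\<in>UNIV. pd i c x *\<^sub>R g i x) + lap c x *\<^sub>R u x))
      = (LINT x|lborel. (\<phi> x * c x) *\<^sub>R F x) + (\<Sum>i\<in>UNIV. 2 *\<^sub>R B i + C i)" .
    show "(LINT x|lborel. lap \<phi> x *\<^sub>R c x *\<^sub>R u x) = (LINT x|lborel. \<phi> x *\<^sub>R (c x *\<^sub>R F x + 2 *\<^sub>R (\<Sum>i\<in>UNIV. pd i c x *\<^sub>R g i x) + lap c x *\<^sub>R u x))"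
      unfolding 2 scaleR_scaleR 1 A by (simp add: sum_2 scaleR_2)
  qed
qed

text \<open>A weight that decreases away from \<open>z\<close> and, for positive
  \<open>\<tau>\<close> and \<open>l\<close>, is strictly subharmonic as soon as
  \<open>l * |x - z|^2 > 1\<close>. Both the size of its Laplacian and its contrast between radii
  grow with \<open>\<tau>\<close>.\<close>

lemma gauss_weight:
  fixes z :: "real^2"
  shows "smooth (\<lambda>x. \<tau> * exp (- l * ((x - z) \<bullet> (x - z))))"
    and "lap (\<lambda>x. \<tau> * exp (- l * ((x - z) \<bullet> (x - z)))) x
      = \<tau> * ((4 * l\<^sup>2 * ((x - z) \<bullet> (x - z)) - 4 * l) * exp (- l * ((x - z) \<bullet> (x - z))))"
proof -
  define q where "q x = - l * ((x - z) \<bullet> (x - z))" for x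
  have sx: "smooth (\<lambda>x. x - z)" by (intro smooth_diff smooth_linear bounded_linear_ident smooth_const)
  have sq: "smooth q" unfolding q_def by (intro smooth_mult smooth_const smooth_inner sx)
  have se: "smooth (\<lambda>x. exp (q x))" by (rule smooth_exp[OF sq])
  show "smooth (\<lambda>x. \<tau> * exp (- l * ((x - z) \<bullet> (x - z))))"
    using smooth_mult[OF smooth_const se] by (simp add: q_def)
  have pq: "pd i q x = - 2 * l * ((x - z) $ i)" for i x
  proof -
    have "(q has_derivative (\<lambda>h. - l * ((x - z) \<bullet> h + h \<bullet> (x - z)))) (at x)"
      unfolding q_def by (auto intro!: derivative_eq_intros)
    from pd_eq[OF this, of i] show ?thesis by (simp add: inner_axis inner_axis')
  qed
  have ppq: "pd i (pd i q) x = - 2 * l" for i x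
  proof -
    have e: "pd i q = (\<lambda>x. - 2 * l * (x $ i - z $ i))" by (rule ext) (simp add: pq)
    have "((\<lambda>x. - 2 * l * (x $ i - z $ i)) has_derivative (\<lambda>h. - 2 * l * (h $ i))) (at x)"
      by (auto intro!: derivative_eq_intros bounded_linear_imp_has_derivative bounded_linear_vec_nth)
    from pd_eq[OF this, of i] show ?thesis by (simp add: e)
  qed
  define \<psi> where "\<psi> x = \<tau> * exp (q x)" for x
  have p: "pd i \<psi> = (\<lambda>x. \<tau> * (exp (q x) * pd i q x))" for i
    unfolding \<psi>_def
    by (rule ext) (simp only: pd_bounded_linear[OF bounded_linear_mult_right smoothD[OF se]] pd_exp[OF sq])
  have pp: "pd i (pd i \<psi>) x = \<tau> * (exp (q x) * ((pd i q x)\<^sup>2 + pd i (pd i q) x))" for i x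
    unfolding p
    by (subst pd_bounded_linear[OF bounded_linear_mult_right smoothD[OF smooth_mult[OF se smooth_pd[OF sq]]]])
      (simp add: pd_mult[OF smoothD[OF se] smoothD[OF smooth_pd[OF sq]]] pd_exp[OF sq] power2_eq_square algebra_simps)
  have "lap \<psi> x = \<tau> * (exp (q x) * (4 * l\<^sup>2 * ((x - z) \<bullet> (x - z)) - 4 * l))"
    by (simp add: lap_def sum_2 pp pq ppq inner_vec2 power2_eq_square algebra_simps)
  then show "lap (\<lambda>x. \<tau> * exp (- l * ((x - z) \<bullet> (x - z)))) x
      = \<tau> * ((4 * l\<^sup>2 * ((x - z) \<bullet> (x - z)) - 4 * l) * exp (- l * ((x - z) \<bullet> (x - z))))"
    by (simp add: \<psi>_def[abs_def] q_def mult.commute)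
qed

text \<open>The weight is at least \<open>Wm\<close> on the ball of radius \<open>R'\<close> and at
  most \<open>Wm\<close> outside. Inside, the source is bounded by \<open>M |u|\<close> and is
  absorbed on the left for large \<open>\<tau>\<close>; outside, the terms from the cutoff carry a
  weight of at most \<open>Wm\<close>. After dividing by \<open>Wm\<close>, the mass of
  \<open>u\<close> inside is bounded by a constant over a quantity growing with
  \<open>\<tau>\<close>, so it is 0.\<close>

lemma ucp_ball:
  assumes U: "open U" and u: "u \<in> L2 lborel" "\<And>i. g i \<in> L2 lborel" "F \<in> L2 lborel"
    and w: "\<And>i. has_weak_pd U i u (g i)" "has_weak_laplacian U u F"
    and M: "AE x in lborel. x \<in> U \<longrightarrow> norm (F x) \<le> M * norm (u x)"
    and r: "0 < r" "r < R'" "R' < R" "ball z R \<subseteq> U"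
    and z: "AE x in lborel. x \<in> ball z r \<longrightarrow> u x = 0"
  shows "AE x in lborel. x \<in> ball z R' \<longrightarrow> u x = 0"
proof -
  have "0 < R'" using r by simp
  then obtain c where c: "c \<in> test_functions (ball z R)" "\<And>x. 0 \<le> c x" "\<And>x. c x \<le> 1" "\<And>x. x \<in> cball z R' \<Longrightarrow> c x = 1"
    using cutoff_exists[of R' R z] r(3) by metis
  have cU: "c \<in> test_functions U" by (rule test_mono[OF c(1) r(4)])
  have sc: "smooth c" and bc: "bsupp c" using c by (auto simp: test_functions_iff)
  have [measurable]: "u \<in> borel_measurable borel" "g i \<in> borel_measurable borel" "F \<in> borel_measurable borel"
    "c \<in> borel_measurable borel" "pd i c \<in> borel_measurable borel" "lap c \<in> borel_measurable borel" for i
    using L2_D(1)[OF u(1)] L2_D(1)[OF u(2)] L2_D(1)[OF u(3)] smooth_borel[OF sc] smooth_borel[OF smooth_pd[OF sc]]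
      smooth_borel[OF smooth_lap[OF sc]] by auto
  have bl: "bsupp (lap c)" using bsupp_add[OF bsupp_pd[OF bsupp_pd[OF bc, of 1], of 1] bsupp_pd[OF bsupp_pd[OF bc, of 2], of 2]]
    by (simp add: lap_def[abs_def] sum_2)
  have cL2: "(\<lambda>x. k x *\<^sub>R y x) \<in> L2 lborel" if k: "smooth k" "bsupp k" and y: "y \<in> L2 lborel" for k :: "real^2 \<Rightarrow> real" and y
  proof -
    obtain B where B: "\<And>x. norm (k x) \<le> B" using bounded_bsupp[OF smooth_continuous[OF k(1)] k(2)] by blast
    show ?thesis by (rule L2_scaleR_bounded[OF y, where B=B]) (use B smooth_borel[OF k(1)] in auto)
  qed
  define G where "G x = c x *\<^sub>R F x + 2 *\<^sub>R (\<Sum>i\<in>UNIV. pd i c x *\<^sub>R g i x) + lap c x *\<^sub>R u x" for x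
  have GL: "G \<in> L2 lborel"
  proof -
    have "(\<lambda>x. c x *\<^sub>R F x + complex_of_real 2 * (\<Sum>i\<in>UNIV. pd i c x *\<^sub>R g i x) + lap c x *\<^sub>R u x) \<in> L2 lborel"
      by (intro L2_add L2_cmult L2_sum cL2 sc bc smooth_pd bsupp_pd smooth_lap bl u)
    then show ?thesis by (simp add: G_def[abs_def] scaleR_conv_of_real)
  qed
  have GB: "bsupp G"
  proof (rule bounded_subset[OF bounded_closure[OF bc]], rule subsetI)
    fix x assume x: "x \<in> {x. G x \<noteq> 0}"
    show "x \<in> closure {x. c x \<noteq> 0}"
    proof (rule ccontr)
      assume n: "x \<notin> closure {x. c x \<noteq> 0}"
      have "c \<in> test_functions (closure {x. c x \<noteq> 0})"
        using sc bc by (auto simp: test_functions_iff)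
      from test_zero[OF this n] have "G x = 0" by (simp add: G_def)
      with x show False by simp
    qed
  qed
  have G_in: "G x = F x" if "x \<in> ball z R'" for x
  proof -
    have c1: "c y = 1" if "y \<in> ball z R'" for y using that c(4) by auto
    have p0: "pd i c y = 0" if "y \<in> ball z R'" for i y
      using pd_cong[of "ball z R'" y c "\<lambda>x. 1" i] that c1 by simp
    have "pd i (pd i c) x = 0" for i
      using pd_cong[of "ball z R'" x "pd i c" "\<lambda>x. 0" i] that p0 by simp
    then show ?thesis using c1[OF that] p0[OF that] by (simp add: G_def lap_def)
  qed
  \<comment> \<open>\<open>carleman_weak\<close> asks for vanishing at every point of the small
    ball, while \<open>u\<close> vanishes there only almost everywhere; the indicator repairs this
    on a null set.\<close>
  define f where "f x = indicator (- ball z r) x *\<^sub>R (c x *\<^sub>R u x)" for x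
  have fL: "f \<in> L2 lborel" unfolding f_def by (intro L2_indicator cL2 sc bc u) simp
  have f_AE: "AE x in lborel. c x *\<^sub>R u x = f x"
    using z by eventually_elim (auto simp: f_def indicator_def)
  have f_supp: "f x = 0" if "dist z x < r \<or> dist z x > R" for x
    using that test_zero(1)[OF c(1), of x] by (auto simp: f_def indicator_def)
  have fb: "bsupp f" by (rule bounded_subset[OF bc]) (auto simp: f_def)
  have weak: "has_weak_laplacian UNIV f G"
  proof (rule weak_laplacian_cong_AE[OF open_UNIV _ _ _ f_AE])
    show "has_weak_laplacian UNIV (\<lambda>x. c x *\<^sub>R u x) G"
      using product_weak_laplacian[OF U u w cU] by (simp add: G_def[abs_def])
  qed (use L2_D(1)[OF fL] L2_D(1)[OF GL] in auto)
  \<comment> \<open>With this value, \<open>l * |x - z|^2\<close> is at least 2 as soon as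
    \<open>|x - z|\<close> is at least \<open>r / 2\<close>, so that the factor of the Laplacian of
    the weight is at least \<open>4 * l\<close>.\<close>
  define l where "l = 8 / r\<^sup>2"
  have lam: "l > 0" "l * r\<^sup>2 = 8" using r(1) by (auto simp: l_def)
  define \<psi> where "\<psi> \<tau> x = \<tau> * exp (- l * ((x - z) \<bullet> (x - z)))" for \<tau> and x :: "real^2"
  define c0 where "c0 = 4 * l * exp (- l * (R + 1)\<^sup>2)"
  have c0: "c0 > 0" using lam by (simp add: c0_def)
  have xz: "(x - z) \<bullet> (x - z) = (dist z x)\<^sup>2" for x :: "real^2"
    by (simp add: dist_norm power2_norm_eq_inner norm_minus_commute[of z])
  have low: "\<tau> * c0 \<le> lap (\<psi> \<tau>) x" if d: "r / 2 \<le> dist z x" "dist z x \<le> R + 1" and "\<tau> \<ge> 0" for x \<tau>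
  proof -
    have "(r / 2)\<^sup>2 \<le> (dist z x)\<^sup>2" using d r by (intro power_mono) auto
    then have "l * r\<^sup>2 \<le> l * (4 * (dist z x)\<^sup>2)"
      using lam by (intro mult_left_mono) (auto simp: power_divide)
    then have "2 \<le> l * (dist z x)\<^sup>2" using lam by simp
    then have "4 * l * 2 \<le> 4 * l * (l * (dist z x)\<^sup>2)" using lam by (intro mult_left_mono) auto
    then have a: "4 * l \<le> 4 * l\<^sup>2 * (dist z x)\<^sup>2 - 4 * l"
      by (simp add: power2_eq_square mult.assoc)
    have "(dist z x)\<^sup>2 \<le> (R + 1)\<^sup>2" using d by (intro power_mono) auto
    then have "exp (- l * (R + 1)\<^sup>2) \<le> exp (- l * (dist z x)\<^sup>2)" using lam by simp
    then have "c0 \<le> (4 * l\<^sup>2 * (dist z x)\<^sup>2 - 4 * l) * exp (- l * (dist z x)\<^sup>2)"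
      unfolding c0_def using a lam by (intro mult_mono) auto
    then show ?thesis
      unfolding \<psi>_def gauss_weight(2) unfolding xz using \<open>\<tau> \<ge> 0\<close> by (rule mult_left_mono)
  qed
  define A where "A = ball z R'"
  have [measurable]: "A \<in> sets borel" by (simp add: A_def)
  define I where "I = (LINT x|lborel. indicator A x * (norm (u x))\<^sup>2)"
  have I0: "I \<ge> 0" unfolding I_def by (intro integral_nonneg_AE) auto
  have key: "(\<tau>\<^sup>2 * c0\<^sup>2 - 4 * M\<^sup>2) * I \<le> 4 * sqn G" if \<tau>: "\<tau> \<ge> 0" "\<tau>\<^sup>2 * c0\<^sup>2 \<ge> 4 * M\<^sup>2" for \<tau>
  proof -
    define Wm where "Wm = exp (\<tau> * exp (- l * R'\<^sup>2))"
    have Wm: "Wm > 0" by (simp add: Wm_def)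
    let ?W = "\<lambda>x. exp (\<psi> \<tau> x)"
    have s\<psi>: "smooth (\<psi> \<tau>)" unfolding \<psi>_def by (rule gauss_weight(1))
    have \<psi>T: "\<psi> \<tau> x \<le> \<tau>" for x
      unfolding \<psi>_def using \<tau>(1) lam by (intro mult_left_le) auto
    have Wb: "?W \<in> borel_measurable borel" "\<And>x. 0 \<le> ?W x" "\<And>x. ?W x \<le> exp \<tau>"
      using smooth_borel[OF smooth_exp[OF s\<psi>]] \<psi>T by auto
    have W_in: "?W x \<ge> Wm" if "x \<in> A" for x
    proof -
      have "(dist z x)\<^sup>2 \<le> R'\<^sup>2" using that by (intro power_mono) (auto simp: A_def)
      then have "exp (- l * R'\<^sup>2) \<le> exp (- l * (dist z x)\<^sup>2)" using lam by simp
      then show ?thesis unfolding Wm_def \<psi>_def xz using \<tau>(1) by (simp add: mult_left_mono)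
    qed
    have W_out: "?W x \<le> Wm" if "x \<notin> A" for x
    proof -
      have "R'\<^sup>2 \<le> (dist z x)\<^sup>2" using that r by (intro power_mono) (auto simp: A_def)
      then have "exp (- l * (dist z x)\<^sup>2) \<le> exp (- l * R'\<^sup>2)" using lam by simp
      then show ?thesis unfolding Wm_def \<psi>_def xz using \<tau>(1) by (simp add: mult_left_mono)
    qed
    note if' = weighted_integrable[OF fL Wb] and iG = weighted_integrable[OF GL Wb]
    have C: "(\<tau> * c0)\<^sup>2 * (LINT x|lborel. (norm (f x))\<^sup>2 * ?W x) \<le> 4 * (LINT x|lborel. (norm (G x))\<^sup>2 * ?W x)"
      by (rule carleman_weak[OF fL fb GL GB weak s\<psi> \<psi>T low _ r(1) f_supp])
        (use \<tau> c0 in auto)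
    have "(LINT x|lborel. (norm (G x))\<^sup>2 * ?W x) \<le> (LINT x|lborel. M\<^sup>2 * ((norm (f x))\<^sup>2 * ?W x) + Wm * (norm (G x))\<^sup>2)"
    proof (rule integral_mono_AE[OF iG])
      show "integrable lborel (\<lambda>x. M\<^sup>2 * ((norm (f x))\<^sup>2 * ?W x) + Wm * (norm (G x))\<^sup>2)"
        using if' L2_D(2)[OF GL] by simp
      show "AE x in lborel. (norm (G x))\<^sup>2 * ?W x \<le> M\<^sup>2 * ((norm (f x))\<^sup>2 * ?W x) + Wm * (norm (G x))\<^sup>2"
        using M f_AE
      proof eventually_elim
        case (elim x)
        show ?case
        proof (cases "x \<in> A")
          case True
          then have xU: "x \<in> U" using r by (auto simp: A_def)
          have fx: "f x = u x" using elim(2) c(4)[of x] True by (simp add: A_def)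
          have "norm (G x) \<le> M * norm (u x)" using G_in[of x] True elim(1) xU by (simp add: A_def)
          then have "(norm (G x))\<^sup>2 \<le> (M * norm (u x))\<^sup>2" by (intro power_mono) auto
          then have "(norm (G x))\<^sup>2 * ?W x \<le> (M\<^sup>2 * (norm (f x))\<^sup>2) * ?W x"
            by (intro mult_right_mono) (auto simp: fx power_mult_distrib)
          moreover have "0 \<le> Wm * (norm (G x))\<^sup>2" using Wm by simp
          ultimately show ?thesis unfolding mult.assoc by linarith
        next
          case False
          have "(norm (G x))\<^sup>2 * ?W x \<le> (norm (G x))\<^sup>2 * Wm" by (intro mult_left_mono W_out False) auto
          moreover have "0 \<le> M\<^sup>2 * ((norm (f x))\<^sup>2 * ?W x)" by simp
          ultimately show ?thesis unfolding mult.commute[of Wm] by linarith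
        qed
      qed
    qed
    also have "\<dots> = M\<^sup>2 * (LINT x|lborel. (norm (f x))\<^sup>2 * ?W x) + Wm * sqn G"
      using if' L2_D(2)[OF GL] by simp
    finally have D: "(\<tau>\<^sup>2 * c0\<^sup>2 - 4 * M\<^sup>2) * (LINT x|lborel. (norm (f x))\<^sup>2 * ?W x) \<le> 4 * (Wm * sqn G)"
      using C by (simp add: power_mult_distrib algebra_simps)
    have "Wm * I = (LINT x|lborel. Wm * (indicator A x * (norm (u x))\<^sup>2))" by (simp add: I_def)
    also have "\<dots> \<le> (LINT x|lborel. (norm (f x))\<^sup>2 * ?W x)"
    proof (rule integral_mono_AE[OF _ if'])
      show "integrable lborel (\<lambda>x. Wm * (indicator A x * (norm (u x))\<^sup>2))"
        using restrict_sqn_le(2)[OF u(1), of A] by simp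
      show "AE x in lborel. Wm * (indicator A x * (norm (u x))\<^sup>2) \<le> (norm (f x))\<^sup>2 * ?W x"
        using f_AE
      proof eventually_elim
        case (elim x)
        show ?case
        proof (cases "x \<in> A")
          case True
          have fx: "f x = u x" using elim c(4)[of x] True by (simp add: A_def)
          show ?thesis using mult_right_mono[OF W_in[OF True], of "(norm (u x))\<^sup>2"] True by (simp add: fx mult.commute)
        qed simp
      qed
    qed
    finally have "(\<tau>\<^sup>2 * c0\<^sup>2 - 4 * M\<^sup>2) * (Wm * I) \<le> (\<tau>\<^sup>2 * c0\<^sup>2 - 4 * M\<^sup>2) * (LINT x|lborel. (norm (f x))\<^sup>2 * ?W x)"
      using \<tau>(2) by (intro mult_left_mono) auto
    with D have "Wm * ((\<tau>\<^sup>2 * c0\<^sup>2 - 4 * M\<^sup>2) * I) \<le> Wm * (4 * sqn G)" by (simp add: mult_ac)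
    then show ?thesis using Wm by (simp only: mult_le_cancel_left_pos)
  qed
  have "I = 0"
  proof (rule ccontr)
    assume "I \<noteq> 0"
    then have I: "I > 0" using I0 by simp
    \<comment> \<open>Chosen so that the left-hand side of \<open>key\<close> becomes
      \<open>4 * sqn G + 1\<close>, one more than its right-hand side permits.\<close>
    define s where "s = 4 * M\<^sup>2 + (4 * sqn G + 1) / I"
    have s: "s \<ge> 4 * M\<^sup>2" "s \<ge> 0" using I by (auto simp: s_def intro!: add_nonneg_nonneg divide_nonneg_pos)
    define \<tau> where "\<tau> = sqrt s / c0"
    have t: "\<tau> \<ge> 0" "\<tau>\<^sup>2 * c0\<^sup>2 = s" using s c0 by (auto simp: \<tau>_def power_divide)
    have "(s - 4 * M\<^sup>2) * I \<le> 4 * sqn G" using key[of \<tau>] t s by simp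
    moreover have "(s - 4 * M\<^sup>2) * I = 4 * sqn G + 1" using I by (simp add: s_def)
    ultimately show False by simp
  qed
  then show ?thesis
    using AE_zero_of_sqn[OF u(1), of A] by (simp add: I_def A_def)
qed

text \<open>The set \<open>Z\<close> of points near which \<open>u\<close> vanishes is open, and by
  \<open>ucp_ball\<close> vanishing fills every ball in \<open>U\<close> centred in
  \<open>Z\<close>; hence the complement of \<open>Z\<close> in \<open>U\<close> is open as
  well.\<close>

lemma ucp_connected:
  assumes U: "open U" "connected U" and u: "u \<in> L2 lborel" "\<And>i. g i \<in> L2 lborel" "F \<in> L2 lborel"
    and w: "\<And>i. has_weak_pd U i u (g i)" "has_weak_laplacian U u F"
    and M: "AE x in lborel. x \<in> U \<longrightarrow> norm (F x) \<le> M * norm (u x)"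
    and z: "z0 \<in> U" "r0 > 0" "AE x in lborel. x \<in> ball z0 r0 \<longrightarrow> u x = 0"
  shows "AE x in lborel. x \<in> U \<longrightarrow> u x = 0"
proof -
  define Z where "Z = {x\<in>U. \<exists>r>0. AE y in lborel. y \<in> ball x r \<longrightarrow> u y = 0}"
  \<comment> \<open>\<open>ucp_ball\<close> is applied about \<open>x\<close> with a radius
    \<open>R'\<close> strictly between \<open>dist x y\<close> and \<open>d\<close>; the result then
    contains a small ball about \<open>y\<close>.\<close>
  have local: "y \<in> Z" if x: "x \<in> Z" "ball x d \<subseteq> U" "y \<in> ball x d" for x y d
  proof -
    obtain r where r: "r > 0" "AE y in lborel. y \<in> ball x r \<longrightarrow> u y = 0" using x by (auto simp: Z_def)
    have d: "d > 0" using x(3)[unfolded mem_ball] zero_le_dist[of x y] by linarith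
    define R' where "R' = (dist x y + d) / 2"
    have R': "dist x y < R'" "R' < d" using x(3) by (auto simp: R'_def)
    define r' where "r' = min r (R' / 2)"
    have R'0: "R' > 0" using R' zero_le_dist[of x y] by linarith
    have r': "0 < r'" "r' < R'" using r(1) R'0 by (auto simp: r'_def)
    have zr: "AE y in lborel. y \<in> ball x r' \<longrightarrow> u y = 0"
      using r(2) by eventually_elim (auto simp: r'_def)
    have "AE y in lborel. y \<in> ball x R' \<longrightarrow> u y = 0"
      by (rule ucp_ball[OF U(1) u w M r' R'(2) x(2) zr])
    then have "AE a in lborel. a \<in> ball y (R' - dist x y) \<longrightarrow> u a = 0"
    proof eventually_elim
      case (elim a)
      then show ?case using dist_triangle[of x a y] by auto
    qed
    moreover have "y \<in> U" using x by auto
    ultimately show ?thesis using R'(1) by (auto simp: Z_def intro!: exI[of _ "R' - dist x y"])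
  qed
  have oZ: "open Z"
  proof (rule openI)
    fix x assume x: "x \<in> Z"
    then obtain d where "d > 0" "ball x d \<subseteq> U" using U(1) by (auto simp: Z_def open_contains_ball)
    then show "\<exists>e>0. ball x e \<subseteq> Z" using local[OF x] by blast
  qed
  have oC: "open (U - Z)"
  proof (rule openI)
    fix x assume x: "x \<in> U - Z"
    then obtain d where d: "d > 0" "ball x d \<subseteq> U" using U(1) by (auto simp: open_contains_ball)
    have "y \<notin> Z" if "y \<in> ball x (d / 2)" for y
    proof
      assume y: "y \<in> Z"
      have "ball y (d / 2) \<subseteq> ball x d"
      proof
        fix a assume "a \<in> ball y (d / 2)"
        then show "a \<in> ball x d" using that dist_triangle[of x a y] by auto
      qed
      then have "ball y (d / 2) \<subseteq> U" using d by blast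
      moreover have "x \<in> ball y (d / 2)" using that by (simp add: dist_commute)
      ultimately have "x \<in> Z" by (rule local[OF y])
      then show False using x by simp
    qed
    moreover have "ball x (d / 2) \<subseteq> U" using d by (auto intro: subsetD[OF d(2)])
    ultimately have "ball x (d / 2) \<subseteq> U - Z" by blast
    then show "\<exists>e>0. ball x e \<subseteq> U - Z" using d(1) by (intro exI[of _ "d / 2"]) auto
  qed
  have "z0 \<in> Z" using z by (auto simp: Z_def)
  then have UZ: "U \<subseteq> Z"
    using connectedD[OF U(2) oZ oC] z(1) by (auto simp: Z_def)
  then have "\<exists>r>0. AE y in lborel. y \<in> ball x r \<longrightarrow> u y = 0" if "x \<in> U" for x
    using that by (auto simp: Z_def)
  then obtain \<rho> where \<rho>: "\<And>x. x \<in> U \<Longrightarrow> \<rho> x > 0 \<and> (AE y in lborel. y \<in> ball x (\<rho> x) \<longrightarrow> u y = 0)" by metis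
  \<comment> \<open>Each point has its own exceptional null set; countably many of the balls already
    cover \<open>U\<close>.\<close>
  obtain \<F> where \<F>: "\<F> \<subseteq> (\<lambda>x. ball x (\<rho> x)) ` U" "countable \<F>" "\<Union>\<F> = \<Union>((\<lambda>x. ball x (\<rho> x)) ` U)"
    using Lindelof[of "(\<lambda>x. ball x (\<rho> x)) ` U"] by auto
  have "AE y in lborel. \<forall>B\<in>\<F>. y \<in> B \<longrightarrow> u y = 0"
    using \<F>(1) \<rho> by (intro AE_ball_countable[OF \<F>(2), THEN iffD2] ballI) auto
  then show ?thesis
  proof eventually_elim
    case (elim y)
    show ?case
    proof
      assume "y \<in> U"
      then have "y \<in> \<Union>\<F>" unfolding \<F>(3) using \<rho>[of y] by (auto intro!: bexI[of _ y])
      then show "u y = 0" using elim by auto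
    qed
  qed
qed

abbreviation sqn_ball :: "real \<Rightarrow> (real^2 \<Rightarrow> complex) \<Rightarrow> real" where
  "sqn_ball r u \<equiv> LINT x|lborel. indicator (ball 0 r) x * (norm (u x))\<^sup>2"

section \<open>Interior regularity of solutions\<close>

text \<open>Smooth on the whole plane, with the equation imposed only on \<open>U\<close>. Solutions
  are always cut off to global functions of this kind, so that derivatives and integrals never have
  to mention the domain.\<close>

definition solution_on :: "real \<Rightarrow> (real^2) set \<Rightarrow> (real^2 \<Rightarrow> complex) \<Rightarrow> bool" where
  "solution_on k U u \<longleftrightarrow> smooth u \<and> (\<forall>x\<in>U. lap u x = - (k *\<^sub>R u x))"

lemma solution_smooth: "solution_on k U u \<Longrightarrow> smooth u"
  by (simp add: solution_on_def)

lemma solution_mono: "solution_on k U u \<Longrightarrow> V \<subseteq> U \<Longrightarrow> solution_on k V u"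
  by (auto simp: solution_on_def)

lemma lap_pd:
  assumes "smooth u"
  shows "lap (pd i u) x = pd i (lap u) x"
proof -
  have c: "pd j (pd i u) = pd i (pd j u)" for j by (rule ext) (rule pd_commute[OF assms])
  have "pd j (pd j (pd i u)) x = pd i (pd j (pd j u)) x" for j
    by (simp only: c) (rule pd_commute[OF smooth_pd[OF assms]])
  then have "lap (pd i u) x = pd i (pd 1 (pd 1 u)) x + pd i (pd 2 (pd 2 u)) x"
    by (simp add: lap_def sum_2)
  also have "\<dots> = pd i (lap u) x"
    unfolding lap_def[abs_def] sum_2
    by (rule pd_add[symmetric]) (intro smoothD smooth_pd assms)+
  finally show ?thesis .
qed

lemma solution_pd:
  assumes "solution_on k U u" "open U"
  shows "solution_on k U (pd i u)"
proof -
  have s: "smooth u" by (rule solution_smooth[OF assms(1)])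
  have "lap (pd i u) x = - (k *\<^sub>R pd i u x)" if "x \<in> U" for x
  proof -
    have "lap (pd i u) x = pd i (\<lambda>x. (- k) *\<^sub>R u x) x"
      unfolding lap_pd[OF s] by (rule pd_cong[OF assms(2) that]) (use assms in \<open>auto simp: solution_on_def\<close>)
    also have "\<dots> = (- k) *\<^sub>R pd i u x"
      by (rule pd_bounded_linear[OF bounded_linear_scaleR_right smoothD[OF s]])
    finally show ?thesis by simp
  qed
  then show ?thesis using s smooth_pd by (auto simp: solution_on_def)
qed

lemma solution_foldr: "solution_on k U u \<Longrightarrow> open U \<Longrightarrow> solution_on k U (foldr pd is u)"
  by (induction "is") (auto intro: solution_pd)

lemma lap_diff:
  assumes "smooth u" "smooth w"
  shows "lap (\<lambda>x. u x - w x) x = lap u x - lap w x"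
proof -
  have "pd i (\<lambda>x. u x - w x) = (\<lambda>x. pd i u x - pd i w x)" for i
    by (rule ext) (rule pd_diff[OF smoothD[OF assms(1)] smoothD[OF assms(2)]])
  then show ?thesis
    by (simp add: lap_def sum_2 pd_diff[OF smoothD[OF smooth_pd[OF assms(1)]] smoothD[OF smooth_pd[OF assms(2)]]])
qed

lemma solution_diff:
  "solution_on k U u \<Longrightarrow> solution_on k U w \<Longrightarrow> solution_on k U (\<lambda>x. u x - w x)"
  by (auto simp: solution_on_def lap_diff scaleR_diff_right)

lemma foldr_pd_diff:
  assumes "smooth u" "smooth w"
  shows "foldr pd is (\<lambda>x. u x - w x) = (\<lambda>x. foldr pd is u x - foldr pd is w x)"
proof (induction "is")
  case (Cons i "is")
  show ?case
    by (rule ext) (simp add: Cons pd_diff[OF smoothD[OF smooth_foldr[OF assms(1)]] smoothD[OF smooth_foldr[OF assms(2)]]])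
qed simp

section \<open>Interior estimates\<close>

lemma ball_integrable:
  fixes f :: "real^2 \<Rightarrow> real"
  assumes "continuous_on UNIV f"
  shows "integrable lborel (\<lambda>x. indicator (ball z r) x * f x)"
proof -
  have "integrable lborel (\<lambda>x. indicator (cball z r) x *\<^sub>R f x)"
    by (rule borel_integrable_compact) (auto intro: continuous_on_subset[OF assms])
  then have "integrable lborel (\<lambda>x. indicator (ball z r) x *\<^sub>R (indicator (cball z r) x *\<^sub>R f x))"
    by (rule integrable_mult_indicator[rotated]) simp
  moreover have "(\<lambda>x. indicator (ball z r) x *\<^sub>R (indicator (cball z r) x *\<^sub>R f x)) = (\<lambda>x. indicator (ball z r) x * f x)"
    by (auto simp: indicator_def fun_eq_iff)
  ultimately show ?thesis by (simp only:)
qed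

lemma sqn_ball_integrable:
  "smooth u \<Longrightarrow> integrable lborel (\<lambda>x. indicator (ball z r) x * (norm (u x))\<^sup>2)"
  by (intro ball_integrable continuous_intros smooth_continuous)

lemma green_lap:
  fixes w :: "real^2 \<Rightarrow> 'b::euclidean_space"
  assumes "smooth c" "bsupp c" "smooth w"
  shows "(LINT x|lborel. lap c x *\<^sub>R w x) = (LINT x|lborel. c x *\<^sub>R lap w x)"
proof -
  have e: "(LINT x|lborel. pd i (pd i c) x *\<^sub>R w x) = (LINT x|lborel. c x *\<^sub>R pd i (pd i w) x)" for i
    using ibp[OF smooth_pd[OF assms(1)] assms(3) bsupp_pd[OF assms(2)], of i i]
      ibp[OF assms(1) smooth_pd[OF assms(3)] assms(2), of i i] by simp
  have i: "integrable lborel (\<lambda>x. pd i (pd i c) x *\<^sub>R w x)" "integrable lborel (\<lambda>x. c x *\<^sub>R pd i (pd i w) x)" for i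
    by (intro integrable_smooth smooth_scaleR smooth_pd assms bsupp_scaleR bsupp_pd)+
  show ?thesis
    using e i by (simp add: lap_def sum_2 scaleR_add_left scaleR_add_right)
qed

text \<open>Integrate \<open>\<Delta>\<bar>u\<bar>\<^sup>2 = 2 \<bar>\<nabla>u\<bar>\<^sup>2 + 2 Re (u\<^sup>* \<Delta>u)\<close> against a cutoff function.\<close>

lemma caccioppoli:
  assumes ab: "0 < a" "a < b"
  obtains C where "C \<ge> 0"
    "\<And>u i. solution_on k (ball 0 b) u \<Longrightarrow> sqn_ball a (pd i u) \<le> C * sqn_ball b u"
proof -
  obtain c :: "real^2 \<Rightarrow> real" where c: "c \<in> test_functions (ball 0 b)" "\<And>x. 0 \<le> c x" "\<And>x. c x \<le> 1"
    "\<And>x. x \<in> cball 0 a \<Longrightarrow> c x = 1"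
    using cutoff_exists[OF ab, of 0] by blast
  have sc: "smooth c" and bc: "bsupp c" using c by (auto simp: test_functions_iff)
  have bl: "bsupp (lap c)" using bsupp_add[OF bsupp_pd[OF bsupp_pd[OF bc, of 1], of 1] bsupp_pd[OF bsupp_pd[OF bc, of 2], of 2]]
    by (simp add: lap_def[abs_def] sum_2)
  obtain B where B: "B \<ge> 0" "\<And>x. norm (lap c x) \<le> B"
    using bounded_bsupp[OF smooth_continuous[OF smooth_lap[OF sc]] bl] by blast
  show ?thesis
  proof (rule that[of "B + 2 * \<bar>k\<bar>"])
    show "B + 2 * \<bar>k\<bar> \<ge> 0" using B by simp
    fix u i assume sol: "solution_on k (ball 0 b) u"
    then have su: "smooth u" by (rule solution_smooth)
    define v where "v x = u x \<bullet> u x" for x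
    have sv: "smooth v" unfolding v_def by (intro smooth_inner su)
    have pv: "pd i v = (\<lambda>x. 2 * (u x \<bullet> pd i u x))" for i
      unfolding v_def by (rule ext) (simp add: pd_inner[OF smoothD[OF su] smoothD[OF su]] inner_commute)
    have ppv: "pd i (pd i v) x = 2 * (pd i u x \<bullet> pd i u x) + 2 * (u x \<bullet> pd i (pd i u) x)" for i x
      unfolding pv
      by (subst pd_bounded_linear[OF bounded_linear_mult_right smoothD[OF smooth_inner[OF su smooth_pd[OF su]]]])
        (simp add: pd_inner[OF smoothD[OF su] smoothD[OF smooth_pd[OF su]]])
    have lv: "lap v x = 2 * (norm (pd 1 u x))\<^sup>2 + 2 * (norm (pd 2 u x))\<^sup>2 - 2 * k * (norm (u x))\<^sup>2" if "x \<in> ball 0 b" for x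
    proof -
      have "lap v x = 2 * (norm (pd 1 u x))\<^sup>2 + 2 * (norm (pd 2 u x))\<^sup>2 + 2 * (u x \<bullet> lap u x)"
        by (simp add: lap_def sum_2 ppv power2_norm_eq_inner inner_add_right)
      also have "lap u x = - (k *\<^sub>R u x)" using sol that by (simp add: solution_on_def)
      finally show ?thesis by (simp add: power2_norm_eq_inner)
    qed
    have i1: "integrable lborel (\<lambda>x. lap c x * v x)" "integrable lborel (\<lambda>x. c x * lap v x)"
      using integrable_smooth[OF smooth_scaleR[OF smooth_lap[OF sc] sv] bsupp_scaleR[OF bl]]
        integrable_smooth[OF smooth_scaleR[OF sc smooth_lap[OF sv]] bsupp_scaleR[OF bc]] by (simp_all only: real_scaleR_def)
    have G: "(LINT x|lborel. lap c x * v x) = (LINT x|lborel. c x * lap v x)"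
      using green_lap[OF sc bc sv] by simp
    have "sqn_ball a (pd i u) \<le> (LINT x|lborel. c x * lap v x + 2 * \<bar>k\<bar> * (indicator (ball 0 b) x * (norm (u x))\<^sup>2))"
    proof (rule integral_mono)
      show "integrable lborel (\<lambda>x. indicator (ball 0 a) x * (norm (pd i u x))\<^sup>2)"
        by (rule sqn_ball_integrable[OF smooth_pd[OF su]])
      show "integrable lborel (\<lambda>x. c x * lap v x + 2 * \<bar>k\<bar> * (indicator (ball 0 b) x * (norm (u x))\<^sup>2))"
        using i1(2) sqn_ball_integrable[OF su, of 0 b] by simp
      fix x :: "real^2"
      show "indicator (ball 0 a) x * (norm (pd i u x))\<^sup>2 \<le> c x * lap v x + 2 * \<bar>k\<bar> * (indicator (ball 0 b) x * (norm (u x))\<^sup>2)"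
      proof (cases "x \<in> ball 0 b")
        case False
        then have "x \<notin> ball 0 a" using ab by auto
        then show ?thesis using False test_zero(1)[OF c(1) False] by simp
      next
        case True
        let ?P = "(norm (pd 1 u x))\<^sup>2 + (norm (pd 2 u x))\<^sup>2"
        have Pi: "(norm (pd i u x))\<^sup>2 \<le> ?P"
          using exhaust_2[of i] by auto
        have le: "indicator (ball 0 a) x * (norm (pd i u x))\<^sup>2 \<le> c x * ?P"
        proof (cases "x \<in> ball 0 a")
          case True
          then have "c x = 1" using c(4) by auto
          then show ?thesis using Pi True by simp
        next
          case False
          then show ?thesis using c(2) by simp
        qed
        have "0 \<le> c x * ?P" using c(2)[of x] by simp
        moreover have "c x * (k * (norm (u x))\<^sup>2) \<le> 1 * (\<bar>k\<bar> * (norm (u x))\<^sup>2)"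
        proof -
          have "c x * (k * (norm (u x))\<^sup>2) \<le> c x * (\<bar>k\<bar> * (norm (u x))\<^sup>2)"
            using c(2)[of x] by (intro mult_left_mono mult_right_mono) auto
          also have "\<dots> \<le> 1 * (\<bar>k\<bar> * (norm (u x))\<^sup>2)"
            using c(3)[of x] by (intro mult_right_mono) auto
          finally show ?thesis .
        qed
        moreover have "c x * lap v x = 2 * (c x * ?P) - 2 * (c x * (k * (norm (u x))\<^sup>2))"
          by (simp add: lv[OF True] algebra_simps)
        ultimately show ?thesis using le True by simp
      qed
    qed
    also have "\<dots> = (LINT x|lborel. lap c x * v x) + 2 * \<bar>k\<bar> * sqn_ball b u"
      using i1(2) sqn_ball_integrable[OF su, of 0 b] by (simp add: G)
    also have "(LINT x|lborel. lap c x * v x) \<le> (LINT x|lborel. B * (indicator (ball 0 b) x * (norm (u x))\<^sup>2))"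
    proof (rule integral_mono[OF i1(1)])
      show "integrable lborel (\<lambda>x. B * (indicator (ball 0 b) x * (norm (u x))\<^sup>2))"
        using sqn_ball_integrable[OF su, of 0 b] by simp
      fix x :: "real^2"
      show "lap c x * v x \<le> B * (indicator (ball 0 b) x * (norm (u x))\<^sup>2)"
      proof (cases "x \<in> ball 0 b")
        case True
        have "lap c x \<le> B" using B(2)[of x] by simp
        then have "lap c x * v x \<le> B * v x" by (rule mult_right_mono) (simp add: v_def)
        then show ?thesis using True by (simp add: v_def power2_norm_eq_inner)
      next
        case False
        then show ?thesis using test_zero(3)[OF c(1) False] by simp
      qed
    qed
    finally show "sqn_ball a (pd i u) \<le> (B + 2 * \<bar>k\<bar>) * sqn_ball b u"
      by (simp add: algebra_simps)
  qed
qed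

lemma sqn_ball_mono:
  assumes "smooth u" "a \<le> b"
  shows "sqn_ball a u \<le> sqn_ball b u"
  by (rule integral_mono[OF sqn_ball_integrable[OF assms(1)] sqn_ball_integrable[OF assms(1)]])
    (use assms(2) in \<open>auto simp: indicator_def\<close>)

text \<open>Derivatives of a solution solve the same equation, so Caccioppoli's inequality can be
  iterated; every derivative uses up half of the remaining gap between the radii.\<close>

lemma derivatives_L2_bound:
  assumes "0 < a" "a < b"
  shows "\<exists>C\<ge>0. \<forall>u. solution_on k (ball 0 b) u \<longrightarrow> sqn_ball a (foldr pd is u) \<le> C * sqn_ball b u"
  using assms
proof (induction "is" arbitrary: a)
  case Nil
  then show ?case using sqn_ball_mono[of _ a b] by (intro exI[of _ 1]) (auto simp: solution_on_def)
next
  case (Cons i "is")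
  define m where "m = (a + b) / 2"
  have m: "0 < m" "a < m" "m < b" using Cons.prems by (auto simp: m_def)
  obtain C1 where C1: "C1 \<ge> 0" "\<And>u i. solution_on k (ball 0 m) u \<Longrightarrow> sqn_ball a (pd i u) \<le> C1 * sqn_ball m u"
    using caccioppoli[OF Cons.prems(1) m(2), of k] by blast
  obtain C2 where C2: "C2 \<ge> 0" "\<And>u. solution_on k (ball 0 b) u \<Longrightarrow> sqn_ball m (foldr pd is u) \<le> C2 * sqn_ball b u"
    using Cons.IH[OF m(1,3)] by blast
  show ?case
  proof (intro exI[of _ "C1 * C2"] conjI allI impI)
    fix u assume u: "solution_on k (ball 0 b) u"
    have "solution_on k (ball 0 m) (foldr pd is u)"
      by (rule solution_foldr[OF solution_mono[OF u]]) (use m in auto)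
    from C1(2)[OF this, of i] have "sqn_ball a (foldr pd (i # is) u) \<le> C1 * sqn_ball m (foldr pd is u)" by simp
    also have "\<dots> \<le> C1 * (C2 * sqn_ball b u)" by (intro mult_left_mono C2 u C1)
    finally show "sqn_ball a (foldr pd (i # is) u) \<le> C1 * C2 * sqn_ball b u" by simp
  qed (use C1 C2 in auto)
qed

lemma ball_jensen:
  fixes h :: "real^2 \<Rightarrow> real"
  assumes "r > 0" "continuous_on UNIV h"
  shows "(LINT x|lborel. indicator (ball 0 r) x * h x)\<^sup>2
    \<le> measure lborel (ball (0::real^2) r) * (LINT x|lborel. indicator (ball 0 r) x * (h x)\<^sup>2)"
proof -
  let ?V = "measure lborel (ball (0::real^2) r)"
  have V: "?V > 0"
    using content_ball_pos[OF assms(1)] by simp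
  let ?\<rho> = "\<lambda>x. indicator (ball (0::real^2) r) x / ?V"
  have i: "integrable lborel (\<lambda>x. indicator (ball (0::real^2) r) x :: real)"
    using emeasure_lborel_ball_finite[of "0::real^2" r] by (intro integrable_real_indicator) auto
  note i1 = ball_integrable[OF assms(2), of 0 r]
  have i2: "integrable lborel (\<lambda>x. indicator (ball 0 r) x * (h x)\<^sup>2)"
    by (rule ball_integrable) (intro continuous_intros assms(2))
  have "(LINT x|lborel. ?\<rho> x * h x)\<^sup>2 \<le> (LINT x|lborel. ?\<rho> x * (h x)\<^sup>2)"
    by (rule jensen_square) (use V i i1 i2 in auto)
  then have "((LINT x|lborel. indicator (ball 0 r) x * h x) / ?V)\<^sup>2 \<le> (LINT x|lborel. indicator (ball 0 r) x * (h x)\<^sup>2) / ?V"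
    by simp
  then show ?thesis using V by (simp add: power_divide power2_eq_square field_simps)
qed

text \<open>\<open>sobolev_sup\<close> is applied to \<open>u\<close> times a cutoff. The mixed
  derivative of this product involves only \<open>u\<close>, its two first derivatives and the mixed
  one, and all four are bounded in square mean on the intermediate ball.\<close>

lemma interior_sup_bound:
  assumes ab: "0 < a" "a < b"
  shows "\<exists>C\<ge>0. \<forall>u. solution_on k (ball 0 b) u \<longrightarrow> (\<forall>x\<in>ball 0 a. (norm (u x))\<^sup>2 \<le> C * sqn_ball b u)"
proof -
  define m where "m = (a + b) / 2"
  have m: "0 < m" "a < m" "m < b" using ab by (auto simp: m_def)
  obtain c :: "real^2 \<Rightarrow> real" where c: "c \<in> test_functions (ball 0 m)" "\<And>x. 0 \<le> c x" "\<And>x. c x \<le> 1"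
    "\<And>x. x \<in> cball 0 a \<Longrightarrow> c x = 1"
    using cutoff_exists[OF ab(1) m(2), of 0] by blast
  have sc: "smooth c" and bc: "bsupp c" using c by (auto simp: test_functions_iff)
  have "\<exists>B. \<forall>x. norm (foldr pd is c x) \<le> B" for "is"
  proof -
    have "bsupp (foldr pd is c)" by (induction "is") (auto intro: bsupp_pd bc)
    then show ?thesis using bounded_bsupp[OF smooth_continuous[OF smooth_foldr[OF sc]]] by metis
  qed
  then obtain Bf where Bf: "\<And>is x. norm (foldr pd is c x) \<le> Bf is" by metis
  define B where "B = max (max (Bf [1,2]) (Bf [2])) (max (Bf [1]) (Bf []))"
  have B: "norm (pd 1 (pd 2 c) x) \<le> B" "norm (pd 2 c x) \<le> B" "norm (pd 1 c x) \<le> B" "norm (c x) \<le> B" for x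
    using Bf[of "[1,2]" x] Bf[of "[2]" x] Bf[of "[1]" x] Bf[of "[]" x] by (auto simp: B_def)
  have B0: "B \<ge> 0" using B(4)[of 0] norm_ge_zero order_trans by blast
  define V where "V = measure lborel (ball (0::real^2) m)"
  have V0: "V \<ge> 0" by (simp add: V_def)
  have "\<forall>is. \<exists>C\<ge>0. \<forall>u. solution_on k (ball 0 b) u \<longrightarrow> sqn_ball m (foldr pd is u) \<le> C * sqn_ball b u"
    by (rule allI) (rule derivatives_L2_bound[OF m(1,3)])
  from choice[OF this] obtain Cf where Cf':
    "\<forall>is. Cf is \<ge> 0 \<and> (\<forall>u. solution_on k (ball 0 b) u \<longrightarrow> sqn_ball m (foldr pd is u) \<le> Cf is * sqn_ball b u)" ..
  then have Cf: "\<And>is. Cf is \<ge> 0" "\<And>is u. solution_on k (ball 0 b) u \<Longrightarrow> sqn_ball m (foldr pd is u) \<le> Cf is * sqn_ball b u"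
    by auto
  define C where "C = V * (4 * B\<^sup>2) * (Cf [] + Cf [1] + Cf [2] + Cf [1,2])"
  show ?thesis
  proof (intro exI[of _ C] conjI allI impI ballI)
    show "C \<ge> 0" unfolding C_def using V0 Cf(1) by (intro mult_nonneg_nonneg add_nonneg_nonneg) auto
    fix u :: "real^2 \<Rightarrow> complex" and x :: "real^2" assume sol: "solution_on k (ball 0 b) u" and x: "x \<in> ball 0 a"
    have su: "smooth u" by (rule solution_smooth[OF sol])
    define F where "F x = c x *\<^sub>R u x" for x
    have sF: "smooth F" "bsupp F" unfolding F_def by (intro smooth_scaleR sc su bsupp_scaleR bc)+
    define h where "h y = B * (norm (u y) + norm (pd 1 u y) + norm (pd 2 u y) + norm (pd 1 (pd 2 u) y))" for y
    have ch: "continuous_on UNIV h" unfolding h_def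
      by (intro continuous_intros smooth_continuous smooth_pd su)
    have p2: "pd 2 F = (\<lambda>y. pd 2 c y *\<^sub>R u y + c y *\<^sub>R pd 2 u y)"
      unfolding F_def by (rule ext) (rule pd_scaleR[OF smoothD[OF sc] smoothD[OF su]])
    have p12: "pd 1 (pd 2 F) y = (pd 1 (pd 2 c) y *\<^sub>R u y + pd 2 c y *\<^sub>R pd 1 u y) + (pd 1 c y *\<^sub>R pd 2 u y + c y *\<^sub>R pd 1 (pd 2 u) y)" for y
      unfolding p2
      by (simp add: pd_add[OF smoothD[OF smooth_scaleR[OF smooth_pd[OF sc] su]] smoothD[OF smooth_scaleR[OF sc smooth_pd[OF su]]]]
        pd_scaleR[OF smoothD[OF smooth_pd[OF sc]] smoothD[OF su]] pd_scaleR[OF smoothD[OF sc] smoothD[OF smooth_pd[OF su]]])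
    have bd: "norm (pd 1 (pd 2 F) y) \<le> indicator (ball 0 m) y * h y" for y
    proof (cases "y \<in> ball 0 m")
      case True
      have "norm (pd 1 (pd 2 F) y) \<le> (norm (pd 1 (pd 2 c) y *\<^sub>R u y) + norm (pd 2 c y *\<^sub>R pd 1 u y)) + (norm (pd 1 c y *\<^sub>R pd 2 u y) + norm (c y *\<^sub>R pd 1 (pd 2 u) y))"
        unfolding p12 by (intro norm_triangle_le add_mono norm_triangle_ineq order_refl)
      also have "\<dots> \<le> (B * norm (u y) + B * norm (pd 1 u y)) + (B * norm (pd 2 u y) + B * norm (pd 1 (pd 2 u) y))"
        unfolding norm_scaleR real_norm_def[symmetric] by (intro add_mono mult_right_mono B norm_ge_zero)
      finally show ?thesis using True by (simp add: h_def algebra_simps)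
    next
      case False
      have "c y = 0" "pd 1 c y = 0" "pd 2 c y = 0" "pd 1 (pd 2 c) y = 0"
        using test_zero(1,2)[OF c(1) False] test_zero(2)[OF test_pd[OF c(1)] False] by auto
      then show ?thesis using False by (simp add: p12)
    qed
    have iF: "integrable lborel (\<lambda>y. norm (pd 1 (pd 2 F) y))"
      by (intro integrable_norm integrable_smooth smooth_pd bsupp_pd sF)
    have "norm (u x) = norm (F x)" using c(4)[of x] x by (simp add: F_def)
    also have "\<dots> \<le> (LINT y|lborel. norm (pd 1 (pd 2 F) y))" by (rule sobolev_sup[OF sF])
    also have "\<dots> \<le> (LINT y|lborel. indicator (ball 0 m) y * h y)"
      by (rule integral_mono[OF iF ball_integrable[OF ch] bd])
    finally have "(norm (u x))\<^sup>2 \<le> (LINT y|lborel. indicator (ball 0 m) y * h y)\<^sup>2"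
      by (intro power_mono) auto
    also have "\<dots> \<le> V * (LINT y|lborel. indicator (ball 0 m) y * (h y)\<^sup>2)"
      unfolding V_def by (rule ball_jensen[OF m(1) ch])
    also have "\<dots> \<le> V * (LINT y|lborel. (4 * B\<^sup>2) * (indicator (ball 0 m) y * (norm (u y))\<^sup>2 + indicator (ball 0 m) y * (norm (pd 1 u y))\<^sup>2
        + indicator (ball 0 m) y * (norm (pd 2 u y))\<^sup>2 + indicator (ball 0 m) y * (norm (pd 1 (pd 2 u) y))\<^sup>2))"
    proof (intro mult_left_mono V0 integral_mono)
      show "integrable lborel (\<lambda>y. indicator (ball 0 m) y * (h y)\<^sup>2)"
        by (rule ball_integrable) (intro continuous_intros ch)
      show "integrable lborel (\<lambda>y. (4 * B\<^sup>2) * (indicator (ball 0 m) y * (norm (u y))\<^sup>2 + indicator (ball 0 m) y * (norm (pd 1 u y))\<^sup>2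
        + indicator (ball 0 m) y * (norm (pd 2 u y))\<^sup>2 + indicator (ball 0 m) y * (norm (pd 1 (pd 2 u) y))\<^sup>2))"
        by (intro integrable_mult_right Bochner_Integration.integrable_add sqn_ball_integrable smooth_pd su)
      fix y :: "real^2"
      have sq4: "(p + q + s + t)\<^sup>2 \<le> 4 * (p\<^sup>2 + q\<^sup>2 + s\<^sup>2 + t\<^sup>2)" for p q s t :: real
      proof -
        have "4 * (p\<^sup>2 + q\<^sup>2 + s\<^sup>2 + t\<^sup>2) - (p + q + s + t)\<^sup>2 = (p - q)\<^sup>2 + (p - s)\<^sup>2 + (p - t)\<^sup>2 + (q - s)\<^sup>2 + (q - t)\<^sup>2 + (s - t)\<^sup>2"
          by (simp add: power2_eq_square algebra_simps)
        also have "\<dots> \<ge> 0" by simp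
        finally show ?thesis by simp
      qed
      have "(h y)\<^sup>2 \<le> B\<^sup>2 * (4 * ((norm (u y))\<^sup>2 + (norm (pd 1 u y))\<^sup>2 + (norm (pd 2 u y))\<^sup>2 + (norm (pd 1 (pd 2 u) y))\<^sup>2))"
        unfolding h_def power_mult_distrib by (intro mult_left_mono sq4) auto
      then show "indicator (ball 0 m) y * (h y)\<^sup>2 \<le> (4 * B\<^sup>2) * (indicator (ball 0 m) y * (norm (u y))\<^sup>2 + indicator (ball 0 m) y * (norm (pd 1 u y))\<^sup>2
        + indicator (ball 0 m) y * (norm (pd 2 u y))\<^sup>2 + indicator (ball 0 m) y * (norm (pd 1 (pd 2 u) y))\<^sup>2)"
        by (auto simp: indicator_def algebra_simps)
    qed
    also have "\<dots> = V * (4 * B\<^sup>2) * (sqn_ball m u + sqn_ball m (pd 1 u) + sqn_ball m (pd 2 u) + sqn_ball m (pd 1 (pd 2 u)))"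
    proof -
      note i = sqn_ball_integrable[OF su, of 0 m] sqn_ball_integrable[OF smooth_pd[OF su, of 1], of 0 m]
        sqn_ball_integrable[OF smooth_pd[OF su, of 2], of 0 m] sqn_ball_integrable[OF smooth_pd[OF smooth_pd[OF su]], of 0 m 1 2]
      show ?thesis using i by (simp add: mult.assoc)
    qed
    also have "\<dots> \<le> V * (4 * B\<^sup>2) * (Cf [] * sqn_ball b u + Cf [1] * sqn_ball b u + Cf [2] * sqn_ball b u + Cf [1,2] * sqn_ball b u)"
      using Cf(2)[OF sol, of "[]"] Cf(2)[OF sol, of "[1]"] Cf(2)[OF sol, of "[2]"] Cf(2)[OF sol, of "[1,2]"] V0
      by (intro mult_left_mono add_mono) auto
    also have "\<dots> = C * sqn_ball b u" by (simp add: C_def algebra_simps)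
    finally show "(norm (u x))\<^sup>2 \<le> C * sqn_ball b u" .
  qed
qed

lemma interior_derivative_bound:
  assumes ab: "0 < a" "a < b"
  shows "\<exists>C\<ge>0. \<forall>u. solution_on k (ball 0 b) u \<longrightarrow> (\<forall>x\<in>ball 0 a. (norm (foldr pd is u x))\<^sup>2 \<le> C * sqn_ball b u)"
proof -
  define m where "m = (a + b) / 2"
  have m: "0 < m" "a < m" "m < b" using ab by (auto simp: m_def)
  obtain C1 where C1: "C1 \<ge> 0" "\<And>u x. solution_on k (ball 0 m) u \<Longrightarrow> x \<in> ball 0 a \<Longrightarrow> (norm (u x))\<^sup>2 \<le> C1 * sqn_ball m u"
    using interior_sup_bound[OF ab(1) m(2), of k] by blast
  obtain C2 where C2: "C2 \<ge> 0" "\<And>u. solution_on k (ball 0 b) u \<Longrightarrow> sqn_ball m (foldr pd is u) \<le> C2 * sqn_ball b u"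
    using derivatives_L2_bound[OF m(1,3)] by blast
  show ?thesis
  proof (intro exI[of _ "C1 * C2"] conjI allI impI ballI)
    fix u x assume u: "solution_on k (ball 0 b) u" and x: "x \<in> ball (0::real^2) a"
    have "solution_on k (ball 0 m) (foldr pd is u)"
      by (rule solution_foldr[OF solution_mono[OF u]]) (use m in auto)
    from C1(2)[OF this x] have "(norm (foldr pd is u x))\<^sup>2 \<le> C1 * sqn_ball m (foldr pd is u)" .
    also have "\<dots> \<le> C1 * (C2 * sqn_ball b u)" by (intro mult_left_mono C2 u C1)
    finally show "(norm (foldr pd is u x))\<^sup>2 \<le> C1 * C2 * sqn_ball b u" by simp
  qed (use C1 C2 in auto)
qed

section \<open>Weyl's lemma\<close>

lemma solution_conv:
  assumes v: "v \<in> L2 lborel" "integrable lborel v"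
    and w: "has_weak_laplacian U v (\<lambda>x. - (of_real k * v x))" "open U"
    and V: "\<And>x. x \<in> V \<Longrightarrow> cball x (1 / (real n + 1)) \<subseteq> U"
  shows "solution_on k V (conv (mollifier n) v)"
proof -
  have m [measurable]: "v \<in> borel_measurable borel" using L2_D(1)[OF v(1)] by simp
  have "lap (conv (mollifier n) v) x = - (k *\<^sub>R conv (mollifier n) v x)" if "x \<in> V" for x
  proof -
    have "lap (conv (mollifier n) v) x = conv (mollifier n) (\<lambda>x. - (of_real k * v x)) x"
      by (rule lap_conv_weak[OF w(2) m _ w(1) mollifier(1,4,3) V[OF that] v(2)]) simp
    also have "\<dots> = (LINT y|lborel. (- k) *\<^sub>R (mollifier n (x - y) *\<^sub>R v y))"
      unfolding conv_def by (intro Bochner_Integration.integral_cong) (auto simp: scaleR_conv_of_real)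
    also have "\<dots> = (- k) *\<^sub>R conv (mollifier n) v x" by (simp only: integral_scaleR_right conv_def)
    finally show ?thesis by simp
  qed
  then show ?thesis using smooth_conv[OF mollifier(1,4) v(2)] by (auto simp: solution_on_def)
qed

text \<open>Uniform convergence of the derivatives lets limit and differentiation be exchanged.
  Doing this for every list of indices makes the limits \<open>L is\<close> a family closed under
  differentiation, so coinduction applies.\<close>

lemma smooth_on_limit:
  fixes v :: "nat \<Rightarrow> real^2 \<Rightarrow> complex"
  assumes U: "open U" "convex U" and v: "\<And>n. smooth (v n)"
    and C: "\<And>is. uniformly_Cauchy_on U (\<lambda>n. foldr pd is (v n))"
  obtains L where "\<And>is. smooth_on U (L is)" "\<And>is i x. x \<in> U \<Longrightarrow> pd i (L is) x = L (i # is) x"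
    "\<And>is. uniform_limit U (\<lambda>n. foldr pd is (v n)) (L is) sequentially"
proof -
  define L where "L is x = lim (\<lambda>n. foldr pd is (v n) x)" for "is" x
  have ul: "uniform_limit U (\<lambda>n. foldr pd is (v n)) (L is) sequentially" for "is"
    using Cauchy_uniformly_convergent[OF C[of "is"]]
    by (simp add: uniformly_convergent_uniform_limit_iff L_def[abs_def])
  have pt: "(\<lambda>n. foldr pd is (v n) x) \<longlonglongrightarrow> L is x" if "x \<in> U" for "is" x
    by (rule tendsto_uniform_limitI[OF ul that])
  have der: "(L is has_derivative (\<lambda>h. \<Sum>j\<in>UNIV. (h $ j) *\<^sub>R L (j # is) x)) (at x)" if x: "x \<in> U" for "is" x
  proof -
    have "\<exists>g. \<forall>y\<in>U. (\<lambda>n. foldr pd is (v n) y) \<longlonglongrightarrow> g y \<and>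
        (g has_derivative (\<lambda>h. \<Sum>j\<in>UNIV. (h $ j) *\<^sub>R L (j # is) y)) (at y within U)"
    proof (rule has_derivative_sequence[OF U(2), where f'="\<lambda>n y h. \<Sum>j\<in>UNIV. (h $ j) *\<^sub>R foldr pd (j # is) (v n) y"])
      show "(foldr pd is (v n) has_derivative (\<lambda>h. \<Sum>j\<in>UNIV. (h $ j) *\<^sub>R foldr pd (j # is) (v n) y)) (at y within U)" for n y
        using has_derivative_at_withinI[OF smooth_has_derivative[OF smooth_foldr[OF v]]] by simp
      show "x \<in> U" by fact
      show "(\<lambda>n. foldr pd is (v n) x) \<longlonglongrightarrow> L is x" by (rule pt[OF x])
      fix e :: real assume e: "e > 0"
      have "\<forall>\<^sub>F n in sequentially. \<forall>y\<in>U. dist (foldr pd (1 # is) (v n) y) (L (1 # is) y) < e / 2"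
        "\<forall>\<^sub>F n in sequentially. \<forall>y\<in>U. dist (foldr pd (2 # is) (v n) y) (L (2 # is) y) < e / 2"
        using uniform_limitD[OF ul[of "1 # is"], of "e / 2"] uniform_limitD[OF ul[of "2 # is"], of "e / 2"] e by simp_all
      then show "\<forall>\<^sub>F n in sequentially. \<forall>y\<in>U. \<forall>h. norm ((\<Sum>j\<in>UNIV. (h $ j) *\<^sub>R foldr pd (j # is) (v n) y)
          - (\<Sum>j\<in>UNIV. (h $ j) *\<^sub>R L (j # is) y)) \<le> e * norm h"
      proof eventually_elim
        case (elim n)
        show ?case
        proof (intro ballI allI)
          fix y and h :: "real^2" assume y: "y \<in> U"
          have b: "norm (foldr pd (j # is) (v n) y - L (j # is) y) \<le> e / 2" for j
            using elim[THEN bspec, OF y] exhaust_2[of j] by (auto simp: dist_norm)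
          have "norm (\<Sum>j\<in>UNIV. (h $ j) *\<^sub>R (foldr pd (j # is) (v n) y - L (j # is) y)) \<le> (\<Sum>j\<in>(UNIV::2 set). e / 2) * norm h"
            by (rule norm_pd_sum_le) (rule b)
          then show "norm ((\<Sum>j\<in>UNIV. (h $ j) *\<^sub>R foldr pd (j # is) (v n) y)
              - (\<Sum>j\<in>UNIV. (h $ j) *\<^sub>R L (j # is) y)) \<le> e * norm h"
            by (simp add: scaleR_diff_right sum_subtractf)
        qed
      qed
    qed
    then obtain g where g: "\<And>y. y \<in> U \<Longrightarrow> (\<lambda>n. foldr pd is (v n) y) \<longlonglongrightarrow> g y"
      "\<And>y. y \<in> U \<Longrightarrow> (g has_derivative (\<lambda>h. \<Sum>j\<in>UNIV. (h $ j) *\<^sub>R L (j # is) y)) (at y within U)" by blast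
    have "g y = L is y" if "y \<in> U" for y
      by (rule LIMSEQ_unique[OF g(1)[OF that] pt[OF that]])
    then have "(L is has_derivative (\<lambda>h. \<Sum>j\<in>UNIV. (h $ j) *\<^sub>R L (j # is) x)) (at x within U)"
      by (intro has_derivative_transform[OF x _ g(2)[OF x]]) simp
    then show ?thesis using at_within_open[OF x U(1)] by simp
  qed
  have pdL: "pd i (L is) x = L (i # is) x" if "x \<in> U" for i "is" x
    by (simp add: pd_eq[OF der[OF that]])
  have "smooth_on U (L is)" for "is"
  proof (rule smooth_on_coinduct[OF U(1), of _ "range L"])
    show "h differentiable (at x)" if "h \<in> range L" "x \<in> U" for h x
      using that differentiableI[OF der] by auto
    show "\<exists>gs. set gs \<subseteq> range L \<and> (\<forall>x\<in>U. pd i h x = (\<Sum>g\<leftarrow>gs. g x))" if "h \<in> range L" for h i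
    proof -
      from that obtain js where "h = L js" by auto
      then show ?thesis using pdL by (intro exI[of _ "[L (i # js)]"]) auto
    qed
  qed simp
  with pdL ul show ?thesis using that by blast
qed

text \<open>With a constant coefficient, mollifications of \<open>v\<close> are genuine solutions on
  a slightly smaller ball. They are Cauchy in square mean, and the interior estimates upgrade this
  to uniform convergence of all derivatives. The limit is cut off, so it is smooth with bounded
  support on the whole plane although it solves the equation only on the inner ball.\<close>

lemma weyl:
  assumes v: "v \<in> L2 lborel" "integrable lborel v"
    and w: "has_weak_laplacian (ball 0 b) v (\<lambda>x. - (of_real k * v x))"
    and ab: "0 < a" "a < b"
  obtains w where "solution_on k (ball 0 a) w" "bsupp w" "AE x in lborel. x \<in> ball 0 a \<longrightarrow> v x = w x"
proof -
  \<comment> \<open>Three gaps of equal width: from \<open>b\<close> to \<open>b1\<close> for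
    mollifying, from \<open>b1\<close> to \<open>a1\<close> for the interior estimates, and from
    \<open>a1\<close> to \<open>a\<close> for the final cutoff.\<close>
  define a1 where "a1 = (2 * a + b) / 3"
  define b1 where "b1 = (a + 2 * b) / 3"
  have o: "a < a1" "a1 < b1" "b1 < b" "0 < a1" "0 < b1" using ab by (auto simp: a1_def b1_def)
  obtain N :: nat where N: "1 / (real N + 1) < b - b1"
    using reals_Archimedean[of "b - b1"] o by (auto simp: inverse_eq_divide add.commute)
  \<comment> \<open>The index is shifted by \<open>N\<close> so that every member of the sequence,
    not only late ones, solves the equation on the ball of radius \<open>b1\<close>.\<close>
  define y where "y n = conv (mollifier (n + N)) v" for n
  have sy: "smooth (y n)" for n unfolding y_def by (rule smooth_conv[OF mollifier(1,4) v(2)])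
  have sol: "solution_on k (ball 0 b1) (y n)" for n
    unfolding y_def
  proof (rule solution_conv[OF v w open_ball])
    fix x :: "real^2" assume x: "x \<in> ball 0 b1"
    have "1 / (real (n + N) + 1) \<le> 1 / (real N + 1)" by (intro divide_left_mono) auto
    with N have n: "1 / (real (n + N) + 1) < b - b1" by simp
    show "cball x (1 / (real (n + N) + 1)) \<subseteq> ball 0 b"
    proof
      fix z assume "z \<in> cball x (1 / (real (n + N) + 1))"
      then have "dist x z < b - b1" using n by (simp add: mem_cball)
      then show "z \<in> ball 0 b" using x dist_triangle[of 0 z x] by auto
    qed
  qed
  have lim0: "(\<lambda>n. sqn (\<lambda>x. y n x - v x)) \<longlonglongrightarrow> 0"
    unfolding y_def using LIMSEQ_ignore_initial_segment[OF mollify_L2(1)[OF v], of N] .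
  have yL: "(\<lambda>x. y n x - v x) \<in> L2 lborel" for n unfolding y_def by (rule mollify_L2(2)[OF v])
  have dist_le: "sqn_ball b1 (\<lambda>x. y m x - y n x) \<le> 2 * sqn (\<lambda>x. y m x - v x) + 2 * sqn (\<lambda>x. y n x - v x)" for m n
  proof -
    have "sqn_ball b1 (\<lambda>x. y m x - y n x) \<le> (LINT x|lborel. 2 * (norm (y m x - v x))\<^sup>2 + 2 * (norm (y n x - v x))\<^sup>2)"
    proof (rule integral_mono)
      show "integrable lborel (\<lambda>x. indicator (ball 0 b1) x * (norm (y m x - y n x))\<^sup>2)"
        by (rule sqn_ball_integrable) (intro smooth_diff sy)
      show "integrable lborel (\<lambda>x. 2 * (norm (y m x - v x))\<^sup>2 + 2 * (norm (y n x - v x))\<^sup>2)"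
        using L2_D(2)[OF yL] by simp
      show "indicator (ball 0 b1) x * (norm (y m x - y n x))\<^sup>2 \<le> 2 * (norm (y m x - v x))\<^sup>2 + 2 * (norm (y n x - v x))\<^sup>2" for x
        using norm_diff_squared[of "y m x - v x" "y n x - v x"] by (auto simp: indicator_def)
    qed
    also have "\<dots> = 2 * sqn (\<lambda>x. y m x - v x) + 2 * sqn (\<lambda>x. y n x - v x)"
      using L2_D(2)[OF yL] by simp
    finally show ?thesis .
  qed
  have cauchy: "uniformly_Cauchy_on (ball 0 a1) (\<lambda>n. foldr pd is (y n))" for "is"
  proof -
    obtain C where C: "C \<ge> 0" "\<And>u x. solution_on k (ball 0 b1) u \<Longrightarrow> x \<in> ball 0 a1 \<Longrightarrow> (norm (foldr pd is u x))\<^sup>2 \<le> C * sqn_ball b1 u"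
      using interior_derivative_bound[OF o(4,2)] by blast
    show ?thesis
      unfolding uniformly_Cauchy_on_def
    proof (intro allI impI)
      fix e :: real assume e: "e > 0"
      \<comment> \<open>Two mollifications differ in square mean by less than \<open>4 * d\<close>;
        the choice makes \<open>C * (4 * d)\<close> smaller than \<open>e^2\<close>, with
        \<open>C + 1\<close> covering \<open>C = 0\<close>.\<close>
      define d where "d = e\<^sup>2 / (4 * (C + 1))"
      have d: "d > 0" using e C(1) by (simp add: d_def)
      have "\<forall>\<^sub>F n in sequentially. sqn (\<lambda>x. y n x - v x) < d"
        using lim0 d by (rule order_tendstoD(2))
      then obtain M where M: "\<And>n. n \<ge> M \<Longrightarrow> sqn (\<lambda>x. y n x - v x) < d"
        unfolding eventually_sequentially by blast
      show "\<exists>M. \<forall>x\<in>ball 0 a1. \<forall>m\<ge>M. \<forall>n\<ge>M. dist (foldr pd is (y m) x) (foldr pd is (y n) x) < e"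
      proof (intro exI[of _ M] ballI allI impI)
        fix x :: "real^2" and m n assume x: "x \<in> ball 0 a1" and mn: "m \<ge> M" "n \<ge> M"
        have "(norm (foldr pd is (\<lambda>x. y m x - y n x) x))\<^sup>2 \<le> C * sqn_ball b1 (\<lambda>x. y m x - y n x)"
          by (rule C(2)[OF solution_diff[OF sol sol] x])
        also have "\<dots> \<le> C * (4 * d)"
          using dist_le[of m n] M[OF mn(1)] M[OF mn(2)] C(1) by (intro mult_left_mono) auto
        also have "\<dots> < (C + 1) * (4 * d)" using d by (intro mult_strict_right_mono) auto
        also have "\<dots> = d * (4 * (C + 1))" by (simp add: algebra_simps)
        also have "\<dots> = e\<^sup>2" using C(1) by (simp add: d_def)
        finally have "norm (foldr pd is (\<lambda>x. y m x - y n x) x) < e"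
          using e by (simp add: power_less_imp_less_base)
        then show "dist (foldr pd is (y m) x) (foldr pd is (y n) x) < e"
          by (simp add: foldr_pd_diff[OF sy sy] dist_norm)
      qed
    qed
  qed
  obtain L where L: "\<And>is. smooth_on (ball 0 a1) (L is)" "\<And>is i x. x \<in> ball 0 a1 \<Longrightarrow> pd i (L is) x = L (i # is) x"
    "\<And>is. uniform_limit (ball 0 a1) (\<lambda>n. foldr pd is (y n)) (L is) sequentially"
    by (rule smooth_on_limit[OF open_ball convex_ball sy cauchy]) (rule that, assumption+)
  obtain c :: "real^2 \<Rightarrow> real" where c: "c \<in> test_functions (ball 0 a1)" "\<And>x. x \<in> cball 0 a \<Longrightarrow> c x = 1"
    by (rule cutoff_exists[OF ab(1) o(1), of 0]) (rule that, assumption+)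
  have sc: "smooth c" and bc: "bsupp c" and cc: "closure {x. c x \<noteq> 0} \<subseteq> ball 0 a1"
    using c by (auto simp: test_functions_iff)
  \<comment> \<open>A product of smooth functions on the ball of radius \<open>a1\<close>, and 0 off
    the closed support of \<open>c\<close>. These two open sets cover the plane, so \<open>W\<close>
    is smooth everywhere.\<close>
  define W where "W x = c x *\<^sub>R L [] x" for x
  have bW: "bsupp W" unfolding W_def by (rule bsupp_scaleR[OF bc])
  have "smooth_on (ball 0 a1) W"
    unfolding W_def using sc smooth_on_subset[of UNIV c] L(1)
    by (intro bounded_bilinear.smooth_on_prod[OF bounded_bilinear_scaleR]) (auto simp: smooth_on_UNIV)
  moreover have "smooth_on (- closure {x. c x \<noteq> 0}) W"
  proof (rule smooth_on_cong[where g="\<lambda>x. 0"])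
    fix x assume "x \<in> - closure {x. c x \<noteq> 0}"
    then have "c x = 0" using closure_subset[of "{x. c x \<noteq> 0}"] by auto
    then show "W x = 0" by (simp add: W_def)
  qed auto
  ultimately have "smooth_on (ball 0 a1 \<union> - closure {x. c x \<noteq> 0}) W" by (rule smooth_on_Un)
  moreover have "ball 0 a1 \<union> - closure {x. c x \<noteq> 0} = UNIV" using cc by auto
  ultimately have sW: "smooth W" by (simp add: smooth_on_UNIV)
  have WL: "W x = L [] x" if "x \<in> ball 0 a" for x using c(2)[of x] that by (simp add: W_def)
  have ptL: "(\<lambda>n. foldr pd is (y n) x) \<longlonglongrightarrow> L is x" if "x \<in> ball 0 a" for x "is"
    by (rule tendsto_uniform_limitI[OF L(3)]) (use that o in auto)
  have lapW: "lap W x = - (k *\<^sub>R W x)" if x: "x \<in> ball 0 a" for x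
  proof -
    have a1: "z \<in> ball 0 a1" if "z \<in> ball 0 a" for z :: "real^2" using that o by auto
    have p: "pd i W z = L [i] z" if "z \<in> ball 0 a" for i z
      using pd_cong[of "ball 0 a" z W "L []" i] WL that L(2)[OF a1[OF that], of i "[]"] by simp
    have pp: "pd i (pd i W) x = L [i, i] x" for i
      using pd_cong[of "ball 0 a" x "pd i W" "L [i]" i] p x L(2)[OF a1[OF x], of i "[i]"] by simp
    have "(\<lambda>n. lap (y n) x) \<longlonglongrightarrow> lap W x"
      unfolding lap_def sum_2 pp
      using tendsto_add[OF ptL[OF x, of "[1, 1]"] ptL[OF x, of "[2, 2]"]] by simp
    moreover have "lap (y n) x = - (k *\<^sub>R y n x)" for n
      using sol[of n] x o by (auto simp: solution_on_def)
    moreover have "(\<lambda>n. - (k *\<^sub>R y n x)) \<longlonglongrightarrow> - (k *\<^sub>R W x)"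
      using ptL[OF x, of "[]"] unfolding WL[OF x] by (intro tendsto_intros) simp
    ultimately show ?thesis using LIMSEQ_unique by auto
  qed
  have WL2: "W \<in> L2 lborel" by (rule L2_smooth[OF sW bW])
  have vW: "(\<lambda>x. v x - W x) \<in> L2 lborel" by (rule L2_diff[OF v(1) WL2])
  have "AE x in lborel. x \<in> ball 0 a \<longrightarrow> v x - W x = 0"
  proof (rule AE_zero_of_sqn[OF vW])
    define I where "I = (LINT x|lborel. indicator (ball 0 a) x * (norm (v x - W x))\<^sup>2)"
    define V where "V = (LINT x|lborel. indicator (ball (0::real^2) a) x * (1 :: real))"
    have V0: "V \<ge> 0" unfolding V_def by (intro integral_nonneg_AE) auto
    have iV: "integrable lborel (\<lambda>x. indicator (ball (0::real^2) a) x * (1 :: real))"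
      by (rule ball_integrable) simp
    have le: "I \<le> e" if e: "e > 0" for e
    proof -
      define d where "d = sqrt (e / (4 * (V + 1)))"
      have d: "d > 0" using e V0 by (simp add: d_def)
      have "\<forall>\<^sub>F n in sequentially. sqn (\<lambda>x. y n x - v x) < e / 4"
        using lim0 e by (intro order_tendstoD(2)) auto
      moreover have "\<forall>\<^sub>F n in sequentially. \<forall>x\<in>ball 0 a1. dist (y n x) (L [] x) < d"
        using uniform_limitD[OF L(3)[of "[]"] d] by simp
      ultimately have "\<forall>\<^sub>F n in sequentially. sqn (\<lambda>x. y n x - v x) < e / 4 \<and> (\<forall>x\<in>ball 0 a1. dist (y n x) (L [] x) < d)"
        by (rule eventually_conj)
      then obtain n where n: "sqn (\<lambda>x. y n x - v x) < e / 4" "\<And>x. x \<in> ball 0 a1 \<Longrightarrow> dist (y n x) (L [] x) < d"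
        using eventually_happens'[OF sequentially_bot] by blast
      have "I \<le> (LINT x|lborel. 2 * (norm (y n x - v x))\<^sup>2 + 2 * d\<^sup>2 * (indicator (ball 0 a) x * 1))"
        unfolding I_def
      proof (rule integral_mono)
        show "integrable lborel (\<lambda>x. indicator (ball 0 a) x * (norm (v x - W x))\<^sup>2)"
          by (rule restrict_sqn_le(2)[OF vW]) simp
        show "integrable lborel (\<lambda>x. 2 * (norm (y n x - v x))\<^sup>2 + 2 * d\<^sup>2 * (indicator (ball 0 a) x * 1))"
          using L2_D(2)[OF yL[of n]] iV by simp
        fix x :: "real^2"
        show "indicator (ball 0 a) x * (norm (v x - W x))\<^sup>2 \<le> 2 * (norm (y n x - v x))\<^sup>2 + 2 * d\<^sup>2 * (indicator (ball 0 a) x * 1)"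
        proof (cases "x \<in> ball 0 a")
          case True
          have "norm (y n x - W x) < d" using n(2)[of x] True o WL[OF True] by (auto simp: dist_norm)
          then have "(norm (y n x - W x))\<^sup>2 \<le> d\<^sup>2" by (intro power_mono) auto
          then show ?thesis
            using norm_diff_squared[of "y n x - W x" "y n x - v x"] True by simp
        qed simp
      qed
      also have "\<dots> = 2 * sqn (\<lambda>x. y n x - v x) + 2 * d\<^sup>2 * V"
        using L2_D(2)[OF yL[of n]] iV by (simp add: V_def)
      also have "2 * d\<^sup>2 * V \<le> e / 2"
      proof -
        have "d\<^sup>2 * (4 * (V + 1)) = e" using e V0 by (simp add: d_def)
        then have "4 * (d\<^sup>2 * V) = e - 4 * d\<^sup>2" by (simp add: algebra_simps)
        moreover have "0 \<le> d\<^sup>2" by simp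
        ultimately show ?thesis by linarith
      qed
      finally show ?thesis using n(1) by simp
    qed
    have "I \<ge> 0" unfolding I_def by (intro integral_nonneg_AE) auto
    moreover have "I \<le> 0" by (rule field_le_epsilon) (use le in simp)
    ultimately have "I = 0" by linarith
    then show "(LINT x|lborel. indicator (ball 0 a) x * (norm (v x - W x))\<^sup>2) = 0"
      unfolding I_def .
  qed simp
  then have "AE x in lborel. x \<in> ball 0 a \<longrightarrow> v x = W x" by simp
  moreover have "solution_on k (ball 0 a) W" using sW lapW by (auto simp: solution_on_def)
  ultimately show ?thesis using that bW by blast
qed

section \<open>Reflections and the Cauchy problem on a line\<close>

lemma dd_compose_linear:
  fixes A :: "real^2 \<Rightarrow> real^2"
  assumes "bounded_linear A" "smooth f"
  shows "dd a (\<lambda>x. f (A x)) x = dd (A a) f (A x)"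
  using dd_eq[OF has_derivative_compose[OF bounded_linear_imp_has_derivative[OF assms(1)] smooth_has_derivative[OF assms(2)]], of a x]
  by (simp add: dd_def)

lemma dd_smooth_scaleR: "smooth f \<Longrightarrow> dd a (\<lambda>x. c *\<^sub>R f x) x = c *\<^sub>R dd a f x"
  using pd_bounded_linear[OF bounded_linear_scaleR_right smoothD[of f]]
  by (simp add: dd_def sum_2 scaleR_add_right mult.commute)

lemma dd_smooth_add: "smooth f \<Longrightarrow> smooth g \<Longrightarrow> dd a (\<lambda>x. f x + g x) x = dd a f x + dd a g x"
  by (simp add: dd_def sum_2 pd_add[OF smoothD smoothD] scaleR_add_right)

lemma dd_dd_expand:
  assumes "smooth f"
  shows "dd a (dd b f) x = (\<Sum>i\<in>UNIV. \<Sum>j\<in>UNIV. (a $ i * b $ j) *\<^sub>R pd i (pd j f) x)"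
proof -
  have "pd i (dd b f) x = (\<Sum>j\<in>UNIV. (b $ j) *\<^sub>R pd i (pd j f) x)" for i
  proof -
    have "pd i (\<lambda>x. b $ 1 *\<^sub>R pd 1 f x + b $ 2 *\<^sub>R pd 2 f x) x
      = pd i (\<lambda>x. b $ 1 *\<^sub>R pd 1 f x) x + pd i (\<lambda>x. b $ 2 *\<^sub>R pd 2 f x) x"
      by (rule pd_add) (intro smoothD smooth_scaleR smooth_const smooth_pd assms)+
    then show ?thesis
      by (simp add: dd_def[abs_def] sum_2 pd_bounded_linear[OF bounded_linear_scaleR_right smoothD[OF smooth_pd[OF assms]]])
  qed
  then show ?thesis by (simp add: dd_def sum_2 scaleR_add_right)
qed

lemma unit_square: "norm (e::real^2) = 1 \<Longrightarrow> e $ 1 * e $ 1 + e $ 2 * e $ 2 = 1"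
  using norm_eq_1[of e] by (simp add: inner_vec2)

lemma lap_orthonormal:
  assumes "smooth f" "norm e = 1"
  shows "lap f x = dd e (dd e f) x + dd (perp e) (dd (perp e) f) x"
proof -
  let ?D = "\<lambda>i j. pd i (pd j f) x"
  have "dd e (dd e f) x + dd (perp e) (dd (perp e) f) x
     = (e $ 1 * e $ 1 + e $ 2 * e $ 2) *\<^sub>R ?D 1 1 + (e $ 1 * e $ 1 + e $ 2 * e $ 2) *\<^sub>R ?D 2 2"
    unfolding dd_dd_expand[OF assms(1)] sum_2 pd_commute[OF assms(1), of 2 1]
    by (simp add: algebra_simps)
  then show ?thesis using unit_square[OF assms(2)] by (simp add: lap_def sum_2)
qed

text \<open>For a unit vector \<open>e\<close>, the reflection that fixes the line spanned by
  \<open>e\<close> and reverses its normals.\<close>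

definition reflect :: "real^2 \<Rightarrow> real^2 \<Rightarrow> real^2" where
  "reflect e x = (2 * (x \<bullet> e)) *\<^sub>R e - x"

lemma bounded_linear_reflect: "bounded_linear (reflect e)"
  unfolding reflect_def
  by (intro bounded_linear_sub bounded_linear_scaleR_const bounded_linear_const_mult bounded_linear_inner_left bounded_linear_ident)

lemma smooth_reflect: "smooth f \<Longrightarrow> smooth (\<lambda>x. f (reflect e x))"
  by (rule smooth_compose_linear[OF bounded_linear_reflect])

lemma norm_reflect:
  assumes "norm e = 1"
  shows "norm (reflect e x) = norm x"
proof -
  have "reflect e x \<bullet> reflect e x = x \<bullet> x"
    using assms by (simp add: reflect_def inner_diff_left inner_diff_right inner_commute norm_eq_1 algebra_simps)
  then show ?thesis by (simp add: norm_eq_sqrt_inner)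
qed

lemma reflect_e: "norm e = 1 \<Longrightarrow> reflect e e = e"
  by (simp add: reflect_def norm_eq_1 vec2_eq_iff)

lemma reflect_perp: "reflect e (perp e) = - perp e"
  by (simp add: reflect_def inner_vec2)

lemma vec2_decompose:
  assumes "norm e = 1"
  shows "x = (x \<bullet> e) *\<^sub>R e + (x \<bullet> perp e) *\<^sub>R perp e"
proof -
  have "x $ 1 = (x $ 1 * e $ 1 + x $ 2 * e $ 2) * e $ 1 - (x $ 2 * e $ 1 - x $ 1 * e $ 2) * e $ 2"
    "x $ 2 = (x $ 1 * e $ 1 + x $ 2 * e $ 2) * e $ 2 + (x $ 2 * e $ 1 - x $ 1 * e $ 2) * e $ 1"
  proof -
    have "(x $ 1 * e $ 1 + x $ 2 * e $ 2) * e $ 1 - (x $ 2 * e $ 1 - x $ 1 * e $ 2) * e $ 2 = x $ 1 * (e $ 1 * e $ 1 + e $ 2 * e $ 2)"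
      "(x $ 1 * e $ 1 + x $ 2 * e $ 2) * e $ 2 + (x $ 2 * e $ 1 - x $ 1 * e $ 2) * e $ 1 = x $ 2 * (e $ 1 * e $ 1 + e $ 2 * e $ 2)"
      by (simp_all add: algebra_simps)
    then show "x $ 1 = (x $ 1 * e $ 1 + x $ 2 * e $ 2) * e $ 1 - (x $ 2 * e $ 1 - x $ 1 * e $ 2) * e $ 2"
    "x $ 2 = (x $ 1 * e $ 1 + x $ 2 * e $ 2) * e $ 2 + (x $ 2 * e $ 1 - x $ 1 * e $ 2) * e $ 1"
      using unit_square[OF assms] by simp_all
  qed
  then show ?thesis by (simp add: vec2_eq_iff inner_vec2)
qed

lemma reflect_line:
  assumes "norm e = 1" "x \<bullet> perp e = 0"
  shows "reflect e x = x"
proof -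
  have x: "(x \<bullet> e) *\<^sub>R e = x"
    using vec2_decompose[OF assms(1), of x] assms(2) by simp
  have "(2 * (x \<bullet> e)) *\<^sub>R e = x + x"
    by (simp only: scaleR_scaleR[symmetric] x scaleR_2)
  then show ?thesis by (simp add: reflect_def)
qed

text \<open>In the frame \<open>e\<close>, \<open>perp e\<close> the reflection changes only the
  sign of the normal direction, and the Laplacian contains the normal derivative twice.\<close>

lemma lap_reflect:
  assumes "smooth f" "norm e = 1"
  shows "lap (\<lambda>x. f (reflect e x)) x = lap f (reflect e x)"
proof -
  have 1: "dd e (\<lambda>x. h (reflect e x)) = (\<lambda>x. dd e h (reflect e x))" if "smooth h" for h :: "real^2 \<Rightarrow> 'a"
    by (rule ext) (simp add: dd_compose_linear[OF bounded_linear_reflect that] reflect_e[OF assms(2)])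
  have m: "dd (- a) h y = - dd a h y" for a y and h :: "real^2 \<Rightarrow> 'a"
    by (simp add: dd_def sum_negf)
  have 2: "dd (perp e) (\<lambda>x. h (reflect e x)) = (\<lambda>x. - dd (perp e) h (reflect e x))" if "smooth h" for h :: "real^2 \<Rightarrow> 'a"
    by (rule ext) (simp add: dd_compose_linear[OF bounded_linear_reflect that] reflect_perp m)
  have 3: "dd (perp e) (\<lambda>x. - h (reflect e x)) y = dd (perp e) h (reflect e y)" if "smooth h" for h :: "real^2 \<Rightarrow> 'a" and y
    using dd_smooth_scaleR[OF smooth_reflect[OF that, of e], of "perp e" "-1" y] fun_cong[OF 2[OF that], of y] by simp
  show ?thesis
    by (simp add: lap_orthonormal[OF smooth_reflect[OF assms(1)] assms(2)] lap_orthonormal[OF assms]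
        1[OF assms(1)] 1[OF smooth_dd[OF assms(1)]] 2[OF assms(1)] 3[OF smooth_dd[OF assms(1)]])
qed

lemma lap_add: "smooth u \<Longrightarrow> smooth w \<Longrightarrow> lap (\<lambda>x. u x + w x) x = lap u x + lap w x"
proof -
  assume s: "smooth u" "smooth w"
  have "pd i (\<lambda>x. u x + w x) = (\<lambda>x. pd i u x + pd i w x)" for i
    by (rule ext) (rule pd_add[OF smoothD[OF s(1)] smoothD[OF s(2)]])
  then show ?thesis
    by (simp add: lap_def sum_2 pd_add[OF smoothD[OF smooth_pd[OF s(1)]] smoothD[OF smooth_pd[OF s(2)]]])
qed

lemma lap_cmult: "smooth u \<Longrightarrow> lap (\<lambda>x. c * u x) x = c * lap u (x :: real^2)" for c :: complex
proof -
  assume s: "smooth u"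
  have "pd i (\<lambda>x. c * u x) = (\<lambda>x. c * pd i u x)" for i
    by (rule ext) (rule pd_bounded_linear[OF bounded_linear_mult_right smoothD[OF s]])
  then show ?thesis
    by (simp add: lap_def sum_2 pd_bounded_linear[OF bounded_linear_mult_right smoothD[OF smooth_pd[OF s]]] distrib_left)
qed

lemma solution_add: "solution_on k U u \<Longrightarrow> solution_on k U w \<Longrightarrow> solution_on k U (\<lambda>x. u x + w x)"
  by (auto simp: solution_on_def lap_add scaleR_add_right)

lemma solution_cmult: "solution_on k U u \<Longrightarrow> solution_on k U (\<lambda>x. c * u x)"
  by (auto simp: solution_on_def lap_cmult intro: smooth_mult)

lemma solution_reflect:
  assumes "solution_on k (ball 0 r) u" "norm e = 1"
  shows "solution_on k (ball 0 r) (\<lambda>x. u (reflect e x))"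
  using assms by (auto simp: solution_on_def lap_reflect smooth_reflect norm_reflect)

text \<open>With \<open>s = x \<bullet> perp e\<close>, \<open>normal_primitive e P\<close> is the primitive \<open>\<integral>\<^sub>0\<^sup>s P\<close> of \<open>P\<close> along the
  normal through the foot of \<open>x\<close> on the line spanned by \<open>e\<close>, rescaled to the unit interval.\<close>

definition slide :: "real^2 \<Rightarrow> real \<Rightarrow> real^2 \<Rightarrow> real^2" where
  "slide e t x = (x \<bullet> e) *\<^sub>R e + (t * (x \<bullet> perp e)) *\<^sub>R perp e"

definition normal_average :: "real^2 \<Rightarrow> nat \<Rightarrow> (real^2 \<Rightarrow> complex) \<Rightarrow> real^2 \<Rightarrow> complex" where
  "normal_average e m P x = (LINT t|lborel. indicator {0..1} t *\<^sub>R (t ^ m *\<^sub>R P (slide e t x)))"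

definition normal_primitive :: "real^2 \<Rightarrow> (real^2 \<Rightarrow> complex) \<Rightarrow> real^2 \<Rightarrow> complex" where
  "normal_primitive e P x = (x \<bullet> perp e) *\<^sub>R normal_average e 0 P x"

lemma norm_perp [simp]: "norm (perp e) = norm e"
  by (simp add: norm_eq_sqrt_inner inner_vec2 add.commute)

lemma slide_add: "slide e t (x + h) = slide e t x + slide e t h"
  by (simp add: slide_def inner_add_left algebra_simps)

lemma slide_1: "norm e = 1 \<Longrightarrow> slide e 1 x = x"
  using vec2_decompose[of e x] by (simp add: slide_def)

lemma norm_slide:
  assumes "norm e = 1" "\<bar>t\<bar> \<le> 1"
  shows "norm (slide e t x) \<le> norm x"
proof -
  let ?p = "x \<bullet> e" and ?q = "x \<bullet> perp e"
  have o: "e \<bullet> perp e = 0" "perp e \<bullet> e = 0" by (simp_all add: inner_vec2)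
  have n: "e \<bullet> e = 1" "perp e \<bullet> perp e = 1"
    using assms(1) norm_perp[of e] norm_eq_1[of e] norm_eq_1[of "perp e"] by simp_all
  have "slide e t x \<bullet> slide e t x = ?p * ?p + (t * t) * (?q * ?q)"
    by (simp add: slide_def inner_add_left inner_add_right o n)
  moreover have "x \<bullet> x = ?p * ?p + ?q * ?q"
    by (subst (1 2) vec2_decompose[OF assms(1), of x]) (simp add: inner_add_left inner_add_right o n)
  moreover have "(t * t) * (?q * ?q) \<le> 1 * (?q * ?q)"
    using assms(2) by (intro mult_right_mono) (auto simp: abs_square_le_1[symmetric] power2_eq_square[symmetric])
  ultimately have "slide e t x \<bullet> slide e t x \<le> x \<bullet> x" by linarith
  then show ?thesis by (simp add: norm_le)
qed

lemma continuous_slide: "continuous_on S (\<lambda>t. slide e t x)"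
  unfolding slide_def by (intro continuous_intros)

lemma unit_interval_integrable:
  fixes q :: "real \<Rightarrow> complex"
  shows "continuous_on UNIV q \<Longrightarrow> integrable lborel (\<lambda>t. indicator {0..1} t *\<^sub>R q t)"
  by (rule borel_integrable_compact) (auto intro: continuous_on_subset)

text \<open>\<open>slide e t\<close> is linear and multiplies the normal component by
  \<open>t\<close>. Each normal derivative therefore raises the power of \<open>t\<close> under the
  integral, which is why the averages carry the weight \<open>t ^ m\<close>.\<close>

lemma normal_average_has_derivative:
  assumes P: "smooth P" "bsupp P" and e: "norm e = 1"
  shows "(normal_average e m P has_derivative (\<lambda>h. (h \<bullet> e) *\<^sub>R normal_average e m (dd e P) x
      + (h \<bullet> perp e) *\<^sub>R normal_average e (Suc m) (dd (perp e) P) x)) (at x)"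
proof -
  obtain C where C: "C \<ge> 0"
    "\<And>x h. norm (P (x + h) - P x - (\<Sum>j\<in>UNIV. (h $ j) *\<^sub>R pd j P x)) \<le> C * (norm h)\<^sup>2"
    using smooth_remainder[OF P] by blast
  let ?J = "normal_average e"
  let ?n = "perp e"
  let ?D = "\<lambda>h. (h \<bullet> e) *\<^sub>R ?J m (dd e P) x + (h \<bullet> ?n) *\<^sub>R ?J (Suc m) (dd ?n P) x"
  have cont: "continuous_on UNIV (\<lambda>t. t ^ j *\<^sub>R Q (slide e t y))" if "smooth Q" for Q :: "real^2 \<Rightarrow> complex" and y j
    by (intro continuous_intros continuous_on_compose2[OF smooth_continuous[OF that, of UNIV] continuous_slide]) auto
  note int = unit_interval_integrable[OF cont]
  show ?thesis
  proof (rule has_derivativeI_sandwich[where e=1 and H="\<lambda>y. C * norm (y - x)"])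
    show "bounded_linear ?D"
      by (intro bounded_linear_add bounded_linear_scaleR_const bounded_linear_inner_left)
    have "((\<lambda>y. C * norm (y - x)) \<longlongrightarrow> C * norm (x - x)) (at x)"
      by (intro tendsto_intros)
    then show "((\<lambda>y. C * norm (y - x)) \<longlongrightarrow> 0) (at x)" by simp
    fix y assume "y \<noteq> x"
    define h where "h = y - x"
    have h: "h \<noteq> 0" "y = x + h" using \<open>y \<noteq> x\<close> by (auto simp: h_def)
    let ?I = "\<lambda>t::real. indicator {0..1} t :: real"
    define r where "r = (\<lambda>t. ?I t *\<^sub>R (t ^ m *\<^sub>R P (slide e t y)) - ?I t *\<^sub>R (t ^ m *\<^sub>R P (slide e t x))
       - ((h \<bullet> e) *\<^sub>R (?I t *\<^sub>R (t ^ m *\<^sub>R dd e P (slide e t x))) + (h \<bullet> ?n) *\<^sub>R (?I t *\<^sub>R (t ^ Suc m *\<^sub>R dd ?n P (slide e t x)))))"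
    have ir: "integrable lborel r"
      unfolding r_def by (intro Bochner_Integration.integrable_diff Bochner_Integration.integrable_add integrable_scaleR_right int P smooth_dd)
    have "?J m P y - ?J m P x - ?D h = (LINT t|lborel. r t)"
    proof -
      note i = int[OF P(1), of m y] int[OF P(1), of m x]
        integrable_scaleR_right[OF int[OF smooth_dd[OF P(1), of e], of m x], of "h \<bullet> e"]
        integrable_scaleR_right[OF int[OF smooth_dd[OF P(1), of ?n], of "Suc m" x], of "h \<bullet> ?n"]
      show ?thesis
        unfolding normal_average_def r_def
        by (subst Bochner_Integration.integral_diff[OF Bochner_Integration.integrable_diff[OF i(1,2)] Bochner_Integration.integrable_add[OF i(3,4)]],
            subst Bochner_Integration.integral_diff[OF i(1,2)], subst Bochner_Integration.integral_add[OF i(3,4)])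
          (simp only: integral_scaleR_right)
    qed
    also have "norm \<dots> \<le> (LINT t|lborel. norm (r t))" by (rule integral_norm_bound)
    also have "\<dots> \<le> (LINT t|lborel. ?I t *\<^sub>R (C * (norm h)\<^sup>2))"
    proof -
      have pt: "norm (r t) \<le> ?I t *\<^sub>R (C * (norm h)\<^sup>2)" for t :: real
      proof (cases "t \<in> {0..1}")
        case True
        have D: "(\<Sum>j\<in>UNIV. (slide e t h $ j) *\<^sub>R pd j P (slide e t x))
          = (h \<bullet> e) *\<^sub>R dd e P (slide e t x) + (h \<bullet> ?n) *\<^sub>R (t *\<^sub>R dd ?n P (slide e t x))"
        proof -
          have "(\<Sum>j\<in>UNIV. (slide e t h $ j) *\<^sub>R pd j P (slide e t x)) = dd (slide e t h) P (slide e t x)"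
            by (simp add: dd_def)
          also have "\<dots> = (h \<bullet> e) *\<^sub>R dd e P (slide e t x) + (t * (h \<bullet> ?n)) *\<^sub>R dd ?n P (slide e t x)"
            unfolding slide_def[of e t h] dd_add dd_scale ..
          finally show ?thesis by (simp add: mult.commute)
        qed
        have "r t = t ^ m *\<^sub>R (P (slide e t x + slide e t h) - P (slide e t x) - (\<Sum>j\<in>UNIV. (slide e t h $ j) *\<^sub>R pd j P (slide e t x)))"
          using True unfolding D by (simp add: r_def h(2) slide_add algebra_simps)
        also have "norm \<dots> \<le> 1 * (C * (norm (slide e t h))\<^sup>2)"
          unfolding norm_scaleR using True by (intro mult_mono C(2)) (auto intro: power_le_one)
        also have "\<dots> \<le> 1 * (C * (norm h)\<^sup>2)"
          using norm_slide[OF e, of t h] True C(1) by (intro mult_left_mono power_mono) auto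
        finally show ?thesis using True by simp
      qed (simp add: r_def)
      have i2: "integrable lborel (\<lambda>t::real. ?I t *\<^sub>R (C * (norm h)\<^sup>2))"
        by (intro integrable_scaleR_left integrable_real_indicator) auto
      show ?thesis by (rule integral_mono[OF integrable_norm[OF ir] i2 pt])
    qed
    also have "\<dots> = C * (norm h)\<^sup>2" by simp
    finally show "norm ((?J m P y - ?J m P x) - ?D (y - x)) / norm (y - x) \<le> C * norm (y - x)"
      using h by (simp add: pos_divide_le_eq power2_eq_square)
  qed simp
qed

text \<open>The fundamental theorem on the segment from the foot of \<open>x\<close> to
  \<open>x\<close>, applied to \<open>P\<close> and to \<open>t\<close> times \<open>P\<close>. The
  second identity is what makes the normal derivative of \<open>normal_primitive\<close> equal to
  \<open>P\<close>.\<close>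

lemma slide_FTC:
  assumes "smooth P"
  shows "(x \<bullet> perp e) *\<^sub>R normal_average e 0 (dd (perp e) P) x = P (slide e 1 x) - P (slide e 0 x)"
    and "normal_average e 0 P x + (x \<bullet> perp e) *\<^sub>R normal_average e 1 (dd (perp e) P) x = P (slide e 1 x)"
proof -
  let ?s = "x \<bullet> perp e"
  have cont: "continuous_on UNIV (\<lambda>t. t ^ j *\<^sub>R Q (slide e t x))" if "smooth Q" for Q :: "real^2 \<Rightarrow> complex" and j
    by (intro continuous_intros continuous_on_compose2[OF smooth_continuous[OF that, of UNIV] continuous_slide]) auto
  note int = unit_interval_integrable[OF cont]
  have sl: "slide e t x = (x \<bullet> e) *\<^sub>R e + t *\<^sub>R (?s *\<^sub>R perp e)" for t
    by (simp add: slide_def)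
  have v: "((\<lambda>t. P (slide e t x)) has_vector_derivative ?s *\<^sub>R dd (perp e) P (slide e t x)) (at t within S)" for t S
    using dd_vector_derivative[OF assms, of "(x \<bullet> e) *\<^sub>R e" "?s *\<^sub>R perp e" t S] unfolding sl by (simp add: dd_scale)
  have c0: "continuous_on {0..1} (\<lambda>t. Q (slide e t x))" if "smooth Q" for Q :: "real^2 \<Rightarrow> complex"
    by (rule continuous_on_compose2[OF smooth_continuous[OF that, of UNIV] continuous_slide]) auto
  have "(LINT t|lborel. indicator {0..1} t *\<^sub>R (?s *\<^sub>R dd (perp e) P (slide e t x))) = P (slide e 1 x) - P (slide e 0 x)"
    by (rule integral_FTC_Icc) (auto intro!: v continuous_intros c0 smooth_dd assms)
  then show "?s *\<^sub>R normal_average e 0 (dd (perp e) P) x = P (slide e 1 x) - P (slide e 0 x)"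
    unfolding normal_average_def integral_scaleR_right[symmetric]
    by (simp add: mult.commute)
  have "((\<lambda>t. t *\<^sub>R P (slide e t x)) has_vector_derivative (t *\<^sub>R (?s *\<^sub>R dd (perp e) P (slide e t x)) + 1 *\<^sub>R P (slide e t x))) (at t within {0..1})" for t
    by (rule has_vector_derivative_scaleR[OF _ v]) (simp add: has_real_derivative_iff_has_vector_derivative[symmetric])
  then have "(LINT t|lborel. indicator {0..1} t *\<^sub>R (t *\<^sub>R (?s *\<^sub>R dd (perp e) P (slide e t x)) + 1 *\<^sub>R P (slide e t x)))
      = 1 *\<^sub>R P (slide e 1 x) - 0 *\<^sub>R P (slide e 0 x)"
    by (intro integral_FTC_Icc) (auto intro!: continuous_intros c0 smooth_dd assms)
  moreover have "(LINT t|lborel. indicator {0..1} t *\<^sub>R (t *\<^sub>R (?s *\<^sub>R dd (perp e) P (slide e t x)) + 1 *\<^sub>R P (slide e t x)))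
    = (LINT t|lborel. indicator {0..1} t *\<^sub>R (t ^ 0 *\<^sub>R P (slide e t x)) + ?s *\<^sub>R (indicator {0..1} t *\<^sub>R (t ^ 1 *\<^sub>R dd (perp e) P (slide e t x))))"
    by (intro Bochner_Integration.integral_cong) (auto simp: algebra_simps)
  moreover have "\<dots> = normal_average e 0 P x + ?s *\<^sub>R normal_average e 1 (dd (perp e) P) x"
    unfolding normal_average_def
    by (subst Bochner_Integration.integral_add[OF int[OF assms] integrable_scaleR_right[OF int[OF smooth_dd[OF assms]]]])
      (simp only: integral_scaleR_right)
  ultimately show "normal_average e 0 P x + ?s *\<^sub>R normal_average e 1 (dd (perp e) P) x = P (slide e 1 x)" by simp
qed

lemma normal_primitive_has_derivative:
  assumes P: "smooth P" "bsupp P" and e: "norm e = 1"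
  shows "(normal_primitive e P has_derivative (\<lambda>h. (h \<bullet> e) *\<^sub>R normal_primitive e (dd e P) x + (h \<bullet> perp e) *\<^sub>R P x)) (at x)"
proof -
  let ?n = "perp e" and ?J = "normal_average e"
  have "((\<lambda>x. x \<bullet> ?n) has_derivative (\<lambda>h. h \<bullet> ?n)) (at x)"
    by (rule bounded_linear_imp_has_derivative[OF bounded_linear_inner_left])
  from has_derivative_scaleR[OF this normal_average_has_derivative[OF P e, of 0 x]]
  have "(normal_primitive e P has_derivative (\<lambda>h. (x \<bullet> ?n) *\<^sub>R ((h \<bullet> e) *\<^sub>R ?J 0 (dd e P) x + (h \<bullet> ?n) *\<^sub>R ?J (Suc 0) (dd ?n P) x)
      + (h \<bullet> ?n) *\<^sub>R ?J 0 P x)) (at x)"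
    by (simp add: normal_primitive_def[abs_def])
  moreover have "(x \<bullet> ?n) *\<^sub>R ((h \<bullet> e) *\<^sub>R ?J 0 (dd e P) x + (h \<bullet> ?n) *\<^sub>R ?J (Suc 0) (dd ?n P) x) + (h \<bullet> ?n) *\<^sub>R ?J 0 P x
     = (h \<bullet> e) *\<^sub>R normal_primitive e (dd e P) x + (h \<bullet> ?n) *\<^sub>R P x" for h
  proof -
    have "P x = ?J 0 P x + (x \<bullet> ?n) *\<^sub>R ?J 1 (dd ?n P) x"
      using slide_FTC(2)[OF P(1), of e x] by (simp add: slide_1[OF e])
    then show ?thesis by (simp add: normal_primitive_def algebra_simps)
  qed
  ultimately show ?thesis by simp
qed

lemma pd_normal_primitive:
  assumes "smooth P" "bsupp P" "norm e = 1"
  shows "pd i (normal_primitive e P) x = (e $ i) *\<^sub>R normal_primitive e (dd e P) x + (perp e $ i) *\<^sub>R P x"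
  using pd_eq[OF normal_primitive_has_derivative[OF assms], of i] by (simp add: inner_axis')

lemma dd_normal_primitive:
  assumes "smooth P" "bsupp P" "norm e = 1"
  shows "dd (perp e) (normal_primitive e P) x = P x"
    "dd e (normal_primitive e P) x = normal_primitive e (dd e P) x"
proof -
  have "e \<bullet> e = 1" "perp e \<bullet> perp e = 1" "e \<bullet> perp e = 0" "perp e \<bullet> e = 0"
    using unit_square[OF assms(3)] by (simp_all add: inner_vec2 algebra_simps)
  then show "dd (perp e) (normal_primitive e P) x = P x"
    "dd e (normal_primitive e P) x = normal_primitive e (dd e P) x"
    by (simp_all add: dd_eq[OF normal_primitive_has_derivative[OF assms]])
qed

text \<open>A partial derivative of the primitive of \<open>Q\<close> is a multiple of the primitive
  of \<open>dd e Q\<close> plus a multiple of \<open>Q\<close>; putting all smooth functions into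
  the family takes care of the second summand.\<close>

lemma smooth_normal_primitive:
  assumes "smooth P" "bsupp P" and e: "norm e = 1"
  shows "smooth (normal_primitive e P)"
proof (rule smooth_coinduct[of _ "{f. smooth f} \<union> {\<lambda>x. c *\<^sub>R normal_primitive e Q x | c Q. smooth Q \<and> bsupp Q}"])
  let ?X = "{f. smooth f} \<union> {\<lambda>x. c *\<^sub>R normal_primitive e Q x | c Q. smooth Q \<and> bsupp Q}"
  have "(\<lambda>x. 1 *\<^sub>R normal_primitive e P x) \<in> ?X" using assms by blast
  then show "normal_primitive e P \<in> ?X" by simp
  have d: "normal_primitive e Q differentiable (at x)" if "smooth Q" "bsupp Q" for Q x
    by (rule differentiableI[OF normal_primitive_has_derivative[OF that e]])
  show "h differentiable (at x)" if "h \<in> ?X" for h x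
  proof -
    from that consider "smooth h" | c Q where "h = (\<lambda>x. c *\<^sub>R normal_primitive e Q x)" "smooth Q" "bsupp Q" by blast
    then show ?thesis
    proof cases
      case 2
      then show ?thesis
        using differentiableI[OF has_derivative_scaleR_right[OF normal_primitive_has_derivative[OF 2(2,3) e]]] by simp
    qed (rule smoothD)
  qed
  show "\<exists>gs. set gs \<subseteq> ?X \<and> (\<forall>x\<in>UNIV. pd i h x = (\<Sum>g\<leftarrow>gs. g x))" if "h \<in> ?X" for h i
  proof -
    from that consider "smooth h" | c Q where "h = (\<lambda>x. c *\<^sub>R normal_primitive e Q x)" "smooth Q" "bsupp Q" by blast
    then show ?thesis
    proof cases
      case 1
      then show ?thesis by (intro exI[of _ "[pd i h]"]) (auto intro: smooth_pd)
    next
      case 2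
      let ?a = "\<lambda>x. (c * e $ i) *\<^sub>R normal_primitive e (dd e Q) x" and ?b = "\<lambda>x. (c * perp e $ i) *\<^sub>R Q x"
      have "?a \<in> ?X" using smooth_dd[OF 2(2)] bsupp_dd[OF 2(3)] by blast
      moreover have "smooth ?b" by (rule smooth_scaleR[OF smooth_const 2(2)])
      moreover have "pd i h x = ?a x + ?b x" for x
        unfolding 2(1) pd_bounded_linear[OF bounded_linear_scaleR_right d[OF 2(2,3)]] pd_normal_primitive[OF 2(2,3) e]
        by (simp add: scaleR_add_right)
      ultimately show ?thesis by (intro exI[of _ "[?a, ?b]"]) simp
    qed
  qed
qed

lemma normal_average_cong:
  "(\<And>t. 0 \<le> t \<Longrightarrow> t \<le> 1 \<Longrightarrow> P (slide e t x) = Q (slide e t x)) \<Longrightarrow> normal_average e m P x = normal_average e m Q x"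
  unfolding normal_average_def by (intro Bochner_Integration.integral_cong) (auto simp: indicator_def)

text \<open>The second normal derivative of \<open>V\<close> is the normal derivative of
  \<open>P\<close>. The second tangential one is the primitive of \<open>- k P\<close> minus the
  second normal derivative of \<open>P\<close>, that is \<open>- k V\<close> minus the normal
  derivative of \<open>P\<close> at \<open>x\<close> plus the one at the foot. The sum is
  \<open>- k V\<close> plus the term at the foot, which vanishes because \<open>P\<close> is
  even.\<close>

lemma cauchy_problem:
  assumes v: "solution_on k (ball 0 r) v" "bsupp v" and e: "norm e = 1"
  obtains V where "solution_on k (ball 0 r) V" "\<And>x. x \<bullet> perp e = 0 \<Longrightarrow> V x = 0"
    "\<And>x. x \<bullet> perp e = 0 \<Longrightarrow> dd (perp e) V x = v x"
proof -
  let ?n = "perp e"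
  \<comment> \<open>The even part of \<open>v\<close> under the reflection: a solution with the
    values of \<open>v\<close> on the line and normal derivative 0 there.\<close>
  define P where "P x = (1 / 2) * v x + (1 / 2) * v (reflect e x)" for x
  have sv: "smooth v" by (rule solution_smooth[OF v(1)])
  have solP: "solution_on k (ball 0 r) P"
    unfolding P_def
    by (rule solution_add[OF solution_cmult[OF v(1)] solution_cmult[OF solution_reflect[OF v(1) e]]])
  have sP: "smooth P" by (rule solution_smooth[OF solP])
  have bP: "bsupp P"
  proof -
    obtain R where R: "\<And>x. norm x \<ge> R \<Longrightarrow> v x = 0" using bsuppE[OF v(2)] by blast
    have "P x = 0" if "norm x \<ge> R" for x using R[of x] R[of "reflect e x"] that by (simp add: P_def norm_reflect[OF e])
    then show ?thesis by (intro bounded_subset[OF bounded_cball[of 0 R]]) (force simp: not_le[symmetric])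
  qed
  have dP: "dd ?n P x = 0" if "x \<bullet> ?n = 0" for x
  proof -
    have m: "dd (- a) h y = - dd a h y" for a y and h :: "real^2 \<Rightarrow> complex"
      by (simp add: dd_def sum_negf)
    have P': "P = (\<lambda>x. (1 / 2) *\<^sub>R v x + (1 / 2) *\<^sub>R v (reflect e x))"
      by (simp add: P_def[abs_def] scaleR_conv_of_real)
    have "dd ?n P x = (1 / 2) *\<^sub>R dd ?n v x + (1 / 2) *\<^sub>R dd ?n (\<lambda>x. v (reflect e x)) x"
      unfolding P'
      by (subst dd_smooth_add[OF smooth_scaleR[OF smooth_const sv] smooth_scaleR[OF smooth_const smooth_reflect[OF sv]]])
        (simp only: dd_smooth_scaleR[OF sv] dd_smooth_scaleR[OF smooth_reflect[OF sv]])
    also have "\<dots> = 0"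
      by (simp add: dd_compose_linear[OF bounded_linear_reflect sv] reflect_perp m reflect_line[OF e that])
    finally show ?thesis .
  qed
  define V where "V = normal_primitive e P"
  have sV: "smooth V" unfolding V_def by (rule smooth_normal_primitive[OF sP bP e])
  have "lap V x = - (k *\<^sub>R V x)" if x: "x \<in> ball 0 r" for x
  proof -
    have e1: "dd ?n V = P" unfolding V_def by (rule ext) (rule dd_normal_primitive(1)[OF sP bP e])
    have e2: "dd e V = normal_primitive e (dd e P)" unfolding V_def by (rule ext) (rule dd_normal_primitive(2)[OF sP bP e])
    have "lap V x = dd ?n P x + normal_primitive e (dd e (dd e P)) x"
      unfolding lap_orthonormal[OF sV e] e1 e2 dd_normal_primitive(2)[OF smooth_dd[OF sP] bsupp_dd[OF bP] e] by simp
    \<comment> \<open>The equation for \<open>P\<close> holds only inside the ball; the segment from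
      the foot to \<open>x\<close> stays inside because \<open>slide\<close> does not increase the
      norm.\<close>
    also have "normal_average e 0 (dd e (dd e P)) x = normal_average e 0 (\<lambda>y. - (k *\<^sub>R P y) - dd ?n (dd ?n P) y) x"
    proof (rule normal_average_cong)
      fix t :: real assume "0 \<le> t" "t \<le> 1"
      then have "slide e t x \<in> ball 0 r" using norm_slide[OF e, of t x] x by simp
      then have "lap P (slide e t x) = - (k *\<^sub>R P (slide e t x))" using solP by (simp add: solution_on_def)
      then show "dd e (dd e P) (slide e t x) = - (k *\<^sub>R P (slide e t x)) - dd ?n (dd ?n P) (slide e t x)"
        by (simp add: lap_orthonormal[OF sP e] algebra_simps)
    qed
    then have "normal_primitive e (dd e (dd e P)) x
      = (x \<bullet> ?n) *\<^sub>R normal_average e 0 (\<lambda>y. - (k *\<^sub>R P y) - dd ?n (dd ?n P) y) x"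
      by (simp add: normal_primitive_def)
    also have "normal_average e 0 (\<lambda>y. - (k *\<^sub>R P y) - dd ?n (dd ?n P) y) x
      = - (k *\<^sub>R normal_average e 0 P x) - normal_average e 0 (dd ?n (dd ?n P)) x"
    proof -
      have cont: "continuous_on UNIV (\<lambda>t. t ^ 0 *\<^sub>R Q (slide e t x))" if "smooth Q" for Q :: "real^2 \<Rightarrow> complex"
        by (intro continuous_intros continuous_on_compose2[OF smooth_continuous[OF that, of UNIV] continuous_slide]) auto
      note i = unit_interval_integrable[OF cont[OF sP]] unit_interval_integrable[OF cont[OF smooth_dd[OF smooth_dd[OF sP]]], of ?n ?n]
      have "normal_average e 0 (\<lambda>y. - (k *\<^sub>R P y) - dd ?n (dd ?n P) y) x
        = (LINT t|lborel. (- k) *\<^sub>R (indicator {0..1} t *\<^sub>R (t ^ 0 *\<^sub>R P (slide e t x))) - indicator {0..1} t *\<^sub>R (t ^ 0 *\<^sub>R dd ?n (dd ?n P) (slide e t x)))"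
        unfolding normal_average_def by (intro Bochner_Integration.integral_cong) (auto simp: algebra_simps)
      also have "\<dots> = (- k) *\<^sub>R normal_average e 0 P x - normal_average e 0 (dd ?n (dd ?n P)) x"
        unfolding normal_average_def
        by (subst Bochner_Integration.integral_diff[OF integrable_scaleR_right[OF i(1)] i(2)]) (simp only: integral_scaleR_right)
      finally show ?thesis by simp
    qed
    also have "(x \<bullet> ?n) *\<^sub>R (- (k *\<^sub>R normal_average e 0 P x) - normal_average e 0 (dd ?n (dd ?n P)) x)
      = - (k *\<^sub>R V x) - (x \<bullet> ?n) *\<^sub>R normal_average e 0 (dd ?n (dd ?n P)) x"
      by (simp add: V_def normal_primitive_def algebra_simps)
    also have "(x \<bullet> ?n) *\<^sub>R normal_average e 0 (dd ?n (dd ?n P)) x = dd ?n P x - dd ?n P (slide e 0 x)"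
      unfolding slide_FTC(1)[OF smooth_dd[OF sP]] slide_1[OF e] ..
    also have "dd ?n P (slide e 0 x) = 0"
      by (rule dP) (simp add: slide_def inner_vec2)
    finally show ?thesis by simp
  qed
  then have "solution_on k (ball 0 r) V" using sV by (auto simp: solution_on_def)
  moreover have "V x = 0" if "x \<bullet> ?n = 0" for x using that by (simp add: V_def normal_primitive_def)
  moreover have "dd ?n V x = v x" if "x \<bullet> ?n = 0" for x
    unfolding V_def dd_normal_primitive(1)[OF sP bP e] by (simp add: P_def reflect_line[OF e that])
  ultimately show ?thesis by (rule that)
qed

text \<open>The zeros reached from \<open>b0\<close> by repeated rotation lie at the angles
  \<open>b0 + 2 * n * \<theta>\<close>. By Kronecker's theorem these are dense modulo
  \<open>2 * pi\<close>, and a continuous function vanishing on a dense set vanishes.\<close>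

lemma irrational_rotation_zero:
  assumes irr: "\<theta> / pi \<notin> \<rat>" and f: "continuous_on UNIV (f :: real^2 \<Rightarrow> complex)"
    and rot: "\<And>b. f (\<rho> *\<^sub>R direction (b + 2 * \<theta>)) = f (\<rho> *\<^sub>R direction b)"
    and z: "f (\<rho> *\<^sub>R direction b0) = 0"
  shows "f (\<rho> *\<^sub>R direction b) = 0"
proof -
  define g where "g b = f (\<rho> *\<^sub>R direction b)" for b
  have dir: "direction b = cos b *\<^sub>R axis 1 1 + sin b *\<^sub>R axis 2 1" for b
    by (simp add: direction_def vec2_eq_iff axis_def)
  have cg: "continuous_on UNIV g"
    unfolding g_def dir by (intro continuous_on_compose2[OF f] continuous_intros) auto
  have p1: "g (b + 2 * pi * of_int m) = g b" for b and m :: int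
    using cos_int_2pin sin_int_2pin by (simp add: g_def direction_def cos_add sin_add mult.assoc)
  have p2: "g (b + 2 * real n * \<theta>) = g b" for b n
  proof (induction n)
    case (Suc n)
    have "g (b + 2 * real (Suc n) * \<theta>) = g ((b + 2 * real n * \<theta>) + 2 * \<theta>)" by (simp add: algebra_simps)
    also have "\<dots> = g (b + 2 * real n * \<theta>)" using rot by (simp add: g_def)
    finally show ?case using Suc by simp
  qed simp
  \<comment> \<open>Angles are measured from \<open>b0\<close> in full turns, so that
    \<open>b\<close> corresponds to a number in the unit interval, as Kronecker's theorem
    requires.\<close>
  define \<alpha> where "\<alpha> = frac ((b - b0) / (2 * pi))"
  have a: "0 \<le> \<alpha>" "\<alpha> \<le> 1" using frac_lt_1[of "(b - b0) / (2 * pi)"] by (auto simp: \<alpha>_def)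
  define c where "c = b0 + 2 * pi * \<alpha>"
  have "b = c + 2 * pi * of_int \<lfloor>(b - b0) / (2 * pi)\<rfloor>"
    by (simp add: c_def \<alpha>_def frac_def field_simps)
  then have bc: "g b = g c" using p1 by metis
  have gz: "g (b0 + 2 * pi * frac (real n * (\<theta> / pi))) = 0" for n
  proof -
    have "b0 + 2 * pi * frac (real n * (\<theta> / pi)) = (b0 + 2 * real n * \<theta>) + 2 * pi * of_int (- \<lfloor>real n * (\<theta> / pi)\<rfloor>)"
      by (simp add: frac_def field_simps)
    then have "g (b0 + 2 * pi * frac (real n * (\<theta> / pi))) = g (b0 + 2 * real n * \<theta>)" using p1 by metis
    then show ?thesis using p2 z by (simp add: g_def)
  qed
  have "g c = 0"
  proof (rule ccontr)
    assume "g c \<noteq> 0"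
    then have "norm (g c) > 0" by simp
    moreover have "isCont g c" using cg by (simp add: continuous_on_eq_continuous_at)
    ultimately obtain d where d: "d > 0" "\<And>y. dist y c < d \<Longrightarrow> dist (g y) (g c) < norm (g c)"
      unfolding continuous_at_eps_delta by metis
    obtain n where n: "\<bar>frac (real n * (\<theta> / pi)) - \<alpha>\<bar> < d / (2 * pi)"
      using Kronecker_approx_1_explicit[OF irr a, of "d / (2 * pi)"] d(1) by auto
    define y where "y = b0 + 2 * pi * frac (real n * (\<theta> / pi))"
    have "y - c = 2 * pi * (frac (real n * (\<theta> / pi)) - \<alpha>)" by (simp add: y_def c_def algebra_simps)
    then have "dist y c = 2 * pi * \<bar>frac (real n * (\<theta> / pi)) - \<alpha>\<bar>" by (simp add: dist_real_def abs_mult)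
    also have "\<dots> < d" using n by (simp add: field_simps)
    finally have "dist (g y) (g c) < norm (g c)" by (rule d(2))
    then show False using gz[of n] by (simp add: y_def)
  qed
  then show ?thesis using bc by (simp add: g_def)
qed

lemma reflect_direction: "reflect (direction a) (\<rho> *\<^sub>R direction b) = \<rho> *\<^sub>R direction (2 * a - b)"
proof -
  have "direction b \<bullet> direction a = cos (a - b)"
    by (simp add: inner_vec2 direction_def cos_diff mult.commute)
  moreover have "2 * cos (a - b) * cos a - cos b = cos (2 * a - b)" "2 * cos (a - b) * sin a - sin b = sin (2 * a - b)"
    using cos_add[of "a - b" a] cos_diff[of "a - b" a] sin_add[of "a - b" a] sin_diff[of "a - b" a]
    by (simp_all add: algebra_simps)
  ultimately show ?thesis
    by (simp add: reflect_def vec2_eq_iff direction_def algebra_simps)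
qed

section \<open>Solutions near a corner\<close>

text \<open>A convex corner with vertex \<open>0\<close> and sides spanned by the unit vectors \<open>e\<close>, \<open>f\<close>, whose exterior
  unit normals are \<open>\<nu>\<close> and \<open>\<mu>\<close>.\<close>

definition corner :: "real^2 \<Rightarrow> real^2 \<Rightarrow> real^2 \<Rightarrow> real^2 \<Rightarrow> bool" where
  "corner e \<nu> f \<mu> \<longleftrightarrow> norm e = 1 \<and> norm f = 1 \<and> (\<nu> = perp e \<or> \<nu> = - perp e) \<and> (\<mu> = perp f \<or> \<mu> = - perp f)
     \<and> \<nu> \<bullet> f < 0 \<and> \<mu> \<bullet> e < 0"

definition closed_cone :: "real^2 \<Rightarrow> real^2 \<Rightarrow> (real^2) set" where
  "closed_cone \<nu> \<mu> = {x. \<nu> \<bullet> x \<le> 0 \<and> \<mu> \<bullet> x \<le> 0}"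

text \<open>The removed ray contains the vertex. A test function on the slit ball thus vanishes near
  the vertex and near the part of the side along \<open>f\<close> inside the ball, and it meets the
  boundary of the corner only in the open side along \<open>e\<close>.\<close>

definition slit_ball :: "real \<Rightarrow> real^2 \<Rightarrow> (real^2) set" where
  "slit_ball r f = ball 0 r - {t *\<^sub>R f | t. t \<ge> 0}"

lemma corner_sym: "corner e \<nu> f \<mu> \<Longrightarrow> corner f \<mu> e \<nu>"
  by (auto simp: corner_def)

lemma cone_sym: "cone e f = cone f e"
  unfolding cone_def by (auto simp: add.commute) (metis add.commute)+

lemma corner_orth:
  assumes "corner e \<nu> f \<mu>"
  shows "\<nu> \<bullet> e = 0" "\<mu> \<bullet> f = 0" "e \<bullet> e = 1" "f \<bullet> f = 1"
  using assms norm_eq_1[of e] norm_eq_1[of f] by (auto simp: corner_def inner_vec2)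

lemma orth_to_normal:
  assumes "norm e = 1" "\<nu> = perp e \<or> \<nu> = - perp e" "\<nu> \<bullet> x = 0"
  shows "x = (x \<bullet> e) *\<^sub>R e"
proof -
  have "x \<bullet> perp e = 0" using assms(2,3) by (auto simp: inner_commute)
  then show ?thesis using vec2_decompose[OF assms(1), of x] by simp
qed

text \<open>\<open>\<mu>\<close> is orthogonal to \<open>f\<close> and \<open>\<nu>\<close> to
  \<open>e\<close>, so pairing with the normals reads off the coordinates along the two
  sides.\<close>

lemma corner_repr:
  assumes c: "corner e \<nu> f \<mu>"
  shows "x = (\<mu> \<bullet> x / (\<mu> \<bullet> e)) *\<^sub>R e + (\<nu> \<bullet> x / (\<nu> \<bullet> f)) *\<^sub>R f"
proof -
  define d where "d = x - ((\<mu> \<bullet> x / (\<mu> \<bullet> e)) *\<^sub>R e + (\<nu> \<bullet> x / (\<nu> \<bullet> f)) *\<^sub>R f)"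
  have n: "\<nu> \<bullet> f \<noteq> 0" "\<mu> \<bullet> e \<noteq> 0" using c by (auto simp: corner_def)
  have "\<nu> \<bullet> d = 0" "\<mu> \<bullet> d = 0"
    using n corner_orth[OF c] by (simp_all add: d_def inner_diff_right inner_add_right)
  then have d: "d = (d \<bullet> e) *\<^sub>R e"
    using orth_to_normal[of e \<nu> d] c by (auto simp: corner_def)
  then have "(d \<bullet> e) * (\<mu> \<bullet> e) = \<mu> \<bullet> d" by (metis inner_scaleR_right)
  then have "d \<bullet> e = 0" using n \<open>\<mu> \<bullet> d = 0\<close> by simp
  then show ?thesis using d by (simp add: d_def)
qed

lemma cone_halfplanes:
  assumes c: "corner e \<nu> f \<mu>"
  shows "cone e f = {x. \<nu> \<bullet> x < 0 \<and> \<mu> \<bullet> x < 0}"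
proof (intro equalityI subsetI)
  have n: "\<nu> \<bullet> f < 0" "\<mu> \<bullet> e < 0" using c by (auto simp: corner_def)
  fix x
  { assume "x \<in> cone e f"
    then obtain s t where x: "x = s *\<^sub>R e + t *\<^sub>R f" "s > 0" "t > 0" unfolding cone_def by blast
    then show "x \<in> {x. \<nu> \<bullet> x < 0 \<and> \<mu> \<bullet> x < 0}"
      using n corner_orth[OF c] by (simp add: inner_add_right mult_pos_neg) }
  { assume "x \<in> {x. \<nu> \<bullet> x < 0 \<and> \<mu> \<bullet> x < 0}"
    then have "\<mu> \<bullet> x / (\<mu> \<bullet> e) > 0" "\<nu> \<bullet> x / (\<nu> \<bullet> f) > 0" using n by (auto intro: divide_neg_neg)
    then show "x \<in> cone e f" unfolding cone_def using corner_repr[OF c, of x] by blast }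
qed

lemma open_cone: "corner e \<nu> f \<mu> \<Longrightarrow> open (cone e f)"
  unfolding cone_halfplanes by (intro open_Collect_conj open_halfspace_lt)

lemma closed_closed_cone: "closed (closed_cone \<nu> \<mu>)"
  unfolding closed_cone_def by (intro closed_Collect_conj closed_halfspace_le)

lemma corner_nonzero: "corner e \<nu> f \<mu> \<Longrightarrow> \<nu> \<noteq> 0 \<and> \<mu> \<noteq> 0"
  by (auto simp: corner_def)

lemma ray_in_closed_cone:
  assumes "corner e \<nu> f \<mu>"
  shows "{t *\<^sub>R f | t. t \<ge> 0} \<subseteq> closed_cone \<nu> \<mu>" "{t *\<^sub>R f | t. t \<ge> 0} \<inter> cone e f = {}"
proof -
  have n: "\<nu> \<bullet> f < 0" using assms by (auto simp: corner_def)
  show "{t *\<^sub>R f | t. t \<ge> 0} \<subseteq> closed_cone \<nu> \<mu>"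
    using n corner_orth[OF assms] by (auto simp: closed_cone_def mult_nonneg_nonpos)
  show "{t *\<^sub>R f | t. t \<ge> 0} \<inter> cone e f = {}"
    unfolding cone_halfplanes[OF assms] using corner_orth[OF assms] by auto
qed

lemma closed_cone_boundary_null:
  assumes c: "corner e \<nu> f \<mu>"
  shows "AE x in lborel. x \<in> closed_cone \<nu> \<mu> \<longrightarrow> x \<in> cone e f"
proof -
  have n0: "negligible {x. a \<bullet> x = 0}" if "a \<noteq> 0" for a :: "real^2"
    using negligible_hyperplane[of a 0] that by simp
  have "AE x in lborel. x \<notin> {x. a \<bullet> x = 0}" if a0: "a \<noteq> 0" for a :: "real^2"
  proof -
    obtain N' where "N' \<in> null_sets lborel" "{x. a \<bullet> x = 0} \<subseteq> N'"
      using n0[OF a0] null_sets_completion_iff2[of "{x. a \<bullet> x = 0}" lborel] by (auto simp: negligible_iff_null_sets)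
    then show ?thesis by (intro AE_I'[of N']) auto
  qed
  from this[of \<nu>] this[of \<mu>] corner_nonzero[OF c]
  have "AE x in lborel. x \<notin> {x. \<nu> \<bullet> x = 0}" "AE x in lborel. x \<notin> {x. \<mu> \<bullet> x = 0}" by auto
  then show ?thesis
    by eventually_elim (auto simp: cone_halfplanes[OF c] closed_cone_def)
qed

lemma open_slit_ball:
  assumes "norm f = 1"
  shows "open (slit_ball r f)"
proof -
  have "{t *\<^sub>R f | t. t \<ge> 0} = {x. perp f \<bullet> x = 0 \<and> f \<bullet> x \<ge> 0}"
  proof (intro equalityI subsetI)
    fix x assume "x \<in> {t *\<^sub>R f | t. t \<ge> 0}"
    then show "x \<in> {x. perp f \<bullet> x = 0 \<and> f \<bullet> x \<ge> 0}" by (auto simp: inner_vec2[of "perp f"] mult_nonneg_nonneg)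
  next
    fix x assume "x \<in> {x. perp f \<bullet> x = 0 \<and> f \<bullet> x \<ge> 0}"
    then have "x = (x \<bullet> f) *\<^sub>R f" "x \<bullet> f \<ge> 0" using orth_to_normal[OF assms, of "perp f" x] by (auto simp: inner_commute)
    then show "x \<in> {t *\<^sub>R f | t. t \<ge> 0}" by blast
  qed
  moreover have "closed {x. perp f \<bullet> x = 0 \<and> f \<bullet> x \<ge> 0}"
    by (intro closed_Collect_conj closed_hyperplane closed_halfspace_ge)
  ultimately show ?thesis unfolding slit_ball_def by (simp add: open_Diff)
qed

text \<open>Star-shaped about a point of the ray opposite to the slit: a segment from there to a
  point off the line of \<open>f\<close> meets that line only at its start, and a segment within the
  line ends on the negative half and stays there.\<close>

lemma connected_slit_ball:
  assumes f: "norm f = 1" and r: "r > 0"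
  shows "connected (slit_ball r f)"
proof (rule starlike_imp_connected)
  define p where "p = (- (r / 2)) *\<^sub>R f"
  have ff: "f \<bullet> f = 1" using f by (simp add: norm_eq_1)
  have pf: "perp f \<bullet> f = 0" by (simp add: inner_vec2)
  have p: "p \<in> slit_ball r f"
  proof -
    have "p \<noteq> t *\<^sub>R f" if "t \<ge> 0" for t
    proof
      assume "p = t *\<^sub>R f"
      then have "p \<bullet> f = t" using ff by simp
      then show False using ff r that by (simp add: p_def)
    qed
    moreover have "norm p < r" using r f by (simp add: p_def)
    ultimately show ?thesis by (auto simp: slit_ball_def)
  qed
  have "closed_segment p x \<subseteq> slit_ball r f" if x: "x \<in> slit_ball r f" for x
  proof
    fix y assume y: "y \<in> closed_segment p x"
    then obtain s where s: "0 \<le> s" "s \<le> 1" "y = (1 - s) *\<^sub>R p + s *\<^sub>R x" by (auto simp: closed_segment_def)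
    have "y \<in> ball 0 r"
      using y closed_segment_subset[of p "ball 0 r" x] p x by (auto simp: slit_ball_def)
    moreover have "y \<noteq> t *\<^sub>R f" if t: "t \<ge> 0" for t
    proof
      assume yt: "y = t *\<^sub>R f"
      then have "perp f \<bullet> y = 0" using pf by simp
      moreover have "perp f \<bullet> y = (1 - s) * (perp f \<bullet> p) + s * (perp f \<bullet> x)"
        by (simp add: s(3) inner_add_right)
      moreover have "perp f \<bullet> p = 0" using pf by (simp add: p_def)
      ultimately have 1: "s * (perp f \<bullet> x) = 0" by simp
      have "y \<bullet> f = t" using ff yt by simp
      moreover have "y \<bullet> f = (1 - s) * (p \<bullet> f) + s * (x \<bullet> f)"
        by (simp add: s(3) inner_add_left)
      moreover have "p \<bullet> f = - (r / 2)" using ff by (simp add: p_def)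
      ultimately have 2: "- ((1 - s) * (r / 2)) + s * (x \<bullet> f) = t" by simp
      show False
      proof (cases "s = 0")
        case True
        then show False using 2 t r by simp
      next
        case False
        then have "x = (x \<bullet> f) *\<^sub>R f" using 1 orth_to_normal[OF f, of "perp f" x] by simp
        then have neg: "x \<bullet> f < 0" using x unfolding slit_ball_def by (cases "x \<bullet> f \<ge> 0") auto
        have "s * (x \<bullet> f) < 0" using False s(1) neg by (simp add: mult_pos_neg)
        moreover have "(1 - s) * (r / 2) \<ge> 0" using s(2) r by simp
        ultimately show False using 2 t by linarith
      qed
    qed
    ultimately show "y \<in> slit_ball r f" by (auto simp: slit_ball_def)
  qed
  with p show "starlike (slit_ball r f)" unfolding starlike_def by blast
qed

lemma slit_ball_subset: "slit_ball r f \<subseteq> ball 0 r"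
  by (auto simp: slit_ball_def)

lemma cone_contains_ball:
  assumes c: "corner e \<nu> f \<mu>" and r: "r > 0"
  obtains z d where "d > 0" "ball z d \<subseteq> cone e f \<inter> ball 0 r"
proof -
  define z where "z = (r / 4) *\<^sub>R e + (r / 4) *\<^sub>R f"
  have "z \<in> cone e f" unfolding cone_def z_def using r by fastforce
  moreover have "norm z < r"
  proof -
    have "norm z \<le> norm ((r / 4) *\<^sub>R e) + norm ((r / 4) *\<^sub>R f)" unfolding z_def by (rule norm_triangle_ineq)
    also have "\<dots> < r" using c r by (simp add: corner_def)
    finally show ?thesis .
  qed
  moreover have "open (cone e f \<inter> ball 0 r)" by (intro open_Int open_cone[OF c] open_ball)
  ultimately show ?thesis using that unfolding open_contains_ball by (metis IntI dist_0_norm mem_ball)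
qed

text \<open>The opposite cone, spanned by \<open>- e\<close> and \<open>- f\<close>, is again a
  corner and misses the closed one.\<close>

lemma exterior_contains_ball:
  assumes c: "corner e \<nu> f \<mu>" and r: "r > 0"
  obtains z d where "d > 0" "ball z d \<subseteq> ball 0 r - closed_cone \<nu> \<mu>"
proof -
  have "corner (- e) (- \<nu>) (- f) (- \<mu>)"
    using c by (auto simp: corner_def perp_def vec2_eq_iff)
  then obtain z d where zd: "d > 0" "ball z d \<subseteq> cone (- e) (- f) \<inter> ball 0 r" and c': "corner (- e) (- \<nu>) (- f) (- \<mu>)"
    using cone_contains_ball[OF _ r] by metis
  have "cone (- e) (- f) \<inter> closed_cone \<nu> \<mu> = {}"
    unfolding cone_halfplanes[OF c'] closed_cone_def by auto
  with zd show ?thesis using that by blast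
qed

section \<open>Green's formula on a corner with one side excluded\<close>

definition side_integral :: "real^2 \<Rightarrow> (real^2 \<Rightarrow> complex) \<Rightarrow> complex" where
  "side_integral e F = (LINT s|lborel. indicator {0<..} s *\<^sub>R F (s *\<^sub>R e))"

abbreviation cut :: "(real^2) set \<Rightarrow> (real^2 \<Rightarrow> complex) \<Rightarrow> real^2 \<Rightarrow> complex" where
  "cut A u \<equiv> \<lambda>x. indicator A x *\<^sub>R u x"

lemma cut_measurable: "A \<in> sets borel \<Longrightarrow> u \<in> borel_measurable borel \<Longrightarrow> cut A u \<in> borel_measurable borel"
  by (intro borel_measurable_scaleR borel_measurable_indicator)

lemma L2_cut_ball:
  assumes "smooth w"
  shows "cut (ball 0 r) w \<in> L2 lborel"
proof (rule L2_bound)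
  show "cut (ball 0 r) w \<in> borel_measurable lborel"
    using cut_measurable[OF _ smooth_borel[OF assms], of "ball 0 r"] by simp
  show "integrable lborel (\<lambda>x. indicator (ball 0 r) x * (norm (w x))\<^sup>2)" by (rule sqn_ball_integrable[OF assms])
  show "(norm (cut (ball 0 r) w x))\<^sup>2 \<le> indicator (ball 0 r) x * (norm (w x))\<^sup>2" for x
    by (simp add: indicator_def)
qed

lemma cut_ball_test:
  assumes "\<phi> \<in> test_functions (ball 0 r)"
  shows "\<phi> x *\<^sub>R cut (ball 0 r) w x = \<phi> x *\<^sub>R w x" "pd i \<phi> x *\<^sub>R cut (ball 0 r) w x = pd i \<phi> x *\<^sub>R w x"
    "lap \<phi> x *\<^sub>R cut (ball 0 r) w x = lap \<phi> x *\<^sub>R w x"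
  using test_zero[OF assms, of x] by (cases "x \<in> ball 0 r"; simp)+

lemma smooth_weak_pd:
  assumes w: "smooth w"
  shows "has_weak_pd (ball 0 r) i (cut (ball 0 r) w) (cut (ball 0 r) (pd i w))"
proof -
  have m: "cut (ball 0 r) w \<in> borel_measurable borel" "cut (ball 0 r) (pd i w) \<in> borel_measurable borel"
    by (intro cut_measurable smooth_borel smooth_pd w; simp)+
  show ?thesis
    by (subst weak_pd_iff[OF open_ball m]) (auto simp: cut_ball_test test_smooth test_bsupp w intro!: ibp simp del: scaleR_scaleR)
qed

lemma smooth_weak_laplacian:
  assumes w: "smooth w"
  shows "has_weak_laplacian (ball 0 r) (cut (ball 0 r) w) (cut (ball 0 r) (lap w))"
proof -
  have m: "cut (ball 0 r) w \<in> borel_measurable borel" "cut (ball 0 r) (lap w) \<in> borel_measurable borel"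
    by (intro cut_measurable smooth_borel smooth_lap w; simp)+
  show ?thesis
    by (subst weak_laplacian_iff[OF open_ball m]) (auto simp: cut_ball_test test_smooth test_bsupp w intro!: green_lap simp del: scaleR_scaleR)
qed

lemma zero_of_AE_zero:
  assumes "continuous_on UNIV y" "open W" "AE x in lborel. x \<in> W \<longrightarrow> y x = (0 :: complex)" "x \<in> W"
  shows "y x = 0"
proof (rule ccontr)
  assume nz: "y x \<noteq> 0"
  let ?N = "W \<inter> {x. y x \<noteq> 0}"
  have "open ?N" by (intro open_Int assms(2) open_Collect_neq assms(1) continuous_on_const)
  moreover have "AE x in lborel. x \<notin> ?N" using assms(3) by eventually_elim auto
  then have "?N \<in> null_sets lborel"
    by (subst AE_iff_null_sets) (use \<open>open ?N\<close> in auto)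
  then have "negligible ?N" using negligible_iff_null_sets null_sets_completionI by blast
  ultimately show False using open_not_negligible[of ?N] nz assms(4) by blast
qed

lemma smooth_ucp:
  assumes y: "solution_on k (ball 0 r) y" and W: "d > 0" "ball z d \<subseteq> ball 0 r" "\<And>x. x \<in> ball z d \<Longrightarrow> y x = 0"
    and x: "x \<in> ball 0 r"
  shows "y x = 0"
proof -
  let ?B = "ball (0::real^2) r"
  have sy: "smooth y" by (rule solution_smooth[OF y])
  have "AE x in lborel. x \<in> ?B \<longrightarrow> cut ?B y x = 0"
  proof (rule ucp_connected[OF open_ball connected_ball L2_cut_ball[OF sy] L2_cut_ball[OF smooth_pd[OF sy]]
        L2_cut_ball[OF smooth_lap[OF sy]] smooth_weak_pd[OF sy] smooth_weak_laplacian[OF sy]])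
    show "AE x in lborel. x \<in> ?B \<longrightarrow> norm (cut ?B (lap y) x) \<le> \<bar>k\<bar> * norm (cut ?B y x)"
      using y by (intro AE_I2) (auto simp: solution_on_def)
    show "z \<in> ?B" using W(1,2) by (meson centre_in_ball subsetD)
    show "d > 0" by fact
    show "AE x in lborel. x \<in> ball z d \<longrightarrow> cut ?B y x = 0" using W(3) by (intro AE_I2) auto
  qed
  then have "AE x in lborel. x \<in> ?B \<longrightarrow> y x = 0" by eventually_elim auto
  from zero_of_AE_zero[OF smooth_continuous[OF sy] open_ball this x] show ?thesis .
qed

text \<open>The equation is assumed in the first-order form in which Green's formula delivers it;
  testing the weak gradient with \<open>pd i \<phi>\<close> converts it to a weak Laplacian, and the
  slit ball is connected.\<close>

lemma slit_ucp:
  assumes f: "norm f = 1" and r: "r > 0" and Z: "Z \<in> L2 lborel" "\<And>i. G i \<in> L2 lborel"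
    and w: "\<And>i. has_weak_pd (slit_ball r f) i Z (G i)"
    and l: "\<And>\<phi>. \<phi> \<in> test_functions (slit_ball r f) \<Longrightarrow>
      (\<Sum>i\<in>UNIV. LINT x|lborel. pd i \<phi> x *\<^sub>R G i x) = k *\<^sub>R (LINT x|lborel. \<phi> x *\<^sub>R Z x)"
    and z: "d > 0" "z \<in> slit_ball r f" "AE x in lborel. x \<in> ball z d \<longrightarrow> Z x = 0"
  shows "AE x in lborel. x \<in> slit_ball r f \<longrightarrow> Z x = 0"
proof -
  let ?M = "slit_ball r f"
  note oM = open_slit_ball[OF f, of r]
  have [measurable]: "Z \<in> borel_measurable borel" "G i \<in> borel_measurable borel" for i
    using L2_D(1)[OF Z(1)] L2_D(1)[OF Z(2)] by auto
  have wl: "has_weak_laplacian ?M Z (\<lambda>x. complex_of_real (- k) * Z x)"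
  proof (subst weak_laplacian_iff[OF oM], simp, simp, rule ballI)
    fix \<phi> assume t: "\<phi> \<in> test_functions ?M"
    have "(LINT x|lborel. lap \<phi> x *\<^sub>R Z x) = (\<Sum>i\<in>UNIV. LINT x|lborel. pd i (pd i \<phi>) x *\<^sub>R Z x)"
    proof -
      have "integrable lborel (\<lambda>x. pd i (pd i \<phi>) x *\<^sub>R Z x)" for i
        by (intro smooth_mult_integrable Z smooth_pd bsupp_pd test_smooth[OF t] test_bsupp[OF t])
      then show ?thesis by (simp add: lap_def sum_2 scaleR_add_left)
    qed
    also have "\<dots> = (\<Sum>i\<in>UNIV. - (LINT x|lborel. pd i \<phi> x *\<^sub>R G i x))"
      using w oM test_pd[OF t] by (intro sum.cong) (auto simp: weak_pd_iff)
    also have "\<dots> = - (k *\<^sub>R (LINT x|lborel. \<phi> x *\<^sub>R Z x))" using l[OF t] by (simp add: sum_negf)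
    also have "\<dots> = (LINT x|lborel. (- k) *\<^sub>R (\<phi> x *\<^sub>R Z x))" by (subst integral_scaleR_right) simp
    also have "\<dots> = (LINT x|lborel. \<phi> x *\<^sub>R (complex_of_real (- k) * Z x))"
      by (intro Bochner_Integration.integral_cong) (auto simp: scaleR_conv_of_real)
    finally show "(LINT x|lborel. lap \<phi> x *\<^sub>R Z x) = (LINT x|lborel. \<phi> x *\<^sub>R (complex_of_real (- k) * Z x))" .
  qed
  show ?thesis
    by (rule ucp_connected[OF oM connected_slit_ball[OF f r] Z L2_cmult[OF Z(1)] w wl _ z(2,1,3), where M="\<bar>k\<bar>"])
      (auto simp: norm_mult)
qed

text \<open>The test function vanishes on the side along \<open>f\<close> and off the ball, so only
  the side along \<open>e\<close> contributes. The cut to the ball changes no integral; it makes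
  \<open>w\<close> square integrable.\<close>

lemma green_side:
  assumes c: "corner e \<nu> f \<mu>" and t: "\<phi> \<in> test_functions (slit_ball r f)" and w: "smooth w"
  shows "(LINT x|lborel. pd i \<phi> x *\<^sub>R cut (cone e f) (cut (ball 0 r) w) x)
      + (LINT x|lborel. \<phi> x *\<^sub>R cut (cone e f) (cut (ball 0 r) (pd i w)) x)
    = (\<nu> $ i) *\<^sub>R side_integral e (\<lambda>x. \<phi> x *\<^sub>R w x)"
proof -
  let ?S = "cone e f" and ?B = "ball (0::real^2) r"
  have tB: "\<phi> \<in> test_functions ?B" by (rule test_mono[OF t slit_ball_subset])
  note s = test_smooth[OF t] and b = test_bsupp[OF t]
  have mS: "?S \<in> sets borel" using open_cone[OF c] by simp
  have iL: "integrable lborel (\<lambda>x. p x *\<^sub>R cut ?S (cut ?B u) x)" if "smooth p" "bsupp p" "smooth u" for p u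
    by (intro smooth_mult_integrable that L2_indicator L2_cut_ball) (use mS in auto)
  have "(LINT x|lborel. pd i \<phi> x *\<^sub>R cut ?S (cut ?B w) x) + (LINT x|lborel. \<phi> x *\<^sub>R cut ?S (cut ?B (pd i w)) x)
    = (LINT x|lborel. pd i \<phi> x *\<^sub>R cut ?S (cut ?B w) x + \<phi> x *\<^sub>R cut ?S (cut ?B (pd i w)) x)"
    by (rule Bochner_Integration.integral_add[symmetric]) (intro iL smooth_pd bsupp_pd s b w)+
  also have "\<dots> = (LINT x|lborel. indicator ?S x *\<^sub>R pd i (\<lambda>x. \<phi> x *\<^sub>R w x) x)"
  proof (intro Bochner_Integration.integral_cong refl)
    fix x
    show "pd i \<phi> x *\<^sub>R cut ?S (cut ?B w) x + \<phi> x *\<^sub>R cut ?S (cut ?B (pd i w)) x = indicator ?S x *\<^sub>R pd i (\<lambda>x. \<phi> x *\<^sub>R w x) x"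
      using test_zero[OF tB, of x] pd_scaleR[OF smoothD[OF s] smoothD[OF w], of i x]
      by (cases "x \<in> ?B"; cases "x \<in> ?S") auto
  qed
  also have "\<dots> = (\<nu> $ i) *\<^sub>R (LINT s|lborel. indicator {0<..} s *\<^sub>R (\<phi> (s *\<^sub>R e) *\<^sub>R w (s *\<^sub>R e)))"
  proof (rule cone_green[OF smooth_scaleR[OF s w] bsupp_scaleR[OF b]])
    show "\<phi> (t *\<^sub>R f) *\<^sub>R w (t *\<^sub>R f) = 0" if "t \<ge> 0" for t
    proof -
      have "t *\<^sub>R f \<notin> slit_ball r f" using that by (auto simp: slit_ball_def)
      then show ?thesis using test_zero(1)[OF t] by simp
    qed
  qed (use c in \<open>auto simp: corner_def\<close>)
  finally show ?thesis by (simp add: side_integral_def)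
qed

lemma green_side_laplacian:
  assumes c: "corner e \<nu> f \<mu>" and t: "\<phi> \<in> test_functions (slit_ball r f)" and w: "smooth w"
  shows "(\<Sum>i\<in>UNIV. LINT x|lborel. pd i \<phi> x *\<^sub>R cut (cone e f) (cut (ball 0 r) (pd i w)) x)
      + (LINT x|lborel. \<phi> x *\<^sub>R cut (cone e f) (cut (ball 0 r) (lap w)) x)
    = side_integral e (\<lambda>x. \<phi> x *\<^sub>R dd \<nu> w x)"
proof -
  let ?S = "cone e f" and ?B = "ball (0::real^2) r"
  note s = test_smooth[OF t] and b = test_bsupp[OF t]
  have mS: "?S \<in> sets borel" using open_cone[OF c] by simp
  have ne: "e \<noteq> 0" using c by (auto simp: corner_def)
  have iL: "integrable lborel (\<lambda>x. p x *\<^sub>R cut ?S (cut ?B u) x)" if "smooth p" "bsupp p" "smooth u" for p u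
    by (intro smooth_mult_integrable that L2_indicator L2_cut_ball) (use mS in auto)
  have i: "integrable lborel (\<lambda>x. \<phi> x *\<^sub>R cut ?S (cut ?B (pd i (pd i w))) x)" for i
    by (intro iL s b smooth_pd w)
  have "(LINT x|lborel. \<phi> x *\<^sub>R cut ?S (cut ?B (lap w)) x) = (\<Sum>i\<in>UNIV. LINT x|lborel. \<phi> x *\<^sub>R cut ?S (cut ?B (pd i (pd i w))) x)"
  proof -
    have "(LINT x|lborel. \<phi> x *\<^sub>R cut ?S (cut ?B (lap w)) x)
      = (LINT x|lborel. \<phi> x *\<^sub>R cut ?S (cut ?B (pd 1 (pd 1 w))) x + \<phi> x *\<^sub>R cut ?S (cut ?B (pd 2 (pd 2 w))) x)"
      by (intro Bochner_Integration.integral_cong) (auto simp: lap_def sum_2 algebra_simps)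
    then show ?thesis using Bochner_Integration.integral_add[OF i[of 1] i[of 2]] by (simp add: sum_2)
  qed
  then have "(\<Sum>i\<in>UNIV. LINT x|lborel. pd i \<phi> x *\<^sub>R cut ?S (cut ?B (pd i w)) x)
      + (LINT x|lborel. \<phi> x *\<^sub>R cut ?S (cut ?B (lap w)) x)
    = (\<Sum>i\<in>UNIV. (\<nu> $ i) *\<^sub>R side_integral e (\<lambda>x. \<phi> x *\<^sub>R pd i w x))"
    by (simp add: green_side[OF c t smooth_pd[OF w], symmetric] sum.distrib)
  also have "\<dots> = side_integral e (\<lambda>x. \<phi> x *\<^sub>R dd \<nu> w x)"
  proof -
    have j: "integrable lborel (\<lambda>s. indicator {0<..} s *\<^sub>R (\<phi> (s *\<^sub>R e) *\<^sub>R pd i w (s *\<^sub>R e)))" for i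
      by (rule integrable_mult_indicator)
        (use smooth_line_FTC(5)[OF smooth_scaleR[OF s smooth_pd[OF w]] bsupp_scaleR[OF b] ne, of 0 i] in auto)
    have "side_integral e (\<lambda>x. \<phi> x *\<^sub>R dd \<nu> w x) = (LINT s|lborel. (\<nu> $ 1) *\<^sub>R (indicator {0<..} s *\<^sub>R (\<phi> (s *\<^sub>R e) *\<^sub>R pd 1 w (s *\<^sub>R e)))
       + (\<nu> $ 2) *\<^sub>R (indicator {0<..} s *\<^sub>R (\<phi> (s *\<^sub>R e) *\<^sub>R pd 2 w (s *\<^sub>R e))))"
      unfolding side_integral_def by (intro Bochner_Integration.integral_cong) (auto simp: dd_def sum_2 algebra_simps)
    also have "\<dots> = (\<Sum>i\<in>UNIV. (\<nu> $ i) *\<^sub>R side_integral e (\<lambda>x. \<phi> x *\<^sub>R pd i w x))"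
      by (subst Bochner_Integration.integral_add[OF integrable_scaleR_right[OF j] integrable_scaleR_right[OF j]])
        (simp only: integral_scaleR_right side_integral_def sum_2)
    finally show ?thesis by simp
  qed
  finally show ?thesis .
qed

text \<open>With zero Cauchy data on the line, cutting \<open>y\<close> off to a quadrant with one
  side along \<open>e\<close> produces no boundary terms there. The result is a weak solution in the
  ball slit along the other side of the quadrant. It vanishes outside the quadrant, hence also
  inside, and from there unique continuation reaches the whole ball.\<close>

lemma cauchy_uniqueness:
  assumes y: "solution_on k (ball 0 r) y" and e: "norm e = 1"
    and z: "\<And>x. x \<bullet> perp e = 0 \<Longrightarrow> x \<in> ball 0 r \<Longrightarrow> y x = 0"
      "\<And>x. x \<bullet> perp e = 0 \<Longrightarrow> x \<in> ball 0 r \<Longrightarrow> dd (perp e) y x = 0" and x: "x \<in> ball 0 r"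
  shows "y x = 0"
proof -
  have r: "r > 0" using x norm_ge_zero[of x] by (auto simp del: norm_ge_zero intro: le_less_trans)
  \<comment> \<open>A right-angled corner with one side along \<open>e\<close> and the other along
    the inner normal; the slit takes care of the second side.\<close>
  let ?f = "- perp e" and ?\<nu> = "perp e" and ?\<mu> = "- e"
  have c: "corner e ?\<nu> ?f ?\<mu>"
  proof -
    have "e \<bullet> e = 1" using e by (simp add: norm_eq_1)
    moreover have "perp e \<bullet> perp e = 1" using e norm_perp[of e] by (metis norm_eq_1)
    moreover have "- e = perp (- perp e) \<or> - e = - perp (- perp e)" by (simp add: vec2_eq_iff)
    ultimately show ?thesis using e by (simp add: corner_def)
  qed
  let ?S = "cone e ?f" and ?B = "ball (0::real^2) r" and ?M = "slit_ball r ?f"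
  have sy: "smooth y" by (rule solution_smooth[OF y])
  have mS: "?S \<in> sets borel" using open_cone[OF c] by simp
  have L: "cut ?S (cut ?B u) \<in> L2 lborel" if "smooth u" for u
    by (intro L2_indicator L2_cut_ball that) (use mS in auto)
  have f: "norm ?f = 1" using e by simp
  obtain p d where pd: "d > 0" "ball p d \<subseteq> ball 0 r - closed_cone ?\<nu> ?\<mu>"
    using exterior_contains_ball[OF c r] by blast
  have sub: "ball 0 r - closed_cone ?\<nu> ?\<mu> \<subseteq> ?M" using ray_in_closed_cone(1)[OF c] by (auto simp: slit_ball_def)
  have SC: "?S \<subseteq> closed_cone ?\<nu> ?\<mu>" unfolding cone_halfplanes[OF c] closed_cone_def by auto
  have perp0: "(s *\<^sub>R e) \<bullet> perp e = 0" for s by (simp add: inner_vec2)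
  have zs: "side_integral e (\<lambda>x. \<phi> x *\<^sub>R y x) = 0" "side_integral e (\<lambda>x. \<phi> x *\<^sub>R dd ?\<nu> y x) = 0"
    if t: "\<phi> \<in> test_functions ?M" for \<phi>
  proof -
    have "\<phi> (s *\<^sub>R e) *\<^sub>R y (s *\<^sub>R e) = 0 \<and> \<phi> (s *\<^sub>R e) *\<^sub>R dd ?\<nu> y (s *\<^sub>R e) = 0" for s
      using z[OF perp0] test_zero(1)[OF test_mono[OF t slit_ball_subset]] by (cases "s *\<^sub>R e \<in> ?B") simp_all
    then show "side_integral e (\<lambda>x. \<phi> x *\<^sub>R y x) = 0" "side_integral e (\<lambda>x. \<phi> x *\<^sub>R dd ?\<nu> y x) = 0"
      unfolding side_integral_def by (simp_all only: scaleR_zero_right integral_zero)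
  qed
  have "AE x in lborel. x \<in> ?M \<longrightarrow> cut ?S (cut ?B y) x = 0"
  proof (rule slit_ucp[OF f r L[OF sy] L[OF smooth_pd[OF sy]], where k=k and d=d and z=p])
    show "has_weak_pd ?M i (cut ?S (cut ?B y)) (cut ?S (cut ?B (pd i y)))" for i
      using green_side[OF c _ sy, of _ r i] zs L2_D(1)[OF L[OF sy]] L2_D(1)[OF L[OF smooth_pd[OF sy, of i]]]
      by (subst weak_pd_iff[OF open_slit_ball[OF f]]) (auto simp: eq_neg_iff_add_eq_0)
    fix \<phi> assume t: "\<phi> \<in> test_functions ?M"
    have "(\<Sum>i\<in>UNIV. LINT x|lborel. pd i \<phi> x *\<^sub>R cut ?S (cut ?B (pd i y)) x) = - (LINT x|lborel. \<phi> x *\<^sub>R cut ?S (cut ?B (lap y)) x)"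
      using green_side_laplacian[OF c t sy] zs(2)[OF t] by (simp add: eq_neg_iff_add_eq_0)
    also have "(LINT x|lborel. \<phi> x *\<^sub>R cut ?S (cut ?B (lap y)) x) = (LINT x|lborel. (- k) *\<^sub>R (\<phi> x *\<^sub>R cut ?S (cut ?B y) x))"
      using y by (intro Bochner_Integration.integral_cong) (auto simp: solution_on_def indicator_def)
    also have "- \<dots> = k *\<^sub>R (LINT x|lborel. \<phi> x *\<^sub>R cut ?S (cut ?B y) x)"
      by (subst integral_scaleR_right) simp
    finally show "(\<Sum>i\<in>UNIV. LINT x|lborel. pd i \<phi> x *\<^sub>R cut ?S (cut ?B (pd i y)) x) = k *\<^sub>R (LINT x|lborel. \<phi> x *\<^sub>R cut ?S (cut ?B y) x)" .
  next
    show "d > 0" by fact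
    show "p \<in> ?M" using pd sub by (meson centre_in_ball subsetD)
    show "AE x in lborel. x \<in> ball p d \<longrightarrow> cut ?S (cut ?B y) x = 0"
      using pd SC by (intro AE_I2) (auto simp: indicator_def)
  qed
  then have ae: "AE x in lborel. x \<in> ?S \<inter> ?B \<longrightarrow> y x = 0"
  proof eventually_elim
    case (elim x)
    show ?case
    proof
      assume x: "x \<in> ?S \<inter> ?B"
      then have "x \<in> ?M" using ray_in_closed_cone(2)[OF c] by (auto simp: slit_ball_def)
      then show "y x = 0" using elim x by simp
    qed
  qed
  obtain z0 d0 where z0: "d0 > 0" "ball z0 d0 \<subseteq> ?S \<inter> ?B" using cone_contains_ball[OF c r] by blast
  have "y x = 0" if "x \<in> ball z0 d0" for x
    by (rule zero_of_AE_zero[OF smooth_continuous[OF sy] open_Int[OF open_cone[OF c] open_ball] ae]) (use that z0 in auto)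
  then show ?thesis
    using smooth_ucp[OF y z0(1) _ _ x] z0(2) by blast
qed

text \<open>The sum of \<open>z\<close> and its reflection has zero Cauchy data on the line: its
  values vanish with those of \<open>z\<close>, and its normal derivative vanishes because the sum
  is even.\<close>

lemma odd_reflection:
  assumes z: "solution_on k (ball 0 r) z" and e: "norm e = 1" and 0: "\<And>x. x \<bullet> perp e = 0 \<Longrightarrow> x \<in> ball 0 r \<Longrightarrow> z x = 0"
    and x: "x \<in> ball 0 r"
  shows "z (reflect e x) = - z x"
proof -
  have sz: "smooth z" by (rule solution_smooth[OF z])
  have m: "dd (- a) h y = - dd a h y" for a y and h :: "real^2 \<Rightarrow> complex"
    by (simp add: dd_def sum_negf)
  have "z x + z (reflect e x) = 0"
  proof (rule cauchy_uniqueness[OF solution_add[OF z solution_reflect[OF z e]] e _ _ x])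
    fix w assume w: "w \<bullet> perp e = 0" "w \<in> ball 0 r"
    show "z w + z (reflect e w) = 0" using 0[OF w] reflect_line[OF e w(1)] by simp
    show "dd (perp e) (\<lambda>x. z x + z (reflect e x)) w = 0"
      by (simp add: dd_smooth_add[OF sz smooth_reflect[OF sz]] dd_compose_linear[OF bounded_linear_reflect sz]
          reflect_perp m reflect_line[OF e w(1)])
  qed
  then show ?thesis by (simp add: eq_neg_iff_add_eq_0 add.commute)
qed

text \<open>Being odd under both reflections, \<open>z\<close> changes sign under
  \<open>c \<mapsto> 2 * a - c\<close> and under \<open>c \<mapsto> 2 * b - c\<close> on each
  circle; composing them gives invariance under rotation by \<open>2 * (a - b)\<close>. A zero on
  each circle is supplied by the line itself.\<close>

lemma two_lines_uniqueness:
  assumes z: "solution_on k (ball 0 r) z" and irr: "(a - b) / pi \<notin> \<rat>"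
    and za: "\<And>x. x \<bullet> perp (direction a) = 0 \<Longrightarrow> x \<in> ball 0 r \<Longrightarrow> z x = 0"
    and zb: "\<And>x. x \<bullet> perp (direction b) = 0 \<Longrightarrow> x \<in> ball 0 r \<Longrightarrow> z x = 0"
    and x: "x \<in> ball 0 r"
  shows "z x = 0"
proof -
  have nd: "norm (direction c) = 1" for c
    by (simp add: norm_eq_1 inner_vec2 direction_def power2_eq_square[symmetric])
  define \<rho> where "\<rho> = norm x"
  have in_ball: "\<rho> *\<^sub>R direction c \<in> ball 0 r" for c using x nd by (simp add: \<rho>_def)
  have ra: "z (\<rho> *\<^sub>R direction (2 * a - c)) = - z (\<rho> *\<^sub>R direction c)" for c
    using odd_reflection[OF z nd za in_ball] by (simp add: reflect_direction)
  have rb: "z (\<rho> *\<^sub>R direction (2 * b - c)) = - z (\<rho> *\<^sub>R direction c)" for c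
    using odd_reflection[OF z nd zb in_ball] by (simp add: reflect_direction)
  have rot: "z (\<rho> *\<^sub>R direction (c + 2 * (a - b))) = z (\<rho> *\<^sub>R direction c)" for c
    using ra[of "2 * b - c"] rb[of c] by (simp add: algebra_simps)
  have "z (\<rho> *\<^sub>R direction b) = 0"
    by (rule zb[OF _ in_ball]) (simp add: inner_vec2)
  then have all: "z (\<rho> *\<^sub>R direction c) = 0" for c
    by (rule irrational_rotation_zero[OF irr smooth_continuous[OF solution_smooth[OF z]] rot])
  have "x = \<rho> *\<^sub>R direction (Arg (Complex (x $ 1) (x $ 2)))"
  proof -
    have n: "cmod (Complex (x $ 1) (x $ 2)) = \<rho>"
      by (simp add: \<rho>_def norm_eq_sqrt_inner[of x] inner_vec2 complex_norm power2_eq_square)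
    have "Complex (x $ 1) (x $ 2) = rcis \<rho> (Arg (Complex (x $ 1) (x $ 2)))"
      using rcis_cmod_Arg[of "Complex (x $ 1) (x $ 2)"] n by simp
    then show ?thesis
      by (simp add: vec2_eq_iff direction_def complex_eq_iff)
  qed
  then show ?thesis using all by metis
qed

text \<open>The closed corner exceeds the open one only by parts of two lines, a null set.\<close>

lemma corner_split:
  assumes c: "corner e \<nu> f \<mu>" and u: "u \<in> L2 lborel" and p: "smooth p" "bsupp p" "\<And>x. x \<notin> ball 0 r \<Longrightarrow> p x = 0"
  shows "(LINT x|lborel. p x *\<^sub>R u x) = (LINT x|lborel. p x *\<^sub>R cut (cone e f) u x)
    + (LINT x|lborel. p x *\<^sub>R cut (ball 0 r - closed_cone \<nu> \<mu>) u x)"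
proof -
  let ?S = "cone e f" and ?E = "ball 0 r - closed_cone \<nu> \<mu>"
  have mS [measurable]: "?S \<in> sets borel" "?E \<in> sets borel"
    using open_cone[OF c] closed_closed_cone by auto
  have [measurable]: "u \<in> borel_measurable borel" "p \<in> borel_measurable borel"
    using L2_D(1)[OF u] smooth_borel[OF p(1)] by auto
  have i: "integrable lborel (\<lambda>x. p x *\<^sub>R cut ?S u x)" "integrable lborel (\<lambda>x. p x *\<^sub>R cut ?E u x)"
    by (intro smooth_mult_integrable L2_indicator u p; use mS in simp)+
  have SC: "?S \<subseteq> closed_cone \<nu> \<mu>" unfolding cone_halfplanes[OF c] closed_cone_def by auto
  have "(LINT x|lborel. p x *\<^sub>R u x) = (LINT x|lborel. p x *\<^sub>R cut ?S u x + p x *\<^sub>R cut ?E u x)"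
  proof (rule integral_cong_AE)
    show "AE x in lborel. p x *\<^sub>R u x = p x *\<^sub>R cut ?S u x + p x *\<^sub>R cut ?E u x"
      using closed_cone_boundary_null[OF c]
    proof eventually_elim
      case (elim x)
      then show ?case using p(3)[of x] SC by (cases "x \<in> ball 0 r"; cases "x \<in> ?S") (auto simp: indicator_def)
    qed
  qed auto
  then show ?thesis using i by simp
qed

text \<open>Cancellation rules with variables in place of long integrals. The first two subtract the
  part inside the corner from an identity over the ball, the third and fourth subtract the identity
  for \<open>V\<close> from the one for \<open>U\<close>, and the last rearranges signs.\<close>

lemma split_sum_zero:
  fixes a b :: complex
  shows "a + b = 0 \<Longrightarrow> a = a1 + a2 \<Longrightarrow> b = b1 + b2 \<Longrightarrow> a1 + b1 = 0 \<Longrightarrow> a2 + b2 = 0"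
    and "a + b + h = 0 \<Longrightarrow> a = a1 + a2 \<Longrightarrow> b = b1 + b2 \<Longrightarrow> h = h1 + h2 \<Longrightarrow> a1 + b1 + h1 = q \<Longrightarrow> a2 + b2 + h2 = - q"
    and "a + b + h = - q \<Longrightarrow> a1 + b1 + h1 = - q \<Longrightarrow> h - h1 = - y \<Longrightarrow> (a - a1) + (b - b1) = y"
    and "a + b = 0 \<Longrightarrow> a1 + b1 = 0 \<Longrightarrow> a - a1 = - (b - b1)"
    and "- a - b = h \<Longrightarrow> a + b + h = 0"
  by (algebra | (drule sym, simp))+

text \<open>The conditions on \<open>U\<close> say, in Green's formula inside the corner, that \<open>U = 0\<close> and
  \<open>\<partial>\<^sub>\<nu>U = \<eta> v\<close> on the side spanned by \<open>e\<close>; testing on the slit ball keeps the other side out.\<close>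

lemma side_step:
  assumes c: "corner e \<nu> f \<mu>" and r: "r > 0"
    and U: "U \<in> L2 lborel" "\<And>i. gU i \<in> L2 lborel" "F \<in> L2 lborel"
    and w: "\<And>i. has_weak_pd (ball 0 r) i U (gU i)" "has_weak_laplacian (ball 0 r) U F"
    and F: "AE x in lborel. x \<in> ball 0 r - closed_cone \<nu> \<mu> \<longrightarrow> F x = - (k *\<^sub>R U x)"
    and dir: "\<And>\<phi> i. \<phi> \<in> test_functions (slit_ball r f) \<Longrightarrow>
      (LINT x|lborel. pd i \<phi> x *\<^sub>R cut (cone e f) U x) + (LINT x|lborel. \<phi> x *\<^sub>R cut (cone e f) (gU i) x) = 0"
    and neu: "\<And>\<phi>. \<phi> \<in> test_functions (slit_ball r f) \<Longrightarrow>
      (\<Sum>i\<in>UNIV. LINT x|lborel. pd i \<phi> x *\<^sub>R cut (cone e f) (gU i) x) + (LINT x|lborel. \<phi> x *\<^sub>R cut (cone e f) F x)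
        = \<eta> * side_integral e (\<lambda>x. \<phi> x *\<^sub>R v x)"
    and v: "solution_on k (ball 0 r) v" "bsupp v"
  obtains V where "solution_on k (ball 0 r) V" "\<And>x. x \<bullet> perp e = 0 \<Longrightarrow> V x = 0"
    "\<And>x. x \<bullet> perp e = 0 \<Longrightarrow> dd \<nu> V x = \<eta> * v x"
    "AE x in lborel. x \<in> ball 0 r - closed_cone \<nu> \<mu> \<longrightarrow> U x = V x"
proof -
  have e: "norm e = 1" and f: "norm f = 1" and \<nu>: "\<nu> = perp e \<or> \<nu> = - perp e" using c by (auto simp: corner_def)
  let ?S = "cone e f" and ?B = "ball (0::real^2) r" and ?M = "slit_ball r f"
  let ?E = "ball 0 r - closed_cone \<nu> \<mu>"
  have mE [measurable]: "?S \<in> sets borel" "?E \<in> sets borel"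
    using open_cone[OF c] closed_closed_cone by auto
  have m: "dd (- a) h y = - dd a h y" for a y and h :: "real^2 \<Rightarrow> complex"
    by (simp add: dd_def sum_negf)
  \<comment> \<open>\<open>cauchy_problem\<close> prescribes the derivative along
    \<open>perp e\<close>, while the exterior normal may be its opposite; \<open>\<sigma>\<close>
    carries that sign.\<close>
  define \<sigma> :: complex where "\<sigma> = (if \<nu> = perp e then 1 else - 1)"
  have sv: "solution_on k ?B (\<lambda>x. (\<sigma> * \<eta>) * v x)" by (rule solution_cmult[OF v(1)])
  have bv: "bsupp (\<lambda>x. (\<sigma> * \<eta>) * v x)" by (rule bsupp_mult[OF v(2)])
  obtain V where V: "solution_on k ?B V" "\<And>x. x \<bullet> perp e = 0 \<Longrightarrow> V x = 0"
    "\<And>x. x \<bullet> perp e = 0 \<Longrightarrow> dd (perp e) V x = (\<sigma> * \<eta>) * v x"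
    by (rule cauchy_problem[OF sv bv e]) (rule that, assumption+)
  have V\<nu>: "dd \<nu> V x = \<eta> * v x" if "x \<bullet> perp e = 0" for x
  proof (cases "\<nu> = perp e")
    case True
    then show ?thesis using V(3)[OF that] by (simp add: \<sigma>_def)
  next
    case False
    then have "dd \<nu> V x = - dd (perp e) V x" using \<nu> m by auto
    also have "\<dots> = \<eta> * v x" unfolding V(3)[OF that] \<sigma>_def using False by simp
    finally show ?thesis .
  qed
  have sV: "smooth V" by (rule solution_smooth[OF V(1)])
  let ?V = "cut ?B V" and ?pV = "\<lambda>i. cut ?B (pd i V)" and ?lV = "cut ?B (lap V)"
  note LV = L2_cut_ball[OF sV, of r] and LpV = L2_cut_ball[OF smooth_pd[OF sV], of r] and LlV = L2_cut_ball[OF smooth_lap[OF sV], of r]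
  \<comment> \<open>Extending \<open>U - V\<close> by 0 across the side along \<open>e\<close>
    creates no boundary terms: the Green integrals of \<open>U\<close> and of \<open>V\<close> over
    the corner agree, as both encode the value 0 and the normal derivative
    \<open>\<eta> v\<close>.\<close>
  define Z where "Z = cut ?E (\<lambda>x. U x - ?V x)"
  define G where "G i = cut ?E (\<lambda>x. gU i x - ?pV i x)" for i
  have ZL: "Z \<in> L2 lborel" unfolding Z_def by (intro L2_indicator L2_diff U LV) simp
  have GL: "G i \<in> L2 lborel" for i unfolding G_def by (intro L2_indicator L2_diff U LpV) simp
  note [measurable] = L2_D(1)[OF ZL, simplified] L2_D(1)[OF GL, simplified] L2_D(1)[OF U(1), simplified] L2_D(1)[OF U(2), simplified]
    L2_D(1)[OF U(3), simplified] L2_D(1)[OF LV, simplified] L2_D(1)[OF LpV, simplified] L2_D(1)[OF LlV, simplified]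
  have perp0: "(s *\<^sub>R e) \<bullet> perp e = 0" for s by (simp add: inner_vec2)
  have int: "integrable lborel (\<lambda>x. p x *\<^sub>R cut ?E u x)" if "smooth p" "bsupp p" "u \<in> L2 lborel" for p u
    by (intro smooth_mult_integrable that L2_indicator) simp
  have diff: "(LINT x|lborel. p x *\<^sub>R cut ?E (\<lambda>x. a x - b x) x)
    = (LINT x|lborel. p x *\<^sub>R cut ?E a x) - (LINT x|lborel. p x *\<^sub>R cut ?E b x)"
    if "smooth p" "bsupp p" "a \<in> L2 lborel" "b \<in> L2 lborel" for p a b
    using int[OF that(1,2,3)] int[OF that(1,2,4)] by (simp add: scaleR_diff_right)
  have wp: "has_weak_pd ?M i Z (G i)" for i
  proof (subst weak_pd_iff[OF open_slit_ball[OF f]], measurable, rule ballI)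
    fix \<phi> assume t: "\<phi> \<in> test_functions ?M"
    then have tB: "\<phi> \<in> test_functions ?B" by (rule test_mono[OF _ slit_ball_subset])
    note s = test_smooth[OF t] and b = test_bsupp[OF t]
    note sp1 = corner_split[OF c _ smooth_pd[OF s, of i] bsupp_pd[OF b, of i] test_zero(2)[OF tB]]
      and sp0 = corner_split[OF c _ s b test_zero(1)[OF tB]]
    have "(LINT x|lborel. pd i \<phi> x *\<^sub>R U x) + (LINT x|lborel. \<phi> x *\<^sub>R gU i x) = 0"
      using w(1)[of i] tB by (simp add: weak_pd_iff)
    then have 1: "(LINT x|lborel. pd i \<phi> x *\<^sub>R cut ?E U x) + (LINT x|lborel. \<phi> x *\<^sub>R cut ?E (gU i) x) = 0"
      by (rule split_sum_zero(1)[OF _ sp1[OF U(1)] sp0[OF U(2)] dir[OF t]])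
    have "(LINT x|lborel. pd i \<phi> x *\<^sub>R ?V x) + (LINT x|lborel. \<phi> x *\<^sub>R ?pV i x) = 0"
      using smooth_weak_pd[OF sV, of r i] tB by (simp add: weak_pd_iff)
    moreover have "(LINT x|lborel. pd i \<phi> x *\<^sub>R cut ?S ?V x) + (LINT x|lborel. \<phi> x *\<^sub>R cut ?S (?pV i) x) = 0"
      unfolding green_side[OF c t sV] using V(2) perp0 by (simp add: side_integral_def)
    ultimately have 2: "(LINT x|lborel. pd i \<phi> x *\<^sub>R cut ?E ?V x) + (LINT x|lborel. \<phi> x *\<^sub>R cut ?E (?pV i) x) = 0"
      using split_sum_zero(1)[OF _ sp1[OF LV] sp0[OF LpV]] by blast
    show "(LINT x|lborel. pd i \<phi> x *\<^sub>R Z x) = - (LINT x|lborel. \<phi> x *\<^sub>R G i x)"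
      unfolding Z_def G_def diff[OF smooth_pd[OF s] bsupp_pd[OF b] U(1) LV] diff[OF s b U(2) LpV]
      by (rule split_sum_zero(4)[OF 1 2])
  qed
  have wl: "(\<Sum>i\<in>UNIV. LINT x|lborel. pd i \<phi> x *\<^sub>R G i x) = k *\<^sub>R (LINT x|lborel. \<phi> x *\<^sub>R Z x)" if t: "\<phi> \<in> test_functions ?M" for \<phi>
  proof -
    have tB: "\<phi> \<in> test_functions ?B" using t by (rule test_mono[OF _ slit_ball_subset])
    note s = test_smooth[OF t] and b = test_bsupp[OF t]
    note sp1 = corner_split[OF c _ smooth_pd[OF s] bsupp_pd[OF b] test_zero(2)[OF tB]]
      and sp0 = corner_split[OF c _ s b test_zero(1)[OF tB]]
    \<comment> \<open>The first-order identity over the whole ball: the weak gradient is tested with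
      \<open>pd i \<phi>\<close> and the weak Laplacian with \<open>\<phi>\<close>. The share of the
      corner is subtracted from it afterwards.\<close>
    have full: "(\<Sum>i\<in>UNIV. LINT x|lborel. pd i \<phi> x *\<^sub>R g i x) + (LINT x|lborel. \<phi> x *\<^sub>R H x) = 0"
      if y: "y \<in> L2 lborel" "\<And>i. g i \<in> L2 lborel" "H \<in> L2 lborel" "\<And>i. has_weak_pd ?B i y (g i)" "has_weak_laplacian ?B y H" for y g H
    proof -
      have bm: "y \<in> borel_measurable borel" "g i \<in> borel_measurable borel" "H \<in> borel_measurable borel" for i
        using L2_D(1)[OF y(1)] L2_D(1)[OF y(2)] L2_D(1)[OF y(3)] by auto
      have "(LINT x|lborel. pd i (pd i \<phi>) x *\<^sub>R y x) = - (LINT x|lborel. pd i \<phi> x *\<^sub>R g i x)" for i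
        using y(4)[of i] test_pd[OF tB] bm by (simp add: weak_pd_iff)
      moreover have "(LINT x|lborel. lap \<phi> x *\<^sub>R y x) = (LINT x|lborel. \<phi> x *\<^sub>R H x)"
        using y(5) tB bm by (simp add: weak_laplacian_iff)
      moreover have "(LINT x|lborel. lap \<phi> x *\<^sub>R y x) = (\<Sum>i\<in>UNIV. LINT x|lborel. pd i (pd i \<phi>) x *\<^sub>R y x)"
      proof -
        have "integrable lborel (\<lambda>x. pd i (pd i \<phi>) x *\<^sub>R y x)" for i
          by (intro smooth_mult_integrable y smooth_pd bsupp_pd s b)
        then show ?thesis by (simp add: lap_def sum_2 scaleR_add_left)
      qed
      ultimately have "- (LINT x|lborel. pd 1 \<phi> x *\<^sub>R g 1 x) - (LINT x|lborel. pd 2 \<phi> x *\<^sub>R g 2 x) = (LINT x|lborel. \<phi> x *\<^sub>R H x)"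
        by (simp add: sum_2)
      then show ?thesis unfolding sum_2 by (rule split_sum_zero(5))
    qed
    have e1: "(LINT x|lborel. pd i \<phi> x *\<^sub>R y x) = (LINT x|lborel. pd i \<phi> x *\<^sub>R cut ?S y x) + (LINT x|lborel. pd i \<phi> x *\<^sub>R cut ?E y x)"
      if "y \<in> L2 lborel" for i y by (rule sp1[OF that])
    have e0: "(LINT x|lborel. \<phi> x *\<^sub>R y x) = (LINT x|lborel. \<phi> x *\<^sub>R cut ?S y x) + (LINT x|lborel. \<phi> x *\<^sub>R cut ?E y x)"
      if "y \<in> L2 lborel" for y by (rule sp0[OF that])
    have 1: "(\<Sum>i\<in>UNIV. LINT x|lborel. pd i \<phi> x *\<^sub>R cut ?E (gU i) x) + (LINT x|lborel. \<phi> x *\<^sub>R cut ?E F x)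
        = - (\<eta> * side_integral e (\<lambda>x. \<phi> x *\<^sub>R v x))"
      unfolding sum_2
      by (rule split_sum_zero(2)[OF full[OF U w, unfolded sum_2] e1[OF U(2)] e1[OF U(2)] e0[OF U(3)] neu[OF t, unfolded sum_2]])
    have sd: "side_integral e (\<lambda>x. \<phi> x *\<^sub>R dd \<nu> V x) = \<eta> * side_integral e (\<lambda>x. \<phi> x *\<^sub>R v x)"
    proof -
      have "side_integral e (\<lambda>x. \<phi> x *\<^sub>R dd \<nu> V x) = (LINT s|lborel. \<eta> * (indicator {0<..} s *\<^sub>R (\<phi> (s *\<^sub>R e) *\<^sub>R v (s *\<^sub>R e))))"
        unfolding side_integral_def using V\<nu> perp0 by (intro Bochner_Integration.integral_cong) auto
      also have "\<dots> = \<eta> * side_integral e (\<lambda>x. \<phi> x *\<^sub>R v x)"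
        unfolding side_integral_def by (rule integral_mult_right_zero)
      finally show ?thesis .
    qed
    have 2: "(\<Sum>i\<in>UNIV. LINT x|lborel. pd i \<phi> x *\<^sub>R cut ?E (?pV i) x) + (LINT x|lborel. \<phi> x *\<^sub>R cut ?E ?lV x)
        = - (\<eta> * side_integral e (\<lambda>x. \<phi> x *\<^sub>R v x))"
      unfolding sum_2
      by (rule split_sum_zero(2)[OF full[OF LV LpV LlV smooth_weak_pd[OF sV] smooth_weak_laplacian[OF sV], unfolded sum_2]
            e1[OF LpV] e1[OF LpV] e0[OF LlV] green_side_laplacian[OF c t sV, unfolded sum_2 sd]])
    have "(LINT x|lborel. \<phi> x *\<^sub>R cut ?E (\<lambda>x. F x - ?lV x) x) = (LINT x|lborel. (- k) *\<^sub>R (\<phi> x *\<^sub>R Z x))"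
    proof (rule integral_cong_AE)
      have m\<phi>: "\<phi> \<in> borel_measurable borel" by (rule smooth_borel[OF s])
      have mF: "(\<lambda>x. F x - ?lV x) \<in> borel_measurable borel" and mZ: "Z \<in> borel_measurable borel"
        using L2_D(1)[OF L2_diff[OF U(3) LlV]] L2_D(1)[OF ZL] by simp_all
      show "(\<lambda>x. \<phi> x *\<^sub>R cut ?E (\<lambda>x. F x - ?lV x) x) \<in> borel_measurable lborel"
        unfolding measurable_lborel2 by (intro borel_measurable_scaleR[OF m\<phi>] cut_measurable[OF mE(2)] mF)
      show "(\<lambda>x. (- k) *\<^sub>R (\<phi> x *\<^sub>R Z x)) \<in> borel_measurable lborel"
        unfolding measurable_lborel2 by (intro borel_measurable_scaleR[OF borel_measurable_const] borel_measurable_scaleR[OF m\<phi> mZ])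
      show "AE x in lborel. \<phi> x *\<^sub>R cut ?E (\<lambda>x. F x - ?lV x) x = (- k) *\<^sub>R (\<phi> x *\<^sub>R Z x)"
        using F
      proof eventually_elim
        case (elim x)
        show ?case
        proof (cases "x \<in> ?E")
          case True
          then have "lap V x = - (k *\<^sub>R V x)" using V(1) by (auto simp: solution_on_def)
          then show ?thesis using True elim by (simp add: Z_def algebra_simps)
        qed (simp add: Z_def)
      qed
    qed
    also have "\<dots> = - (k *\<^sub>R (LINT x|lborel. \<phi> x *\<^sub>R Z x))" by (subst integral_scaleR_right) simp
    finally have 3: "(LINT x|lborel. \<phi> x *\<^sub>R cut ?E F x) - (LINT x|lborel. \<phi> x *\<^sub>R cut ?E ?lV x) = - (k *\<^sub>R (LINT x|lborel. \<phi> x *\<^sub>R Z x))"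
      unfolding diff[OF s b U(3) LlV] .
    have 4: "(LINT x|lborel. pd i \<phi> x *\<^sub>R G i x) = (LINT x|lborel. pd i \<phi> x *\<^sub>R cut ?E (gU i) x) - (LINT x|lborel. pd i \<phi> x *\<^sub>R cut ?E (?pV i) x)" for i
      unfolding G_def by (rule diff[OF smooth_pd[OF s] bsupp_pd[OF b] U(2) LpV])
    show ?thesis
      unfolding sum_2 4 by (rule split_sum_zero(3)[OF 1[unfolded sum_2] 2[unfolded sum_2] 3])
  qed
  obtain z d where z: "d > 0" "ball z d \<subseteq> ?S \<inter> ?B" using cone_contains_ball[OF c r] by blast
  have SC: "?S \<subseteq> closed_cone \<nu> \<mu>" unfolding cone_halfplanes[OF c] closed_cone_def by auto
  have SM: "?S \<inter> ?B \<subseteq> ?M" using ray_in_closed_cone(2)[OF c] by (auto simp: slit_ball_def)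
  have EM: "?E \<subseteq> ?M" using ray_in_closed_cone(1)[OF c] by (auto simp: slit_ball_def)
  have "AE x in lborel. x \<in> ?M \<longrightarrow> Z x = 0"
  proof (rule slit_ucp[OF f r ZL GL wp wl])
    show "d > 0" by fact
    show "z \<in> ?M" using z SM by (meson centre_in_ball subsetD)
    show "AE x in lborel. x \<in> ball z d \<longrightarrow> Z x = 0"
      using z SC by (intro AE_I2) (auto simp: Z_def indicator_def)
  qed
  then have "AE x in lborel. x \<in> ?E \<longrightarrow> U x = V x"
  proof eventually_elim
    case (elim x)
    show ?case
    proof
      assume x: "x \<in> ?E"
      then have "Z x = 0" using elim EM by auto
      then show "U x = V x" using x by (simp add: Z_def)
    qed
  qed
  from that[OF V(1,2) V\<nu> this] show ?thesis by blast
qed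

section \<open>Borel representatives, traces and normal derivatives\<close>

lemma AE_lebesgue_on:
  fixes U :: "(real^2) set"
  assumes "U \<in> sets borel"
  shows "(AE x in lebesgue_on U. P x) \<longleftrightarrow> (AE x in lborel. x \<in> U \<longrightarrow> P x)"
  using assms by (subst AE_restrict_space_iff) (auto simp: AE_completion_iff sets_completionI_sets)

lemma borel_measurable_lebesgue_on: "u \<in> borel_measurable borel \<Longrightarrow> u \<in> borel_measurable (lebesgue_on U)"
  by (intro measurable_restrict_space1 measurable_completion) simp

lemma integral_lebesgue_on:
  fixes G :: "real^2 \<Rightarrow> 'b::{banach, second_countable_topology}"
  assumes "U \<in> sets borel" "G \<in> borel_measurable borel"
  shows "(LINT x|lebesgue_on U. G x) = (LINT x|lborel. indicator U x *\<^sub>R G x)"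
    "integrable (lebesgue_on U) G \<longleftrightarrow> integrable lborel (\<lambda>x. indicator U x *\<^sub>R G x)"
proof -
  have m: "(\<lambda>x. indicator U x *\<^sub>R G x) \<in> borel_measurable lborel"
    using assms by (simp add: borel_measurable_scaleR borel_measurable_indicator)
  have U: "U \<inter> space lebesgue \<in> sets lebesgue" using assms(1) by (simp add: sets_completionI_sets)
  show "(LINT x|lebesgue_on U. G x) = (LINT x|lborel. indicator U x *\<^sub>R G x)"
    using integral_restrict_space[OF U, of G] integral_completion[OF m] by simp
  show "integrable (lebesgue_on U) G \<longleftrightarrow> integrable lborel (\<lambda>x. indicator U x *\<^sub>R G x)"
    using integrable_restrict_space[OF U, of G] integrable_completion[OF m] by simp
qed

lemma integral_representative:
  fixes U :: "(real^2) set" and u :: "real^2 \<Rightarrow> complex"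
  assumes U: "U \<in> sets borel" and u: "u \<in> borel_measurable (lebesgue_on U)" and u': "u' \<in> borel_measurable borel"
    and eq: "AE x in lborel. x \<in> U \<longrightarrow> u x = u' x" and c: "c \<in> borel_measurable borel"
  shows "(LINT x|lebesgue_on U. c x *\<^sub>R u x) = (LINT x|lborel. c x *\<^sub>R cut U u' x)"
proof -
  note mc = borel_measurable_lebesgue_on[OF c, of U] and mu' = borel_measurable_lebesgue_on[OF u', of U]
  have "(LINT x|lebesgue_on U. c x *\<^sub>R u x) = (LINT x|lebesgue_on U. c x *\<^sub>R u' x)"
  proof (rule integral_cong_AE)
    show "AE x in lebesgue_on U. c x *\<^sub>R u x = c x *\<^sub>R u' x"
      unfolding AE_lebesgue_on[OF U] using eq by eventually_elim simp
  qed (intro borel_measurable_scaleR mc mu' u)+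
  also have "\<dots> = (LINT x|lborel. indicator U x *\<^sub>R (c x *\<^sub>R u' x))"
    by (rule integral_lebesgue_on(1)[OF U]) (intro borel_measurable_scaleR c u')
  finally show ?thesis by (simp add: mult.commute)
qed

lemma L2_of_representative:
  fixes U :: "(real^2) set" and u :: "real^2 \<Rightarrow> complex"
  assumes U: "U \<in> sets borel" and u: "u \<in> borel_measurable (lebesgue_on U)" and u': "u' \<in> L2 lborel"
    and eq: "AE x in lborel. x \<in> U \<longrightarrow> u x = u' x"
  shows "u \<in> L2 (lebesgue_on U)"
proof -
  have m: "u' \<in> borel_measurable borel" using L2_D(1)[OF u'] by simp
  have m2: "(\<lambda>x. (norm (u' x))\<^sup>2) \<in> borel_measurable borel" using m by measurable
  have "integrable (lebesgue_on U) (\<lambda>x. (norm (u' x))\<^sup>2)"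
    unfolding integral_lebesgue_on(2)[OF U m2]
    by (rule integrable_mult_indicator) (use U L2_D(2)[OF u'] in auto)
  then have "integrable (lebesgue_on U) (\<lambda>x. (norm (u x))\<^sup>2)"
  proof (rule integrable_cong_AE_imp)
    show "(\<lambda>x. (norm (u x))\<^sup>2) \<in> borel_measurable (lebesgue_on U)" using u by measurable
    show "AE x in lebesgue_on U. (norm (u' x))\<^sup>2 = (norm (u x))\<^sup>2"
      unfolding AE_lebesgue_on[OF U] using eq by eventually_elim simp
  qed
  then show ?thesis using u by (simp add: L2_def)
qed

text \<open>A Lebesgue measurable function agrees almost everywhere with a Borel function, here
  taken for real and imaginary parts separately. Setting it to 0 off \<open>U\<close> makes it
  square integrable over the plane, as the estimates above assume.\<close>

lemma L2_representative:
  fixes U :: "(real^2) set" and u :: "real^2 \<Rightarrow> complex"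
  assumes U: "U \<in> sets borel" and u: "u \<in> L2 (lebesgue_on U)"
  obtains u' where "u' \<in> L2 lborel" "\<And>x. x \<notin> U \<Longrightarrow> u' x = 0" "AE x in lborel. x \<in> U \<longrightarrow> u x = u' x"
proof -
  have mu: "u \<in> borel_measurable (lebesgue_on U)" by (rule L2_D(1)[OF u])
  have Ul: "U \<in> sets lebesgue" using U by (simp add: sets_completionI_sets)
  define w where "w x = (if x \<in> U then u x else 0)" for x
  have mw: "w \<in> borel_measurable lebesgue"
    unfolding w_def using borel_measurable_if[OF Ul, of u] mu by simp
  have "(\<lambda>x. Re (w x)) \<in> borel_measurable lebesgue" "(\<lambda>x. Im (w x)) \<in> borel_measurable lebesgue"
    using mw by measurable
  note m = this
  obtain a :: "real^2 \<Rightarrow> real" where a: "a \<in> borel_measurable lborel" "AE x in lborel. Re (w x) = a x"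
    using completion_ex_borel_measurable_real[OF m(1)] by auto
  obtain b :: "real^2 \<Rightarrow> real" where b: "b \<in> borel_measurable lborel" "AE x in lborel. Im (w x) = b x"
    using completion_ex_borel_measurable_real[OF m(2)] by auto
  define u' where "u' = cut U (\<lambda>x. of_real (a x) + \<i> * of_real (b x))"
  have ma: "a \<in> borel_measurable borel" "b \<in> borel_measurable borel" using a b by simp_all
  have mu': "u' \<in> borel_measurable borel"
    unfolding u'_def by (rule cut_measurable[OF U]) (use ma in measurable)
  have eq: "AE x in lborel. x \<in> U \<longrightarrow> u x = u' x"
    using a(2) b(2)
  proof eventually_elim
    case (elim x)
    show ?case
    proof
      assume x: "x \<in> U"
      then have "w x = u x" by (simp add: w_def)
      then show "u x = u' x" using elim x by (simp add: u'_def complex_eq_iff)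
    qed
  qed
  have m2: "(\<lambda>x. (norm (u' x))\<^sup>2) \<in> borel_measurable borel" using mu' by measurable
  have "integrable (lebesgue_on U) (\<lambda>x. (norm (u' x))\<^sup>2)"
  proof (rule integrable_cong_AE_imp[OF L2_D(2)[OF u]])
    show "(\<lambda>x. (norm (u' x))\<^sup>2) \<in> borel_measurable (lebesgue_on U)" by (rule borel_measurable_lebesgue_on[OF m2])
    show "AE x in lebesgue_on U. (norm (u x))\<^sup>2 = (norm (u' x))\<^sup>2"
      unfolding AE_lebesgue_on[OF U] using eq by eventually_elim simp
  qed
  then have "integrable lborel (\<lambda>x. indicator U x *\<^sub>R (norm (u' x))\<^sup>2)"
    unfolding integral_lebesgue_on(2)[OF U m2] .
  moreover have "(\<lambda>x. indicator U x *\<^sub>R (norm (u' x))\<^sup>2) = (\<lambda>x. (norm (u' x))\<^sup>2)"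
    by (auto simp: u'_def indicator_def fun_eq_iff)
  ultimately have "integrable lborel (\<lambda>x. (norm (u' x))\<^sup>2)" by (simp only:)
  then have "u' \<in> L2 lborel" using mu' by (simp add: L2_def)
  moreover have "u' x = 0" if "x \<notin> U" for x using that by (simp add: u'_def)
  ultimately show ?thesis using that eq by blast
qed

lemma weak_pd_representative:
  assumes U: "open U" and u: "u \<in> borel_measurable (lebesgue_on U)" "g \<in> borel_measurable (lebesgue_on U)"
    and u': "u' \<in> borel_measurable borel" "g' \<in> borel_measurable borel"
    and eq: "AE x in lborel. x \<in> U \<longrightarrow> u x = u' x" "AE x in lborel. x \<in> U \<longrightarrow> g x = g' x"
  shows "has_weak_pd U i u g \<longleftrightarrow> has_weak_pd U i u' g'"
proof -
  have Ub: "U \<in> sets borel" using U by simp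
  have "(LINT x|lebesgue_on U. pd i \<phi> x *\<^sub>R u x) = (LINT x|lebesgue_on U. pd i \<phi> x *\<^sub>R u' x)
      \<and> (LINT x|lebesgue_on U. \<phi> x *\<^sub>R g x) = (LINT x|lebesgue_on U. \<phi> x *\<^sub>R g' x)" if t: "\<phi> \<in> test_functions U" for \<phi>
    using integral_representative[OF Ub u(1) u'(1) eq(1) smooth_borel[OF smooth_pd[OF test_smooth[OF t]]]]
      integral_representative[OF Ub borel_measurable_lebesgue_on[OF u'(1)] u'(1) _ smooth_borel[OF smooth_pd[OF test_smooth[OF t]]]]
      integral_representative[OF Ub u(2) u'(2) eq(2) smooth_borel[OF test_smooth[OF t]]]
      integral_representative[OF Ub borel_measurable_lebesgue_on[OF u'(2)] u'(2) _ smooth_borel[OF test_smooth[OF t]]]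
    by simp
  then show ?thesis by (simp add: has_weak_pd_def)
qed

lemma weak_laplacian_representative:
  assumes U: "open U" and u: "u \<in> borel_measurable (lebesgue_on U)" "F \<in> borel_measurable (lebesgue_on U)"
    and u': "u' \<in> borel_measurable borel" "F' \<in> borel_measurable borel"
    and eq: "AE x in lborel. x \<in> U \<longrightarrow> u x = u' x" "AE x in lborel. x \<in> U \<longrightarrow> F x = F' x"
  shows "has_weak_laplacian U u F \<longleftrightarrow> has_weak_laplacian U u' F'"
proof -
  have Ub: "U \<in> sets borel" using U by simp
  have "(LINT x|lebesgue_on U. lap \<phi> x *\<^sub>R u x) = (LINT x|lebesgue_on U. lap \<phi> x *\<^sub>R u' x)
      \<and> (LINT x|lebesgue_on U. \<phi> x *\<^sub>R F x) = (LINT x|lebesgue_on U. \<phi> x *\<^sub>R F' x)" if t: "\<phi> \<in> test_functions U" for \<phi>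
    using integral_representative[OF Ub u(1) u'(1) eq(1) smooth_borel[OF smooth_lap[OF test_smooth[OF t]]]]
      integral_representative[OF Ub borel_measurable_lebesgue_on[OF u'(1)] u'(1) _ smooth_borel[OF smooth_lap[OF test_smooth[OF t]]]]
      integral_representative[OF Ub u(2) u'(2) eq(2) smooth_borel[OF test_smooth[OF t]]]
      integral_representative[OF Ub borel_measurable_lebesgue_on[OF u'(2)] u'(2) _ smooth_borel[OF test_smooth[OF t]]]
    by simp
  then show ?thesis by (simp add: has_weak_laplacian_def lap_def)
qed

lemma zero_off_integrable:
  fixes U :: "(real^2) set" and u :: "real^2 \<Rightarrow> complex"
  assumes "u \<in> L2 lborel" "bounded U" "\<And>x. x \<notin> U \<Longrightarrow> u x = 0"
  shows "integrable lborel u"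
  by (rule L2_integrable_bounded_set[OF assms(1) bounded_subset[OF assms(2)]]) (use assms(3) in auto)

text \<open>\<open>weak_pd\<close> is a choice among all weak derivatives. Existence makes the
  choice legitimate, and uniqueness up to null sets ties it to the given derivative
  \<open>g\<close>.\<close>

lemma weak_pd_choice:
  assumes U: "open U" "bounded U" and v: "v \<in> borel_measurable (lebesgue_on U)" "v' \<in> borel_measurable borel"
    "AE x in lborel. x \<in> U \<longrightarrow> v x = v' x"
    and g: "g \<in> L2 lborel" "integrable lborel g" "has_weak_pd U i v' g"
  shows "weak_pd U i v \<in> L2 (lebesgue_on U)" "AE x in lborel. x \<in> U \<longrightarrow> weak_pd U i v x = g x"
proof -
  have Ub: "U \<in> sets borel" using U by simp
  have gm: "g \<in> borel_measurable borel" using L2_D(1)[OF g(1)] by simp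
  have "g \<in> L2 (lebesgue_on U)"
    by (rule L2_of_representative[OF Ub borel_measurable_lebesgue_on[OF gm] g(1)]) simp
  moreover have "has_weak_pd U i v g"
    by (subst weak_pd_representative[OF U(1) v(1) borel_measurable_lebesgue_on[OF gm] v(2) gm v(3)]) (simp, rule g(3))
  ultimately have "weak_pd U i v \<in> L2 (lebesgue_on U) \<and> has_weak_pd U i v (weak_pd U i v)"
    unfolding weak_pd_def by (intro someI[where P = "\<lambda>g. g \<in> L2 (lebesgue_on U) \<and> has_weak_pd U i v g"] conjI)
  then have p: "weak_pd U i v \<in> L2 (lebesgue_on U)" "has_weak_pd U i v (weak_pd U i v)" by simp_all
  then show "weak_pd U i v \<in> L2 (lebesgue_on U)" by simp
  obtain p' where p': "p' \<in> L2 lborel" "\<And>x. x \<notin> U \<Longrightarrow> p' x = 0" "AE x in lborel. x \<in> U \<longrightarrow> weak_pd U i v x = p' x"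
    by (rule L2_representative[OF Ub p(1)]) (rule that, assumption+)
  have ip': "integrable lborel p'" by (rule zero_off_integrable[OF p'(1) U(2)]) (rule p'(2))
  have "has_weak_pd U i v' p'"
    using weak_pd_representative[OF U(1) v(1) L2_D(1)[OF p(1)] v(2) _ v(3) p'(3)] p(2) L2_D(1)[OF p'(1), unfolded measurable_lborel2] by blast
  then have "AE x in lborel. x \<in> U \<longrightarrow> p' x = g x"
    by (rule weak_pd_unique[OF U(1) bounded_ne_UNIV[OF U(2)] v(2) p'(1) ip' g(1,2) _ g(3)])
  with p'(3) show "AE x in lborel. x \<in> U \<longrightarrow> weak_pd U i v x = g x" by eventually_elim simp
qed

lemma weak_laplacian_choice:
  assumes U: "open U" "bounded U" and v: "v \<in> borel_measurable (lebesgue_on U)" "v' \<in> borel_measurable borel"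
    "AE x in lborel. x \<in> U \<longrightarrow> v x = v' x"
    and g: "g \<in> L2 lborel" "integrable lborel g" "has_weak_laplacian U v' g"
  shows "weak_laplacian U v \<in> L2 (lebesgue_on U)" "AE x in lborel. x \<in> U \<longrightarrow> weak_laplacian U v x = g x"
proof -
  have Ub: "U \<in> sets borel" using U by simp
  have gm: "g \<in> borel_measurable borel" using L2_D(1)[OF g(1)] by simp
  have "g \<in> L2 (lebesgue_on U)"
    by (rule L2_of_representative[OF Ub borel_measurable_lebesgue_on[OF gm] g(1)]) simp
  moreover have "has_weak_laplacian U v g"
    by (subst weak_laplacian_representative[OF U(1) v(1) borel_measurable_lebesgue_on[OF gm] v(2) gm v(3)]) (simp, rule g(3))
  ultimately have "weak_laplacian U v \<in> L2 (lebesgue_on U) \<and> has_weak_laplacian U v (weak_laplacian U v)"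
    unfolding weak_laplacian_def by (intro someI[where P = "\<lambda>g. g \<in> L2 (lebesgue_on U) \<and> has_weak_laplacian U v g"] conjI)
  then have p: "weak_laplacian U v \<in> L2 (lebesgue_on U)" "has_weak_laplacian U v (weak_laplacian U v)" by simp_all
  then show "weak_laplacian U v \<in> L2 (lebesgue_on U)" by simp
  obtain p' where p': "p' \<in> L2 lborel" "\<And>x. x \<notin> U \<Longrightarrow> p' x = 0" "AE x in lborel. x \<in> U \<longrightarrow> weak_laplacian U v x = p' x"
    by (rule L2_representative[OF Ub p(1)]) (rule that, assumption+)
  have ip': "integrable lborel p'" by (rule zero_off_integrable[OF p'(1) U(2)]) (rule p'(2))
  have "has_weak_laplacian U v' p'"
    using weak_laplacian_representative[OF U(1) v(1) L2_D(1)[OF p(1)] v(2) _ v(3) p'(3)] p(2) L2_D(1)[OF p'(1), unfolded measurable_lborel2] by blast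
  then have "AE x in lborel. x \<in> U \<longrightarrow> p' x = g x"
    by (rule weak_laplacian_unique[OF U(1) bounded_ne_UNIV[OF U(2)] v(2) p'(1) ip' g(1,2) _ g(3)])
  with p'(3) show "AE x in lborel. x \<in> U \<longrightarrow> weak_laplacian U v x = g x" by eventually_elim simp
qed

text \<open>A Cauchy-Schwarz argument in the form of Young's inequality. The limit is measured by a
  nonnegative integral, whose smallness for late \<open>n\<close> yields the integrability of the
  squared difference.\<close>

lemma L2_pairing_limit:
  fixes c :: "'a \<Rightarrow> real" and h :: "'a \<Rightarrow> complex"
  assumes c: "c \<in> borel_measurable M" "integrable M (\<lambda>x. (c x)\<^sup>2)"
    and h: "\<And>n. hn n \<in> borel_measurable M" "h \<in> borel_measurable M"
    and lim: "(\<lambda>n. \<integral>\<^sup>+x. ennreal ((norm (hn n x - h x))\<^sup>2) \<partial>M) \<longlonglongrightarrow> 0"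
    and i: "\<And>n. integrable M (\<lambda>x. c x *\<^sub>R hn n x)"
  shows "(\<lambda>n. LINT x|M. c x *\<^sub>R hn n x) \<longlonglongrightarrow> (LINT x|M. c x *\<^sub>R h x)"
proof (rule tendstoI)
  fix e :: real assume e: "e > 0"
  define K where "K = (LINT x|M. (c x)\<^sup>2)"
  have K: "K \<ge> 0" unfolding K_def by (intro integral_nonneg_AE) auto
  \<comment> \<open>The weight in \<open>a * b \<le> s / 2 * a^2 + b^2 / (2 * s)\<close>: with this
    \<open>s\<close> the first term contributes at most \<open>e / 2\<close>, and the second less
    than \<open>e / 2\<close> once the squared distance is below \<open>e * s\<close>.\<close>
  define s where "s = e / (K + 1)"
  have s: "s > 0" using e K by (simp add: s_def)
  have "\<forall>\<^sub>F n in sequentially. (\<integral>\<^sup>+x. ennreal ((norm (hn n x - h x))\<^sup>2) \<partial>M) < ennreal (e * s)"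
    using lim by (rule order_tendstoD(2)) (use e s in simp)
  then show "\<forall>\<^sub>F n in sequentially. dist (LINT x|M. c x *\<^sub>R hn n x) (LINT x|M. c x *\<^sub>R h x) < e"
  proof eventually_elim
    case (elim n)
    define d where "d x = hn n x - h x" for x
    have md: "d \<in> borel_measurable M" unfolding d_def by (intro borel_measurable_diff h)
    have md2: "(\<lambda>x. (norm (d x))\<^sup>2) \<in> borel_measurable M" using md by measurable
    have id: "integrable M (\<lambda>x. (norm (d x))\<^sup>2)"
      by (rule integrableI_nonneg[OF md2]) (use elim in \<open>auto simp: d_def intro: less_trans ennreal_less_top\<close>)
    have "ennreal (LINT x|M. (norm (d x))\<^sup>2) < ennreal (e * s)"
      using elim nn_integral_eq_integral[OF id] by (simp add: d_def)
    then have dl: "(LINT x|M. (norm (d x))\<^sup>2) < e * s" using e s by (simp add: ennreal_less_iff)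
    have dL: "d \<in> L2 M" using md id by (simp add: L2_def)
    have icd: "integrable M (\<lambda>x. c x *\<^sub>R d x)" by (rule L2_mult_integrable[OF dL c])
    have "(\<lambda>x. c x *\<^sub>R h x) = (\<lambda>x. c x *\<^sub>R hn n x - c x *\<^sub>R d x)"
      by (auto simp: d_def algebra_simps)
    then have ich: "integrable M (\<lambda>x. c x *\<^sub>R h x)"
      using Bochner_Integration.integrable_diff[OF i[of n] icd] by (simp only:)
    have "(LINT x|M. c x *\<^sub>R hn n x) - (LINT x|M. c x *\<^sub>R h x) = (LINT x|M. c x *\<^sub>R d x)"
      by (subst Bochner_Integration.integral_diff[OF i ich, symmetric]) (simp add: d_def scaleR_diff_right)
    also have "norm \<dots> \<le> (LINT x|M. norm (c x *\<^sub>R d x))" by (rule integral_norm_bound)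
    also have "\<dots> \<le> (LINT x|M. (s / 2) * (c x)\<^sup>2 + (1 / (2 * s)) * (norm (d x))\<^sup>2)"
    proof (rule integral_mono[OF integrable_norm[OF icd]])
      show "integrable M (\<lambda>x. (s / 2) * (c x)\<^sup>2 + (1 / (2 * s)) * (norm (d x))\<^sup>2)" using c(2) id by simp
      fix x
      have "0 \<le> (s * \<bar>c x\<bar> - norm (d x))\<^sup>2 / (2 * s)" using s by simp
      also have "\<dots> = (s / 2) * (c x)\<^sup>2 - \<bar>c x\<bar> * norm (d x) + (1 / (2 * s)) * (norm (d x))\<^sup>2"
        using s by (simp add: power2_diff power_mult_distrib field_simps) (simp add: power2_eq_square algebra_simps)
      finally show "norm (c x *\<^sub>R d x) \<le> (s / 2) * (c x)\<^sup>2 + (1 / (2 * s)) * (norm (d x))\<^sup>2" by simp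
    qed
    also have "\<dots> = (s / 2) * K + (1 / (2 * s)) * (LINT x|M. (norm (d x))\<^sup>2)"
      using c(2) id by (simp add: K_def)
    also have "\<dots> < e"
    proof -
      have "(s / 2) * K \<le> e / 2"
      proof -
        have "s * K \<le> s * (K + 1)" using s by (intro mult_left_mono) auto
        also have "\<dots> = e" using K by (simp add: s_def)
        finally show ?thesis by simp
      qed
      moreover have "(1 / (2 * s)) * (LINT x|M. (norm (d x))\<^sup>2) < (1 / (2 * s)) * (e * s)"
        using dl s by (intro mult_strict_left_mono) auto
      moreover have "(1 / (2 * s)) * (e * s) = e / 2" using s by simp
      ultimately show ?thesis by linarith
    qed
    finally show ?case by (simp add: dist_norm)
  qed
qed

section \<open>Green's formula with traces and weak normal derivatives\<close>

lemma norm_direction [simp]: "norm (direction \<theta>) = 1"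
  by (simp add: norm_eq_1 inner_vec2 direction_def power2_eq_square[symmetric])

lemma side_length_integral:
  fixes F :: "real^2 \<Rightarrow> complex"
  assumes F: "continuous_on UNIV F"
  shows "integrable (side_length \<theta> r0) F"
    and "(\<And>x. norm x \<ge> r0 \<Longrightarrow> F x = 0) \<Longrightarrow> (LINT x|side_length \<theta> r0. F x) = side_integral (direction \<theta>) F"
proof -
  let ?q = "\<lambda>s. F (s *\<^sub>R direction \<theta>)"
  have m: "(\<lambda>r. r *\<^sub>R direction \<theta>) \<in> restrict_space lborel {0<..<r0} \<rightarrow>\<^sub>M borel"
    by (rule measurable_restrict_space1) simp
  have mF: "F \<in> borel_measurable borel" by (rule borel_measurable_continuous_onI[OF F])
  have O: "{0<..<r0} \<inter> space lborel \<in> sets lborel" by simp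
  have cq: "continuous_on UNIV ?q" by (intro continuous_on_compose2[OF F] continuous_intros) auto
  have "integrable lborel (\<lambda>s. indicator {0..r0} s *\<^sub>R ?q s)"
    by (rule borel_integrable_compact) (auto intro: continuous_on_subset[OF cq])
  then have "integrable lborel (\<lambda>s. indicator {0<..<r0} s *\<^sub>R (indicator {0..r0} s *\<^sub>R ?q s))"
    by (rule integrable_mult_indicator[rotated]) simp
  moreover have "(\<lambda>s. indicator {0<..<r0} s *\<^sub>R (indicator {0..r0} s *\<^sub>R ?q s)) = (\<lambda>s. indicator {0<..<r0} s *\<^sub>R ?q s)"
    by (auto simp: indicator_def fun_eq_iff)
  ultimately have "integrable lborel (\<lambda>s. indicator {0<..<r0} s *\<^sub>R ?q s)" by (simp only:)
  then have "integrable (restrict_space lborel {0<..<r0}) ?q"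
    using integrable_restrict_space[OF O, of ?q] by simp
  then show "integrable (side_length \<theta> r0) F"
    unfolding side_length_def by (subst integrable_distr_eq[OF m mF])
  show "(LINT x|side_length \<theta> r0. F x) = side_integral (direction \<theta>) F" if z: "\<And>x. norm x \<ge> r0 \<Longrightarrow> F x = 0"
  proof -
    have "(LINT x|side_length \<theta> r0. F x) = (LINT s|restrict_space lborel {0<..<r0}. ?q s)"
      unfolding side_length_def by (rule integral_distr[OF m mF])
    also have "\<dots> = (LINT s|lborel. indicator {0<..<r0} s *\<^sub>R ?q s)"
      by (rule integral_restrict_space[OF O])
    also have "\<dots> = (LINT s|lborel. indicator {0<..} s *\<^sub>R ?q s)"
    proof (intro Bochner_Integration.integral_cong refl)
      fix s :: real
      show "indicator {0<..<r0} s *\<^sub>R ?q s = indicator {0<..} s *\<^sub>R ?q s"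
        using z[of "s *\<^sub>R direction \<theta>"] by (cases "s \<ge> r0"; cases "s > 0") (auto simp: indicator_def)
    qed
    finally show ?thesis by (simp add: side_integral_def)
  qed
qed

lemma cut_agree:
  assumes "\<And>x. x \<notin> B \<Longrightarrow> p x = 0" "\<And>x. x \<in> B \<Longrightarrow> x \<in> A \<longleftrightarrow> x \<in> A'"
  shows "p x *\<^sub>R cut A u x = p x *\<^sub>R cut A' u x"
  using assms[of x] by (cases "x \<in> B") (auto simp: indicator_def)

text \<open>Green's formula holds for the smooth functions that define the trace. Each of its three
  integrals pairs a fixed test function with a sequence converging in square mean, so it passes to
  the limit.\<close>

lemma trace_green:
  assumes c: "corner (direction \<theta>) \<nu> f \<mu>" and r: "0 < r" "r < r0"
    and \<Omega>: "open \<Omega>" "\<And>x. x \<in> ball 0 r \<Longrightarrow> x \<in> \<Omega> \<longleftrightarrow> x \<in> cone (direction \<theta>) f"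
    and tr: "has_trace \<Omega> (side_length \<theta> r0) v g"
    and v: "v \<in> borel_measurable (lebesgue_on \<Omega>)" "v' \<in> borel_measurable borel" "AE x in lborel. x \<in> \<Omega> \<longrightarrow> v x = v' x"
    and p: "weak_pd \<Omega> i v \<in> borel_measurable (lebesgue_on \<Omega>)" "p' \<in> borel_measurable borel"
      "AE x in lborel. x \<in> \<Omega> \<longrightarrow> weak_pd \<Omega> i v x = p' x"
    and t: "\<phi> \<in> test_functions (slit_ball r f)"
  shows "(LINT x|lborel. pd i \<phi> x *\<^sub>R cut (cone (direction \<theta>) f) v' x) + (LINT x|lborel. \<phi> x *\<^sub>R cut (cone (direction \<theta>) f) p' x)
    = (\<nu> $ i) *\<^sub>R (LINT x|side_length \<theta> r0. \<phi> x *\<^sub>R g x)"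
proof -
  let ?e = "direction \<theta>" and ?\<sigma> = "side_length \<theta> r0" and ?L = "lebesgue_on \<Omega>" and ?B = "ball (0::real^2) r"
  let ?S = "cone ?e f"
  note s = test_smooth[OF t] and b = test_bsupp[OF t]
  have tB: "\<phi> \<in> test_functions ?B" by (rule test_mono[OF t slit_ball_subset])
  have \<Omega>b: "\<Omega> \<in> sets borel" using \<Omega>(1) by simp
  have mg: "g \<in> borel_measurable ?\<sigma>" using tr by (simp add: has_trace_def)
  obtain \<Phi> where \<Phi>: "\<And>n. smooth (\<Phi> n)"
    "(\<lambda>n. \<integral>\<^sup>+x. ennreal ((norm (\<Phi> n x - v x))\<^sup>2 + (\<Sum>i\<in>UNIV. (norm (pd i (\<Phi> n) x - weak_pd \<Omega> i v x))\<^sup>2)) \<partial>?L) \<longlonglongrightarrow> 0"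
    "(\<lambda>n. \<integral>\<^sup>+x. ennreal ((norm (\<Phi> n x - g x))\<^sup>2) \<partial>?\<sigma>) \<longlonglongrightarrow> 0"
    using tr unfolding has_trace_def by blast
  have l1: "(\<lambda>n. \<integral>\<^sup>+x. ennreal ((norm (\<Phi> n x - v x))\<^sup>2) \<partial>?L) \<longlonglongrightarrow> 0"
    by (rule tendsto_sandwich[OF _ _ tendsto_const \<Phi>(2)])
      (auto intro!: always_eventually nn_integral_mono ennreal_leI sum_nonneg)
  have l2: "(\<lambda>n. \<integral>\<^sup>+x. ennreal ((norm (pd i (\<Phi> n) x - weak_pd \<Omega> i v x))\<^sup>2) \<partial>?L) \<longlonglongrightarrow> 0"
  proof (rule tendsto_sandwich[OF _ _ tendsto_const \<Phi>(2)])
    have "(norm (pd i (\<Phi> n) x - weak_pd \<Omega> i v x))\<^sup>2 \<le> (norm (\<Phi> n x - v x))\<^sup>2 + (\<Sum>i\<in>UNIV. (norm (pd i (\<Phi> n) x - weak_pd \<Omega> i v x))\<^sup>2)" for n x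
      using member_le_sum[of i UNIV "\<lambda>i. (norm (pd i (\<Phi> n) x - weak_pd \<Omega> i v x))\<^sup>2"] by (simp add: add_increasing)
    then show "\<forall>\<^sub>F n in sequentially. (\<integral>\<^sup>+x. ennreal ((norm (pd i (\<Phi> n) x - weak_pd \<Omega> i v x))\<^sup>2) \<partial>?L)
      \<le> (\<integral>\<^sup>+x. ennreal ((norm (\<Phi> n x - v x))\<^sup>2 + (\<Sum>i\<in>UNIV. (norm (pd i (\<Phi> n) x - weak_pd \<Omega> i v x))\<^sup>2)) \<partial>?L)"
      by (intro always_eventually allI nn_integral_mono ennreal_leI)
  qed simp
  have iS: "integrable ?L G" if "smooth G" "bsupp G" for G :: "real^2 \<Rightarrow> 'c::{banach, second_countable_topology}"
    unfolding integral_lebesgue_on(2)[OF \<Omega>b smooth_borel[OF that(1)]]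
    by (rule integrable_mult_indicator[OF _ integrable_smooth[OF that]]) (use \<Omega>b in simp)
  have sq: "integrable ?L (\<lambda>x. (p x)\<^sup>2)" if "smooth p" "bsupp p" for p :: "real^2 \<Rightarrow> real"
    using iS[OF smooth_mult[OF that(1,1)] bsupp_mult[OF that(2)]] by (simp add: power2_eq_square)
  note bm = borel_measurable_lebesgue_on[OF smooth_borel]
  have A: "(\<lambda>n. LINT x|?L. pd i \<phi> x *\<^sub>R \<Phi> n x) \<longlonglongrightarrow> (LINT x|?L. pd i \<phi> x *\<^sub>R v x)"
    by (rule L2_pairing_limit[OF _ _ _ v(1) l1]) (intro bm sq iS smooth_scaleR bsupp_scaleR smooth_pd bsupp_pd s b \<Phi>(1))+
  have B: "(\<lambda>n. LINT x|?L. \<phi> x *\<^sub>R pd i (\<Phi> n) x) \<longlonglongrightarrow> (LINT x|?L. \<phi> x *\<^sub>R weak_pd \<Omega> i v x)"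
    by (rule L2_pairing_limit[OF _ _ _ p(1) l2]) (intro bm sq iS smooth_scaleR bsupp_scaleR smooth_pd bsupp_pd s b \<Phi>(1))+
  have C: "(\<lambda>n. LINT x|?\<sigma>. \<phi> x *\<^sub>R \<Phi> n x) \<longlonglongrightarrow> (LINT x|?\<sigma>. \<phi> x *\<^sub>R g x)"
  proof (rule L2_pairing_limit[OF _ _ _ mg \<Phi>(3)])
    have bs: "G \<in> borel_measurable ?\<sigma>" if "G \<in> borel_measurable borel" for G :: "real^2 \<Rightarrow> 'c::topological_space"
      using that by (simp add: side_length_def)
    show "\<phi> \<in> borel_measurable ?\<sigma>" "\<Phi> n \<in> borel_measurable ?\<sigma>" for n
      by (intro bs smooth_borel s \<Phi>(1))+
    show "integrable ?\<sigma> (\<lambda>x. \<phi> x *\<^sub>R \<Phi> n x)" for n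
      by (rule side_length_integral(1)) (intro smooth_continuous smooth_scaleR s \<Phi>(1))
    have "integrable ?\<sigma> (\<lambda>x. complex_of_real ((\<phi> x)\<^sup>2))"
      by (rule side_length_integral(1)) (intro continuous_intros smooth_continuous s)
    then show "integrable ?\<sigma> (\<lambda>x. (\<phi> x)\<^sup>2)" by (simp only: complex_of_real_integrable_eq)
  qed
  have key: "(LINT x|?L. pd i \<phi> x *\<^sub>R \<Phi> n x) + (LINT x|?L. \<phi> x *\<^sub>R pd i (\<Phi> n) x) = (\<nu> $ i) *\<^sub>R (LINT x|?\<sigma>. \<phi> x *\<^sub>R \<Phi> n x)" for n
  proof -
    have conv: "(LINT x|?L. q x *\<^sub>R G x) = (LINT x|lborel. q x *\<^sub>R cut ?S (cut ?B G) x)"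
      if "smooth q" "smooth G" "\<And>x. x \<notin> ?B \<Longrightarrow> q x = 0" for q :: "real^2 \<Rightarrow> real" and G :: "real^2 \<Rightarrow> complex"
    proof -
      have "(LINT x|?L. q x *\<^sub>R G x) = (LINT x|lborel. q x *\<^sub>R cut \<Omega> G x)"
        by (rule integral_representative[OF \<Omega>b borel_measurable_lebesgue_on[OF smooth_borel[OF that(2)]] smooth_borel[OF that(2)] _ smooth_borel[OF that(1)]]) simp
      also have "\<dots> = (LINT x|lborel. q x *\<^sub>R cut ?S (cut ?B G) x)"
      proof (intro Bochner_Integration.integral_cong refl)
        fix x show "q x *\<^sub>R cut \<Omega> G x = q x *\<^sub>R cut ?S (cut ?B G) x"
          using that(3)[of x] \<Omega>(2)[of x] by (cases "x \<in> ?B") (auto simp: indicator_def)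
      qed
      finally show ?thesis .
    qed
    have "(LINT x|?L. pd i \<phi> x *\<^sub>R \<Phi> n x) + (LINT x|?L. \<phi> x *\<^sub>R pd i (\<Phi> n) x)
      = (LINT x|lborel. pd i \<phi> x *\<^sub>R cut ?S (cut ?B (\<Phi> n)) x) + (LINT x|lborel. \<phi> x *\<^sub>R cut ?S (cut ?B (pd i (\<Phi> n))) x)"
      using conv[OF smooth_pd[OF s] \<Phi>(1) test_zero(2)[OF tB]] conv[OF s smooth_pd[OF \<Phi>(1)] test_zero(1)[OF tB]] by simp
    also have "\<dots> = (\<nu> $ i) *\<^sub>R side_integral ?e (\<lambda>x. \<phi> x *\<^sub>R \<Phi> n x)"
      by (rule green_side[OF c t \<Phi>(1)])
    also have "side_integral ?e (\<lambda>x. \<phi> x *\<^sub>R \<Phi> n x) = (LINT x|?\<sigma>. \<phi> x *\<^sub>R \<Phi> n x)"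
    proof (rule side_length_integral(2)[symmetric])
      show "continuous_on UNIV (\<lambda>x. \<phi> x *\<^sub>R \<Phi> n x)" by (intro smooth_continuous smooth_scaleR s \<Phi>(1))
      show "\<phi> x *\<^sub>R \<Phi> n x = 0" if "norm x \<ge> r0" for x using test_zero(1)[OF tB, of x] that r by simp
    qed
    finally show ?thesis .
  qed
  have "(\<lambda>n. (\<nu> $ i) *\<^sub>R (LINT x|?\<sigma>. \<phi> x *\<^sub>R \<Phi> n x)) \<longlonglongrightarrow> (LINT x|?L. pd i \<phi> x *\<^sub>R v x) + (LINT x|?L. \<phi> x *\<^sub>R weak_pd \<Omega> i v x)"
    using tendsto_add[OF A B] by (simp only: key)
  moreover have "(\<lambda>n. (\<nu> $ i) *\<^sub>R (LINT x|?\<sigma>. \<phi> x *\<^sub>R \<Phi> n x)) \<longlonglongrightarrow> (\<nu> $ i) *\<^sub>R (LINT x|?\<sigma>. \<phi> x *\<^sub>R g x)"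
    by (rule tendsto_scaleR[OF tendsto_const C])
  ultimately have "(LINT x|?L. pd i \<phi> x *\<^sub>R v x) + (LINT x|?L. \<phi> x *\<^sub>R weak_pd \<Omega> i v x) = (\<nu> $ i) *\<^sub>R (LINT x|?\<sigma>. \<phi> x *\<^sub>R g x)"
    by (rule LIMSEQ_unique)
  moreover have "(LINT x|?L. pd i \<phi> x *\<^sub>R v x) = (LINT x|lborel. pd i \<phi> x *\<^sub>R cut ?S v' x)"
    unfolding integral_representative[OF \<Omega>b v smooth_borel[OF smooth_pd[OF s]]]
    by (intro Bochner_Integration.integral_cong refl cut_agree[OF test_zero(2)[OF tB] \<Omega>(2)])
  moreover have "(LINT x|?L. \<phi> x *\<^sub>R weak_pd \<Omega> i v x) = (LINT x|lborel. \<phi> x *\<^sub>R cut ?S p' x)"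
    unfolding integral_representative[OF \<Omega>b p smooth_borel[OF s]]
    by (intro Bochner_Integration.integral_cong refl cut_agree[OF test_zero(1)[OF tB] \<Omega>(2)])
  ultimately show ?thesis by simp
qed

lemma normal_derivative_representative:
  assumes \<Omega>: "open \<Omega>" "\<And>x. x \<in> ball 0 r \<Longrightarrow> x \<in> \<Omega> \<longleftrightarrow> x \<in> S"
    and p: "\<And>i. weak_pd \<Omega> i v \<in> L2 (lebesgue_on \<Omega>)" "\<And>i. p' i \<in> borel_measurable borel"
      "\<And>i. AE x in lborel. x \<in> \<Omega> \<longrightarrow> weak_pd \<Omega> i v x = p' i x"
    and l: "weak_laplacian \<Omega> v \<in> L2 (lebesgue_on \<Omega>)" "l' \<in> borel_measurable borel"
      "AE x in lborel. x \<in> \<Omega> \<longrightarrow> weak_laplacian \<Omega> v x = l' x"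
    and t: "\<phi> \<in> test_functions (ball 0 r)"
  shows "normal_derivative \<Omega> v \<phi> = (\<Sum>i\<in>UNIV. LINT x|lborel. pd i \<phi> x *\<^sub>R cut S (p' i) x) + (LINT x|lborel. \<phi> x *\<^sub>R cut S l' x)"
proof -
  let ?L = "lebesgue_on \<Omega>"
  note s = test_smooth[OF t] and b = test_bsupp[OF t]
  have \<Omega>b: "\<Omega> \<in> sets borel" using \<Omega>(1) by simp
  have sq: "integrable ?L (\<lambda>x. (q x)\<^sup>2)" if "smooth q" "bsupp q" for q :: "real^2 \<Rightarrow> real"
  proof -
    have "integrable ?L (\<lambda>x. q x * q x)"
      unfolding integral_lebesgue_on(2)[OF \<Omega>b smooth_borel[OF smooth_mult[OF that(1,1)]]]
      by (rule integrable_mult_indicator[OF _ integrable_smooth[OF smooth_mult[OF that(1,1)] bsupp_mult[OF that(2)]]]) (use \<Omega>b in simp)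
    then show ?thesis by (simp add: power2_eq_square)
  qed
  note bm = borel_measurable_lebesgue_on[OF smooth_borel]
  have i1: "integrable ?L (\<lambda>x. pd i \<phi> x *\<^sub>R weak_pd \<Omega> i v x)" for i
    by (rule L2_mult_integrable[OF p(1)]) (intro bm sq smooth_pd bsupp_pd s b)+
  have i2: "integrable ?L (\<lambda>x. \<phi> x *\<^sub>R weak_laplacian \<Omega> v x)"
    by (rule L2_mult_integrable[OF l(1)]) (intro bm sq s b)+
  have "normal_derivative \<Omega> v \<phi> = (\<Sum>i\<in>UNIV. LINT x|?L. pd i \<phi> x *\<^sub>R weak_pd \<Omega> i v x) + (LINT x|?L. \<phi> x *\<^sub>R weak_laplacian \<Omega> v x)"
    unfolding normal_derivative_def
    by (subst Bochner_Integration.integral_add[OF Bochner_Integration.integrable_sum[OF i1] i2])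
      (simp only: Bochner_Integration.integral_sum[OF i1])
  moreover have "(LINT x|?L. pd i \<phi> x *\<^sub>R weak_pd \<Omega> i v x) = (LINT x|lborel. pd i \<phi> x *\<^sub>R cut S (p' i) x)" for i
    unfolding integral_representative[OF \<Omega>b L2_D(1)[OF p(1)] p(2,3) smooth_borel[OF smooth_pd[OF s]]]
    by (intro Bochner_Integration.integral_cong refl cut_agree[OF test_zero(2)[OF t] \<Omega>(2)])
  moreover have "(LINT x|?L. \<phi> x *\<^sub>R weak_laplacian \<Omega> v x) = (LINT x|lborel. \<phi> x *\<^sub>R cut S l' x)"
    unfolding integral_representative[OF \<Omega>b L2_D(1)[OF l(1)] l(2,3) smooth_borel[OF s]]
    by (intro Bochner_Integration.integral_cong refl cut_agree[OF test_zero(1)[OF t] \<Omega>(2)])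
  ultimately show ?thesis by simp
qed

section \<open>Translating the hypotheses into conditions on a corner\<close>

lemma sector_corner:
  assumes "- pi \<le> \<theta>m" "\<theta>m < \<theta>M" "\<theta>M < pi" "\<theta>M - \<theta>m < pi"
  shows "corner (direction \<theta>M) (perp (direction \<theta>M)) (direction \<theta>m) (- perp (direction \<theta>m))" (is ?c)
    and "sector \<theta>m \<theta>M = cone (direction \<theta>M) (direction \<theta>m)"
proof -
  have s: "sin (\<theta>M - \<theta>m) > 0" by (rule sin_gt_zero) (use assms in auto)
  have d: "direction \<theta> $ 1 = cos \<theta>" "direction \<theta> $ 2 = sin \<theta>" for \<theta>
    by (simp_all add: direction_def)
  from s show c: ?c
    by (simp add: corner_def inner_vec2 d sin_diff algebra_simps)
  \<comment> \<open>The signs of the two sines describe the sector only modulo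
    \<open>2 * pi\<close>. With \<open>\<phi>\<close> in the range of \<open>Arg\<close>, an angle
    beyond one bound but with the right sign there is more than \<open>pi\<close> away from it, and
    then the sign at the other bound fails.\<close>
  have "(\<theta>m < \<phi> \<and> \<phi> < \<theta>M) \<longleftrightarrow> (sin (\<phi> - \<theta>M) < 0 \<and> sin (\<phi> - \<theta>m) > 0)" if \<phi>: "- pi < \<phi>" "\<phi> \<le> pi" for \<phi>
  proof
    assume h: "\<theta>m < \<phi> \<and> \<phi> < \<theta>M"
    have "sin (\<theta>M - \<phi>) > 0" "sin (\<phi> - \<theta>m) > 0" by (rule sin_gt_zero; use h assms in simp)+
    then show "sin (\<phi> - \<theta>M) < 0 \<and> sin (\<phi> - \<theta>m) > 0"
      using sin_minus[of "\<theta>M - \<phi>"] by simp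
  next
    assume h: "sin (\<phi> - \<theta>M) < 0 \<and> sin (\<phi> - \<theta>m) > 0"
    have "\<phi> > \<theta>m"
    proof (rule ccontr)
      assume n: "\<not> \<theta>m < \<phi>"
      have "\<theta>m - \<phi> > pi"
      proof (rule ccontr)
        assume "\<not> pi < \<theta>m - \<phi>"
        then have "sin (\<theta>m - \<phi>) \<ge> 0" using n by (intro sin_ge_zero) auto
        then show False using h sin_minus[of "\<theta>m - \<phi>"] by simp
      qed
      then have "sin (\<phi> - \<theta>M + 2 * pi) > 0" using \<phi> assms by (intro sin_gt_zero) auto
      then show False using h by simp
    qed
    moreover have "\<phi> < \<theta>M"
    proof (rule ccontr)
      assume n: "\<not> \<phi> < \<theta>M"
      have "\<phi> - \<theta>M > pi"
      proof (rule ccontr)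
        assume "\<not> pi < \<phi> - \<theta>M"
        then have "sin (\<phi> - \<theta>M) \<ge> 0" using n by (intro sin_ge_zero) auto
        then show False using h by simp
      qed
      then have "\<phi> - \<theta>m - pi \<ge> 0" "\<phi> - \<theta>m - pi \<le> pi" using \<phi> assms by auto
      then have "sin (\<phi> - \<theta>m - pi) \<ge> 0" by (rule sin_ge_zero)
      then show False using h by (simp add: sin_diff)
    qed
    ultimately show "\<theta>m < \<phi> \<and> \<phi> < \<theta>M" by simp
  qed
  note trig = this
  show "sector \<theta>m \<theta>M = cone (direction \<theta>M) (direction \<theta>m)"
  proof (intro set_eqI)
    fix x :: "real^2"
    define z where "z = Complex (x $ 1) (x $ 2)"
    define \<rho> where "\<rho> = cmod z"
    have "z = rcis \<rho> (Arg z)" by (simp add: \<rho>_def rcis_cmod_Arg)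
    then have "Re z = \<rho> * cos (Arg z)" "Im z = \<rho> * sin (Arg z)"
      by (metis Re_rcis, metis Im_rcis)
    then have x12: "x $ 1 = \<rho> * cos (Arg z)" "x $ 2 = \<rho> * sin (Arg z)" by (simp_all add: z_def)
    have p: "perp (direction \<theta>M) \<bullet> x = \<rho> * sin (Arg z - \<theta>M)" "(- perp (direction \<theta>m)) \<bullet> x = - (\<rho> * sin (Arg z - \<theta>m))"
      by (simp_all add: inner_vec2 direction_def x12 sin_diff algebra_simps)
    have z0: "x = 0 \<longleftrightarrow> \<rho> = 0" by (simp add: \<rho>_def z_def vec2_eq_iff complex_eq_iff)
    have "\<rho> \<ge> 0" by (simp add: \<rho>_def)
    then have "(\<rho> * sin (Arg z - \<theta>M) < 0 \<and> - (\<rho> * sin (Arg z - \<theta>m)) < 0) \<longleftrightarrow> \<rho> \<noteq> 0 \<and> sin (Arg z - \<theta>M) < 0 \<and> sin (Arg z - \<theta>m) > 0"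
      by (auto simp: mult_less_0_iff zero_less_mult_iff)
    moreover have "x \<in> cone (direction \<theta>M) (direction \<theta>m) \<longleftrightarrow> (\<rho> * sin (Arg z - \<theta>M) < 0 \<and> - (\<rho> * sin (Arg z - \<theta>m)) < 0)"
      unfolding cone_halfplanes[OF c] mem_Collect_eq p ..
    moreover have "x \<in> sector \<theta>m \<theta>M \<longleftrightarrow> \<rho> \<noteq> 0 \<and> (\<theta>m < Arg z \<and> Arg z < \<theta>M)"
      by (simp add: sector_def z_def[symmetric] z0)
    ultimately show "x \<in> sector \<theta>m \<theta>M \<longleftrightarrow> x \<in> cone (direction \<theta>M) (direction \<theta>m)"
      using trig[of "Arg z"] Arg_bounded[of z] by simp
  qed
qed

text \<open>Collects what unique continuation consumes: Borel functions on the plane vanishing off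
  \<open>D\<close>, weak derivatives, and a constant in the differential inequality, which comes
  from the essential bound of the coefficient.\<close>

lemma helmholtz_data:
  fixes D :: "(real^2) set" and v \<gamma> :: "real^2 \<Rightarrow> complex"
  assumes D: "open D" and v: "v \<in> sobolev 1 D" and h: "helmholtz D \<gamma> v" and \<gamma>: "\<gamma> \<in> L_infinity (lebesgue_on D)"
  obtains v' g F C where "v' \<in> L2 lborel" "\<And>i. g i \<in> L2 lborel" "F \<in> L2 lborel"
    "\<And>i x. x \<notin> D \<Longrightarrow> g i x = 0" "\<And>x. x \<notin> D \<Longrightarrow> F x = 0" "\<And>x. x \<notin> D \<Longrightarrow> v' x = 0"
    "AE x in lborel. x \<in> D \<longrightarrow> v x = v' x"
    "\<And>i. has_weak_pd D i v' (g i)" "has_weak_laplacian D v' F"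
    "AE x in lborel. x \<in> D \<longrightarrow> F x = - (\<gamma> x * v' x)"
    "AE x in lborel. x \<in> D \<longrightarrow> norm (F x) \<le> C * norm (v' x)"
proof -
  have Db: "D \<in> sets borel" using D by simp
  have v2: "v \<in> L2 (lebesgue_on D)" and pd: "\<exists>g\<in>L2 (lebesgue_on D). has_weak_pd D i v g" for i
    using v by (auto simp: One_nat_def)
  obtain v' where v': "v' \<in> L2 lborel" "\<And>x. x \<notin> D \<Longrightarrow> v' x = 0" "AE x in lborel. x \<in> D \<longrightarrow> v x = v' x"
    by (rule L2_representative[OF Db v2]) (rule that, assumption+)
  have m: "v \<in> borel_measurable (lebesgue_on D)" "v' \<in> borel_measurable borel"
    using L2_D(1)[OF v2] L2_D(1)[OF v'(1)] by simp_all
  have "\<exists>p. p \<in> L2 lborel \<and> (\<forall>x. x \<notin> D \<longrightarrow> p x = 0) \<and> has_weak_pd D i v' p" for i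
  proof -
    obtain q where q: "q \<in> L2 (lebesgue_on D)" "has_weak_pd D i v q" using pd by blast
    obtain p where p: "p \<in> L2 lborel" "\<And>x. x \<notin> D \<Longrightarrow> p x = 0" "AE x in lborel. x \<in> D \<longrightarrow> q x = p x"
      by (rule L2_representative[OF Db q(1)]) (rule that, assumption+)
    have "p \<in> borel_measurable borel" using L2_D(1)[OF p(1)] by simp
    then have "has_weak_pd D i v' p"
      using weak_pd_representative[OF D m(1) L2_D(1)[OF q(1)] m(2) _ v'(3) p(3)] q(2) by blast
    then show ?thesis using p(1,2) by blast
  qed
  then obtain g where g: "\<And>i. g i \<in> L2 lborel \<and> (\<forall>x. x \<notin> D \<longrightarrow> g i x = 0) \<and> has_weak_pd D i v' (g i)"
    by metis
  obtain C where C: "AE x in lebesgue_on D. norm (\<gamma> x) \<le> C" and m\<gamma>: "\<gamma> \<in> borel_measurable (lebesgue_on D)"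
    using \<gamma> by (auto simp: L_infinity_def)
  define G where "G x = - (\<gamma> x * v x)" for x
  have mG: "G \<in> borel_measurable (lebesgue_on D)" unfolding G_def using m\<gamma> m(1) by measurable
  have "integrable (lebesgue_on D) (\<lambda>x. (norm (G x))\<^sup>2)"
  proof (rule Bochner_Integration.integrable_bound)
    show "integrable (lebesgue_on D) (\<lambda>x. C\<^sup>2 * (norm (v x))\<^sup>2)" using L2_D(2)[OF v2] by simp
    show "(\<lambda>x. (norm (G x))\<^sup>2) \<in> borel_measurable (lebesgue_on D)" using mG by measurable
    show "AE x in lebesgue_on D. norm ((norm (G x))\<^sup>2) \<le> norm (C\<^sup>2 * (norm (v x))\<^sup>2)"
      using C
    proof eventually_elim
      case (elim x)
      then have "(norm (\<gamma> x))\<^sup>2 \<le> C\<^sup>2" by (intro power_mono) auto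
      then show ?case by (simp add: G_def norm_mult power_mult_distrib mult_right_mono)
    qed
  qed
  then have G2: "G \<in> L2 (lebesgue_on D)" using mG by (simp add: L2_def)
  obtain F where F: "F \<in> L2 lborel" "\<And>x. x \<notin> D \<Longrightarrow> F x = 0" "AE x in lborel. x \<in> D \<longrightarrow> G x = F x"
    by (rule L2_representative[OF Db G2]) (rule that, assumption+)
  have "F \<in> borel_measurable borel" using L2_D(1)[OF F(1)] by simp
  moreover have "has_weak_laplacian D v G" using h by (simp add: helmholtz_def G_def[abs_def])
  ultimately have wF: "has_weak_laplacian D v' F"
    using weak_laplacian_representative[OF D m(1) mG m(2) _ v'(3) F(3)] by blast
  have F': "AE x in lborel. x \<in> D \<longrightarrow> F x = - (\<gamma> x * v' x)"
    using v'(3) F(3) by eventually_elim (auto simp: G_def)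
  have FC: "AE x in lborel. x \<in> D \<longrightarrow> norm (F x) \<le> C * norm (v' x)"
    using F' C[unfolded AE_lebesgue_on[OF Db]] by eventually_elim (auto simp: norm_mult mult_right_mono)
  show ?thesis
    by (rule that[of v' g F C]) (use v' g F wF F' FC in auto)
qed

text \<open>Every point off the support has a neighbourhood on which the function vanishes almost
  everywhere; by Lindelof countably many of these suffice, so the exceptional sets add up to a null
  set.\<close>

lemma ess_supp_AE:
  fixes D K :: "(real^2) set"
  assumes D: "open D" and s: "ess_supp D f \<subseteq> K"
  shows "AE x in lborel. x \<in> D - K \<longrightarrow> f x = 0"
proof -
  define N where "N = {N :: (real^2) set. open N \<and> (AE y in lborel. y \<in> D \<inter> N \<longrightarrow> f y = 0)}"
  have "D - K \<subseteq> \<Union>N"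
  proof
    fix x assume "x \<in> D - K"
    then have "x \<notin> ess_supp D f" using s by blast
    then obtain M where M: "open M" "x \<in> M" "AE y in lebesgue_on (D \<inter> M). f y = 0"
      by (auto simp: ess_supp_def)
    have "D \<inter> M \<in> sets borel" using D M(1) by simp
    with M show "x \<in> \<Union>N" unfolding N_def AE_lebesgue_on[OF \<open>D \<inter> M \<in> sets borel\<close>] by blast
  qed
  moreover obtain N' where N': "N' \<subseteq> N" "countable N'" "\<Union>N' = \<Union>N"
    by (rule Lindelof[of N]) (auto simp: N_def)
  moreover have "AE x in lborel. \<forall>M\<in>N'. x \<in> D \<inter> M \<longrightarrow> f x = 0"
    using N'(1) by (subst AE_ball_countable[OF N'(2)]) (auto simp: N_def)
  then have "AE x in lborel. x \<in> D \<inter> \<Union>N' \<longrightarrow> f x = 0"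
    by eventually_elim auto
  then show ?thesis by eventually_elim (use calculation in auto)
qed

lemma closure_near_corner:
  assumes c: "corner e \<nu> f \<mu>" and \<Omega>: "\<And>x. x \<in> ball 0 r \<Longrightarrow> x \<in> \<Omega> \<longleftrightarrow> x \<in> cone e f" and x: "x \<in> closure \<Omega>" "x \<in> ball 0 r"
  shows "x \<in> closed_cone \<nu> \<mu>"
proof -
  have "x \<in> closure (ball 0 r \<inter> \<Omega>)"
    using open_Int_closure_subset[of "ball 0 r" \<Omega>] x by auto
  moreover have "ball 0 r \<inter> \<Omega> \<subseteq> closed_cone \<nu> \<mu>"
    using \<Omega> cone_halfplanes[OF c] by (auto simp: closed_cone_def)
  ultimately show ?thesis using closure_minimal[OF _ closed_closed_cone] by blast
qed

lemma test_diff_integral: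
  assumes "\<phi> \<in> test_functions U" "u \<in> L2 lborel" "w \<in> L2 lborel" "A \<in> sets borel"
  shows "(LINT x|lborel. \<phi> x *\<^sub>R cut A (\<lambda>x. w x - u x) x)
    = (LINT x|lborel. \<phi> x *\<^sub>R cut A w x) - (LINT x|lborel. \<phi> x *\<^sub>R cut A u x)"
proof -
  have i: "integrable lborel (\<lambda>x. \<phi> x *\<^sub>R cut A u x)" if "u \<in> L2 lborel" for u
    by (rule smooth_mult_integrable[OF L2_indicator[OF that] test_smooth[OF assms(1)] test_bsupp[OF assms(1)]]) (use assms(4) in simp)
  show ?thesis
    by (subst Bochner_Integration.integral_diff[OF i[OF assms(3)] i[OF assms(2)], symmetric]) (simp add: scaleR_diff_right)
qed

lemma weak_diff:
  assumes U: "open U" and u: "u \<in> L2 lborel" "g \<in> L2 lborel" and w: "w \<in> L2 lborel" "h \<in> L2 lborel"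
  shows "has_weak_pd U i u g \<Longrightarrow> has_weak_pd U i w h \<Longrightarrow> has_weak_pd U i (\<lambda>x. w x - u x) (\<lambda>x. h x - g x)"
    and "has_weak_laplacian U u g \<Longrightarrow> has_weak_laplacian U w h \<Longrightarrow> has_weak_laplacian U (\<lambda>x. w x - u x) (\<lambda>x. h x - g x)"
proof -
  note m = L2_D(1)[OF u(1), unfolded measurable_lborel2] L2_D(1)[OF u(2), unfolded measurable_lborel2]
    L2_D(1)[OF w(1), unfolded measurable_lborel2] L2_D(1)[OF w(2), unfolded measurable_lborel2]
  note md = borel_measurable_diff[OF m(3,1)] borel_measurable_diff[OF m(4,2)]
  have d: "(LINT x|lborel. \<phi> x *\<^sub>R (b x - a x)) = (LINT x|lborel. \<phi> x *\<^sub>R b x) - (LINT x|lborel. \<phi> x *\<^sub>R a x)"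
    if "\<phi> \<in> test_functions U" "a \<in> L2 lborel" "b \<in> L2 lborel" for \<phi> a b
    using test_diff_integral[OF that, of UNIV] by simp
  show "has_weak_pd U i (\<lambda>x. w x - u x) (\<lambda>x. h x - g x)" if "has_weak_pd U i u g" "has_weak_pd U i w h"
    using that unfolding weak_pd_iff[OF U m(1,2)] weak_pd_iff[OF U m(3,4)] weak_pd_iff[OF U md]
    by (simp add: d[OF _ u(2) w(2)] d[OF test_pd u(1) w(1)])
  have l: "lap \<phi> \<in> test_functions U" if "\<phi> \<in> test_functions U" for \<phi>
  proof -
    have "\<phi> \<in> test_functions (closure {x. \<phi> x \<noteq> 0})" using that by (simp add: test_functions_iff)
    then have "{x. lap \<phi> x \<noteq> 0} \<subseteq> closure {x. \<phi> x \<noteq> 0}" using test_zero(3) by auto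
    then have "closure {x. lap \<phi> x \<noteq> 0} \<subseteq> closure {x. \<phi> x \<noteq> 0}" "bsupp (lap \<phi>)"
      by (rule closure_minimal[OF _ closed_closure], rule bounded_subset[OF bounded_closure[OF test_bsupp[OF that]]])
    then show ?thesis
      using that smooth_lap[of \<phi>] unfolding test_functions_iff by blast
  qed
  show "has_weak_laplacian U (\<lambda>x. w x - u x) (\<lambda>x. h x - g x)" if "has_weak_laplacian U u g" "has_weak_laplacian U w h"
    using that unfolding weak_laplacian_iff[OF U m(1,2)] weak_laplacian_iff[OF U m(3,4)] weak_laplacian_iff[OF U md]
    by (simp add: d[OF _ u(2) w(2)] d[OF l u(1) w(1)])
qed

text \<open>Supplies the hypotheses of \<open>side_step\<close>. A common trace gives
  \<open>v\<close> and \<open>w\<close> the same boundary term in Green's formula, so it cancels in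
  the difference. In the Neumann condition the abstract trace is replaced by the smooth
  representative \<open>u\<close> of \<open>v\<close>.\<close>

lemma transmission_side:
  assumes c: "corner (direction \<theta>) \<nu> f \<mu>" and r: "0 < r" "r < r0"
    and \<Omega>: "open \<Omega>" "bounded \<Omega>" "\<And>x. x \<in> ball 0 r0 \<Longrightarrow> x \<in> \<Omega> \<longleftrightarrow> x \<in> cone (direction \<theta>) f"
    and tr: "conductive_transmission \<Omega> (side \<theta> r0) (side_length \<theta> r0) \<eta> v w"
    and v: "v \<in> borel_measurable (lebesgue_on \<Omega>)" "v' \<in> L2 lborel" "AE x in lborel. x \<in> \<Omega> \<longrightarrow> v x = v' x"
    and gv: "\<And>i. gv i \<in> L2 lborel" "\<And>i. integrable lborel (gv i)" "\<And>i. has_weak_pd \<Omega> i v' (gv i)"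
    and Fv: "Fv \<in> L2 lborel" "integrable lborel Fv" "has_weak_laplacian \<Omega> v' Fv"
    and w: "w \<in> borel_measurable (lebesgue_on \<Omega>)" "w' \<in> L2 lborel" "AE x in lborel. x \<in> \<Omega> \<longrightarrow> w x = w' x"
    and gw: "\<And>i. gw i \<in> L2 lborel" "\<And>i. integrable lborel (gw i)" "\<And>i. has_weak_pd \<Omega> i w' (gw i)"
    and Fw: "Fw \<in> L2 lborel" "integrable lborel Fw" "has_weak_laplacian \<Omega> w' Fw"
    and u: "smooth u" "AE x in lborel. x \<in> ball 0 r \<longrightarrow> v' x = u x" "\<And>i. AE x in lborel. x \<in> ball 0 r \<longrightarrow> gv i x = pd i u x"
    and t: "\<phi> \<in> test_functions (slit_ball r f)"
  shows "(LINT x|lborel. pd i \<phi> x *\<^sub>R cut (cone (direction \<theta>) f) (\<lambda>x. w' x - v' x) x)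
      + (LINT x|lborel. \<phi> x *\<^sub>R cut (cone (direction \<theta>) f) (\<lambda>x. gw i x - gv i x) x) = 0" (is ?dir)
    and "(\<Sum>i\<in>UNIV. LINT x|lborel. pd i \<phi> x *\<^sub>R cut (cone (direction \<theta>) f) (\<lambda>x. gw i x - gv i x) x)
      + (LINT x|lborel. \<phi> x *\<^sub>R cut (cone (direction \<theta>) f) (\<lambda>x. Fw x - Fv x) x)
      = \<eta> * side_integral (direction \<theta>) (\<lambda>x. \<phi> x *\<^sub>R u x)" (is ?neu)
proof -
  let ?e = "direction \<theta>"
  let ?C = "cone ?e f"
  note s = test_smooth[OF t] and b = test_bsupp[OF t]
  have tB: "\<phi> \<in> test_functions (ball 0 r)" by (rule test_mono[OF t slit_ball_subset])
  have \<Omega>r: "x \<in> \<Omega> \<longleftrightarrow> x \<in> ?C" if "x \<in> ball 0 r" for x using \<Omega>(3)[of x] that r by simp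
  have Cb: "?C \<in> sets borel" using open_cone[OF c] by simp
  have m: "v' \<in> borel_measurable borel" "w' \<in> borel_measurable borel" "Fv \<in> borel_measurable borel" "Fw \<in> borel_measurable borel"
    "gv i \<in> borel_measurable borel" "gw i \<in> borel_measurable borel" for i
    using L2_D(1)[OF v(2)] L2_D(1)[OF w(2)] L2_D(1)[OF Fv(1)] L2_D(1)[OF Fw(1)] L2_D(1)[OF gv(1)] L2_D(1)[OF gw(1)] by simp_all
  note pv = weak_pd_choice[OF \<Omega>(1,2) v(1) m(1) v(3) gv(1,2,3)] and pw = weak_pd_choice[OF \<Omega>(1,2) w(1) m(2) w(3) gw(1,2,3)]
  note lv = weak_laplacian_choice[OF \<Omega>(1,2) v(1) m(1) v(3) Fv] and lw = weak_laplacian_choice[OF \<Omega>(1,2) w(1) m(2) w(3) Fw]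
  obtain g where g: "has_trace \<Omega> (side_length \<theta> r0) v g" "has_trace \<Omega> (side_length \<theta> r0) w g"
    and nd: "\<forall>\<phi>\<in>boundary_tests \<Omega> (side \<theta> r0).
           normal_derivative \<Omega> v \<phi> + \<eta> * (LINT x|side_length \<theta> r0. \<phi> x *\<^sub>R g x) = normal_derivative \<Omega> w \<phi>"
    using tr unfolding conductive_transmission_def by blast
  define G where "G = (LINT x|side_length \<theta> r0. \<phi> x *\<^sub>R g x)"
  have Av: "(LINT x|lborel. pd i \<phi> x *\<^sub>R cut ?C v' x) + (LINT x|lborel. \<phi> x *\<^sub>R cut ?C (gv i) x) = (\<nu> $ i) *\<^sub>R G" for i
    unfolding G_def by (rule trace_green[OF c r \<Omega>(1) \<Omega>r g(1) v(1) m(1) v(3) L2_D(1)[OF pv(1)] m(5) pv(2) t])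
  have Aw: "(LINT x|lborel. pd i \<phi> x *\<^sub>R cut ?C w' x) + (LINT x|lborel. \<phi> x *\<^sub>R cut ?C (gw i) x) = (\<nu> $ i) *\<^sub>R G" for i
    unfolding G_def by (rule trace_green[OF c r \<Omega>(1) \<Omega>r g(2) w(1) m(2) w(3) L2_D(1)[OF pw(1)] m(6) pw(2) t])
  show ?dir
    unfolding test_diff_integral[OF test_pd[OF t] v(2) w(2) Cb] test_diff_integral[OF t gv(1) gw(1) Cb]
    using Av[of i] Aw[of i] by (simp add: algebra_simps)
  \<comment> \<open>Green's formula for \<open>v\<close> with its trace and for \<open>u\<close>
    with its values have equal left-hand sides, since the functions and their gradients agree almost
    everywhere in the ball. Some component of \<open>\<nu>\<close> is nonzero and can be
    cancelled.\<close>
  have G: "G = side_integral ?e (\<lambda>x. \<phi> x *\<^sub>R u x)"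
  proof -
    have "(\<nu> $ i) *\<^sub>R G = (\<nu> $ i) *\<^sub>R side_integral ?e (\<lambda>x. \<phi> x *\<^sub>R u x)" for i
    proof -
      have e: "(LINT x|lborel. p x *\<^sub>R cut ?C a x) = (LINT x|lborel. p x *\<^sub>R cut ?C (cut (ball 0 r) q) x)"
        if p: "smooth p" "\<And>x. x \<notin> ball 0 r \<Longrightarrow> p x = 0" and a: "a \<in> borel_measurable borel" "smooth q"
          "AE x in lborel. x \<in> ball 0 r \<longrightarrow> a x = q x" for p :: "real^2 \<Rightarrow> real" and a q :: "real^2 \<Rightarrow> complex"
      proof (rule integral_cong_AE)
        show "AE x in lborel. p x *\<^sub>R cut ?C a x = p x *\<^sub>R cut ?C (cut (ball 0 r) q) x"
          using a(3)
        proof eventually_elim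
          case (elim x)
          then show ?case using p(2)[of x] by (cases "x \<in> ball 0 r") simp_all
        qed
        have B: "ball (0::real^2) r \<in> sets borel" by simp
        show "(\<lambda>x. p x *\<^sub>R cut ?C a x) \<in> borel_measurable lborel"
          "(\<lambda>x. p x *\<^sub>R cut ?C (cut (ball 0 r) q) x) \<in> borel_measurable lborel"
          unfolding measurable_lborel2
          by (intro borel_measurable_scaleR[OF smooth_borel[OF p(1)]] cut_measurable[OF Cb] cut_measurable[OF B] a(1) smooth_borel[OF a(2)])+
      qed
      show ?thesis
        unfolding Av[of i, symmetric] green_side[OF c t u(1), symmetric]
        by (intro arg_cong2[where f="(+)"] e s smooth_pd u test_zero[OF tB] m)
    qed
    moreover obtain i where "\<nu> $ i \<noteq> 0" using corner_nonzero[OF c] by (auto simp: vec_eq_iff)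
    ultimately show ?thesis by (metis real_vector.scale_cancel_left)
  qed
  \<comment> \<open>Near the vertex the boundary of \<open>\<Omega>\<close> lies in the two closed
    rays. The support of \<open>\<phi>\<close> avoids the ray of \<open>f\<close> including the
    vertex, which leaves points with a strictly positive coordinate along the other side.\<close>
  have "\<phi> \<in> boundary_tests \<Omega> (side \<theta> r0)"
  proof -
    have "x \<in> side \<theta> r0" if x: "x \<in> supp \<phi>" "x \<in> frontier \<Omega>" for x
    proof -
      have "x \<in> slit_ball r f" using t x(1) by (auto simp: test_functions_def)
      then have xr: "x \<in> ball 0 r" and nf: "x \<notin> {t *\<^sub>R f | t. t \<ge> 0}" by (auto simp: slit_ball_def)
      have cl: "x \<in> closure \<Omega>" and nx: "x \<notin> \<Omega>" using x(2) \<Omega>(1) by (auto simp: frontier_def interior_open)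
      have cc: "\<nu> \<bullet> x \<le> 0" "\<mu> \<bullet> x \<le> 0"
        using closure_near_corner[OF c \<Omega>r cl xr] by (auto simp: closed_cone_def)
      have nc: "\<not> (\<nu> \<bullet> x < 0 \<and> \<mu> \<bullet> x < 0)" using nx \<Omega>r[OF xr] cone_halfplanes[OF c] by blast
      have neg: "\<nu> \<bullet> f < 0" "\<mu> \<bullet> ?e < 0" using c by (auto simp: corner_def)
      have rep: "x = (\<mu> \<bullet> x / (\<mu> \<bullet> ?e)) *\<^sub>R ?e + (\<nu> \<bullet> x / (\<nu> \<bullet> f)) *\<^sub>R f" by (rule corner_repr[OF c])
      have "\<mu> \<bullet> x \<noteq> 0"
      proof
        assume z: "\<mu> \<bullet> x = 0"
        have "x = (\<nu> \<bullet> x / (\<nu> \<bullet> f)) *\<^sub>R f" using rep unfolding z by simp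
        moreover have "\<nu> \<bullet> x / (\<nu> \<bullet> f) \<ge> 0" using cc neg by (simp add: divide_nonpos_neg)
        ultimately show False using nf by blast
      qed
      then have \<mu>x: "\<mu> \<bullet> x < 0" using cc by simp
      then have "\<nu> \<bullet> x = 0" using nc cc by simp
      then have "x = (\<mu> \<bullet> x / (\<mu> \<bullet> ?e)) *\<^sub>R ?e" using rep by simp
      moreover have "\<mu> \<bullet> x / (\<mu> \<bullet> ?e) > 0" using \<mu>x neg by (simp add: divide_neg_neg)
      ultimately have "x \<in> {r *\<^sub>R ?e | r. r > 0}" by blast
      moreover have "x \<in> ball 0 r0" using xr r by simp
      ultimately show ?thesis by (simp add: side_def)
    qed
    then show ?thesis using t by (auto simp: boundary_tests_def test_functions_def)
  qed
  then have "normal_derivative \<Omega> v \<phi> + \<eta> * G = normal_derivative \<Omega> w \<phi>" using nd unfolding G_def by blast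
  then have "\<eta> * G = normal_derivative \<Omega> w \<phi> - normal_derivative \<Omega> v \<phi>" by (simp add: algebra_simps)
  moreover have "normal_derivative \<Omega> v \<phi> = (\<Sum>i\<in>UNIV. LINT x|lborel. pd i \<phi> x *\<^sub>R cut ?C (gv i) x) + (LINT x|lborel. \<phi> x *\<^sub>R cut ?C Fv x)"
    by (rule normal_derivative_representative[OF \<Omega>(1) \<Omega>r pv(1) m(5) pv(2) lv(1) m(3) lv(2) tB])
  moreover have "normal_derivative \<Omega> w \<phi> = (\<Sum>i\<in>UNIV. LINT x|lborel. pd i \<phi> x *\<^sub>R cut ?C (gw i) x) + (LINT x|lborel. \<phi> x *\<^sub>R cut ?C Fw x)"
    by (rule normal_derivative_representative[OF \<Omega>(1) \<Omega>r pw(1) m(6) pw(2) lw(1) m(4) lw(2) tB])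
  ultimately show ?neu
    unfolding test_diff_integral[OF test_pd[OF t] gv(1) gw(1) Cb] test_diff_integral[OF t Fv(1) Fw(1) Cb] G
    by (simp add: sum_subtractf)
qed

lemma corner_vanishing:
  assumes c: "corner (direction a) \<nu> (direction b) \<mu>" and irr: "(a - b) / pi \<notin> \<rat>" and r: "r > 0"
    and U: "U \<in> L2 lborel" "\<And>i. gU i \<in> L2 lborel" "F \<in> L2 lborel"
    and w: "\<And>i. has_weak_pd (ball 0 r) i U (gU i)" "has_weak_laplacian (ball 0 r) U F"
    and F: "AE x in lborel. x \<in> ball 0 r - closed_cone \<nu> \<mu> \<longrightarrow> F x = - (k *\<^sub>R U x)"
    and v: "solution_on k (ball 0 r) v" "bsupp v" and \<eta>: "\<eta> \<noteq> 0"
    and dir: "\<And>\<phi> i. \<phi> \<in> test_functions (slit_ball r (direction b)) \<Longrightarrow>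
      (LINT x|lborel. pd i \<phi> x *\<^sub>R cut (cone (direction a) (direction b)) U x)
        + (LINT x|lborel. \<phi> x *\<^sub>R cut (cone (direction a) (direction b)) (gU i) x) = 0"
    and neu: "\<And>\<phi>. \<phi> \<in> test_functions (slit_ball r (direction b)) \<Longrightarrow>
      (\<Sum>i\<in>UNIV. LINT x|lborel. pd i \<phi> x *\<^sub>R cut (cone (direction a) (direction b)) (gU i) x)
        + (LINT x|lborel. \<phi> x *\<^sub>R cut (cone (direction a) (direction b)) F x)
        = \<eta> * side_integral (direction a) (\<lambda>x. \<phi> x *\<^sub>R v x)"
    and dir': "\<And>\<phi> i. \<phi> \<in> test_functions (slit_ball r (direction a)) \<Longrightarrow>
      (LINT x|lborel. pd i \<phi> x *\<^sub>R cut (cone (direction b) (direction a)) U x)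
        + (LINT x|lborel. \<phi> x *\<^sub>R cut (cone (direction b) (direction a)) (gU i) x) = 0"
    and neu': "\<And>\<phi>. \<phi> \<in> test_functions (slit_ball r (direction a)) \<Longrightarrow>
      (\<Sum>i\<in>UNIV. LINT x|lborel. pd i \<phi> x *\<^sub>R cut (cone (direction b) (direction a)) (gU i) x)
        + (LINT x|lborel. \<phi> x *\<^sub>R cut (cone (direction b) (direction a)) F x)
        = \<eta> * side_integral (direction b) (\<lambda>x. \<phi> x *\<^sub>R v x)"
  shows "\<And>x. x \<in> ball 0 r \<Longrightarrow> v x = 0"
    and "AE x in lborel. x \<in> ball 0 r - closed_cone \<nu> \<mu> \<longrightarrow> U x = 0"
proof -
  have ccs: "closed_cone \<mu> \<nu> = closed_cone \<nu> \<mu>" by (auto simp: closed_cone_def)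
  obtain V where V: "solution_on k (ball 0 r) V" "\<And>x. x \<bullet> perp (direction a) = 0 \<Longrightarrow> V x = 0"
    "\<And>x. x \<bullet> perp (direction a) = 0 \<Longrightarrow> dd \<nu> V x = \<eta> * v x"
    "AE x in lborel. x \<in> ball 0 r - closed_cone \<nu> \<mu> \<longrightarrow> U x = V x"
    by (rule side_step[OF c r U w F _ _ v]) ((erule dir neu)+, rule that, assumption+)
  obtain W where W: "solution_on k (ball 0 r) W" "\<And>x. x \<bullet> perp (direction b) = 0 \<Longrightarrow> W x = 0"
    "\<And>x. x \<bullet> perp (direction b) = 0 \<Longrightarrow> dd \<mu> W x = \<eta> * v x"
    "AE x in lborel. x \<in> ball 0 r - closed_cone \<nu> \<mu> \<longrightarrow> U x = W x"
    by (rule side_step[OF corner_sym[OF c] r U w F[folded ccs] _ _ v, unfolded ccs]) ((erule dir' neu')+, rule that, assumption+)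
  have y: "solution_on k (ball 0 r) (\<lambda>x. V x - W x)" by (rule solution_diff[OF V(1) W(1)])
  have ext: "V x - W x = 0" if "x \<in> ball 0 r - closed_cone \<nu> \<mu>" for x
  proof (rule zero_of_AE_zero[OF smooth_continuous[OF solution_smooth[OF y]] _ _ that])
    show "open (ball 0 r - closed_cone \<nu> \<mu>)" by (intro open_Diff open_ball closed_closed_cone)
    show "AE x in lborel. x \<in> ball 0 r - closed_cone \<nu> \<mu> \<longrightarrow> V x - W x = 0"
      using V(4) W(4) by eventually_elim auto
  qed
  obtain z d where zd: "d > 0" "ball z d \<subseteq> ball 0 r - closed_cone \<nu> \<mu>"
    by (rule exterior_contains_ball[OF c r]) (rule that, assumption+)
  \<comment> \<open>Here the data of the two sides meet: \<open>V\<close> and \<open>W\<close> agree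
    with \<open>U\<close> outside the corner, and as solutions in the full ball they then agree
    inside the corner too.\<close>
  have VW: "V x - W x = 0" if "x \<in> ball 0 r" for x
    by (rule smooth_ucp[OF y zd(1) _ _ that]) (use zd(2) ext in auto)
  have V0: "V x = 0" if x: "x \<in> ball 0 r" for x
  proof (rule two_lines_uniqueness[OF V(1) irr V(2) _ x])
    show "V x = 0" if "x \<bullet> perp (direction b) = 0" "x \<in> ball 0 r" for x
      using VW[OF that(2)] W(2)[OF that(1)] by simp
  qed
  have dd0: "dd q Y x = 0" if "\<And>x. x \<in> ball 0 r \<Longrightarrow> Y x = 0" "x \<in> ball 0 r" for q x and Y :: "real^2 \<Rightarrow> complex"
    using pd_cong[of "ball 0 r" x Y "\<lambda>x. 0"] that by (simp add: dd_def)
  have W0: "W x = 0" if "x \<in> ball 0 r" for x using VW[OF that] V0[OF that] by simp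
  show "v x = 0" if x: "x \<in> ball 0 r" for x
  proof (rule two_lines_uniqueness[OF v(1) irr _ _ x])
    show "v x = 0" if "x \<bullet> perp (direction a) = 0" "x \<in> ball 0 r" for x
      using V(3)[OF that(1)] dd0[of V x \<nu>, OF V0 that(2)] \<eta> by simp
    show "v x = 0" if "x \<bullet> perp (direction b) = 0" "x \<in> ball 0 r" for x
      using W(3)[OF that(1)] dd0[of W x \<mu>, OF W0 that(2)] \<eta> by simp
  qed
  show "AE x in lborel. x \<in> ball 0 r - closed_cone \<nu> \<mu> \<longrightarrow> U x = 0"
    using V(4) by eventually_elim (use V0 in auto)
qed

theorem theorem1p1:
  fixes D \<Omega> :: "(real^2) set"
    and \<gamma>1 :: real and \<gamma>2 :: "real^2 \<Rightarrow> complex"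
    and \<theta>m \<theta>M r0 :: real and \<eta> :: complex
    and v w :: "real^2 \<Rightarrow> complex"
  assumes "bounded_lipschitz_domain D" and "bounded_lipschitz_domain \<Omega>"
    and "connected (- closure D)" and "connected (- closure \<Omega>)"
    and "closure \<Omega> \<subseteq> D"
    and "\<gamma>1 > 0"
    and "\<gamma>2 \<in> L_infinity (lebesgue_on D)" and "\<gamma>2 \<in> sobolev 2 \<Omega>"
    and "ess_supp D (\<lambda>x. \<gamma>2 x - of_real \<gamma>1) \<subseteq> closure \<Omega>"
    and "- pi \<le> \<theta>m" and "\<theta>m < \<theta>M" and "\<theta>M < pi" and "\<theta>M - \<theta>m < pi"
    and "0 \<in> frontier \<Omega>"
    and "r0 > 0" and "\<Omega> \<inter> ball 0 r0 = sector \<theta>m \<theta>M \<inter> ball 0 r0"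
    and "v \<in> sobolev 1 D" and "w \<in> sobolev 1 D"
    and "helmholtz D (\<lambda>x. of_real \<gamma>1) v" and "helmholtz D \<gamma>2 w"
    and "conductive_transmission \<Omega> (side \<theta>M r0) (side_length \<theta>M r0) \<eta> v w"
    and "conductive_transmission \<Omega> (side \<theta>m r0) (side_length \<theta>m r0) \<eta> v w"
    and "(\<theta>M - \<theta>m) / pi \<notin> \<rat>"
    and "\<eta> \<noteq> 0"
  shows "(AE x in lebesgue_on D. v x = 0) \<and> (AE x in lebesgue_on D. w x = 0)"
proof -
  let ?e = "direction \<theta>M" and ?f = "direction \<theta>m"
  define \<nu> where "\<nu> = perp ?e"
  define \<mu> where "\<mu> = - perp ?f"
  have c: "corner ?e \<nu> ?f \<mu>" unfolding \<nu>_def \<mu>_def by (rule sector_corner(1)[OF assms(10-13)])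
  have oD: "open D" "connected D" "bounded D" and o\<Omega>: "open \<Omega>" "bounded \<Omega>"
    using assms(1,2) by (auto simp: bounded_lipschitz_domain_def)
  have Db: "D \<in> sets borel" using oD by simp
  have \<Omega>D: "\<Omega> \<subseteq> D" using assms(5) closure_subset[of \<Omega>] by blast
  have \<Omega>c: "x \<in> \<Omega> \<longleftrightarrow> x \<in> cone ?e ?f" if "x \<in> ball 0 r0" for x
    using assms(16) sector_corner(2)[OF assms(10-13)] that by blast
  have "0 \<in> D" using assms(5,14) by (auto simp: frontier_def)
  then obtain \<rho> where \<rho>: "\<rho> > 0" "ball 0 \<rho> \<subseteq> D" using oD(1) open_contains_ball by blast
  \<comment> \<open>Two radii, because Weyl's lemma gives smoothness only on a ball smaller than the
    one where the equation is used. Since \<open>r\<close> is below \<open>r0\<close>, test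
    functions in the inner ball see only the straight part of the boundary.\<close>
  define r1 where "r1 = min \<rho> r0"
  define r where "r = r1 / 2"
  have r: "0 < r" "r < r1" "r < r0" and r1D: "ball 0 r1 \<subseteq> D" "ball 0 r \<subseteq> D"
    using \<rho> assms(15) by (auto simp: r1_def r_def min_def)
  have "(\<lambda>x. of_real \<gamma>1) \<in> L_infinity (lebesgue_on D)" by (auto simp: L_infinity_def)
  then obtain v' gv Fv Cv where v': "v' \<in> L2 lborel" and gv: "\<And>i. gv i \<in> L2 lborel" and Fv: "Fv \<in> L2 lborel"
    and gv0: "\<And>i x. x \<notin> D \<Longrightarrow> gv i x = 0" and Fv0: "\<And>x. x \<notin> D \<Longrightarrow> Fv x = 0" and v0: "\<And>x. x \<notin> D \<Longrightarrow> v' x = 0"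
    and vv: "AE x in lborel. x \<in> D \<longrightarrow> v x = v' x"
    and wv: "\<And>i. has_weak_pd D i v' (gv i)" "has_weak_laplacian D v' Fv"
    and Fve: "AE x in lborel. x \<in> D \<longrightarrow> Fv x = - (of_real \<gamma>1 * v' x)"
    and Cv: "AE x in lborel. x \<in> D \<longrightarrow> norm (Fv x) \<le> Cv * norm (v' x)"
    by (rule helmholtz_data[OF oD(1) assms(17,19)]) (rule that, assumption+)
  obtain w' gw Fw Cw where w': "w' \<in> L2 lborel" and gw: "\<And>i. gw i \<in> L2 lborel" and Fw: "Fw \<in> L2 lborel"
    and gw0: "\<And>i x. x \<notin> D \<Longrightarrow> gw i x = 0" and Fw0: "\<And>x. x \<notin> D \<Longrightarrow> Fw x = 0" and w0: "\<And>x. x \<notin> D \<Longrightarrow> w' x = 0"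
    and ww: "AE x in lborel. x \<in> D \<longrightarrow> w x = w' x"
    and wwk: "\<And>i. has_weak_pd D i w' (gw i)" "has_weak_laplacian D w' Fw"
    and Fwe: "AE x in lborel. x \<in> D \<longrightarrow> Fw x = - (\<gamma>2 x * w' x)"
    and Cw: "AE x in lborel. x \<in> D \<longrightarrow> norm (Fw x) \<le> Cw * norm (w' x)"
    by (rule helmholtz_data[OF oD(1) assms(18,20,7)]) (rule that, assumption+)
  have m: "v' \<in> borel_measurable borel" "w' \<in> borel_measurable borel" "Fv \<in> borel_measurable borel" "Fw \<in> borel_measurable borel"
    "gv i \<in> borel_measurable borel" "gw i \<in> borel_measurable borel" for i
    using L2_D(1)[OF v'] L2_D(1)[OF w'] L2_D(1)[OF Fv] L2_D(1)[OF Fw] L2_D(1)[OF gv] L2_D(1)[OF gw] by simp_all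
  have int: "integrable lborel v'" "integrable lborel Fv" "integrable lborel Fw" "integrable lborel (gv i)" "integrable lborel (gw i)" for i
    by (rule zero_off_integrable[OF _ oD(3)]; rule v' Fv Fw gv gw v0 Fv0 Fw0 gv0 gw0; assumption)+

  have "has_weak_laplacian (ball 0 r1) v' Fv" by (rule weak_laplacian_mono[OF oD(1) open_ball m(1,3) wv(2) r1D(1)])
  moreover have mk: "(\<lambda>x. - (of_real \<gamma>1 * v' x)) \<in> borel_measurable borel" using m(1) by measurable
  \<comment> \<open>\<open>Fv\<close> equals \<open>- \<gamma>1 v'\<close> only almost everywhere,
    whereas Weyl's lemma is stated with the source literally in that form.\<close>
  have "has_weak_laplacian (ball 0 r1) v' Fv \<longleftrightarrow> has_weak_laplacian (ball 0 r1) v' (\<lambda>x. - (of_real \<gamma>1 * v' x))"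
  proof (rule weak_laplacian_representative[OF open_ball borel_measurable_lebesgue_on[OF m(1)] borel_measurable_lebesgue_on[OF m(3)] m(1) mk])
    show "AE x in lborel. x \<in> ball 0 r1 \<longrightarrow> Fv x = - (of_real \<gamma>1 * v' x)"
      using Fve by eventually_elim (use r1D in auto)
  qed simp
  ultimately have wk: "has_weak_laplacian (ball 0 r1) v' (\<lambda>x. - (of_real \<gamma>1 * v' x))" by simp
  obtain u where u: "solution_on \<gamma>1 (ball 0 r) u" "bsupp u" "AE x in lborel. x \<in> ball 0 r \<longrightarrow> v' x = u x"
    by (rule weyl[OF v' int(1) wk r(1,2)]) (rule that, assumption+)
  have su: "smooth u" by (rule solution_smooth[OF u(1)])
  \<comment> \<open>\<open>gv\<close> is some weak gradient of \<open>v'\<close>; uniqueness of weak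
    derivatives identifies it with the classical gradient of the smooth representative.\<close>
  have gu: "AE x in lborel. x \<in> ball 0 r \<longrightarrow> gv i x = pd i u x" for i
  proof -
    have bb: "ball (0::real^2) r \<in> sets borel" by simp
    note mu = cut_measurable[OF bb smooth_borel[OF su]] cut_measurable[OF bb smooth_borel[OF smooth_pd[OF su]], of i]
    have "has_weak_pd (ball 0 r) i (cut (ball 0 r) u) (cut (ball 0 r) (pd i u)) \<longleftrightarrow> has_weak_pd (ball 0 r) i v' (cut (ball 0 r) (pd i u))"
    proof (rule weak_pd_representative[OF open_ball borel_measurable_lebesgue_on[OF mu(1)] borel_measurable_lebesgue_on[OF mu(2)] m(1) mu(2)])
      show "AE x in lborel. x \<in> ball 0 r \<longrightarrow> cut (ball 0 r) u x = v' x" using u(3) by eventually_elim simp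
    qed simp
    then have h: "has_weak_pd (ball 0 r) i v' (cut (ball 0 r) (pd i u))" using smooth_weak_pd[OF su] by blast
    have L: "cut (ball 0 r) (pd i u) \<in> L2 lborel" by (rule L2_cut_ball[OF smooth_pd[OF su]])
    have iL: "integrable lborel (cut (ball 0 r) (pd i u))" by (rule zero_off_integrable[OF L bounded_ball[of 0 r]]) simp
    have "AE x in lborel. x \<in> ball 0 r \<longrightarrow> gv i x = cut (ball 0 r) (pd i u) x"
      by (rule weak_pd_unique[OF open_ball bounded_ne_UNIV[OF bounded_ball] m(1) gv int(4) L iL
            weak_pd_mono[OF oD(1) open_ball m(1,5) wv(1) r1D(2)] h])
    then show ?thesis by eventually_elim simp
  qed

  have v\<Omega>: "v \<in> borel_measurable (lebesgue_on \<Omega>)" "w \<in> borel_measurable (lebesgue_on \<Omega>)"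
    using assms(17,18) by (auto simp: L2_def intro!: measurable_restrict_mono[OF _ \<Omega>D])
  have vv\<Omega>: "AE x in lborel. x \<in> \<Omega> \<longrightarrow> v x = v' x" using vv by eventually_elim (use \<Omega>D in auto)
  have ww\<Omega>: "AE x in lborel. x \<in> \<Omega> \<longrightarrow> w x = w' x" using ww by eventually_elim (use \<Omega>D in auto)
  note wk\<Omega> = weak_pd_mono[OF oD(1) o\<Omega>(1) m(1,5) wv(1) \<Omega>D] weak_laplacian_mono[OF oD(1) o\<Omega>(1) m(1,3) wv(2) \<Omega>D]
    weak_pd_mono[OF oD(1) o\<Omega>(1) m(2,6) wwk(1) \<Omega>D] weak_laplacian_mono[OF oD(1) o\<Omega>(1) m(2,4) wwk(2) \<Omega>D]
  \<comment> \<open>The second side is treated by exchanging the roles of the two directions; the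
    cone itself is symmetric in them.\<close>
  have \<Omega>c': "x \<in> \<Omega> \<longleftrightarrow> x \<in> cone ?f ?e" if "x \<in> ball 0 r0" for x
    using \<Omega>c[OF that] by (simp add: cone_sym)
  note sM = transmission_side[OF c r(1,3) o\<Omega> \<Omega>c assms(21) v\<Omega>(1) v' vv\<Omega> gv int(4) wk\<Omega>(1) Fv int(2) wk\<Omega>(2)
      v\<Omega>(2) w' ww\<Omega> gw int(5) wk\<Omega>(3) Fw int(3) wk\<Omega>(4) su u(3) gu]
  note sm = transmission_side[OF corner_sym[OF c] r(1,3) o\<Omega> \<Omega>c' assms(22) v\<Omega>(1) v' vv\<Omega> gv int(4) wk\<Omega>(1) Fv int(2) wk\<Omega>(2)
      v\<Omega>(2) w' ww\<Omega> gw int(5) wk\<Omega>(3) Fw int(3) wk\<Omega>(4) su u(3) gu]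
  define U where "U x = w' x - v' x" for x
  define gU where "gU i x = gw i x - gv i x" for i x
  define F where "F x = Fw x - Fv x" for x
  have L: "U \<in> L2 lborel" "gU i \<in> L2 lborel" "F \<in> L2 lborel" for i
    unfolding U_def[abs_def] gU_def[abs_def] F_def[abs_def] by (intro L2_diff w' v' gw gv Fw Fv)+
  have wU: "has_weak_pd (ball 0 r) i U (gU i)" "has_weak_laplacian (ball 0 r) U F" for i
    unfolding U_def[abs_def] gU_def[abs_def] F_def[abs_def]
    by (rule weak_diff(1)[OF open_ball v' gv w' gw weak_pd_mono[OF oD(1) open_ball m(1,5) wv(1) r1D(2)]
          weak_pd_mono[OF oD(1) open_ball m(2,6) wwk(1) r1D(2)]],
        rule weak_diff(2)[OF open_ball v' Fv w' Fw weak_laplacian_mono[OF oD(1) open_ball m(1,3) wv(2) r1D(2)]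
          weak_laplacian_mono[OF oD(1) open_ball m(2,4) wwk(2) r1D(2)]])
  \<comment> \<open>In the small ball, a point off the closed corner is off the closure of
    \<open>\<Omega>\<close>, where the support condition makes \<open>\<gamma>2\<close> equal to
    \<open>\<gamma>1\<close> almost everywhere.\<close>
  have FU: "AE x in lborel. x \<in> ball 0 r - closed_cone \<nu> \<mu> \<longrightarrow> F x = - (\<gamma>1 *\<^sub>R U x)"
    using ess_supp_AE[OF oD(1) assms(9)] Fve Fwe
  proof eventually_elim
    case (elim x)
    show ?case
    proof
      assume x: "x \<in> ball 0 r - closed_cone \<nu> \<mu>"
      have "x \<notin> closure \<Omega>" using closure_near_corner[OF c \<Omega>c] x r by auto
      moreover have "x \<in> D" using x r1D by blast
      ultimately show "F x = - (\<gamma>1 *\<^sub>R U x)"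
        using elim by (simp add: F_def U_def scaleR_conv_of_real algebra_simps)
    qed
  qed
  note van = corner_vanishing[OF c assms(23) r(1) L wU FU u(1,2) assms(24) sM[folded U_def gU_def F_def] sm[folded U_def gU_def F_def]]
  have u0: "u x = 0" if "x \<in> ball 0 r" for x by (rule van(1); (rule that | assumption))
  have U0: "AE x in lborel. x \<in> ball 0 r - closed_cone \<nu> \<mu> \<longrightarrow> U x = 0" by (rule van(2); assumption)
  have "AE x in lborel. x \<in> ball 0 r \<longrightarrow> v' x = 0" using u(3) by eventually_elim (use u0 in auto)
  moreover have "0 \<in> D" by fact
  ultimately have vz: "AE x in lborel. x \<in> D \<longrightarrow> v' x = 0"
    by (intro ucp_connected[OF oD(1,2) v' gv Fv wv Cv _ r(1)])
  obtain z d where zd: "d > 0" "ball z d \<subseteq> ball 0 r - closed_cone \<nu> \<mu>"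
    by (rule exterior_contains_ball[OF c r(1)]) (rule that, assumption+)
  \<comment> \<open>Outside the corner \<open>w'\<close> is the sum of \<open>U\<close> and
    \<open>v'\<close>, which both vanish there; this is the seed from which unique continuation for
    \<open>w\<close> starts.\<close>
  have "AE x in lborel. x \<in> ball z d \<longrightarrow> w' x = 0"
    using U0 vz by eventually_elim (use zd r1D in \<open>auto simp: U_def\<close>)
  moreover have "z \<in> D" using zd r1D by (meson Diff_subset centre_in_ball subsetD)
  ultimately have "AE x in lborel. x \<in> D \<longrightarrow> w' x = 0"
    by (intro ucp_connected[OF oD(1,2) w' gw Fw wwk Cw _ zd(1)])
  with ww have "AE x in lborel. x \<in> D \<longrightarrow> w x = 0" by eventually_elim simp
  moreover from vv vz have "AE x in lborel. x \<in> D \<longrightarrow> v x = 0" by eventually_elim simp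
  ultimately show ?thesis unfolding AE_lebesgue_on[OF Db] by simp
qed

end
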